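(* Fix a small $\delta>0$, a positive integer $n$ and a nonnegative integer $r$. As $\mu\to\infty$ with $\lambda=\kappa/\mu\in[0,1-\delta]$ (i.e. for all sufficiently large $\mu$ and all such $\lambda$), with $\xi$, $Z$, $(z/Z)^{1/2}$ and the coefficients $\hat E_s(z)$ taking their principal values, we have for $z\in Z_1(\delta)\cap S_1$ $$M_{\kappa,\mu}(\mu z)=\frac{ie^{(\mu-\kappa)\pi i}}{(1-\lambda^2)^{\mu}\{2(1+\lambda)\}^{\kappa}}\left(\frac{4\mu}{e}\right)^{\mu}\left(\frac{2\mu z}{Z}\right)^{1/2}\exp\left\{-\mu\xi+\sum_{s=1}^{n-1}(-1)^s\frac{\hat E_s(z)-k_s}{\mu^s}\right\}\{1+\eta_{n,4}(\mu,z)\},$$ and for $z\in Z_3(\delta)\cap S_{-1}$ $$W_{-\kappa,\mu}\left(\mu ze^{-\pi i}\right)=-\frac{ie^{\mu\pi i}}{(1+\lambda)^{\mu}}\left\{\frac{e}{2\mu(1-\lambda^2)}\right\}^{\kappa}\left(\frac zZ\right)^{1/2}\exp\left\{-\mu\xi+\sum_{s=1}^{n-1}(-1)^s\frac{\hat E_s(z)-l_s}{\mu^s}\right\}\{1+\eta_{n,5}(\mu,z)\},$$ with error bounds $$|\eta_{n,4}(\mu,z)|\le\left|\exp\left\{\sum_{s=n}^{n+r-1}(-1)^s\frac{\hat E_s(z)-k_s}{\mu^s}\right\}-1\right|+\frac{\omega_{n+r,1}(\mu,z)}{\mu^{n+r}}\exp\left\{\frac{\varpi_{n+r,1}(\mu,z)}{\mu}+\sum_{s=n}^{n+r-1}(-1)^s\frac{\Re\{\hat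 E_s(z)\}-k_s}{\mu^s}+\frac{\omega_{n+r,1}(\mu,z)}{\mu^{n+r}}\right\}$$ and $$|\eta_{n,5}(\mu,z)|\le\left|\exp\left\{\sum_{s=n}^{n+r-1}(-1)^s\frac{\hat E_s(z)-l_s}{\mu^s}\right\}-1\right|+\frac{\omega_{n+r,3}(\mu,z)}{\mu^{n+r}}\exp\left\{\frac{\varpi_{n+r,3}(\mu,z)}{\mu}+\sum_{s=n}^{n+r-1}(-1)^s\frac{\Re\{\hat E_s(z)-l_s\}}{\mu^s}+\frac{\omega_{n+r,3}(\mu,z)}{\mu^{n+r}}\right\}$$ (sums being zero if $r=0$), where for $j=1,3$ $$\omega_{n,j}(\mu,z)=\int_{\mathscr L_j(z)}\left|\frac{Z(t)\hat F_n(t)\,dt}{t}\right|+\sum_{s=1}^{n-1}\frac{1}{2\mu^s}\int_{\mathscr L_j(z)}\left|\frac{Z(t)\hat G_{n,s}(t)\,dt}{t}\right|,\qquad \varpi_{n,j}(\mu,z)=\sum_{s=0}^{n-2}\frac{2}{\mu^s}\int_{\mathscr L_j(z)}\left|\frac{Z(t)\hat F_{s+1}(t)\,dt}{t}\right|,$$ with $\hat G_{n,s}(z)=\sum_{k=s}^{n-1}\hat F_k(z)\hat F_{s+n-k-1}(z)$ and $\mathscr L_j(z)$ a progressive path linking $z$ to $z^{(j)}$ ($z^{(1)}=0$, $z^{(3)}=\infty e^{\pi i}$).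
   Context: $M_{\kappa,\mu}$ and $W_{\kappa,\mu}$ are the Whittaker functions, solutions of $y''=\left(\frac{\mu^2-1/4}{z^2}-\frac{\kappa}{z}+\frac14\right)y$, with $M_{\kappa,\mu}(z)\sim z^{\mu+1/2}$ as $z\to0$ and $W_{\kappa,\mu}(z)\sim z^\kappa e^{-z/2}$ as $z\to\infty$, $|\arg z|\le\frac32\pi-\delta$. Here $\mu>0$, $\kappa=\lambda\mu$ are real and $\mathbb C^+=\{z\ne0:0\le\arg z\le\pi\}$. $\delta$ denotes an arbitrary small positive constant. **Turning point and Liouville variable.** Put $f(z)=\frac{z^2-4\lambda z+4}{4z^2}$. For $0\le\lambda<1$ its zero in the upper half plane is $z^+=z^+(\lambda)=2\lambda+2i\sqrt{1-\lambda^2}$. Let $$Z=Z(z)=(z^2-4\lambda z+4)^{1/2},\qquad \xi=\xi(z)=\tfrac12Z-\lambda\ln(Z+z-2\lambda)-\ln\left(\frac{Z-\lambda z+2}{z}\right),$$ so that $d\xi/dz=f^{1/2}(z)=Z/(2z)$. **Curves and regions.** Three level curves $\Re\,\xi(z)=\Re\,\xi(z^+)$ in $\mathbb C^+$ emanate from $z^+$ and divide $\mathbb C^+$ into three regions: $S_{-1}$ (bounded, having $z^{(1)}=0$ on its boundary), $S_0$ (containing the end $z^{(2)}=+\infty$ of the positive real axis) and $S_1$ (containing the end $z^{(3)}=\infty e^{\pi i}$ of the negative real axis). The curve separating $S_0$ and $S_1$ is $\gamma_1$, the one separating $S_{-1}$ and $S_1$ is $\gamma_2$, and the one separating $S_{-1}$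 and $S_0$ is $\gamma_3$. $Z_j(\delta)$ ($j=1,2,3$) is the set of points of $\mathbb C^+$ whose distance to $\gamma_j$ is at least $\delta$. **Principal values.** With a branch cut along $\gamma_2$, the principal values of $Z$, $\xi$, $(z/Z)^{1/2}$ are the branches continuous in $\mathbb C^+\setminus\gamma_2$ for which $Z>0$, $\xi$ is real and $(z/Z)^{1/2}>0$ for $z\in(0,\infty)$ (so $(z/Z)^{1/2}\to1$ as $z\to\infty$ in $\mathbb C^+$). For $z$ on $\gamma_2$ regarded as a point of $S_1$ (resp. $S_{-1}$), values are limits from that region. **Progressive paths.** A path $\mathscr L_j(z)$ from $z^{(j)}$ to $z\in Z_j(\delta)$ is progressive if (i) it is a finite chain of $R_2$ arcs (arcs with a parametrization having continuous second derivative and nonvanishing first derivative); (ii) $\Re\,\xi(t)$ is monotonic as $t$ passes along it from $z^{(j)}$ to $z$, with the branch of $\xi(t)$ taken continuous in $Z_j(\delta)$ (so $\xi(t)$ is continued across $\gamma_2$ when the path crosses it); (iii) $|t-z^+|\ge\delta$ for all $t$ on it. $Z_j(\delta)$ is such that all its points can be linked to $z^{(j)}$ by such a path. **Coefficients.** $$\hat F_1(z)=-\frac{z(z^3-16z+4\lambda^2z+16\lambda)}{2Z^6},\qquad \hat F_2(z)=-\frac zZ\frac{d\hat F_1(z)}{dz},$$ $$\hat F_{s+1}(z)=-\frac zZ\frac{d\hat F_s(z)}{dz}-\frac12\sum_{j=1}^{s-1}\hat F_j(z)\hat F_{s-j}(z)\quad(s\ge2),\qquad \hat E_s(z)=\frac12\int_\infty^z\frac{Z(t)\hat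 F_s(t)}{t}\,dt\quad(s\ge1),$$ whose principal values are those with $Z$ principal and the integration path in $\mathbb C^+\setminus\gamma_2$; $\hat E_s(0)$ is the limit of the principal value as $z\to0$. **Constants.** $k_{2m}=l_{2m}=0$ for $m\ge1$, and for $m\ge0$ $$l_{2m+1}=\lim_{z\to-\infty}\hat E_{2m+1}(z),\qquad k_{2m+1}=l_{2m+1}-\hat E_{2m+1}(0),$$ where in this limit $\hat E_{2m+1}$ is the continuation across the cut $\gamma_2$ (from $S_{-1}$), so that $Z\sim|z|$ rather than $Z\sim z$. For example $l_1=-\frac{\lambda}{12(1-\lambda^2)}$ and $k_1=\frac{2+\lambda}{24(1+\lambda)}$. *)

theory Defs
  imports "HOL-Complex_Analysis.Complex_Analysis"
begin

section \<open>Whittaker functions\<close>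

text \<open>
  The Whittaker functions live on the Riemann surface of the logarithm. A function \<open>y\<close> on that
  surface is represented by the entire function \<open>Y v = y (exp v)\<close> of \<open>v = log z\<close>, so that \<open>Im v\<close>
  is the (unrestricted) argument of \<open>z\<close>. By the chain rule \<open>z_deriv Y\<close> represents \<open>dy/dz\<close>.
\<close>

definition z_deriv :: "(complex \<Rightarrow> complex) \<Rightarrow> complex \<Rightarrow> complex" where
  "z_deriv Y v = deriv Y v / exp v"

definition whittaker_solution :: "real \<Rightarrow> real \<Rightarrow> (complex \<Rightarrow> complex) \<Rightarrow> bool" where
  "whittaker_solution \<kappa> \<mu> Y \<longleftrightarrow> Y holomorphic_on UNIV \<and>
     (\<forall>v. z_deriv (z_deriv Y) v =
        ((of_real \<mu> ^ 2 - 1/4) / exp v ^ 2 - of_real \<kappa> / exp v + 1/4) * Y v)"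

definition whittaker_M :: "real \<Rightarrow> real \<Rightarrow> complex \<Rightarrow> complex" where
  "whittaker_M \<kappa> \<mu> = (THE Y. whittaker_solution \<kappa> \<mu> Y \<and>
     ((\<lambda>v. Y v / exp ((of_real \<mu> + 1/2) * v)) \<longlongrightarrow> 1) (filtercomap Re at_bot))"

definition whittaker_W :: "real \<Rightarrow> real \<Rightarrow> complex \<Rightarrow> complex" where
  "whittaker_W \<kappa> \<mu> = (THE Y. whittaker_solution \<kappa> \<mu> Y \<and>
     (\<forall>d>0. ((\<lambda>v. Y v / exp (of_real \<kappa> * v - exp v / 2)) \<longlongrightarrow> 1)
        (inf (filtercomap Re at_top) (principal {v. \<bar>Im v\<bar> \<le> 3/2 * pi - d}))))"


section \<open>Level curves and regions\<close>

definition Cplus :: "complex set" where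
  "Cplus = {z. z \<noteq> 0 \<and> 0 \<le> Im z}"

definition turning_pt :: "real \<Rightarrow> complex" where
  "turning_pt lam = Complex (2 * lam) (2 * sqrt (1 - lam\<^sup>2))"

definition Zsq :: "real \<Rightarrow> complex \<Rightarrow> complex" where
  "Zsq lam z = z\<^sup>2 - 4 * of_real lam * z + 4"

definition xi_formula :: "real \<Rightarrow> complex \<Rightarrow> complex \<Rightarrow> complex" where
  "xi_formula lam Z z =
     Z / 2 - of_real lam * Ln (Z + z - 2 * of_real lam) - Ln ((Z - of_real lam * z + 2) / z)"

text \<open>
  The set where \<open>Re \<xi> = Re \<xi>(z\<^sup>+)\<close>. It does not depend on the branches used: \<open>lam\<close> being real, other
  values of the logarithms change \<open>\<xi>\<close> by an imaginary constant, and replacing \<open>Z\<close> by \<open>-Z\<close> replaces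
  \<open>Re \<xi>(z) - Re \<xi>(z\<^sup>+)\<close> by its negative, because
  \<open>(Z + z - 2 lam) (-Z + z - 2 lam) = -4 (1 - lam\<^sup>2)\<close> and
  \<open>(Z - lam z + 2) (-Z - lam z + 2) = -(1 - lam\<^sup>2) z\<^sup>2\<close>. At \<open>z\<^sup>+\<close> one has \<open>Z = 0\<close>.
\<close>

definition level_set :: "real \<Rightarrow> complex set" where
  "level_set lam = {z \<in> Cplus.
     Re (xi_formula lam (csqrt (Zsq lam z)) z) = Re (xi_formula lam 0 (turning_pt lam))}"

text \<open>Each of the following unions is over a single connected component.\<close>

definition Sm1 :: "real \<Rightarrow> complex set" where
  "Sm1 lam = \<Union>{C \<in> components (Cplus - level_set lam). bounded C \<and> 0 \<in> closure C}"

definition S0 :: "real \<Rightarrow> complex set" where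
  "S0 lam = \<Union>{C \<in> components (Cplus - level_set lam). \<forall>\<^sub>F x::real in at_top. of_real x \<in> C}"

definition S1 :: "real \<Rightarrow> complex set" where
  "S1 lam = \<Union>{C \<in> components (Cplus - level_set lam). \<forall>\<^sub>F x::real in at_bot. of_real x \<in> C}"

text \<open>The curves include their common end point \<open>z\<^sup>+\<close>.\<close>

definition gamma1 :: "real \<Rightarrow> complex set" where
  "gamma1 lam = level_set lam \<inter> closure (S0 lam) \<inter> closure (S1 lam)"

definition gamma2 :: "real \<Rightarrow> complex set" where
  "gamma2 lam = level_set lam \<inter> closure (Sm1 lam) \<inter> closure (S1 lam)"

definition gamma3 :: "real \<Rightarrow> complex set" where
  "gamma3 lam = level_set lam \<inter> closure (Sm1 lam) \<inter> closure (S0 lam)"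

text \<open>\<open>away_from (gamma1 lam) \<delta>\<close> is the set \<open>Z\<^sub>1(\<delta>)\<close>, and likewise for the other two curves.\<close>

definition away_from :: "complex set \<Rightarrow> real \<Rightarrow> complex set" where
  "away_from C \<delta> = {z \<in> Cplus. \<forall>t\<in>C. \<delta> \<le> dist z t}"


section \<open>Principal values\<close>

definition pdom :: "real \<Rightarrow> complex set" where
  "pdom lam = Cplus - gamma2 lam"

definition Z_pv :: "real \<Rightarrow> complex \<Rightarrow> complex" where
  "Z_pv lam = (SOME Z. continuous_on (pdom lam) Z \<and> (\<forall>z\<in>pdom lam. (Z z)\<^sup>2 = Zsq lam z) \<and>
     (\<forall>x::real. 0 < x \<longrightarrow> Im (Z (of_real x)) = 0 \<and> 0 < Re (Z (of_real x))))"

definition xi_pv :: "real \<Rightarrow> complex \<Rightarrow> complex" where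
  "xi_pv lam = (SOME \<xi>.
     (\<exists>L1 L2. continuous_on (pdom lam) L1 \<and> continuous_on (pdom lam) L2 \<and>
        (\<forall>z\<in>pdom lam. exp (L1 z) = Z_pv lam z + z - 2 * of_real lam \<and>
           exp (L2 z) = (Z_pv lam z - of_real lam * z + 2) / z \<and>
           \<xi> z = Z_pv lam z / 2 - of_real lam * L1 z - L2 z)) \<and>
     (\<forall>x::real. 0 < x \<longrightarrow> Im (\<xi> (of_real x)) = 0))"

text \<open>The principal value of \<open>(z/Z)\<^bsup>1/2\<^esup>\<close>.\<close>

definition rt_pv :: "real \<Rightarrow> complex \<Rightarrow> complex" where
  "rt_pv lam = (SOME q. continuous_on (pdom lam) q \<and> (\<forall>z\<in>pdom lam. (q z)\<^sup>2 = z / Z_pv lam z) \<and>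
     (\<forall>x::real. 0 < x \<longrightarrow> Im (q (of_real x)) = 0 \<and> 0 < Re (q (of_real x))))"

text \<open>
  Value at \<open>z\<close> of a function as seen from the region \<open>S\<close>: on the boundary of \<open>S\<close> (that is, for
  \<open>z\<close> on the cut \<open>\<gamma>\<^sub>2\<close>) it is the limit from \<open>S\<close>.
\<close>

definition from_region :: "complex set \<Rightarrow> (complex \<Rightarrow> complex) \<Rightarrow> complex \<Rightarrow> complex" where
  "from_region S f z = (if z \<in> S then f z else Lim (at z within S) f)"

text \<open>
  Continuation of a principal value \<open>f\<close> from a region \<open>S\<close> to the plane cut along another curve \<open>C\<close>
  (hence across \<open>\<gamma>\<^sub>2\<close>). Points of the real axis are boundary points of \<open>Cplus\<close>, where
  \<open>holomorphic_on\<close> refers to the derivative within the set.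
\<close>

definition continue_from ::
    "complex set \<Rightarrow> complex set \<Rightarrow> (complex \<Rightarrow> complex) \<Rightarrow> complex \<Rightarrow> complex" where
  "continue_from S C f = (SOME g. g holomorphic_on (Cplus - C) \<and> (\<forall>z\<in>S. g z = f z))"


section \<open>Coefficients\<close>

definition deriv_within :: "complex set \<Rightarrow> (complex \<Rightarrow> complex) \<Rightarrow> complex \<Rightarrow> complex" where
  "deriv_within S f z = (THE d. (f has_field_derivative d) (at z within S))"

text \<open>
  Principal values of \<open>F\<^sub>s\<close> (the index \<open>0\<close> is not used). The last equation, for the index
  \<open>s + 2\<close>, covers both \<open>F\<^sub>2\<close>, with an empty sum, and the general recursion.
\<close>

fun hatF :: "real \<Rightarrow> nat \<Rightarrow> complex \<Rightarrow> complex" where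
  "hatF lam 0 = (\<lambda>z. 0)"
| "hatF lam (Suc 0) = (\<lambda>z. - (z * (z ^ 3 - 16 * z + 4 * of_real lam ^ 2 * z + 16 * of_real lam))
      / (2 * Z_pv lam z ^ 6))"
| "hatF lam (Suc (Suc s)) = (\<lambda>z.
      - (z / Z_pv lam z) * deriv_within (pdom lam) (hatF lam (Suc s)) z
      - 1/2 * (\<Sum>j\<in>{1..s}. hatF lam j z * hatF lam (Suc s - j) z))"

definition hatG :: "real \<Rightarrow> nat \<Rightarrow> nat \<Rightarrow> complex \<Rightarrow> complex" where
  "hatG lam n s z = (\<Sum>k\<in>{s..<n}. hatF lam k z * hatF lam (s + n - k - 1) z)"

text \<open>
  The integral from \<open>\<infinity>\<close> to \<open>z\<close> is the limit of the integrals from \<open>R\<close> to \<open>z\<close> as \<open>R \<rightarrow> +\<infinity>\<close>,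
  along any path in the cut plane (the integrand is analytic there and \<open>O(t\<^bsup>-2\<^esup>)\<close> at \<open>\<infinity>\<close>).
\<close>

definition hatE :: "real \<Rightarrow> nat \<Rightarrow> complex \<Rightarrow> complex" where
  "hatE lam s z = 1/2 * Lim at_top (\<lambda>R::real. contour_integral
     (SOME p. valid_path p \<and> path_image p \<subseteq> pdom lam \<and> pathstart p = of_real R \<and> pathfinish p = z)
     (\<lambda>t. Z_pv lam t * hatF lam s t / t))"

text \<open>The constants are real numbers, represented as elements of type \<^typ>\<open>complex\<close>.\<close>

definition l_const :: "real \<Rightarrow> nat \<Rightarrow> complex" where
  "l_const lam s = (if odd s
     then Lim at_bot (\<lambda>x::real. continue_from (Sm1 lam) (gamma1 lam) (hatE lam s) (of_real x))
     else 0)"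

definition k_const :: "real \<Rightarrow> nat \<Rightarrow> complex" where
  "k_const lam s = (if odd s then l_const lam s - Lim (at 0 within pdom lam) (hatE lam s) else 0)"


section \<open>Progressive paths and variations\<close>

definition R2_arc_on :: "real set \<Rightarrow> (real \<Rightarrow> complex) \<Rightarrow> bool" where
  "R2_arc_on I L \<longleftrightarrow> (\<exists>L' L''.
     (\<forall>\<tau>\<in>I. (L has_vector_derivative L' \<tau>) (at \<tau> within I) \<and> L' \<tau> \<noteq> 0 \<and>
        (L' has_vector_derivative L'' \<tau>) (at \<tau> within I)) \<and> continuous_on I L'')"

text \<open>
  \<open>I\<close> is \<open>{0..1}\<close> for a path with finite starting point, \<open>{0<..1}\<close> for a path coming from infinity.
\<close>

definition R2_chain :: "real set \<Rightarrow> (real \<Rightarrow> complex) \<Rightarrow> bool" where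
  "R2_chain I L \<longleftrightarrow> continuous_on I L \<and>
     (\<exists>m (c :: nat \<Rightarrow> real). c 0 = 0 \<and> c m = 1 \<and>
        (\<forall>i<m. c i < c (Suc i) \<and> R2_arc_on ({c i..c (Suc i)} \<inter> I) L))"

text \<open>
  \<open>S\<close> is the region at the start of the path and \<open>C\<close> the curve opposite to it, which the path does
  not meet; the branch of \<open>\<xi>\<close> is the one continuous off \<open>C\<close>.
\<close>

definition progressive ::
    "real \<Rightarrow> real \<Rightarrow> complex set \<Rightarrow> complex set \<Rightarrow> real set \<Rightarrow> (real \<Rightarrow> complex) \<Rightarrow> complex \<Rightarrow> bool" where
  "progressive lam \<delta> S C I L z \<longleftrightarrow> L 1 = z \<and> R2_chain I L \<and>
     (\<forall>\<tau>\<in>{0<..1}. L \<tau> \<in> Cplus - C \<and> \<delta> \<le> dist (L \<tau>) (turning_pt lam)) \<and>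
     (monotone_on {0<..1} (\<le>) (\<le>) (\<lambda>\<tau>. Re (continue_from S C (xi_pv lam) (L \<tau>))) \<or>
      monotone_on {0<..1} (\<le>) (\<ge>) (\<lambda>\<tau>. Re (continue_from S C (xi_pv lam) (L \<tau>))))"

text \<open>Progressive paths from \<open>z\<^bsup>(1)\<^esup> = 0\<close> and from \<open>z\<^bsup>(3)\<^esup> = \<infinity> e\<^bsup>\<pi> i\<^esup>\<close>.\<close>

definition progressive1 :: "real \<Rightarrow> real \<Rightarrow> (real \<Rightarrow> complex) \<Rightarrow> complex \<Rightarrow> bool" where
  "progressive1 lam \<delta> L z \<longleftrightarrow> L 0 = 0 \<and> progressive lam \<delta> (Sm1 lam) (gamma1 lam) {0..1} L z"

definition progressive3 :: "real \<Rightarrow> real \<Rightarrow> (real \<Rightarrow> complex) \<Rightarrow> complex \<Rightarrow> bool" where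
  "progressive3 lam \<delta> L z \<longleftrightarrow> filterlim L at_infinity (at_right 0) \<and>
     ((\<lambda>\<tau>. Arg (L \<tau>)) \<longlongrightarrow> pi) (at_right 0) \<and>
     progressive lam \<delta> (S1 lam) (gamma3 lam) {0<..1} L z"

text \<open>The integral of \<open>|h(t) dt|\<close> along \<open>L\<close>, which may be infinite if \<open>L\<close> is unbounded.\<close>

definition variation_along :: "(complex \<Rightarrow> complex) \<Rightarrow> (real \<Rightarrow> complex) \<Rightarrow> ennreal" where
  "variation_along h L =
     (\<integral>\<^sup>+\<tau>\<in>{0<..1}. ennreal (norm (h (L \<tau>)) * norm (vector_derivative L (at \<tau> within {0..1}))) \<partial>lborel)"

text \<open>
  The integrands are continued along the path from the starting region \<open>S\<close>, as the principal value
  of \<open>Z\<close> is not defined on \<open>\<gamma>\<^sub>2\<close>.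
\<close>

definition omega ::
    "real \<Rightarrow> real \<Rightarrow> complex set \<Rightarrow> complex set \<Rightarrow> nat \<Rightarrow> (real \<Rightarrow> complex) \<Rightarrow> ennreal" where
  "omega lam \<mu> S C n L =
     variation_along (continue_from S C (\<lambda>t. Z_pv lam t * hatF lam n t / t)) L +
     (\<Sum>s\<in>{1..<n}. ennreal (1 / (2 * \<mu> ^ s)) *
        variation_along (continue_from S C (\<lambda>t. Z_pv lam t * hatG lam n s t / t)) L)"

definition varpi ::
    "real \<Rightarrow> real \<Rightarrow> complex set \<Rightarrow> complex set \<Rightarrow> nat \<Rightarrow> (real \<Rightarrow> complex) \<Rightarrow> ennreal" where
  "varpi lam \<mu> S C n L =
     (\<Sum>s<n - 1. ennreal (2 / \<mu> ^ s) *
        variation_along (continue_from S C (\<lambda>t. Z_pv lam t * hatF lam (s + 1) t / t)) L)"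

definition omega1 :: "real \<Rightarrow> real \<Rightarrow> nat \<Rightarrow> (real \<Rightarrow> complex) \<Rightarrow> ennreal" where
  "omega1 lam \<mu> = omega lam \<mu> (Sm1 lam) (gamma1 lam)"

definition varpi1 :: "real \<Rightarrow> real \<Rightarrow> nat \<Rightarrow> (real \<Rightarrow> complex) \<Rightarrow> ennreal" where
  "varpi1 lam \<mu> = varpi lam \<mu> (Sm1 lam) (gamma1 lam)"

definition omega3 :: "real \<Rightarrow> real \<Rightarrow> nat \<Rightarrow> (real \<Rightarrow> complex) \<Rightarrow> ennreal" where
  "omega3 lam \<mu> = omega lam \<mu> (S1 lam) (gamma3 lam)"

definition varpi3 :: "real \<Rightarrow> real \<Rightarrow> nat \<Rightarrow> (real \<Rightarrow> complex) \<Rightarrow> ennreal" where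
  "varpi3 lam \<mu> = varpi lam \<mu> (S1 lam) (gamma3 lam)"

end

theory Submission
  imports Defs "HOL-Real_Asymp.Real_Asymp"
begin

text \<open>Liouville-Green expansion with Olver's explicit remainder. An exact solution divided by the
truncated exponential is \<open>1 + h\<close>, where \<open>h'' = - 2 \<mu> h' + \<dots>\<close> in the variable \<open>x = - \<xi>\<close> with a residual
of order \<open>\<mu>\<close> to the power \<open>1 - N\<close>. As Re \<open>x\<close> increases along a progressive path, \<open>h'\<close> and the first
integral \<open>2 \<mu> h + h'\<close> stay small by a Gronwall argument. The constants are fixed by the behaviour of M
at 0, and of W at infinity after continuation across the cut; since the coefficients are polynomials
divided by powers of Z, all integrals converge at both ends of the paths.\<close>

section \<open>Linear differential equations in the complex plane\<close>

text \<open>Three obstacles shape the development. The \<open>THE\<close> and \<open>SOME\<close> in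
  the definitions say nothing until existence and uniqueness are proved: M comes from Kummer's
  series, W from Laplace integrals along rotated rays, and every branch of Z and of (z/Z)^(1/2) is
  written as m^2 \<open>csq\<close> and m \<open>q0\<close> with a piecewise constant fourth root of
  unity m. The regions are given topologically; their shape is read off from two signs. Along
  circles about 0 the derivative of Re xi has the sign of -Im Z, along rays that of Re Z, so the
  level is monotone in each polar coordinate on either side of the line Re z = 2 lam. For odd s the
  integral defining E_s involves half-integral powers of Q and is algebraic, but for even s the
  integrand is rational and could produce logarithms. A formal power series identity excludes them:
  the F_s of even index add up to -1/2 times the logarithmic derivative of 1 plus those of odd
  index. It also makes the even E_s vanish at 0 and at infinity, which agrees with k and l being 0
  at even indices.\<close>

fun ode_coeff :: "(nat=>complex)=>complex=>complex=>nat=>complex" where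
 "ode_coeff q a b 0=a"
| "ode_coeff q a b (Suc 0)=b"
| "ode_coeff q a b (Suc (Suc n)) =
   (\<Sum>k\<le>n. q k * ode_coeff q a b (n - k))/(of_nat (Suc n) * of_nat (Suc (Suc n)))"

text \<open>The recursion for the Taylor coefficients of a solution of u'' = q u divides by
  (n+1)(n+2). Once this divisor is at least R^2 times the majorant of q, the weights |c_n| R^n
  cannot exceed their earlier maximum.\<close>

lemma ode_coeff_bounded:
 fixes R :: real
 assumes R: "0<R" and sm: "summable (%k. norm (q k) * R^k)"
 shows "\<exists>K. \<forall>n. norm (ode_coeff q a b n) * R^n<=K"
proof -
 define c where "c = ode_coeff q a b"
 define B where "B=(\<Sum>k. norm (q k) * R^k)"
 have B0: "0<=B" unfolding B_def using R by (intro suminf_nonneg sm) auto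
 obtain N :: nat where N: "R\<^sup>2 * B<=real N" using real_arch_simple by blast
 define K where "K=Max ((%n. norm (c n) * R^n) ` {..Suc N})"
 have K0: "norm (c n) * R^n<=K" if "n<=Suc N" for n
  unfolding K_def using that by (intro Max_ge) auto
 have Knn: "0<=K"
  using order_trans[OF norm_ge_zero[of "c 0"], of K] K0[of 0] by simp
 have "norm (c n) * R^n<=K" for n
 proof (induction n rule: less_induct)
  case (less n)
  show ?case
  proof (cases "n<=Suc N")
   case False
   then obtain m where n: "n=Suc (Suc m)" and m: "N<=m"
    by (metis Suc_le_D Suc_le_mono not_less_eq_eq le_SucI)
   have "norm (c n)*(real (Suc m) * real (Suc (Suc m)))=norm (\<Sum>k\<le>m. q k * c (m - k))"
    unfolding n c_def ode_coeff.simps norm_divide norm_mult norm_of_nat by simp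
   also have "\<dots><=(\<Sum>k\<le>m. norm (q k) * norm (c (m - k)))"
    by (rule order_trans[OF norm_sum]) (simp add: norm_mult)
   finally have 1: "norm (c n)*(real (Suc m) * real (Suc (Suc m))) <=
    (\<Sum>k\<le>m. norm (q k) * norm (c (m - k)))" .
   have "norm (c n) * R^n*(real (Suc m) * real (Suc (Suc m))) =
    (norm (c n)*(real (Suc m) * real (Suc (Suc m)))) * R^n" by simp
   also have "\<dots><=(\<Sum>k\<le>m. norm (q k) * norm (c (m - k))) * R^n"
    using 1 R by (intro mult_right_mono) auto
   also have "\<dots>=R\<^sup>2*(\<Sum>k\<le>m. (norm (q k) * R^k)*(norm (c (m - k)) * R^(m - k)))"
   proof -
    have "R^n=R\<^sup>2*(R^k * R^(m - k))" if "k<=m" for k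
    using that unfolding n by (simp add: power2_eq_square flip: power_add)
    thus ?thesis unfolding sum_distrib_left sum_distrib_right
    by (intro sum.cong refl) simp
   qed
   also have "\<dots><=R\<^sup>2*(\<Sum>k\<le>m. (norm (q k) * R^k) * K)"
    using R less.IH n by (intro mult_left_mono sum_mono) auto
   also have "\<dots><=R\<^sup>2*(B * K)"
    unfolding sum_distrib_right[symmetric] B_def using R Knn
    by (intro mult_left_mono mult_right_mono sum_le_suminf sm) auto
   also have "\<dots><=real N * K" using N Knn by (metis mult.assoc mult_right_mono)
   also have "\<dots><=(real (Suc m) * real (Suc (Suc m))) * K"
   proof -
    have "real N*1<=real (Suc m) * real (Suc (Suc m))"
    using m by (intro mult_mono) auto
    thus ?thesis using Knn by (intro mult_right_mono) auto
   qed
   finally have "norm (c n) * R^n*(real (Suc m) * real (Suc (Suc m)))<=K*(real (Suc m) * real (Suc (Suc m)))"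
    by (simp add: mult.commute)
   thus ?thesis
    by (rule mult_right_le_imp_le) simp
  qed (use K0 in auto)
 qed
 thus ?thesis unfolding c_def by blast
qed

lemma entire_ode_exists:
 fixes q :: "complex=>complex"
 assumes q: "q holomorphic_on UNIV"
 obtains u where "u holomorphic_on UNIV" "u 0=a" "deriv u 0=b"
  "!!v. deriv (deriv u) v=q v * u v"
proof -
 define qc where "qc=(%k. (deriv ^^ k) q 0/fact k)"
 have qs: "(%k. qc k * v^k) sums q v" for v
  using holomorphic_power_series[of q 0 "norm v+1" v] q
  by (auto simp: qc_def intro: holomorphic_on_subset)
 have qsum: "summable (%k. norm (qc k) * R^k)" if "0<R" for R :: real
 proof -
  have "summable (%k. qc k * complex_of_real (R+1)^k)" using qs sums_summable by blast
  hence "summable (%k. norm (qc k * complex_of_real R^k))"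
   by (rule powser_insidea) (use that in auto)
  thus ?thesis using that by (simp add: norm_mult norm_power)
 qed
 define c where "c = ode_coeff qc a b"
 have csum: "summable (%n. norm (c n) * r^n)" if "0<=r" for r :: real
 proof -
  have r: "0<r+1" using that by simp
  obtain K where "\<forall>n. norm (c n)*(r+1)^n<=K"
   using ode_coeff_bounded[OF r qsum[OF r]] unfolding c_def by blast
  thus ?thesis
   by (intro Abel_lemma[of r "r+1"]) (use that in auto)
 qed
 have cn: "summable (%n. norm (c n * v^n))" for v
  using csum[of "norm v"] by (simp add: norm_mult norm_power)
 have cs: "summable (%n. c n * v^n)" for v by (rule summable_norm_cancel[OF cn])
 define u where "u=(%v. \<Sum>n. c n * v^n)"
 define u1 where "u1=(%v. \<Sum>n. diffs c n * v^n)"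
 define u2 where "u2=(%v. \<Sum>n. diffs (diffs c) n * v^n)"
 have d1: "(u has_field_derivative u1 v) (at v)" for v
  unfolding u_def u1_def by (rule termdiffs_strong_converges_everywhere[OF cs])
 have cs1: "summable (%n. diffs c n * v^n)" for v
  by (rule termdiff_converges_all[OF cs])
 have d2: "(u1 has_field_derivative u2 v) (at v)" for v
  unfolding u1_def u2_def by (rule termdiffs_strong_converges_everywhere[OF cs1])
 have du: "deriv u=u1" "deriv u1=u2" using d1 d2 DERIV_imp_deriv by blast+
 have "u2 v=q v * u v" for v
 proof -
  have "q v * u v=(\<Sum>k. qc k * v^k)*(\<Sum>k. c k * v^k)"
   unfolding u_def using qs sums_unique by metis
  also have "\<dots>=(\<Sum>k. \<Sum>i\<le>k. (qc i * v^i)*(c (k - i) * v^(k - i)))"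
  proof (rule Cauchy_product[OF _ cn])
   show "summable (%k. norm (qc k * v^k))"
   proof (cases "v=0")
    case False
    thus ?thesis using qsum[of "norm v"] by (simp add: norm_mult norm_power)
   qed (auto intro!: summable_finite[of "{0}"] simp: power_0_left split: if_splits)
  qed
  also have "\<dots>=u2 v"
  proof -
   have "(\<Sum>i\<le>k. (qc i * v^i)*(c (k - i) * v^(k - i)))=diffs (diffs c) k * v^k" for k
   proof -
    have "(\<Sum>i\<le>k. (qc i * v^i)*(c (k - i) * v^(k - i)))=(\<Sum>i\<le>k. qc i * c (k - i)) * v^k"
    unfolding sum_distrib_right
    proof (intro sum.cong refl)
    fix i assume "i\<in>{..k}"
    hence "v^k=v^i * v^(k - i)" by (simp flip: power_add)
    thus "(qc i * v^i)*(c (k - i) * v^(k - i))=qc i * c (k - i) * v^k" by simp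
    qed
    also have "(\<Sum>i\<le>k. qc i * c (k - i)) = of_nat (Suc k) * of_nat (Suc (Suc k)) * c (Suc (Suc k))"
    unfolding c_def ode_coeff.simps by (simp del: of_nat_Suc)
    finally show ?thesis unfolding diffs_def by (simp add: mult.assoc)
   qed
   thus ?thesis unfolding u2_def by simp
  qed
  finally show ?thesis ..
 qed
 moreover have "u holomorphic_on UNIV"
  using d1 by (auto simp: holomorphic_on_def field_differentiable_def)
 moreover have "u 0=a" "u1 0=b"
  unfolding u_def u1_def by (simp_all add: c_def diffs_def)
 ultimately show ?thesis using that du by metis
qed

text \<open>By the equation every derivative of order n + 2 at \<open>z\<close> is a Leibniz sum
  over lower ones, so the whole Taylor series at \<open>z\<close> vanishes.\<close>

lemma ode_zero_unique:
 assumes S: "open S" "connected S" and f: "f holomorphic_on S" and p: "p holomorphic_on S" and q: "q holomorphic_on S"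
  and ode: "!!v. v\<in>S==>deriv (deriv f) v=p v * deriv f v + q v * f v"
  and z: "z\<in>S" "f z=0" "deriv f z=0" and w: "w\<in>S"
 shows "f w=0"
proof (rule holomorphic_fun_eq_0_on_connected[OF f S _ z(1) w])
 fix n
 have df: "deriv f holomorphic_on S" by (rule holomorphic_deriv[OF f S(1)])
 show "(deriv ^^ n) f z=0"
 proof (induction n rule: less_induct)
  case (less n)
  consider "n=0" | "n=1" | m where "n=Suc (Suc m)" by (metis One_nat_def not0_implies_Suc)
  thus ?case
  proof cases
   case 3
   have "(deriv ^^ n) f z=(deriv ^^ m) (deriv (deriv f)) z" unfolding 3
    by (simp add: funpow_Suc_right del: funpow.simps)
   also have "\<dots>=(deriv ^^ m) (%v. p v * deriv f v + q v * f v) z"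
    by (rule higher_deriv_transform_within_open[OF holomorphic_deriv[OF df S(1)] _ S(1) z(1)])
    (auto intro!: holomorphic_intros f df p q simp: ode)
   also have "\<dots>=(deriv ^^ m) (%v. p v * deriv f v) z+(deriv ^^ m) (%v. q v * f v) z"
    by (rule higher_deriv_add[OF _ _ S(1) z(1)]) (auto intro!: holomorphic_intros f df p q)
   also have "(deriv ^^ m) (%v. q v * f v) z=0"
    unfolding higher_deriv_mult[OF q f S(1) z(1)]
    by (rule sum.neutral) (use less 3 in auto)
   also have "(deriv ^^ m) (%v. p v * deriv f v) z=0"
   proof -
    have "(deriv ^^ (m - i)) (deriv f) z=0" for i
    using less.IH[of "Suc (m - i)"] 3 by (simp add: funpow_Suc_right del: funpow.simps)
    thus ?thesis
    unfolding higher_deriv_mult[OF p df S(1) z(1)] by simp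
   qed
   finally show ?thesis by simp
  qed (use z in auto)
 qed
qed

section \<open>Whittaker's equation in the logarithmic variable\<close>

text \<open>This is z^2 times the bracket in Whittaker's equation, at z = exp v. In this variable
  z^2 d^2/dz^2 is d^2/dv^2 - d/dv, which explains the first derivative in
  \<open>whit_on\<close>.\<close>

definition whit_pot :: "real=>real=>complex=>complex" where
 "whit_pot \<kappa> mu v = of_real mu^2-1/4 - of_real \<kappa> * exp v + exp v^2/4"

definition whit_on :: "real=>real=>complex set=>(complex=>complex)=>bool" where
 "whit_on \<kappa> mu S Y\<longleftrightarrow>Y holomorphic_on S &
   (\<forall>v\<in>S. deriv (deriv Y) v=deriv Y v + whit_pot \<kappa> mu v * Y v)"

lemma whit_pot_holomorphic [holomorphic_intros]: "whit_pot \<kappa> mu holomorphic_on S"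
 unfolding whit_pot_def by (intro holomorphic_intros) auto

lemma whit_on_subset: "whit_on \<kappa> mu S Y==>T\<subseteq>S==>whit_on \<kappa> mu T Y"
 unfolding whit_on_def using holomorphic_on_subset by blast

lemma whittaker_solution_iff: "whittaker_solution \<kappa> mu Y\<longleftrightarrow>whit_on \<kappa> mu UNIV Y"
proof (cases "Y holomorphic_on UNIV")
 case True
 have d: "deriv Y holomorphic_on UNIV" by (intro holomorphic_deriv True) auto
 have "z_deriv (z_deriv Y) v=(deriv (deriv Y) v - deriv Y v)/exp v^2" for v
 proof -
  have "(deriv Y has_field_derivative deriv (deriv Y) v) (at v)"
   using holomorphic_derivI[OF d open_UNIV] by auto
  hence "((%v. deriv Y v/exp v) has_field_derivative
    (deriv (deriv Y) v * exp v - deriv Y v * exp v)/(exp v * exp v)) (at v)"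
   by (intro derivative_intros) (auto intro!: derivative_eq_intros)
  hence "deriv (z_deriv Y) v=(deriv (deriv Y) v * exp v - deriv Y v * exp v)/(exp v * exp v)"
   unfolding z_deriv_def[abs_def] by (rule DERIV_imp_deriv)
  also have "\<dots>=(deriv (deriv Y) v - deriv Y v)/exp v"
   by (simp add: left_diff_distrib[symmetric])
  finally show ?thesis unfolding z_deriv_def[of "z_deriv Y"]
   by (simp add: power2_eq_square)
 qed
 moreover have "((of_real mu^2-1/4)/exp v^2 - of_real \<kappa>/exp v+1/4) * Y v=(whit_pot \<kappa> mu v * Y v)/exp v^2" for v
  unfolding whit_pot_def by (simp add: power2_eq_square field_simps)
 ultimately show ?thesis unfolding whittaker_solution_def whit_on_def using True
  by (auto simp: algebra_simps)
qed (auto simp: whittaker_solution_def whit_on_def)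

text \<open>The substitution Y = exp (v/2) u removes the first derivative and adds 1/4 to the
  potential, so that \<open>entire_ode_exists\<close> applies.\<close>

lemma whit_on_exists:
 obtains Y where "whit_on \<kappa> mu UNIV Y" "Y 0=a" "deriv Y 0=b"
proof -
 obtain u where u: "u holomorphic_on UNIV" "u 0=a" "deriv u 0=b - a/2"
  "!!v. deriv (deriv u) v=(whit_pot \<kappa> mu v+1/4) * u v"
 proof (rule entire_ode_exists[of "%v. whit_pot \<kappa> mu v+1/4" a "b - a/2"])
  show "(%v. whit_pot \<kappa> mu v+1/4) holomorphic_on UNIV" by (intro holomorphic_intros)
 qed blast
 define Y where "Y=(%v. exp (v/2) * u v)"
 have du: "(u has_field_derivative deriv u v) (at v)" for v
  using holomorphic_derivI[OF u(1) open_UNIV] by auto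
 have "deriv u holomorphic_on UNIV" by (intro holomorphic_deriv u) auto
 hence du2: "(deriv u has_field_derivative deriv (deriv u) v) (at v)" for v
  using holomorphic_derivI[OF _ open_UNIV] by auto
 have Y1: "deriv Y=(%v. exp (v/2)*(u v/2 + deriv u v))"
 proof
  fix v show "deriv Y v=exp (v/2)*(u v/2 + deriv u v)" unfolding Y_def
   by (rule DERIV_imp_deriv) (auto intro!: derivative_eq_intros du simp: field_simps)
 qed
 have Y2: "deriv (deriv Y) v=exp (v/2)*(u v/4 + deriv u v + deriv (deriv u) v)" for v
  unfolding Y1
  by (rule DERIV_imp_deriv) (auto intro!: derivative_eq_intros du du2 simp: field_simps)
 have "Y holomorphic_on UNIV" unfolding Y_def by (intro holomorphic_intros u) auto
 moreover have "deriv (deriv Y) v=deriv Y v + whit_pot \<kappa> mu v * Y v" for v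
 proof -
  have Yv: "Y v=exp (v/2) * u v" by (simp add: Y_def)
  show ?thesis unfolding Y2[of v] u(4)[of v] fun_cong[OF Y1, of v] Yv by (simp add: algebra_simps)
 qed
 ultimately have "whit_on \<kappa> mu UNIV Y" unfolding whit_on_def by blast
 moreover have "Y 0=a" "deriv Y 0=b" unfolding Y1 by (auto simp: Y_def u)
 ultimately show ?thesis using that by blast
qed

lemma whit_on_unique_initial:
 assumes S: "open S" "connected S" and Y: "whit_on \<kappa> mu S Y" "whit_on \<kappa> mu S X"
  and z: "z\<in>S" "Y z=X z" "deriv Y z=deriv X z" and w: "w\<in>S"
 shows "Y w=X w"
proof -
 have hol: "Y holomorphic_on S" "X holomorphic_on S" using Y by (auto simp: whit_on_def)
 have 1: "deriv (%v. Y v - X v) v=deriv Y v - deriv X v" if "v\<in>S" for v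
  using hol S(1) that by (intro deriv_diff) (auto simp: holomorphic_on_open field_differentiable_def)
 have 2: "deriv (deriv (%v. Y v - X v)) v=deriv (deriv Y) v - deriv (deriv X) v" if "v\<in>S" for v
 proof -
  have h: "deriv Y holomorphic_on S" "deriv X holomorphic_on S" using hol S(1) holomorphic_deriv by blast+
  have "deriv (deriv (%v. Y v - X v)) v=deriv (%v. deriv Y v - deriv X v) v"
   by (rule complex_derivative_transform_within_open[of _ S]) (use hol S h that 1 in "auto intro!: holomorphic_intros")
  also have "\<dots>=deriv (deriv Y) v - deriv (deriv X) v"
   using h S(1) that by (intro deriv_diff) (auto simp: holomorphic_on_open field_differentiable_def)
  finally show ?thesis .
 qed
 have "(%v. Y v - X v) w=0"
 proof (rule ode_zero_unique[where p = "%_. 1" and q = "whit_pot \<kappa> mu", OF S _ _ _ _ z(1) _ _ w])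
  show "deriv (deriv (%v. Y v - X v)) v=1 * deriv (%v. Y v - X v) v + whit_pot \<kappa> mu v * (Y v - X v)"
   if "v\<in>S" for v
   unfolding 1[OF that] 2[OF that] using Y that by (simp add: whit_on_def algebra_simps)
 qed (use z 1 in "auto intro!: holomorphic_intros hol")
 thus ?thesis by simp
qed

text \<open>By Abel's identity the Wronskian divided by exp v is constant. It equals E^2/exp v times
  a quantity that tends to 0 along \<open>G\<close>, so the constant is 0, the solutions are
  proportional, and the common normalisation makes the factor 1. Here \<open>th\<close> is meant to
  be the logarithmic derivative of \<open>E\<close>.\<close>

lemma whit_on_unique_recessive:
 assumes S: "open S" "connected S" and Y: "whit_on \<kappa> mu S Y" "whit_on \<kappa> mu S X"
  and G: "G~=bot" "eventually (%v. v\<in>S) G" and E0: "!!v. E v~=0"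
  and lim: "((%v. Y v/E v)\<longlongrightarrow>1) G" "((%v. X v/E v)\<longlongrightarrow>1) G"
  and lim1: "((%v. (deriv Y v-th v * Y v)/E v)\<longlongrightarrow>0) G" "((%v. (deriv X v-th v * X v)/E v)\<longlongrightarrow>0) G"
  and rec: "((%v. E v^2/exp v)\<longlongrightarrow>0) G"
  and w: "w\<in>S"
 shows "Y w=X w"
proof -
 have hol: "Y holomorphic_on S" "X holomorphic_on S" using Y by (auto simp: whit_on_def)
 have h1: "deriv Y holomorphic_on S" "deriv X holomorphic_on S" using hol S(1) holomorphic_deriv by blast+
 have d: "(Y has_field_derivative deriv Y v) (at v)" "(X has_field_derivative deriv X v) (at v)"
  "(deriv Y has_field_derivative deriv (deriv Y) v) (at v)" "(deriv X has_field_derivative deriv (deriv X) v) (at v)"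
  if "v\<in>S" for v using holomorphic_derivI[OF _ S(1) that] hol h1 by auto
 define Wr where "Wr=(%v. (Y v * deriv X v - deriv Y v * X v)/exp v)"
 have dW: "(Wr has_field_derivative 0) (at v)" if "v\<in>S" for v
 proof -
  have "(Wr has_field_derivative
    ((deriv Y v * deriv X v + deriv (deriv X) v * Y v-(deriv (deriv Y) v * X v + deriv X v * deriv Y v)) * exp v
    - (Y v * deriv X v - deriv Y v * X v) * exp v)/(exp v * exp v)) (at v)"
   unfolding Wr_def using that by (intro derivative_intros d) auto
  moreover have "(deriv Y v * deriv X v + deriv (deriv X) v * Y v-(deriv (deriv Y) v * X v + deriv X v * deriv Y v)) * exp v
    - (Y v * deriv X v - deriv Y v * X v) * exp v=0"
   using Y that unfolding whit_on_def by (simp add: algebra_simps)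
  ultimately show ?thesis by simp
 qed
 obtain c where c: "!!v. v\<in>S==>Wr v=c"
 proof (rule DERIV_zero_connected_constant[OF S(2,1) finite.emptyI, of Wr])
  show "continuous_on S Wr"
   using dW DERIV_isCont by (intro continuous_at_imp_continuous_on) blast
 qed (use dW in auto)
 have "c=0"
 proof -
  have "Wr v=E v^2/exp v * ((Y v/E v)*((deriv X v-th v * X v)/E v)-((deriv Y v-th v * Y v)/E v)*(X v/E v))" for v
   using E0[of v] by (simp add: Wr_def field_simps power2_eq_square)
  moreover have "((%v. E v^2/exp v * ((Y v/E v)*((deriv X v-th v * X v)/E v)-((deriv Y v-th v * Y v)/E v)*(X v/E v)))\<longlongrightarrow>0*(1*0-0*1)) G"
   by (intro tendsto_intros lim lim1 rec)
  ultimately have "(Wr\<longlongrightarrow>0*(1*0-0*1)) G" by presburger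
  hence "(Wr\<longlongrightarrow>0) G" by simp
  moreover have "(Wr\<longlongrightarrow>c) G"
   by (rule tendsto_eventually) (use G(2) c in "auto elim: eventually_mono")
  ultimately show ?thesis using tendsto_unique[OF G(1)] by metis
 qed
 have "eventually (%v. Y v/E v~=0) G"
  using lim(1) by (rule tendsto_imp_eventually_ne) auto
 then obtain v0 where v0: "v0\<in>S" "Y v0~=0"
  using eventually_happens[OF eventually_conj[OF G(2)]] G(1) by fastforce
 define k where "k=X v0/Y v0"
 have XY: "X v=k * Y v" if "v\<in>S" for v
 proof (rule whit_on_unique_initial[OF S Y(2) _ v0(1) _ _ that])
  have "deriv (%v. k * Y v) v=k * deriv Y v" if "v\<in>S" for v
   by (rule DERIV_imp_deriv) (use d that in "auto intro!: derivative_eq_intros")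
  moreover from this have "deriv (deriv (%v. k * Y v)) v=k * deriv (deriv Y) v" if "v\<in>S" for v
  proof -
   have "deriv (deriv (%v. k * Y v)) v=deriv (%v. k * deriv Y v) v"
    by (rule complex_derivative_transform_within_open[of _ S])
    (use hol S h1 that calculation in "auto intro!: holomorphic_intros")
   also have "\<dots>=k * deriv (deriv Y) v"
    by (rule DERIV_imp_deriv) (use d that in "auto intro!: derivative_eq_intros")
   finally show ?thesis .
  qed
  ultimately show "whit_on \<kappa> mu S (%v. k * Y v)"
   using Y hol unfolding whit_on_def
   by (auto intro!: holomorphic_intros simp: algebra_simps)
  have "deriv X v0=k * deriv Y v0"
   using c[OF v0(1)] \<open>c = 0\<close> v0 unfolding Wr_def k_def by (simp add: field_simps)
  thus "deriv X v0=deriv (%v. k * Y v) v0"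
   using \<open>\<And>v. v \<in> S \<Longrightarrow> deriv (\<lambda>v. k * Y v) v = k * deriv Y v\<close> v0 by simp
 qed (use v0 in "auto simp: k_def")
 have "((%v. k*(Y v/E v))\<longlongrightarrow>k*1) G" by (intro tendsto_intros lim)
 moreover have "((%v. k*(Y v/E v))\<longlongrightarrow>1) G"
  by (rule Lim_transform_eventually[OF lim(2)]) (use G(2) XY in "auto elim!: eventually_mono")
 ultimately have "k=1" using tendsto_unique[OF G(1)] by fastforce
 thus ?thesis using XY w by simp
qed

text \<open>Cauchy's estimate on discs of fixed radius turns asymptotics of a function into
  asymptotics of its derivative. The discs about points of \<open>G\<close> must stay within reach
  of \<open>G'\<close>; for this reason the strip in \<open>W_char\<close> loses half its
  width.\<close>

lemma deriv_tendsto_0_Cauchy: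
 fixes \<rho> :: "complex=>complex"
 assumes r: "0<r" and hol: "\<rho> holomorphic_on S" and lim: "(\<rho>\<longlongrightarrow>c) G'"
  and nbhd: "!!P. eventually P G'==>eventually (%v. \<forall>w\<in>cball v r. P w) G"
  and S: "eventually (%v. cball v r\<subseteq>S) G"
 shows "(deriv \<rho>\<longlongrightarrow>0) G"
proof (rule tendstoI)
 fix e :: real assume e: "0<e"
 have "eventually (%w. dist (\<rho> w) c<e * r/2) G'"
  using lim e r by (intro tendstoD) auto
 from nbhd[OF this] S show "eventually (%v. dist (deriv \<rho> v) 0<e) G"
 proof eventually_elim
  case (elim v)
  have h: "\<rho> holomorphic_on cball v r" using hol elim(2) holomorphic_on_subset by blast
  have "norm ((deriv ^^ 1) \<rho> v)<=fact 1*(e * r/2)/r^1"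
  proof (rule Cauchy_higher_deriv_bound[of _ _ _ c])
   show "\<rho> holomorphic_on ball v r" using h holomorphic_on_subset ball_subset_cball by blast
   show "continuous_on (cball v r) \<rho>" using h holomorphic_on_imp_continuous_on by blast
   show "!!w. w\<in>ball v r==>\<rho> w\<in>ball c (e * r/2)" using elim(1) by (force simp: dist_commute)
  qed (use r in auto)
  also have "\<dots><e" using r e by simp
  finally show ?case by simp
 qed
qed

text \<open>The end Re v -> +infinity of a horizontal strip; for suitable \<open>A\<close> this is
  the filter in the definition of \<open>whittaker_W\<close>.\<close>

definition strip_at_top :: "real set=>complex filter" where
 "strip_at_top A=inf (filtercomap Re at_top) (principal {v. Im v\<in>A})"

lemma eventually_strip_at_top:
 "eventually P (strip_at_top A)\<longleftrightarrow>(\<exists>R. \<forall>v. R<=Re v-->Im v\<in>A-->P v)"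
 unfolding strip_at_top_def eventually_inf_principal eventually_filtercomap_at_top_linorder
 by simp

lemma eventually_Re_at_bot:
 "eventually P (filtercomap Re at_bot)\<longleftrightarrow>(\<exists>R. \<forall>v. Re v<=R-->P v)"
 by (rule eventually_filtercomap_at_bot_linorder)

lemma Re_at_bot_neq_bot: "filtercomap Re at_bot~=(bot::complex filter)"
proof
 assume "filtercomap Re at_bot=(bot::complex filter)"
 hence "eventually (%v::complex. False) (filtercomap Re at_bot)" by simp
 then obtain R where "!!v::complex. Re v<=R==>False" unfolding eventually_Re_at_bot by blast
 from this[of "complex_of_real R"] show False by simp
qed

lemma strip_at_top_neq_bot: "A~={}==>strip_at_top A~=bot"
proof
 assume A: "A~={}" and "strip_at_top A=bot"
 hence "eventually (%v. False) (strip_at_top A)" by simp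
 then obtain R where R: "!!v. R<=Re v==>Im v\<in>A==>False" unfolding eventually_strip_at_top by blast
 obtain a where "a\<in>A" using A by blast
 thus False using R[of "Complex R a"] by simp
qed

lemma strip_at_top_mono: "A\<subseteq>B==>strip_at_top A<=strip_at_top B"
 unfolding strip_at_top_def by (intro inf_mono) auto

section \<open>The function M\<close>

text \<open>The Taylor coefficients of Kummer's function 1F1(a; b; z).\<close>

definition kummer_coeff :: "complex=>complex=>nat=>complex" where
 "kummer_coeff a b n=(\<Prod>i<n. (a + of_nat i)/((b + of_nat i) * of_nat (Suc i)))"

lemma kummer_coeff_summable:
 assumes b: "0<Re b"
 shows "summable (%n. kummer_coeff a b n * z^n)"
proof -
 obtain N :: nat where N: "2*((norm a+1) * norm z)<=real N" using real_arch_simple by blast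
 show ?thesis
 proof (rule summable_ratio_test[where c = "1/2" and N = "Suc N"])
  fix n assume n: "Suc N<=n"
  have bn: "real n<=norm (b + of_nat n)" "0<norm (b + of_nat n)"
   using complex_Re_le_cmod[of "b + of_nat n"] b by auto
  have "norm (a + of_nat n)<=norm a + real n" using norm_triangle_ineq[of a "of_nat n"] by simp
  also have "\<dots><=(norm a+1) * real (Suc n)" by (simp add: algebra_simps)
  finally have an: "norm (a + of_nat n)<=(norm a+1) * real (Suc n)" .
  have "norm (kummer_coeff a b (Suc n) * z^Suc n)=norm (kummer_coeff a b n * z^n) *
    (norm (a + of_nat n) * norm z/(norm (b + of_nat n) * real (Suc n)))"
   unfolding kummer_coeff_def by (simp add: norm_mult norm_divide norm_power del: of_nat_Suc)
  also have "\<dots><=norm (kummer_coeff a b n * z^n)*(1/2)"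
  proof (rule mult_left_mono)
   have "norm (a + of_nat n) * norm z<=(norm a+1) * norm z * real (Suc n)"
    using mult_right_mono[OF an, of "norm z"] by (simp add: mult.commute mult.left_commute)
   also have "\<dots><=(real n/2) * real (Suc n)" proof (intro mult_right_mono)
    show "(norm a+1) * norm z<=real n/2" using N n by linarith
   qed simp
   also have "\<dots><=(norm (b + of_nat n)/2) * real (Suc n)" using bn by (intro mult_right_mono) auto
   finally show "norm (a + of_nat n) * norm z/(norm (b + of_nat n) * real (Suc n))<=1/2"
    using bn by (simp add: divide_simps)
  qed simp
  finally show "norm (kummer_coeff a b (Suc n) * z^Suc n)<=1/2 * norm (kummer_coeff a b n * z^n)"
   by (simp only: mult.commute)
 qed simp
qed

lemma kummer_exists:
 assumes b: "0<Re b"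
 obtains F F1 F2 where "!!z. (F has_field_derivative F1 z) (at z)" "!!z. (F1 has_field_derivative F2 z) (at z)"
  "F 0=1" "!!z. z * F2 z+(b - z) * F1 z - a * F z=0"
proof -
 define c where "c=kummer_coeff a b"
 have cs: "summable (%n. c n * z^n)" for z unfolding c_def by (rule kummer_coeff_summable[OF b])
 have ds: "summable (%n. diffs c n * z^n)" for z by (rule termdiff_converges_all[OF cs])
 have dds: "summable (%n. diffs (diffs c) n * z^n)" for z by (rule termdiff_converges_all[OF ds])
 define F where "F=(%z. \<Sum>n. c n * z^n)"
 define F1 where "F1=(%z. \<Sum>n. diffs c n * z^n)"
 define F2 where "F2=(%z. \<Sum>n. diffs (diffs c) n * z^n)"
 have shift: "(%n. of_nat n * h n * z^n) sums (z*(\<Sum>n. diffs h n * z^n))"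
  if "summable (%n. diffs h n * z^n)" for h :: "nat=>complex" and z
 proof -
  have "z*(of_nat n * h n * z^(n - Suc 0)) = of_nat n * h n * z^n" for n
   by (cases n) auto
  with sums_mult[OF diffs_equiv[OF that], of z] show ?thesis by simp
 qed
 have "z * F2 z+(b - z) * F1 z - a * F z=0" for z
 proof -
  have "(%n. of_nat n * diffs c n * z^n + b*(diffs c n * z^n) - of_nat n * c n * z^n - a*(c n * z^n))
   sums (z * F2 z + b * F1 z - z * F1 z - a * F z)"
   unfolding F_def F1_def F2_def
   by (intro sums_add sums_diff sums_mult shift dds ds summable_sums cs)
  moreover have "of_nat n * diffs c n * z^n + b*(diffs c n * z^n) - of_nat n * c n * z^n - a*(c n * z^n)=0" for n
  proof -
   have "b + of_nat n~=0" using b by (metis Re_complex_of_real add.commute add_eq_0_iff complex_Re_of_nat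
    less_eq_real_def neg_0_le_iff_le not_less of_nat_0_le_iff uminus_complex.simps(1))
   hence "(b + of_nat n) * diffs c n=(a + of_nat n) * c n"
    unfolding diffs_def c_def kummer_coeff_def by (simp del: of_nat_Suc)
   hence "((b + of_nat n) * diffs c n-(a + of_nat n) * c n) * z^n=0" by simp
   thus ?thesis by (simp add: algebra_simps)
  qed
  ultimately have "(%n. 0) sums (z * F2 z + b * F1 z - z * F1 z - a * F z)" by simp
  hence "z * F2 z + b * F1 z - z * F1 z - a * F z=0" 
   using sums_unique2 sums_zero by blast
  thus ?thesis by (simp add: algebra_simps)
 qed
 moreover have "(F has_field_derivative F1 z) (at z)" "(F1 has_field_derivative F2 z) (at z)" for z
  unfolding F_def F1_def F2_def
  by (rule termdiffs_strong_converges_everywhere[OF cs], rule termdiffs_strong_converges_everywhere[OF ds])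
 moreover have "F 0=1" unfolding F_def by (simp add: c_def kummer_coeff_def)
 ultimately show ?thesis using that by blast
qed

text \<open>Kummer's equation for \<open>F\<close> turns into Whittaker's equation for \<open>exp (- z/2) z\<^bsup>mu + 1/2\<^esup> F z\<close>, \<open>z = exp v\<close>.\<close>

lemma whit_on_kummer:
 assumes F: "!!v. v\<in>S==>(F has_field_derivative F1 (exp v)) (at (exp v))"
   "!!v. v\<in>S==>(F1 has_field_derivative F2 (exp v)) (at (exp v))"
  and K: "!!v. v\<in>S==>exp v * F2 (exp v)+(of_real (1+2*mu) - exp v) * F1 (exp v) - of_real (mu - \<kappa> + 1/2) * F (exp v)=0"
  and S: "open S"
 shows "whit_on \<kappa> mu S (%v. exp (of_real (mu + 1/2) * v - exp v/2) * F (exp v))"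
proof -
 define s where "s=complex_of_real (mu + 1/2)"
 define Y where "Y=(%v. exp (s * v - exp v/2) * F (exp v))"
 define Y1 where "Y1=(%v. exp (s * v - exp v/2)*((s - exp v/2) * F (exp v) + exp v * F1 (exp v)))"
 define Y2 where "Y2=(%v. exp (s * v - exp v/2)*((s - exp v/2)^2 * F (exp v)+2*(s - exp v/2) * exp v * F1 (exp v)
   - exp v/2 * F (exp v) + exp v * F1 (exp v) + exp v^2 * F2 (exp v)))"
 have FF: "((%v. F (exp v)) has_field_derivative F1 (exp v) * exp v) (at v)"
   "((%v. F1 (exp v)) has_field_derivative F2 (exp v) * exp v) (at v)" if "v\<in>S" for v
  using DERIV_chain2[OF F(1)[OF that] DERIV_exp] DERIV_chain2[OF F(2)[OF that] DERIV_exp] by auto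
 have dY: "(Y has_field_derivative Y1 v) (at v)" if "v\<in>S" for v
  unfolding Y_def Y1_def using that
  by (auto intro!: derivative_eq_intros FF simp: algebra_simps)
 have dY1: "(Y1 has_field_derivative Y2 v) (at v)" if "v\<in>S" for v
 proof -
  have dE: "((%v. exp (s * v - exp v/2)) has_field_derivative exp (s * v - exp v/2)*(s - exp v/2)) (at v)"
   by (auto intro!: derivative_eq_intros)
  have dG: "((%v. (s - exp v/2) * F (exp v) + exp v * F1 (exp v)) has_field_derivative
    - (exp v/2) * F (exp v)+(s - exp v/2)*(F1 (exp v) * exp v)+(exp v * F1 (exp v) + exp v * (F2 (exp v) * exp v))) (at v)"
   by (auto intro!: derivative_eq_intros FF[OF that])
  have "x*((s - t/2) * f + t * f1)+(- (t/2) * f+(s - t/2)*(f1 * t)+(t * f1 + t*(f2 * t))) * e =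
   e*((s - t/2)\<^sup>2 * f+2*(s - t/2) * t * f1 - t/2 * f + t * f1 + t\<^sup>2 * f2)"
   if "x=e*(s - t/2)" for x e t f f1 f2
   unfolding that by (simp add: field_simps power2_eq_square)
  from this[OF refl] show ?thesis unfolding Y1_def Y2_def
   by (rule DERIV_cong[OF DERIV_mult[OF dE dG]])
 qed
 have hol: "Y holomorphic_on S" using dY S by (auto simp: holomorphic_on_open)
 have D1: "deriv Y v=Y1 v" if "v\<in>S" for v using dY[OF that] by (rule DERIV_imp_deriv)
 have D2: "deriv (deriv Y) v=Y2 v" if "v\<in>S" for v
 proof -
  have "deriv (deriv Y) v=deriv Y1 v"
   by (rule complex_derivative_transform_within_open[of _ S])
    (use D1 dY1 S that holomorphic_deriv[OF hol S] in "auto simp: holomorphic_on_open")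
  thus ?thesis using DERIV_imp_deriv[OF dY1[OF that]] by simp
 qed
 have "Y2 v=Y1 v + whit_pot \<kappa> mu v * Y v" if "v\<in>S" for v
 proof -
  define x where "x=exp v"
  have s: "of_real (1+2*mu)=2 * s" "of_real (mu - \<kappa> + 1/2)=s - of_real \<kappa>" "of_real mu=s-1/2"
   by (simp_all add: s_def)
  have k: "x * F2 x=(s - of_real \<kappa>) * F x-(2 * s - x) * F1 x"
   using K[OF that] unfolding s x_def[symmetric] by (simp add: algebra_simps)
  have "e*((t - x/2)^2 * f+2*(t - x/2) * x * f1 - x/2 * f + x * f1 + x^2 * f2) -
    e*((t - x/2) * f + x * f1)-((t-1/2)^2-1/4 - c * x + x^2/4)*(e * f)=0"
   if "x * f2=(t - c) * f-(2 * t - x) * f1" for e f f1 f2 t c :: complex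
  proof -
   have "e*((t - x/2)^2 * f+2*(t - x/2) * x * f1 - x/2 * f + x * f1 + x^2 * f2) -
    e*((t - x/2) * f + x * f1)-((t-1/2)^2-1/4 - c * x + x^2/4)*(e * f) =
    e * x*((2 * t - x) * f1 + x * f2-(t - c) * f)"
    by (simp add: field_simps power2_eq_square)
   thus ?thesis unfolding that by (simp add: algebra_simps)
  qed
  hence "Y2 v - Y1 v - whit_pot \<kappa> mu v * Y v=0"
   unfolding Y2_def Y1_def Y_def whit_pot_def s(3) x_def[symmetric] using k .
  thus ?thesis by (simp add: algebra_simps)
 qed
 hence "whit_on \<kappa> mu S Y" unfolding whit_on_def using D1 D2 hol by simp
 thus ?thesis unfolding Y_def s_def .
qed

lemma logderiv_eq:
 assumes "(Y has_field_derivative Y') (at v)" and E: "E v~=0" "(E has_field_derivative th * E v) (at v)"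
 shows "deriv (%v. Y v/E v) v=(Y'-th * Y v)/E v"
 by (rule DERIV_imp_deriv) (use assms in "auto intro!: derivative_eq_intros simp: field_simps")

text \<open>\<open>deriv_tendsto_0_Cauchy\<close> for the quotient by the leading term: the
  normalisation of the function alone fixes the asymptotics of its derivative, which both the
  uniqueness of M and the start of the paths rely on.\<close>

lemma M_char:
 fixes \<kappa> mu :: real
 assumes Y: "whit_on \<kappa> mu UNIV Y"
  and lim: "((%v. Y v/exp ((of_real mu + 1/2) * v))\<longlongrightarrow>1) (filtercomap Re at_bot)"
 shows "((%v. (deriv Y v-(of_real mu + 1/2) * Y v)/exp ((of_real mu + 1/2) * v))\<longlongrightarrow>0) (filtercomap Re at_bot)"
proof -
 define E where "E=(%v. exp ((of_real mu + 1/2) * v::complex))"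
 have hol: "Y holomorphic_on UNIV" using Y by (simp add: whit_on_def)
 have "((deriv (%v. Y v/E v))\<longlongrightarrow>0) (filtercomap Re at_bot)"
 proof (rule deriv_tendsto_0_Cauchy[where r = 1 and S = UNIV])
  show "(%v. Y v/E v) holomorphic_on UNIV" unfolding E_def by (intro holomorphic_intros hol) auto
  show "\<forall>\<^sub>F v in filtercomap Re at_bot. \<forall>w\<in>cball v 1. P w" if "eventually P (filtercomap Re at_bot)" for P
  proof -
   from that obtain R where R: "!!v. Re v<=R==>P v" unfolding eventually_Re_at_bot by blast
   have "P w" if "Re v<=R-1" "w\<in>cball v 1" for v w
    using that abs_Re_le_cmod[of "v - w"] by (intro R) (auto simp: dist_norm)
   thus ?thesis unfolding eventually_Re_at_bot by blast
  qed
 qed (use lim in "auto simp: E_def")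
 moreover have "deriv (%v. Y v/E v)=(%v. (deriv Y v-(of_real mu + 1/2) * Y v)/E v)"
  by (rule ext, rule logderiv_eq) (use holomorphic_derivI[OF hol] in "auto simp: E_def intro!: derivative_eq_intros")
 ultimately show ?thesis unfolding E_def by metis
qed

text \<open>M is exp (-z/2) z^(mu + 1/2) times Kummer's function with a = mu - kappa + 1/2 and b = 1
  + 2 mu. It is the only solution with its leading term E because E^2/exp v = exp (2 mu v) tends to
  0 at the end Re v -> -infinity.\<close>

lemma whittaker_M_props:
 fixes \<kappa> mu :: real
 assumes mu: "0<mu"
 shows "whit_on \<kappa> mu UNIV (whittaker_M \<kappa> mu)"
  and "((%v. whittaker_M \<kappa> mu v/exp ((of_real mu + 1/2) * v))\<longlongrightarrow>1) (filtercomap Re at_bot)"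
proof -
 let ?E = "%v. exp ((of_real mu + 1/2) * v)::complex"
 let ?P = "%Y. whittaker_solution \<kappa> mu Y&((%v. Y v/?E v)\<longlongrightarrow>1) (filtercomap Re at_bot)"
 have b: "0<Re (complex_of_real (1+2*mu))" using mu by simp
 obtain F F1 F2 :: "complex=>complex" where F: "!!z. (F has_field_derivative F1 z) (at z)" "!!z. (F1 has_field_derivative F2 z) (at z)"
  "F 0=1" "!!z. z * F2 z+(of_real (1+2*mu) - z) * F1 z - of_real (mu - \<kappa> + 1/2) * F z=0"
  by (rule kummer_exists[OF b, of "of_real (mu - \<kappa> + 1/2)"]) blast
 have ex0: "((%v. exp v)\<longlongrightarrow>(0::complex)) (filtercomap Re at_bot)"
 proof (rule tendsto_norm_zero_cancel)
  show "((%v::complex. norm (exp v))\<longlongrightarrow>0) (filtercomap Re at_bot)"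
   unfolding norm_exp_eq_Re by (rule filterlim_compose[OF exp_at_bot filterlim_filtercomap])
 qed
 define Y where "Y=(%v. exp (of_real (mu + 1/2) * v - exp v/2) * F (exp v))"
 have PY: "?P Y"
 proof
  show "whittaker_solution \<kappa> mu Y" unfolding whittaker_solution_iff Y_def
   by (rule whit_on_kummer) (use F in auto)
  have "Y v/?E v=exp (- exp v/2) * F (exp v)" for v
  proof -
   have "of_real (mu + 1/2) * v - exp v/2=(of_real mu + 1/2) * v+(- exp v/2)" by simp
   hence "exp (of_real (mu + 1/2) * v - exp v/2)=?E v * exp (- exp v/2)"
    by (simp only: exp_add)
   thus ?thesis unfolding Y_def by simp
  qed
  moreover have "((%v. exp (- exp v/2) * F (exp v))\<longlongrightarrow>exp (- 0/2) * F 0) (filtercomap Re at_bot)"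
   by (intro tendsto_intros ex0 isCont_tendsto_compose[OF DERIV_isCont[OF F(1)] ex0]) simp
  ultimately show "((%v. Y v/?E v)\<longlongrightarrow>1) (filtercomap Re at_bot)" by (simp add: F(3))
 qed
 have "Y1=Y2" if "?P Y1" "?P Y2" for Y1 Y2
 proof
  fix w
  have rec: "((%v. ?E v^2/exp v)\<longlongrightarrow>0) (filtercomap Re at_bot)"
  proof -
   have "norm (?E v^2/exp v)=exp (2*mu * Re v)" for v
   proof -
    have "(of_real mu + 1/2) * v+(of_real mu + 1/2) * v - v = of_real (2*mu) * v"
    by (simp add: algebra_simps)
    hence "?E v^2/exp v=exp (of_real (2*mu) * v)"
    by (simp only: power2_eq_square exp_add[symmetric] exp_diff[symmetric])
    thus ?thesis by simp
   qed
   moreover have "((%v. exp (2*mu * Re v))\<longlongrightarrow>0) (filtercomap Re at_bot)"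
   proof -
    have "((%x. exp (2*mu * x))\<longlongrightarrow>0) at_bot" using mu by real_asymp
    thus ?thesis by (rule filterlim_compose[OF _ filterlim_filtercomap])
   qed
   ultimately show "((%v. ?E v^2/exp v)\<longlongrightarrow>0) (filtercomap Re at_bot)"
    by (subst tendsto_norm_zero_iff[symmetric]) simp
  qed
  have W: "whit_on \<kappa> mu UNIV Y1" "whit_on \<kappa> mu UNIV Y2"
   and L: "((%v. Y1 v/?E v)\<longlongrightarrow>1) (filtercomap Re at_bot)" "((%v. Y2 v/?E v)\<longlongrightarrow>1) (filtercomap Re at_bot)"
   using that by (auto simp: whittaker_solution_iff)
  show "Y1 w=Y2 w"
   by (rule whit_on_unique_recessive[OF open_UNIV connected_UNIV W Re_at_bot_neq_bot _ _ L
    M_char[OF W(1) L(1)] M_char[OF W(2) L(2)] rec UNIV_I]) auto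
 qed
 note uniq = this
 have "\<exists>!Y. ?P Y"
 proof (rule ex1I[of ?P Y, OF PY])
  show "X=Y" if "?P X" for X by (rule uniq[OF that PY])
 qed
 from theI'[OF this] have "?P (whittaker_M \<kappa> mu)" unfolding whittaker_M_def .
 thus "whit_on \<kappa> mu UNIV (whittaker_M \<kappa> mu)"
  "((%v. whittaker_M \<kappa> mu v/?E v)\<longlongrightarrow>1) (filtercomap Re at_bot)"
  by (auto simp: whittaker_solution_iff)
qed

section \<open>The function W\<close>

text \<open>Integrand of the Laplace integral of Tricomi's function U(a, b, z) along the ray through
  \<open>e\<close>, with p = a - 1 and c = b - a - 1. The first power is taken of the real parameter
  \<open>t\<close>, which changes the integral by a constant factor only.\<close>

definition lap_kernel :: "complex=>real=>real=>complex=>real=>complex" where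
 "lap_kernel e p c z t = of_real (t powr p)*(1 + of_real t * e) powr of_real c * exp (- z * of_real t * e)"

definition lap_part :: "complex=>real=>real=>nat=>complex=>complex" where
 "lap_part e p c N z=integral {0..real N} (lap_kernel e p c z)"

definition lap :: "complex=>real=>real=>complex=>complex" where
 "lap e p c z=lim (%N. lap_part e p c N z)"

lemma norm_powr_real_exponent: "z~=0==>norm (z powr complex_of_real c)=norm z powr c"
 by (simp add: powr_def)

lemma powr_real_continuous: "0<p==>continuous_on {0..} (%t::real. t powr p)"
 by (intro continuous_on_powr' continuous_intros) auto

lemma Gamma_partial_bound:
 fixes p \<eta> :: real
 assumes p: "0<p" and \<eta>: "0<\<eta>"
 shows "integral {0..real N} (%t. t powr p * exp (- \<eta> * t))<=Gamma (p+1)/\<eta> powr (p+1)"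
proof -
 define f where "f=(%t::real. t powr p/exp t)"
 have cf: "continuous_on {0..} f" unfolding f_def by (intro continuous_intros powr_real_continuous p) auto
 have G: "(f has_integral Gamma (p+1)) {0..}" using Gamma_integral_real[of "p+1"] p by (simp add: f_def)
 have int: "f integrable_on {0..a}" for a
  by (rule integrable_continuous_real, rule continuous_on_subset[OF cf]) auto
 have 1: "integral {0..a} f<=Gamma (p+1)" for a
 proof -
  have "integral {0..a} f<=integral {0..} f"
   by (rule integral_subset_le) (use int G in "auto simp: f_def")
  thus ?thesis using integral_unique[OF G] by simp
 qed
 have "((%x. f (\<eta> * x)) has_integral (1/\<bar>\<eta>\<bar>) *\<^sub>R integral {0..\<eta> * real N} f) ((%x. x/\<eta>) ` {0..\<eta> * real N})"
  by (rule has_integral_stretch_real[OF integrable_integral[OF int]]) (use \<eta> in auto)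
 moreover have "(%x. x/\<eta>) ` {0..\<eta> * real N}={0..real N}"
  using \<eta> by (subst image_divide_atLeastAtMost) auto
 ultimately have 2: "((%x. f (\<eta> * x)) has_integral (1/\<eta>) * integral {0..\<eta> * real N} f) {0..real N}"
  using \<eta> by simp
 have "((%x. (1/\<eta> powr p) * f (\<eta> * x)) has_integral (1/\<eta> powr p)*((1/\<eta>) * integral {0..\<eta> * real N} f)) {0..real N}"
  by (rule has_integral_mult_right[OF 2])
 hence "((%t. t powr p * exp (- \<eta> * t)) has_integral (1/\<eta> powr p)*((1/\<eta>) * integral {0..\<eta> * real N} f)) {0..real N}"
  by (rule has_integral_eq[rotated]) (use \<eta> in "auto simp: f_def powr_mult exp_minus field_simps")
 hence "integral {0..real N} (%t. t powr p * exp (- \<eta> * t))=integral {0..\<eta> * real N} f/(\<eta> powr p*\<eta>)"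
  by (simp add: integral_unique)
 also have "\<dots><=Gamma (p+1)/(\<eta> powr p*\<eta>)"
  using 1 \<eta> by (intro divide_right_mono) auto
 also have "\<eta> powr p*\<eta>=\<eta> powr (p+1)" using \<eta> by (simp add: powr_add)
 finally show ?thesis .
qed

text \<open>From d (1 + t) <= 1 + d t <= exp (d t), raised to the power c, with d so small that c d
  <= eta.\<close>

lemma one_plus_powr_le_exp:
 assumes c: "0<=c" and \<eta>: "0<(\<eta>::real)"
 shows "\<exists>C>0. \<forall>t\<ge>0. (1 + t) powr c<=C * exp (\<eta> * t)"
proof -
 define d where "d=min 1 (\<eta>/(c+1))"
 have d: "0<d" "d<=1" "c * d<=\<eta>"
 proof -
  have "c * d<=c*(\<eta>/(c+1))" unfolding d_def using c by (intro mult_left_mono) auto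
  also have "\<dots><=\<eta>" using c \<eta> by (simp add: field_simps)
  finally show "c * d<=\<eta>" .
 qed (use c \<eta> in "auto simp: d_def")
 have "(1 + t) powr c<=(1/d) powr c * exp (\<eta> * t)" if t: "0<=t" for t
 proof -
  have "d*(1 + t)<=1 + d * t" using d by (simp add: algebra_simps)
  also have "\<dots><=exp (d * t)" by (rule exp_ge_add_one_self)
  finally have "1 + t<=(1/d) * exp (d * t)" using d by (simp add: field_simps)
  hence "(1 + t) powr c<=((1/d) * exp (d * t)) powr c" using t c by (intro powr_mono2) auto
  also have "\<dots>=(1/d) powr c * exp (d * t) powr c"
   by (rule powr_mult)
  also have "\<dots>=(1/d) powr c * exp (c * d * t)"
   by (simp add: powr_def[of "exp _"] mult_ac)
  also have "\<dots><=(1/d) powr c * exp (\<eta> * t)"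
   using d(3) t by (intro mult_left_mono) (auto intro: mult_right_mono)
  finally show ?thesis .
 qed
 thus ?thesis using d by (intro exI[of _ "(1/d) powr c"]) auto
qed

text \<open>The assumption \<open>e_slit\<close> keeps the ray away from the branch point -1 of (1 +
  s)^c, and \<open>p\<close> > 0 makes the integrand continuous at its starting point.\<close>

locale laplace_ray =
 fixes e :: complex and p c :: real
 assumes e: "norm e=1" and e_slit: "e~=-1" and p: "0<p" and c: "0<=c"
begin

lemma slit: "1 + of_real t * e\<notin>\<real>\<^sub>\<le>\<^sub>0" if "0<=t"
proof
 assume "1 + of_real t * e\<in>\<real>\<^sub>\<le>\<^sub>0"
 hence 1: "t * Im e=0" "1 + t * Re e<=0" by (auto simp: complex_nonpos_Reals_iff)
 hence "t~=0" by auto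
 hence "Im e=0" "t * Re e<0" using 1 by auto
 hence "Re e<0" using that by (simp add: mult_less_0_iff)
 moreover have "\<bar>Re e\<bar>=1" using e \<open>Im e = 0\<close> by (simp add: cmod_def)
 ultimately have "Re e = -1" by linarith
 thus False using e_slit \<open>Im e = 0\<close> by (auto simp: complex_eq_iff)
qed

lemma slit0: "0<=t==>1 + of_real t * e~=0"
 using slit[of t] by auto

lemma cont2: "continuous_on (U \<times> {0..}) (%(z,t). lap_kernel e p c z t)"
proof -
 have P: "continuous_on (U \<times> {0..}) (%x. snd x powr p)"
  by (rule continuous_on_compose2[OF powr_real_continuous[OF p]]) (auto intro: continuous_intros)
 have L: "continuous_on (U \<times> {0..}) (%x. Ln (1 + of_real (snd x) * e))"
  by (intro continuous_intros) (use slit in force)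
 have "continuous_on (U \<times> {0..}) (%x. of_real (snd x powr p) *
   exp (of_real c * Ln (1 + of_real (snd x) * e)) * exp (- fst x * of_real (snd x) * e))"
  by (intro continuous_on_mult continuous_on_of_real[OF P] continuous_on_exp L)
   (intro continuous_intros)+
 thus ?thesis
  by (rule continuous_on_eq) (use slit0 in \<open>auto simp: lap_kernel_def powr_def[of "1 + _"]\<close>)
qed

lemma cont1: "continuous_on {0..} (lap_kernel e p c z)"
proof -
 have "continuous_on {0..} ((%(z,t). lap_kernel e p c z t) \<circ> Pair z)"
  by (intro continuous_on_compose continuous_intros continuous_on_subset[OF cont2[of UNIV]]) auto
 thus ?thesis by (simp add: o_def)
qed

lemma int1: "0<=a==>lap_kernel e p c z integrable_on {a..b}"
 by (rule integrable_continuous_real, rule continuous_on_subset[OF cont1]) auto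

lemma kernel_bound:
 assumes "0<=t" "\<eta><=Re (z * e)"
 shows "norm (lap_kernel e p c z t)<=t powr p*(1 + t) powr c * exp (- \<eta> * t)"
proof -
 have "norm (1 + of_real t * e)<=1 + t"
  using norm_triangle_ineq[of 1 "of_real t * e"] e assms by (simp add: norm_mult)
 hence 1: "norm ((1 + of_real t * e) powr of_real c)<=(1 + t) powr c"
  using slit0[OF assms(1)] c by (simp add: norm_powr_real_exponent powr_mono2)
 have "Re (- z * of_real t * e) = - (Re (z * e) * t)" by (simp add: algebra_simps)
 hence 2: "norm (exp (- z * of_real t * e))<=exp (- \<eta> * t)"
  using mult_right_mono[OF assms(2,1)] by simp
 show ?thesis unfolding lap_kernel_def norm_mult
  by (intro mult_mono 1 2) auto
qed

text \<open>On the half plane Re (z e) >= eta one integrable function dominates all the integrands,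
  the factor (1 + t)^c being absorbed by half of the exponential decay. Hence the tail bound
  \<open>h\<close> does not depend on \<open>z\<close>.\<close>

lemma tail:
 assumes "0<\<eta>"
 shows "\<exists>h. h \<longlonglongrightarrow> 0&(\<forall>z. \<eta><=Re (z * e)-->(\<forall>N M. N<=M -->
  norm (lap_part e p c M z - lap_part e p c N z)<=h N))"
proof -
 define g where "g=(%t. t powr p*(1 + t) powr c * exp (- \<eta> * t))"
 define D where "D=(%N. integral {0..real N} g)"
 have gc: "continuous_on {0..} g" unfolding g_def
  using c by (intro continuous_intros powr_real_continuous p) auto
 have gi: "g integrable_on {a..b}" if "0<=a" for a b
  by (rule integrable_continuous_real, rule continuous_on_subset[OF gc]) (use that in auto)
 have g0: "0<=g t" for t unfolding g_def by auto
 obtain C where C: "0<C" "!!t. 0<=t==>(1 + t) powr c<=C * exp (\<eta>/2 * t)"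
  using one_plus_powr_le_exp[OF c, of "\<eta>/2"] assms by auto
 have comb: "integral {real N..real M} g=D M - D N" if "N<=M" for N M
  using Henstock_Kurzweil_Integration.integral_combine[OF _ _ gi, of 0 "real N" "real M"] that unfolding D_def by force
 have inc: "incseq D"
 proof (rule incseq_SucI)
  fix n show "D n<=D (Suc n)" using comb[of n "Suc n"] integral_nonneg[OF gi, of "real n" "real (Suc n)"] g0 by auto
 qed
 have bd: "D N<=C*(Gamma (p+1)/(\<eta>/2) powr (p+1))" for N
 proof -
  have "D N<=integral {0..real N} (%t. C*(t powr p * exp (- (\<eta>/2) * t)))" unfolding D_def
  proof (rule integral_le[OF gi])
   show "(%t. C*(t powr p * exp (- (\<eta>/2) * t))) integrable_on {0..real N}"
    by (rule integrable_continuous_real, intro continuous_intros continuous_on_subset[OF powr_real_continuous[OF p]]) auto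
   fix t assume t: "t\<in>{0..real N}"
   have "g t<=t powr p*(C * exp (\<eta>/2 * t)) * exp (- \<eta> * t)"
    unfolding g_def using C t by (intro mult_right_mono mult_left_mono) auto
   also have "\<dots>=C*(t powr p*(exp (\<eta>/2 * t) * exp (- \<eta> * t)))" by simp
   also have "exp (\<eta>/2 * t) * exp (- \<eta> * t)=exp (- (\<eta>/2) * t)"
    unfolding exp_add[symmetric] by (rule arg_cong[of _ _ exp]) (simp add: field_simps)
   finally show "g t<=C*(t powr p * exp (- (\<eta>/2) * t))" .
  qed simp
  also have "\<dots>=C * integral {0..real N} (%t. t powr p * exp (- (\<eta>/2) * t))" by simp
  also have "\<dots><=C*(Gamma (p+1)/(\<eta>/2) powr (p+1))"
   using C assms by (intro mult_left_mono Gamma_partial_bound p) auto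
  finally show ?thesis .
 qed
 obtain L where L: "D \<longlonglongrightarrow> L" "!!n. D n<=L" using incseq_convergent[OF inc] bd by metis
 have "norm (lap_part e p c M z - lap_part e p c N z)<=L - D N" if "\<eta><=Re (z * e)" "N<=M" for z N M
 proof -
  have "lap_part e p c M z - lap_part e p c N z=integral {real N..real M} (lap_kernel e p c z)"
   using Henstock_Kurzweil_Integration.integral_combine[OF _ _ int1, of 0 "real N" "real M" z] that unfolding lap_part_def by (force simp: algebra_simps)
  also have "norm \<dots><=integral {real N..real M} g"
   by (rule integral_norm_bound_integral[OF int1 gi]) (use kernel_bound that in "auto simp: g_def")
  also have "\<dots><=L - D N" using comb[OF that(2)] L by simp
  finally show ?thesis .
 qed
 moreover have "(%N. L - D N) \<longlonglongrightarrow> 0" using tendsto_diff[OF tendsto_const[of L] L(1)] by simp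
 ultimately show ?thesis by blast
qed

lemma lap_uniform:
 assumes "0<\<eta>"
 shows "uniform_limit {z. \<eta><=Re (z * e)} (lap_part e p c) (lap e p c) sequentially"
proof -
 obtain h where h: "h \<longlonglongrightarrow> 0" "!!z N M. \<eta><=Re (z * e)==>N<=M ==>
  norm (lap_part e p c M z - lap_part e p c N z)<=h N" using tail[OF assms] by blast
 have "uniformly_Cauchy_on {z. \<eta><=Re (z * e)} (lap_part e p c)"
 proof (rule uniformly_Cauchy_onI')
  fix d :: real assume "0<d"
  hence "\<forall>\<^sub>F n in sequentially. h n<d" by (intro order_tendstoD[OF h(1)]) auto
  then obtain M where M: "!!n. M<=n==>h n<d" unfolding eventually_sequentially by blast
  show "\<exists>M. \<forall>x\<in>{z. \<eta><=Re (z * e)}. \<forall>m\<ge>M. \<forall>n>m. dist (lap_part e p c m x) (lap_part e p c n x)<d"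
  proof (intro exI ballI allI impI)
   fix x m n assume "x\<in>{z. \<eta><=Re (z * e)}" "M<=m" "m<n"
   hence "norm (lap_part e p c n x - lap_part e p c m x)<d"
    using h(2)[of x m n] M[of m] by auto
   thus "dist (lap_part e p c m x) (lap_part e p c n x)<d" by (simp add: dist_norm norm_minus_commute)
  qed
 qed
 from Cauchy_uniformly_convergent[OF this] show ?thesis
  unfolding uniformly_convergent_uniform_limit_iff lap_def .
qed

lemma lap_lim: "0<Re (z * e)==>(%N. lap_part e p c N z) \<longlonglongrightarrow> lap e p c z"
 using tendsto_uniform_limitI[OF lap_uniform, of "Re (z * e)" z] by simp

lemma lap_part_deriv: "(lap_part e p c N has_field_derivative - e * lap_part e (p+1) c N z) (at z)"
proof -
 have sub: "laplace_ray e (p+1) c" by unfold_locales (use e e_slit p c in auto)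
 have "((%z. integral (cbox 0 (real N)) (lap_kernel e p c z)) has_field_derivative
   integral (cbox 0 (real N)) (%t. - e * lap_kernel e (p+1) c z t)) (at z within UNIV)"
 proof (rule leibniz_rule_field_derivative)
  fix x and t :: real assume "t\<in>cbox 0 (real N)"
  hence t: "0<=t" by simp
  have "(lap_kernel e p c x t)*(- of_real t * e) = - e * lap_kernel e (p+1) c x t"
  proof (cases "t=0")
   case False
   thus ?thesis using t unfolding lap_kernel_def by (simp add: powr_add)
  qed (use p in "auto simp: lap_kernel_def")
  moreover have "((%x. lap_kernel e p c x t) has_field_derivative (lap_kernel e p c x t)*(- of_real t * e)) (at x)"
   unfolding lap_kernel_def by (auto intro!: derivative_eq_intros)
  ultimately have "((%x. lap_kernel e p c x t) has_field_derivative - e * lap_kernel e (p+1) c x t) (at x)"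
   by (simp only:)
  thus "((%x. lap_kernel e p c x t) has_field_derivative - e * lap_kernel e (p+1) c x t) (at x within UNIV)" by simp
 next
  show "continuous_on (UNIV \<times> cbox 0 (real N)) (%(x,t). - e * lap_kernel e (p+1) c x t)"
   using laplace_ray.cont2[OF sub, of UNIV] unfolding case_prod_unfold
   by (intro continuous_intros) (rule continuous_on_subset, auto)
 qed (use int1[of 0] in auto)
 thus ?thesis unfolding lap_part_def[abs_def] by (simp add: cbox_interval)
qed

text \<open>The integral is a locally uniform limit of its holomorphic truncations. Differentiating
  the exponential brings down -t e, which raises \<open>p\<close> by one.\<close>

lemma lap_deriv:
 assumes "0<Re (z * e)"
 shows "(lap e p c has_field_derivative - e * lap e (p+1) c z) (at z)"
proof -
 have sub: "laplace_ray e (p+1) c" by unfold_locales (use e e_slit p c in auto)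
 let ?S = "{z. 0<Re (z * e)}"
 have op: "open ?S" by (intro open_Collect_less continuous_intros)
 have "\<exists>g'. \<forall>x\<in>?S. (lap e p c has_field_derivative g' x) (at x)&((%n. - e * lap_part e (p+1) c n x) \<longlonglongrightarrow> g' x)"
 proof (rule has_complex_derivative_uniform_sequence[OF op])
  fix x assume x: "x\<in>?S"
  define d where "d=Re (x * e)/2"
  have d: "0<d" using x by (simp add: d_def)
  have sub: "d<=Re (y * e)" if "y\<in>cball x d" for y
  proof -
   have "\<bar>Re ((x - y) * e)\<bar><=norm ((x - y) * e)" by (rule abs_Re_le_cmod)
   also have "\<dots><=d" using that e by (simp add: norm_mult dist_norm)
   finally have "\<bar>Re ((x - y) * e)\<bar><=d" .
   moreover have "Re ((x - y) * e)=Re (x * e) - Re (y * e)" by (simp add: algebra_simps)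
   ultimately show ?thesis unfolding d_def by linarith
  qed
  have "uniform_limit (cball x d) (lap_part e p c) (lap e p c) sequentially"
   by (rule uniform_limit_on_subset[OF lap_uniform[OF d]]) (use sub in auto)
  moreover have "cball x d\<subseteq>?S" using sub d by force
  ultimately show "\<exists>d>0. cball x d\<subseteq>?S&uniform_limit (cball x d) (lap_part e p c) (lap e p c) sequentially"
   using d by blast
 qed (use lap_part_deriv in auto)
 then obtain g' where g': "!!x. 0<Re (x * e)==>(lap e p c has_field_derivative g' x) (at x)"
  "!!x. 0<Re (x * e)==>(%n. - e * lap_part e (p+1) c n x) \<longlonglongrightarrow> g' x" by auto
 have "(%n. - e * lap_part e (p+1) c n z) \<longlonglongrightarrow> - e * lap e (p+1) c z"
  by (intro tendsto_intros laplace_ray.lap_lim[OF sub assms])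
 hence "g' z = - e * lap e (p+1) c z" by (rule LIMSEQ_unique[OF g'(2)[OF assms]])
 thus ?thesis using g'(1)[OF assms] by (simp only:)
qed

lemma boundary_term:
 assumes "0<Re (z * e)"
 shows "(%N. of_real (real N powr (p+1))*(1 + of_real (real N) * e) powr of_real (c+1) * exp (- z * of_real (real N) * e)) \<longlonglongrightarrow> 0"
proof -
 have sub: "laplace_ray e (p+1) (c+1)" by unfold_locales (use e e_slit p c in auto)
 define \<eta> where "\<eta>=Re (z * e)"
 have \<eta>: "0<\<eta>" using assms by (simp add: \<eta>_def)
 show ?thesis
 proof (rule Lim_null_comparison)
  have "norm (lap_kernel e (p+1) (c+1) z (real N))<=(1 + real N) powr (p + c+2) * exp (- \<eta> * real N)" for N
  proof -
   have "norm (lap_kernel e (p+1) (c+1) z (real N))<=real N powr (p+1)*(1 + real N) powr (c+1) * exp (- \<eta> * real N)"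
    by (rule laplace_ray.kernel_bound[OF sub]) (auto simp: \<eta>_def)
   also have "\<dots><=(1 + real N) powr (p+1)*(1 + real N) powr (c+1) * exp (- \<eta> * real N)"
    using p by (intro mult_right_mono powr_mono2) auto
   also have "\<dots>=(1 + real N) powr (p + c+2) * exp (- \<eta> * real N)" by (simp add: add_ac flip: powr_add)
   finally show ?thesis .
  qed
  thus "\<forall>\<^sub>F N in sequentially. norm (of_real (real N powr (p+1))*(1 + of_real (real N) * e) powr of_real (c+1) * exp (- z * of_real (real N) * e))
    <=(1 + real N) powr (p + c+2) * exp (- \<eta> * real N)"
   unfolding lap_kernel_def by simp
  show "(%N. (1 + real N) powr (p + c+2) * exp (- \<eta> * real N)) \<longlonglongrightarrow> 0"
   using \<eta> by real_asymp
 qed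
qed

text \<open>Up to sign the left side is the integral of the derivative of t^(p+1) (1 + t e)^(c+1)
  exp (-z t e), which vanishes at both ends. In view of \<open>lap_deriv\<close> this is Kummer's
  equation with a = p + 1 and b = p + c + 2.\<close>

lemma lap_ode:
 assumes z: "0<Re (z * e)"
 shows "z*(e^2 * lap e (p+2) c z)+(of_real (p + c+2) - z)*(- e * lap e (p+1) c z) - of_real (p+1) * lap e p c z=0"
proof -
 have sub: "laplace_ray e (p+1) c" "laplace_ray e (p+2) c" by unfold_locales (use e e_slit p c in auto)
 define I where "I=(%q. lap_kernel e q c z)"
 define B where "B=(%t. of_real (t powr (p+1))*(1 + of_real t * e) powr of_real (c+1) * exp (- z * of_real t * e))"
 define B' where "B'=(%t. of_real (p+1) * I p t+(of_real (p + c+2) - z) * e * I (p+1) t - z * e^2 * I (p+2) t)"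
 have dB: "(B has_vector_derivative B' t) (at t)" if t: "0<t" for t
 proof -
  define w where "w=1 + of_real t * e"
  have w: "w~=0" "w\<notin>\<real>\<^sub>\<le>\<^sub>0" using slit0[of t] slit[of t] t by (auto simp: w_def)
  have d1: "((%t. complex_of_real (t powr (p+1))) has_vector_derivative of_real ((p+1) * t powr p)) (at t)"
   by (intro has_vector_derivative_of_real) (use t in "auto intro!: derivative_eq_intros simp flip: has_real_derivative_iff_has_vector_derivative")
  have "((%s. (1 + s * e) powr of_real (c+1)) has_field_derivative of_real (c+1) * w powr of_real c * e) (at (of_real t))"
   using w t by (auto intro!: derivative_eq_intros simp: w_def)
  from has_vector_derivative_real_field[OF this]
  have d2: "((%t. (1 + of_real t * e) powr of_real (c+1)) has_vector_derivative of_real (c+1) * w powr of_real c * e) (at t)"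
   by (simp add: o_def)
  have "((%s. exp (- z * s * e)) has_field_derivative exp (- z * of_real t * e)*(- z * e)) (at (of_real t))"
   by (auto intro!: derivative_eq_intros)
  from has_vector_derivative_real_field[OF this]
  have d3: "((%t. exp (- z * of_real t * e)) has_vector_derivative exp (- z * of_real t * e)*(- z * e)) (at t)"
   by (simp add: o_def)
  have wp: "w powr of_real (c+1)=w powr of_real c * w" "w powr (of_real c+1)=w powr of_real c * w"
    "w powr (1 + of_real c)=w powr of_real c * w" using w by (simp_all add: powr_add)
  have tp: "complex_of_real (t powr (p+1)) = of_real (t powr p) * of_real t"
    "complex_of_real (t powr (p+2)) = of_real (t powr p) * of_real t * of_real t"
   using t by (simp_all add: powr_add power2_eq_square)
  show ?thesis unfolding B_def
   by (rule has_vector_derivative_eq_rhs, rule has_vector_derivative_mult[OF has_vector_derivative_mult[OF d1 d2] d3])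
    (simp add: B'_def I_def lap_kernel_def w_def[symmetric] wp tp,
    simp add: w_def algebra_simps power2_eq_square)
 qed
 have cB: "continuous_on {0..} B"
  using laplace_ray.cont1[of e "p+1" "c+1" z] e e_slit p c
  unfolding B_def lap_kernel_def[abs_def] laplace_ray_def by simp
 have "of_real (p+1) * lap_part e p c N z+(of_real (p + c+2) - z) * e * lap_part e (p+1) c N z - z * e^2 * lap_part e (p+2) c N z=B (real N)" for N
 proof -
  have "(B' has_integral (B (real N) - B 0)) {0..real N}"
   by (rule fundamental_theorem_of_calculus_interior) (use dB continuous_on_subset[OF cB] in auto)
  moreover have "(B' has_integral (of_real (p+1) * lap_part e p c N z+(of_real (p + c+2) - z) * e * lap_part e (p+1) c N z - z * e^2 * lap_part e (p+2) c N z)) {0..real N}"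
   unfolding B'_def I_def lap_part_def
   by (intro has_integral_diff has_integral_add has_integral_mult_right integrable_integral
    int1 laplace_ray.int1[OF sub(1)] laplace_ray.int1[OF sub(2)]) auto
  ultimately have "B (real N) - B 0 = of_real (p+1) * lap_part e p c N z+(of_real (p + c+2) - z) * e * lap_part e (p+1) c N z - z * e^2 * lap_part e (p+2) c N z"
   by (rule has_integral_unique)
  moreover have "B 0=0" using p by (simp add: B_def)
  ultimately show ?thesis by simp
 qed
 hence "(%N. of_real (p+1) * lap_part e p c N z+(of_real (p + c+2) - z) * e * lap_part e (p+1) c N z - z * e^2 * lap_part e (p+2) c N z) \<longlonglongrightarrow> 0"
  using boundary_term[OF z] unfolding B_def by simp
 moreover have "(%N. of_real (p+1) * lap_part e p c N z+(of_real (p + c+2) - z) * e * lap_part e (p+1) c N z - z * e^2 * lap_part e (p+2) c N z)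
   \<longlonglongrightarrow> of_real (p+1) * lap e p c z+(of_real (p + c+2) - z) * e * lap e (p+1) c z - z * e^2 * lap e (p+2) c z"
  by (intro tendsto_intros lap_lim[OF z] laplace_ray.lap_lim[OF sub(1) z] laplace_ray.lap_lim[OF sub(2) z])
 ultimately have "of_real (p+1) * lap e p c z+(of_real (p + c+2) - z) * e * lap e (p+1) c z - z * e^2 * lap e (p+2) c z=0"
  using LIMSEQ_unique by blast
 thus ?thesis by (simp add: algebra_simps)
qed

end

section \<open>Leading behaviour of the Laplace integrals at infinity\<close>

context laplace_ray
begin

lemma powr_diff_bound:
 assumes c1: "1<=c" and t: "0<=t"
 shows "norm ((1 + of_real t * e) powr of_real c-1)<=c * t * exp (c * t)"
proof -
 let ?S = "closed_segment 0 (of_real t * e)"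
 have S: "\<exists>u. 0<=u&u<=t&s = of_real u * e" if "s\<in>?S" for s
 proof -
  from that obtain x where x: "0<=x" "x<=1" "s = of_real (x * t) * e"
   by (auto simp: in_segment scaleR_conv_of_real mult.assoc)
  thus ?thesis using t by (intro exI[of _ "x * t"]) (auto simp: mult_left_le_one_le)
 qed
 have "norm ((%s. (1 + s) powr of_real c) (of_real t * e)-(%s. (1 + s) powr of_real c) 0)
   <=c * exp (c * t) * norm (of_real t * e-0)"
 proof (rule field_differentiable_bound[of ?S])
  fix s assume "s\<in>?S"
  then obtain u where u: "0<=u" "u<=t" "s = of_real u * e" using S by blast
  have nz: "1 + s\<notin>\<real>\<^sub>\<le>\<^sub>0" "1 + s~=0" using slit[OF u(1)] slit0[OF u(1)] u(3) by auto
  show "((%s. (1 + s) powr of_real c) has_field_derivative of_real c*(1 + s) powr (of_real c-1)) (at s within ?S)"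
   using nz by (auto intro!: derivative_eq_intros)
  have "norm (1 + s)<=1 + t" using norm_triangle_ineq[of 1 s] u e by (simp add: norm_mult)
  hence "norm (1 + s) powr (c-1)<=(1 + t) powr (c-1)" using c1 by (intro powr_mono2) auto
  also have "\<dots><=exp t powr (c-1)" using c1 t exp_ge_add_one_self[of t] by (intro powr_mono2) auto
  also have "\<dots><=exp (c * t)" using t by (simp add: powr_def algebra_simps)
  finally have "norm ((1 + s) powr of_real (c-1))<=exp (c * t)"
   by (subst norm_powr_real_exponent[OF nz(2)])
  thus "norm (of_real c*(1 + s) powr (of_real c-1))<=c * exp (c * t)"
   using c1 by (simp add: norm_mult)
 qed auto
 thus ?thesis using t e by (simp add: norm_mult mult_ac)
qed

text \<open>Replacing (1 + t e)^c by 1 costs at most c t exp (c t). The extra factor t gains a power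
  of 1/z over the leading term \<open>lap e p 0 z\<close>, and exp (c t) only shifts the decay rate
  by c.\<close>

lemma lap_diff:
 assumes c1: "1<=c" and z: "c<Re (z * e)"
 shows "norm (lap e p c z - lap e p 0 z)<=c*(Gamma (p+2)/(Re (z * e) - c) powr (p+2))"
proof -
 have sub: "laplace_ray e p 0" by unfold_locales (use e e_slit p in auto)
 define \<eta> where "\<eta>=Re (z * e)"
 have \<eta>: "0<\<eta>" "0<\<eta> - c" using z c1 by (auto simp: \<eta>_def)
 have "norm (lap_part e p c N z - lap_part e p 0 N z)<=c*(Gamma (p+2)/(\<eta> - c) powr (p+2))" for N
 proof -
  have "lap_part e p c N z - lap_part e p 0 N z=integral {0..real N} (%t. lap_kernel e p c z t - lap_kernel e p 0 z t)"
   unfolding lap_part_def by (rule Henstock_Kurzweil_Integration.integral_diff[symmetric]) (use int1 laplace_ray.int1[OF sub] in auto)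
  also have "norm \<dots><=integral {0..real N} (%t. c*(t powr (p+1) * exp (- (\<eta> - c) * t)))"
  proof (rule integral_norm_bound_integral)
   show "(%t. lap_kernel e p c z t - lap_kernel e p 0 z t) integrable_on {0..real N}"
    by (intro integrable_diff int1 laplace_ray.int1[OF sub]) auto
   show "(%t. c*(t powr (p+1) * exp (- (\<eta> - c) * t))) integrable_on {0..real N}"
    using p by (intro integrable_continuous_real continuous_intros continuous_on_subset[OF powr_real_continuous]) auto
   fix t assume "t\<in>{0..real N}"
   hence t: "0<=t" by simp
   have "lap_kernel e p c z t - lap_kernel e p 0 z t = of_real (t powr p)*((1 + of_real t * e) powr of_real c-1) * exp (- z * of_real t * e)"
    unfolding lap_kernel_def using slit0[OF t] by (simp add: algebra_simps)
   moreover have "norm (exp (- z * of_real t * e))=exp (- \<eta> * t)"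
    by (simp add: \<eta>_def algebra_simps)
   ultimately have "norm (lap_kernel e p c z t - lap_kernel e p 0 z t)=t powr p * norm ((1 + of_real t * e) powr of_real c-1) * exp (- \<eta> * t)"
    by (simp only: norm_mult norm_of_real) simp
   also have "\<dots><=t powr p*(c * t * exp (c * t)) * exp (- \<eta> * t)"
    by (intro mult_right_mono mult_left_mono powr_diff_bound[OF c1 t]) auto
   also have "\<dots>=c*(t powr (p+1) * exp (- (\<eta> - c) * t))"
   proof -
    have "exp (- (\<eta> - c) * t)=exp (c * t) * exp (- \<eta> * t)"
    unfolding exp_add[symmetric] by (rule arg_cong[of _ _ exp]) (simp add: algebra_simps)
    moreover have "t powr (p+1)=t powr p * t" using t by (cases "t=0") (auto simp: powr_add)
    ultimately show ?thesis by (simp only: mult_ac)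
   qed
   finally show "norm (lap_kernel e p c z t - lap_kernel e p 0 z t)<=c*(t powr (p+1) * exp (- (\<eta> - c) * t))" .
  qed
  also have "\<dots>=c * integral {0..real N} (%t. t powr (p+1) * exp (- (\<eta> - c) * t))" by simp
  also have "\<dots><=c*(Gamma (p+1+1)/(\<eta> - c) powr (p+1+1))"
   using c1 p \<eta> by (intro mult_left_mono Gamma_partial_bound) auto
  finally show ?thesis by (simp add: add.assoc)
 qed
 moreover have "(%N. norm (lap_part e p c N z - lap_part e p 0 N z)) \<longlonglongrightarrow> norm (lap e p c z - lap e p 0 z)"
  using \<eta> by (intro tendsto_intros lap_lim laplace_ray.lap_lim[OF sub]) (auto simp: \<eta>_def)
 ultimately show ?thesis unfolding \<eta>_def[symmetric] by (intro LIMSEQ_le_const2) auto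
qed

text \<open>Integration by parts for c = 0. It says that z d/dz acts as multiplication by -(p + 1),
  so \<open>lap e p 0 z\<close> is a constant multiple of z^(-p-1), and the constant need not be
  evaluated.\<close>

lemma lap0_euler:
 assumes z: "0<Re (z * e)"
 shows "z*(e * lap e (p+1) 0 z) = of_real (p+1) * lap e p 0 z"
proof -
 have sub: "laplace_ray e p 0" "laplace_ray e (p+1) 0" by unfold_locales (use e e_slit p in auto)
 define \<eta> where "\<eta>=Re (z * e)"
 have \<eta>: "0<\<eta>" using z by (auto simp: \<eta>_def)
 have k0: "lap_kernel e q 0 z t = of_real (t powr q) * exp (- z * of_real t * e)" if "0<=t" for q t
  unfolding lap_kernel_def using slit0[OF that] by simp
 define B where "B=(%t. of_real (t powr (p+1)) * exp (- z * of_real t * e))"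
 define B' where "B'=(%t. of_real (p+1) * lap_kernel e p 0 z t - z * e * lap_kernel e (p+1) 0 z t)"
 have dB: "(B has_vector_derivative B' t) (at t)" if t: "0<t" for t
 proof -
  have d1: "((%t. complex_of_real (t powr (p+1))) has_vector_derivative of_real ((p+1) * t powr p)) (at t)"
   by (intro has_vector_derivative_of_real) (use t in "auto intro!: derivative_eq_intros simp flip: has_real_derivative_iff_has_vector_derivative")
  have "((%s. exp (- z * s * e)) has_field_derivative exp (- z * of_real t * e)*(- z * e)) (at (of_real t))"
   by (auto intro!: derivative_eq_intros)
  from has_vector_derivative_real_field[OF this]
  have d3: "((%t. exp (- z * of_real t * e)) has_vector_derivative exp (- z * of_real t * e)*(- z * e)) (at t)"
   by (simp add: o_def)
  show ?thesis unfolding B_def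
   by (rule has_vector_derivative_eq_rhs, rule has_vector_derivative_mult[OF d1 d3])
    (use t in "simp add: B'_def k0 algebra_simps")
 qed
 have cB: "continuous_on {0..} B"
  by (rule continuous_on_eq[OF laplace_ray.cont1[OF sub(2), of z]]) (simp add: B_def k0)
 have "of_real (p+1) * lap_part e p 0 N z - z * e * lap_part e (p+1) 0 N z=B (real N)" for N
 proof -
  have "(B' has_integral (B (real N) - B 0)) {0..real N}"
   by (rule fundamental_theorem_of_calculus_interior) (use dB continuous_on_subset[OF cB] in auto)
  moreover have "(B' has_integral (of_real (p+1) * lap_part e p 0 N z - z * e * lap_part e (p+1) 0 N z)) {0..real N}"
   unfolding B'_def lap_part_def
   by (intro has_integral_diff has_integral_mult_right integrable_integral
    laplace_ray.int1[OF sub(1)] laplace_ray.int1[OF sub(2)]) auto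
  ultimately have "B (real N) - B 0 = of_real (p+1) * lap_part e p 0 N z - z * e * lap_part e (p+1) 0 N z"
   by (rule has_integral_unique)
  moreover have "B 0=0" using p by (simp add: B_def)
  ultimately show ?thesis by simp
 qed
 moreover have "(%N. B (real N)) \<longlonglongrightarrow> 0"
 proof (rule tendsto_norm_zero_cancel)
  have "norm (B (real N))=real N powr (p+1) * exp (- \<eta> * real N)" for N
   by (simp add: B_def norm_mult \<eta>_def algebra_simps)
  moreover have "(%N. real N powr (p+1) * exp (- \<eta> * real N)) \<longlonglongrightarrow> 0" using \<eta> by real_asymp
  ultimately show "(%N. norm (B (real N))) \<longlonglongrightarrow> 0" by (simp only:)
 qed
 ultimately have "(%N. of_real (p+1) * lap_part e p 0 N z - z * e * lap_part e (p+1) 0 N z) \<longlonglongrightarrow> 0" by simp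
 moreover have "(%N. of_real (p+1) * lap_part e p 0 N z - z * e * lap_part e (p+1) 0 N z)
   \<longlonglongrightarrow> of_real (p+1) * lap e p 0 z - z * e * lap e (p+1) 0 z"
  by (intro tendsto_intros laplace_ray.lap_lim[OF sub(1) z] laplace_ray.lap_lim[OF sub(2) z])
 ultimately have "of_real (p+1) * lap e p 0 z - z * e * lap e (p+1) 0 z=0"
  using LIMSEQ_unique by blast
 thus ?thesis by (simp add: algebra_simps)
qed

text \<open>At z = 1/e the integrand becomes the positive function t^p exp (-t).\<close>

lemma lap0_nonzero:
 assumes z: "z * e=1"
 shows "lap e p 0 z~=0"
proof -
 have sub: "laplace_ray e p 0" by unfold_locales (use e e_slit p in auto)
 define g where "g=(%t. t powr p * exp (- t))"
 have gc: "continuous_on {0..} g" unfolding g_def by (intro continuous_intros powr_real_continuous p)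
 have gi: "g integrable_on {0..a}" for a
  by (rule integrable_continuous_real, rule continuous_on_subset[OF gc]) auto
 have eq: "Re (lap_part e p 0 N z)=integral {0..real N} g" for N
 proof -
  have "lap_part e p 0 N z=integral {0..real N} (%t. of_real (g t))"
   unfolding lap_part_def
  proof (rule integral_cong)
   fix t assume "t\<in>{0..real N}"
   hence "0<=t" by simp
   moreover have "- z * of_real t * e = - of_real t" using z by (simp add: algebra_simps)
   hence "exp (- z * of_real t * e) = of_real (exp (- t))" by (simp only: exp_of_real[symmetric] of_real_minus)
   ultimately show "lap_kernel e p 0 z t = of_real (g t)"
    unfolding lap_kernel_def g_def using slit0[of t] by simp
  qed
  also have "\<dots> = of_real (integral {0..real N} g)"
   by (intro integral_unique has_integral_of_real integrable_integral gi)
  finally show ?thesis by simp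
 qed
 have pos: "0<integral {0..1} g"
 proof -
  have "0<=integral {0..1} g" by (rule integral_nonneg[OF gi]) (simp add: g_def)
  moreover have "integral {0..1} g~=0"
  proof
   assume "integral {0..1} g=0"
   hence "\<forall>x\<in>{0..1}. g x=0"
    by (subst (asm) integral_eq_0_iff) (auto simp: g_def intro!: continuous_on_subset[OF gc[unfolded g_def]])
   hence "g 1=0" by auto
   thus False by (simp add: g_def)
  qed
  ultimately show ?thesis by linarith
 qed
 have "(%N. Re (lap_part e p 0 N z)) \<longlonglongrightarrow> Re (lap e p 0 z)"
  by (intro tendsto_intros laplace_ray.lap_lim[OF sub]) (simp add: z)
 moreover have "\<exists>N. \<forall>n\<ge>N. integral {0..1} g<=Re (lap_part e p 0 n z)"
 proof (intro exI[of _ 1] allI impI)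
  fix n :: nat assume "1<=n"
  thus "integral {0..1} g<=Re (lap_part e p 0 n z)"
   unfolding eq by (intro integral_subset_le gi) (auto simp: g_def)
 qed
 ultimately have "integral {0..1} g<=Re (lap e p 0 z)" by (rule LIMSEQ_le_const)
 thus ?thesis using pos by auto
qed

end

section \<open>Solutions with the asymptotics of W in single sectors, and their gluing\<close>

lemma Re_exp_cis: "Re (exp v * cis (- \<phi>))=exp (Re v) * cos (Im v-\<phi>)"
 by (simp add: exp_eq_polar cis_mult cos_diff algebra_simps)

lemma Im_strip:
 shows "convex {v. \<bar>Im v - a\<bar><b}" "open {v. \<bar>Im v - a\<bar><b}"
proof -
 have "{v. \<bar>Im v - a\<bar><b}={v. a - b<Im v}\<inter>{v. Im v<a + b}" by (auto simp: abs_less_iff)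
 thus "convex {v. \<bar>Im v - a\<bar><b}" "open {v. \<bar>Im v - a\<bar><b}"
  by (simp_all add: convex_Int convex_halfspace_Im_gt convex_halfspace_Im_lt open_halfspace_Im_gt open_halfspace_Im_lt open_Int)
qed

lemma cos_pos_strip: "\<bar>x\<bar><pi/2==>0<cos x"
 by (rule cos_gt_zero_pi) auto

text \<open>By \<open>lap0_euler\<close> the left side has derivative 0 in \<open>v\<close> on the
  convex strip; the right side is its value at v = i phi.\<close>

lemma lap0_exact:
 fixes \<phi> p :: real
 assumes ray: "laplace_ray (cis (-\<phi>)) p 0" and v: "\<bar>Im v-\<phi>\<bar><pi/2"
 shows "exp (of_real (p+1) * v) * lap (cis (-\<phi>)) p 0 (exp v) =
  exp (of_real (p+1)*(\<i> * of_real \<phi>)) * lap (cis (-\<phi>)) p 0 (cis \<phi>)"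
proof -
 let ?S = "{v. \<bar>Im v-\<phi>\<bar><pi/2}"
 let ?e = "cis (-\<phi>)"
 note S = Im_strip[of \<phi> "pi/2"]
 have d: "((%v. exp (of_real (p+1) * v) * lap ?e p 0 (exp v)) has_field_derivative 0) (at v)" if "v\<in>?S" for v
 proof -
  have pos: "0<Re (exp v * ?e)" using that cos_pos_strip unfolding Re_exp_cis by auto
  have "(exp (of_real (p+1) * v) * of_real (p+1)) * lap ?e p 0 (exp v)
    + ((- ?e * lap ?e (p+1) 0 (exp v)) * exp v) * exp (of_real (p+1) * v)=0"
   using laplace_ray.lap0_euler[OF ray pos] by (simp add: algebra_simps)
  moreover have "((%v. lap ?e p 0 (exp v)) has_field_derivative (- ?e * lap ?e (p+1) 0 (exp v)) * exp v) (at v)"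
   by (rule DERIV_chain2[OF laplace_ray.lap_deriv[OF ray pos] DERIV_exp])
  hence "((%v. exp (of_real (p+1) * v) * lap ?e p 0 (exp v)) has_field_derivative
   (exp (of_real (p+1) * v) * of_real (p+1)) * lap ?e p 0 (exp v)
    + ((- ?e * lap ?e (p+1) 0 (exp v)) * exp v) * exp (of_real (p+1) * v)) (at v)"
   by (intro DERIV_mult) (auto intro!: derivative_eq_intros)
  ultimately show ?thesis by (simp only:)
 qed
 have "\<exists>c. \<forall>x\<in>?S. exp (of_real (p+1) * x) * lap ?e p 0 (exp x)=c"
  by (rule has_field_derivative_zero_constant[OF S(1)]) (rule has_field_derivative_at_within, rule d)
 then obtain c where "!!x. x\<in>?S==>exp (of_real (p+1) * x) * lap ?e p 0 (exp x)=c" by blast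
 from this[of v] this[of "\<i> * of_real \<phi>"] v show ?thesis by (simp add: cis_conv_exp)
qed

lemma strip_at_top_Un: "strip_at_top (A\<union>B)=sup (strip_at_top A) (strip_at_top B)"
proof (rule filter_eqI)
 fix P
 have "(\<exists>R. \<forall>v. R<=Re v-->Im v\<in>A\<union>B-->P v)"
  if "\<forall>v. R<=Re v-->Im v\<in>A-->P v" "\<forall>v. R'<=Re v-->Im v\<in>B-->P v" for R R'
  by (rule exI[of _ "max R R'"]) (use that in auto)
 thus "eventually P (strip_at_top (A\<union>B))=eventually P (sup (strip_at_top A) (strip_at_top B))"
  unfolding eventually_sup eventually_strip_at_top by blast
qed

text \<open>The Laplace integral along the ray of argument -phi converges for |arg z - phi| < pi/2.
  Division by the constant \<open>C\<close> of the exact leading term gives a solution with the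
  behaviour of W in this sector.\<close>

lemma W_sector:
 fixes \<kappa> mu \<phi> :: real
 assumes p: "0<mu - \<kappa> - 1/2" and c: "1<=mu + \<kappa> - 1/2" and \<phi>: "\<bar>\<phi>\<bar><pi"
 obtains Y where "whit_on \<kappa> mu {v. \<bar>Im v-\<phi>\<bar><pi/2} Y"
  "!!d. 0<d==>((%v. Y v/exp (of_real \<kappa> * v - exp v/2))\<longlongrightarrow>1) (strip_at_top {x. \<bar>x-\<phi>\<bar><=pi/2 - d})"
proof -
 define e where "e=cis (-\<phi>)"
 define p where "p=mu - \<kappa> - 1/2"
 define c where "c=mu + \<kappa> - 1/2"
 have pc: "0<p" "1<=c" using assms by (auto simp: p_def c_def)
 have e1: "norm e=1" by (simp add: e_def)
 have e2: "e~=-1"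
 proof
  assume "e = -1"
  hence "cos \<phi> = -1" by (simp add: e_def complex_eq_iff)
  hence "cos (\<bar>\<phi>\<bar>)=cos pi" by simp
  hence "\<bar>\<phi>\<bar>=pi" using \<phi> by (intro cos_inj_pi[of "\<bar>\<phi>\<bar>" pi]) (simp_all only: abs_ge_zero less_imp_le pi_ge_zero order_refl)
  thus False using \<phi> by simp
 qed
 note e = e1 e2
 have r0: "laplace_ray e p 0" and r: "laplace_ray e p c" and r1: "laplace_ray e (p+1) c"
  by (unfold_locales; use e pc in auto)+
 define S where "S={v. \<bar>Im v-\<phi>\<bar><pi/2}"
 have opS: "open S" unfolding S_def by (rule Im_strip)
 have pos: "0<Re (exp v * e)" if "v\<in>S" for v
  using that cos_pos_strip unfolding S_def e_def Re_exp_cis by auto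
 define C where "C=exp (of_real (p+1)*(\<i> * of_real \<phi>)) * lap e p 0 (cis \<phi>)"
 have C: "C~=0"
 proof -
  have "cis \<phi> * e=1" by (simp add: e_def cis_mult)
  thus ?thesis using laplace_ray.lap0_nonzero[OF r0] by (simp add: C_def)
 qed
 have exact: "exp (of_real (p+1) * v) * lap e p 0 (exp v)=C" if "v\<in>S" for v
  using lap0_exact[OF r0[unfolded e_def], of v] that unfolding C_def e_def S_def by simp
 define F where "F=(%z. lap e p c z/C)"
 define F1 where "F1=(%z. - e * lap e (p+1) c z/C)"
 define F2 where "F2=(%z. e^2 * lap e (p+2) c z/C)"
 define Y where "Y=(%v. exp (of_real (mu + 1/2) * v - exp v/2) * F (exp v))"
 have "whit_on \<kappa> mu S Y" unfolding Y_def
 proof (rule whit_on_kummer[of S F F1 F2, OF _ _ _ opS])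
  fix v assume v: "v\<in>S"
  show "(F has_field_derivative F1 (exp v)) (at (exp v))"
   unfolding F_def F1_def by (intro DERIV_cdivide laplace_ray.lap_deriv[OF r pos[OF v]])
  have "((%z. - e * lap e (p+1) c z/C) has_field_derivative - e*(- e * lap e (p+1+1) c (exp v))/C) (at (exp v))"
   by (intro DERIV_cdivide DERIV_cmult laplace_ray.lap_deriv[OF r1 pos[OF v]])
  thus "(F1 has_field_derivative F2 (exp v)) (at (exp v))"
   unfolding F1_def F2_def by (rule DERIV_cong) (simp add: power2_eq_square add.assoc)
  have "p + c+2=1+2*mu" "p+1=mu - \<kappa> + 1/2" by (auto simp: p_def c_def)
  with laplace_ray.lap_ode[OF r pos[OF v]]
  have "(exp v * (e^2 * lap e (p+2) c (exp v))+(of_real (1+2*mu) - exp v)*(- e * lap e (p+1) c (exp v)) - of_real (mu - \<kappa> + 1/2) * lap e p c (exp v))/C=0"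
   by (simp only: div_0)
  thus "exp v * F2 (exp v)+(of_real (1+2*mu) - exp v) * F1 (exp v) - of_real (mu - \<kappa> + 1/2) * F (exp v)=0"
   unfolding F_def F1_def F2_def by (simp only: diff_divide_distrib add_divide_distrib times_divide_eq_right)
 qed
 moreover have "((%v. Y v/exp (of_real \<kappa> * v - exp v/2))\<longlongrightarrow>1) (strip_at_top {x. \<bar>x-\<phi>\<bar><=pi/2 - d})" if d: "0<d" for d
 proof -
  define d' where "d'=min d (pi/4)"
  have d': "0<d'" "d'<=d" "d'<pi/2" using d pi_gt_zero by (auto simp: d'_def min_def)
  \<comment> \<open>The minimum of cos (x - phi) on the narrowed strip, so that Re (exp v e) is at
    least s exp (Re v).\<close>
  define s where "s=sin d'"
  have s: "0<s" unfolding s_def using d' by (intro sin_gt_zero) auto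
  define A where "A={x. \<bar>x-\<phi>\<bar><=pi/2 - d'}"
  have AS: "v\<in>S" if "Im v\<in>A" for v using that d' by (auto simp: A_def S_def)
  have cosA: "s<=cos (x-\<phi>)" if "x\<in>A" for x
  proof -
   have "cos (pi/2 - d')<=cos \<bar>x-\<phi>\<bar>" using that d' unfolding A_def by (intro cos_monotone_0_pi_le) auto
   thus ?thesis by (simp add: s_def cos_sin_eq[of "pi/2 - d'"])
  qed
  define K where "K=c * Gamma (p+2)*(2/s) powr (p+2)/norm C"
  have ev: "eventually (%v. Im v\<in>A&2 * c<=s * exp (Re v)) (strip_at_top A)"
   unfolding eventually_strip_at_top
  proof (intro exI[of _ "ln (2 * c/s)"] allI impI conjI)
   fix v assume "ln (2 * c/s)<=Re v"
   hence "2 * c/s<=exp (Re v)" using pc s by (metis exp_le_cancel_iff exp_ln divide_pos_pos less_le_trans mult_pos_pos zero_less_numeral zero_less_one)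
   thus "2 * c<=s * exp (Re v)" using s by (simp add: field_simps)
  qed
  have bound: "norm (Y v/exp (of_real \<kappa> * v - exp v/2)-1)<=K * exp (- Re v)" if v: "Im v\<in>A&2 * c<=s * exp (Re v)" for v
  proof -
   have vS: "v\<in>S" using AS v by blast
   have "of_real (mu + 1/2) * v - exp v/2=(of_real \<kappa> * v - exp v/2) + of_real (p+1) * v"
    by (simp add: p_def algebra_simps)
   hence "exp (of_real (mu + 1/2) * v - exp v/2)=exp (of_real \<kappa> * v - exp v/2) * exp (of_real (p+1) * v)"
    by (simp only: exp_add)
   hence "Y v/exp (of_real \<kappa> * v - exp v/2)-1=(exp (of_real (p+1) * v) * lap e p c (exp v) - C)/C"
    unfolding Y_def F_def using C by (simp add: diff_divide_distrib)
   also have "\<dots>=exp (of_real (p+1) * v)*(lap e p c (exp v) - lap e p 0 (exp v))/C"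
    using exact[OF vS] by (simp add: algebra_simps)
   also have "norm \<dots>=exp ((p+1) * Re v) * norm (lap e p c (exp v) - lap e p 0 (exp v))/norm C"
    by (simp add: norm_mult norm_divide)
   also have "\<dots><=exp ((p+1) * Re v)*(c*(Gamma (p+2)*(2/s) powr (p+2) * exp (- (p+2) * Re v)))/norm C"
   proof (intro divide_right_mono mult_left_mono)
    \<comment> \<open>Half of s exp (Re v) pays for the shift c in the decay rate of
      \<open>lap_diff\<close>.\<close>
    have eta: "s * exp (Re v)/2<=Re (exp v * e) - c"
    proof -
    have "s * exp (Re v)<=Re (exp v * e)" using cosA v unfolding e_def Re_exp_cis by (simp add: mult.commute)
    thus ?thesis using v by linarith
    qed
    have pos2: "0<s * exp (Re v)/2" using s by simp
    have "norm (lap e p c (exp v) - lap e p 0 (exp v))<=c*(Gamma (p+2)/(Re (exp v * e) - c) powr (p+2))"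
    by (rule laplace_ray.lap_diff[OF r pc(2)]) (use eta pos2 in linarith)
    also have "\<dots><=c*(Gamma (p+2)/(s * exp (Re v)/2) powr (p+2))"
    using pc eta pos2 Gamma_real_pos[of "p+2"]
    by (intro mult_left_mono divide_left_mono powr_mono2 mult_pos_pos) auto
    also have "\<dots>=c*(Gamma (p+2)*(2/s) powr (p+2) * exp (- (p+2) * Re v))"
    proof -
    have "(s * exp (Re v)/2) powr (p+2)=(s/2) powr (p+2) * exp (Re v) powr (p+2)"
    using powr_mult[of "s/2" "exp (Re v)" "p+2"] by simp
    also have "exp (Re v) powr (p+2)=exp ((p+2) * Re v)" by (simp add: powr_def)
    finally have 1: "(s * exp (Re v)/2) powr (p+2)=(s/2) powr (p+2) * exp ((p+2) * Re v)" .
    have 2: "exp (- (p+2) * Re v)=inverse (exp ((p+2) * Re v))"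
    by (simp only: mult_minus_left exp_minus)
    have 3: "(2/s) powr (p+2)=inverse ((s/2) powr (p+2))"
    using s by (simp add: powr_divide)
    show ?thesis unfolding 1 2 3 by (simp only: divide_inverse inverse_mult_distrib mult.assoc)
    qed
    finally show "norm (lap e p c (exp v) - lap e p 0 (exp v))<=c*(Gamma (p+2)*(2/s) powr (p+2) * exp (- (p+2) * Re v))" .
   qed auto
   also have "\<dots>=K*(exp ((p+1) * Re v) * exp (- (p+2) * Re v))" by (simp add: K_def)
   also have "exp ((p+1) * Re v) * exp (- (p+2) * Re v)=exp (- Re v)"
    unfolding exp_add[symmetric] by (rule arg_cong[of _ _ exp]) (simp add: algebra_simps)
   finally show ?thesis .
  qed
  have "((%v. Y v/exp (of_real \<kappa> * v - exp v/2)-1)\<longlongrightarrow>0) (strip_at_top A)"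
  proof (rule Lim_null_comparison)
   show "\<forall>\<^sub>F v in strip_at_top A. norm (Y v/exp (of_real \<kappa> * v - exp v/2)-1)<=K * exp (- Re v)"
    using ev by (rule eventually_mono) (rule bound)
   have "((%x. K * exp (- x))\<longlongrightarrow>0) at_top" by real_asymp
   moreover have "filterlim Re at_top (strip_at_top A)" unfolding strip_at_top_def
    by (rule filterlim_mono[OF filterlim_filtercomap order_refl inf_le1])
   ultimately show "((%v. K * exp (- Re v))\<longlongrightarrow>0) (strip_at_top A)" by (rule filterlim_compose)
  qed
  hence "((%v. Y v/exp (of_real \<kappa> * v - exp v/2))\<longlongrightarrow>1) (strip_at_top A)" by (simp add: LIM_zero_iff)
  thus ?thesis by (rule tendsto_mono[rotated]) (use d' in "auto simp: A_def intro!: strip_at_top_mono")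
 qed
 ultimately show ?thesis using that unfolding S_def by blast
qed

lemma W_char:
 fixes \<kappa> \<alpha> r :: real
 assumes hol: "Y holomorphic_on S" and S: "open S" "!!v. \<bar>Im v-\<alpha>\<bar><=2 * r==>v\<in>S" and r: "0<r"
  and lim: "((%v. Y v/exp (of_real \<kappa> * v - exp v/2))\<longlongrightarrow>1) (strip_at_top {x. \<bar>x-\<alpha>\<bar><=2 * r})"
 shows "((%v. (deriv Y v-(of_real \<kappa> - exp v/2) * Y v)/exp (of_real \<kappa> * v - exp v/2))\<longlongrightarrow>0)
    (strip_at_top {x. \<bar>x-\<alpha>\<bar><=r})"
proof -
 define E where "E=(%v::complex. exp (of_real \<kappa> * v - exp v/2))"
 have near: "r\<ge>\<bar>Im v - Im w\<bar>" "r\<ge>\<bar>Re v - Re w\<bar>" if "w\<in>cball v r" for v w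
  using that abs_Im_le_cmod[of "v - w"] abs_Re_le_cmod[of "v - w"] by (auto simp: dist_norm)
 have "((deriv (%v. Y v/E v))\<longlongrightarrow>0) (strip_at_top {x. \<bar>x-\<alpha>\<bar><=r})"
 proof (rule deriv_tendsto_0_Cauchy[OF r, of _ S 1 "strip_at_top {x. \<bar>x-\<alpha>\<bar><=2 * r}"])
  show "((%v. Y v/E v)\<longlongrightarrow>1) (strip_at_top {x. \<bar>x-\<alpha>\<bar><=2 * r})"
   using lim by (simp add: E_def)
  show "(%v. Y v/E v) holomorphic_on S" unfolding E_def by (intro holomorphic_intros hol) auto
  show "\<forall>\<^sub>F v in strip_at_top {x. \<bar>x-\<alpha>\<bar><=r}. \<forall>w\<in>cball v r. P w"
   if ev: "eventually P (strip_at_top {x. \<bar>x-\<alpha>\<bar><=2 * r})" for P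
  proof -
   from ev obtain R where R: "!!v. R<=Re v==>\<bar>Im v-\<alpha>\<bar><=2 * r==>P v" unfolding eventually_strip_at_top by auto
   have "P w" if "R + r<=Re v" "\<bar>Im v-\<alpha>\<bar><=r" "w\<in>cball v r" for v w
    using that(1,2) near[OF that(3)] by (intro R) linarith+
   thus ?thesis unfolding eventually_strip_at_top by blast
  qed
  have "cball v r\<subseteq>S" if v: "\<bar>Im v-\<alpha>\<bar><=r" for v
  proof
   fix w assume "w\<in>cball v r"
   from near(1)[OF this] v show "w\<in>S" by (intro S(2)) linarith
  qed
  thus "\<forall>\<^sub>F v in strip_at_top {x. \<bar>x-\<alpha>\<bar><=r}. cball v r\<subseteq>S"
   unfolding eventually_strip_at_top by blast
 qed
 moreover have "\<forall>\<^sub>F v in strip_at_top {x. \<bar>x-\<alpha>\<bar><=r}. deriv (%v. Y v/E v) v=(deriv Y v-(of_real \<kappa> - exp v/2) * Y v)/E v"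
  unfolding eventually_strip_at_top
 proof (intro exI allI impI)
  fix v assume "Im v\<in>{x. \<bar>x-\<alpha>\<bar><=r}"
  hence "v\<in>S" using r by (intro S(2)) auto
  thus "deriv (%v. Y v/E v) v=(deriv Y v-(of_real \<kappa> - exp v/2) * Y v)/E v"
   by (intro logderiv_eq holomorphic_derivI[OF hol S(1)]) (auto simp: E_def intro!: derivative_eq_intros)
 qed
 ultimately have "((%v. (deriv Y v-(of_real \<kappa> - exp v/2) * Y v)/E v)\<longlongrightarrow>0) (strip_at_top {x. \<bar>x-\<alpha>\<bar><=r})"
  by (rule Lim_transform_eventually)
 thus ?thesis unfolding E_def .
qed

text \<open>On a strip inside |Im v| < pi/2 the leading term is recessive: E^2/exp v contains exp (-
  exp v), and Re (exp v) is at least s exp (Re v) there.\<close>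

lemma W_unique:
 fixes \<kappa> mu \<alpha> r :: real
 assumes S: "open S" "connected S" "!!v. \<bar>Im v-\<alpha>\<bar><=2 * r==>v\<in>S"
  and r: "0<r" "\<bar>\<alpha>\<bar> + r<pi/2" and W: "whit_on \<kappa> mu S Y" "whit_on \<kappa> mu S X"
  and lim: "((%v. Y v/exp (of_real \<kappa> * v - exp v/2))\<longlongrightarrow>1) (strip_at_top {x. \<bar>x-\<alpha>\<bar><=2 * r})"
    "((%v. X v/exp (of_real \<kappa> * v - exp v/2))\<longlongrightarrow>1) (strip_at_top {x. \<bar>x-\<alpha>\<bar><=2 * r})"
  and w: "w\<in>S"
 shows "Y w=X w"
proof -
 let ?E = "%v. exp (of_real \<kappa> * v - exp v/2)"
 let ?A = "{x. \<bar>x-\<alpha>\<bar><=r}"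
 have le: "strip_at_top ?A<=strip_at_top {x. \<bar>x-\<alpha>\<bar><=2 * r}" using r by (intro strip_at_top_mono) auto
 have hol: "Y holomorphic_on S" "X holomorphic_on S" using W by (auto simp: whit_on_def)
 have evS: "eventually (%v. v\<in>S) (strip_at_top ?A)"
  unfolding eventually_strip_at_top using S(3) r by force
 have nb: "strip_at_top ?A~=bot" using r by (intro strip_at_top_neq_bot) (auto intro: exI[of _ \<alpha>])
 define s where "s=cos (\<bar>\<alpha>\<bar> + r)"
 have s: "0<s" unfolding s_def using r by (intro cos_gt_zero_pi) auto
 have "((%v. ?E v^2/exp v)\<longlongrightarrow>0) (strip_at_top ?A)"
 proof (rule Lim_null_comparison)
  have "norm (?E v^2/exp v)<=exp ((2*\<kappa> - 1) * Re v - s * exp (Re v))" if v: "Im v\<in>?A" for v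
  proof -
   have "?E v^2/exp v=exp ((of_real \<kappa> * v - exp v/2)+(of_real \<kappa> * v - exp v/2) - v)"
    by (simp only: power2_eq_square exp_add[symmetric] exp_diff[symmetric])
   also have "norm \<dots>=exp ((2*\<kappa> - 1) * Re v - cos (Im v) * exp (Re v))"
    by (simp add: Re_exp algebra_simps)
   also have "\<dots><=exp ((2*\<kappa> - 1) * Re v - s * exp (Re v))"
   proof -
    have "cos (\<bar>\<alpha>\<bar> + r)<=cos \<bar>Im v\<bar>" using v r by (intro cos_monotone_0_pi_le) auto
    thus ?thesis unfolding s_def by (simp add: mult_right_mono)
   qed
   finally show ?thesis .
  qed
  thus "\<forall>\<^sub>F v in strip_at_top ?A. norm (?E v^2/exp v)<=exp ((2*\<kappa> - 1) * Re v - s * exp (Re v))"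
   unfolding eventually_strip_at_top by blast
  have "((%x. exp ((2*\<kappa> - 1) * x - s * exp x))\<longlongrightarrow>0) at_top" using s by real_asymp
  moreover have "filterlim Re at_top (strip_at_top ?A)" unfolding strip_at_top_def
   by (rule filterlim_mono[OF filterlim_filtercomap order_refl inf_le1])
  ultimately show "((%v. exp ((2*\<kappa> - 1) * Re v - s * exp (Re v)))\<longlongrightarrow>0) (strip_at_top ?A)"
   by (rule filterlim_compose)
 qed
 thus ?thesis
  by (intro whit_on_unique_recessive[OF S(1,2) W nb evS _ tendsto_mono[OF le lim(1)] tendsto_mono[OF le lim(2)]
    W_char[OF hol(1) S(1,3) r(1) lim(1)] W_char[OF hol(2) S(1,3) r(1) lim(2)] _ w]) auto
qed

lemma tendsto_strip_Un:
 assumes "(f\<longlongrightarrow>l) (strip_at_top A)" "(f\<longlongrightarrow>l) (strip_at_top B)"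
 shows "(f\<longlongrightarrow>l) (strip_at_top (A\<union>B))"
 using assms unfolding strip_at_top_Un by (rule filterlim_sup)

text \<open>The solution of the sector about 0 extends to an entire one. For |phi| < pi the sector
  about phi overlaps it in a strip about phi/2 inside |Im v| < pi/2, where \<open>W_unique\<close>
  identifies the two solutions.\<close>

lemma whittaker_W_props:
 fixes \<kappa> mu :: real
 assumes p: "0<mu - \<kappa> - 1/2" and c: "1<=mu + \<kappa> - 1/2"
 shows "whit_on \<kappa> mu UNIV (whittaker_W \<kappa> mu)"
  and "0<d==>((%v. whittaker_W \<kappa> mu v/exp (of_real \<kappa> * v - exp v/2))\<longlongrightarrow>1) (strip_at_top {x. \<bar>x\<bar><=3/2 * pi - d})"
proof -
 let ?E = "%v. exp (of_real \<kappa> * v - exp v/2)"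
 let ?P = "%Y. whittaker_solution \<kappa> mu Y&(\<forall>d>0. ((%v. Y v/?E v)\<longlongrightarrow>1)
    (inf (filtercomap Re at_top) (principal {v. \<bar>Im v\<bar><=3/2 * pi - d})))"
 have P: "?P Y\<longleftrightarrow>whit_on \<kappa> mu UNIV Y&(\<forall>d>0. ((%v. Y v/?E v)\<longlongrightarrow>1) (strip_at_top {x. \<bar>x\<bar><=3/2 * pi - d}))" for Y
  by (simp add: whittaker_solution_iff strip_at_top_def)
 obtain Y0 where Y0: "whit_on \<kappa> mu {v. \<bar>Im v-0\<bar><pi/2} Y0"
   "!!d. 0<d==>((%v. Y0 v/?E v)\<longlongrightarrow>1) (strip_at_top {x. \<bar>x-0\<bar><=pi/2 - d})"
  using W_sector[OF p c, of 0] by auto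
 obtain Y where Y: "whit_on \<kappa> mu UNIV Y" "Y 0=Y0 0" "deriv Y 0=deriv Y0 0" by (rule whit_on_exists)
 have YY0: "Y v=Y0 v" if "\<bar>Im v\<bar><pi/2" for v
  by (rule whit_on_unique_initial[OF Im_strip(2) convex_connected[OF Im_strip(1)] whit_on_subset[OF Y(1)] Y0(1), of 0])
    (use that Y in auto)
 have Y0lim: "((%v. Y v/?E v)\<longlongrightarrow>1) (strip_at_top {x. \<bar>x\<bar><=pi/2 - d})" if "0<d" for d
 proof (rule Lim_transform_eventually)
  show "((%v. Y0 v/?E v)\<longlongrightarrow>1) (strip_at_top {x. \<bar>x\<bar><=pi/2 - d})" using Y0(2)[OF that] by simp
  show "\<forall>\<^sub>F v in strip_at_top {x. \<bar>x\<bar><=pi/2 - d}. Y0 v/?E v=Y v/?E v"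
   unfolding eventually_strip_at_top using YY0 that by force
 qed
 have sector: "((%v. Y v/?E v)\<longlongrightarrow>1) (strip_at_top {x. \<bar>x-\<phi>\<bar><=pi/2 - d})" if \<phi>: "\<bar>\<phi>\<bar><pi" and d: "0<d" for \<phi> d
 proof -
  obtain X where X: "whit_on \<kappa> mu {v. \<bar>Im v-\<phi>\<bar><pi/2} X"
    "!!d. 0<d==>((%v. X v/?E v)\<longlongrightarrow>1) (strip_at_top {x. \<bar>x-\<phi>\<bar><=pi/2 - d})"
   using W_sector[OF p c \<phi>] by blast
  \<comment> \<open>With this value the strip of half width 2 r about phi/2 lies in both sectors,
    and the one of half width r lies in |Im v| < pi/2.\<close>
  define r where "r=(pi-\<bar>\<phi>\<bar>)/8"
  have r: "0<r" "8 * r=pi-\<bar>\<phi>\<bar>" using \<phi> by (auto simp: r_def)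
  have XY: "Y v=X v" if v: "\<bar>Im v-\<phi>\<bar><pi/2" for v
  proof -
   have S: "open {v. \<bar>Im v-\<phi>\<bar><pi/2}" "connected {v. \<bar>Im v-\<phi>\<bar><pi/2}"
    by (rule Im_strip(2), rule convex_connected[OF Im_strip(1)])
   have S2: "v\<in>{v. \<bar>Im v-\<phi>\<bar><pi/2}" if "\<bar>Im v-\<phi>/2\<bar><=2 * r" for v
    using that r unfolding mem_Collect_eq by arith
   have r2: "\<bar>\<phi>/2\<bar> + r<pi/2" using r by arith
   have W: "whit_on \<kappa> mu {v. \<bar>Im v-\<phi>\<bar><pi/2} Y" by (rule whit_on_subset[OF Y(1)]) auto
   have "{x. \<bar>x-\<phi>/2\<bar><=2 * r}\<subseteq>{x. \<bar>x\<bar><=pi/2 - r}" using r unfolding subset_iff mem_Collect_eq by arith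
   hence L: "((%v. Y v/?E v)\<longlongrightarrow>1) (strip_at_top {x. \<bar>x-\<phi>/2\<bar><=2 * r})"
    by (rule tendsto_mono[OF strip_at_top_mono Y0lim[OF r(1)]])
   have "{x. \<bar>x-\<phi>/2\<bar><=2 * r}\<subseteq>{x. \<bar>x-\<phi>\<bar><=pi/2 - r}" using r unfolding subset_iff mem_Collect_eq by arith
   hence L2: "((%v. X v/?E v)\<longlongrightarrow>1) (strip_at_top {x. \<bar>x-\<phi>/2\<bar><=2 * r})"
    by (rule tendsto_mono[OF strip_at_top_mono X(2)[OF r(1)]])
   show ?thesis
    by (rule W_unique[OF S S2 r(1) r2 W X(1) L L2]) (use v in auto)
  qed
  show ?thesis
  proof (rule Lim_transform_eventually[OF X(2)[OF d]])
   show "\<forall>\<^sub>F v in strip_at_top {x. \<bar>x-\<phi>\<bar><=pi/2 - d}. X v/?E v=Y v/?E v"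
    unfolding eventually_strip_at_top using XY d by force
  qed
 qed
 have PY: "?P Y" unfolding P
 proof (intro conjI allI impI Y(1))
  fix d :: real assume "0<d"
  define e where "e=min d 1"
  have e: "0<e" "e<=1" "e<=d" using \<open>0 < d\<close> by (auto simp: e_def)
  have pi3: "3<pi" using pi_gt3 .
  \<comment> \<open>Strips of half width pi/2 - e/4 about 0, about pi/2 and -pi/2, and about pi -
    e/2 and its negative cover |Im v| <= 3/2 pi - d, because e <= d.\<close>
  have "((%v. Y v/?E v)\<longlongrightarrow>1) (strip_at_top ({x. \<bar>x-0\<bar><=pi/2 - e/4}\<union>({x. \<bar>x - pi/2\<bar><=pi/2 - e/4} \<union>
    ({x. \<bar>x-(-pi/2)\<bar><=pi/2 - e/4}\<union>({x. \<bar>x-(pi - e/2)\<bar><=pi/2 - e/4}\<union>{x. \<bar>x-(-(pi - e/2))\<bar><=pi/2 - e/4})))))"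
   by (intro tendsto_strip_Un sector) (use e pi3 in auto)
  thus "((%v. Y v/?E v)\<longlongrightarrow>1) (strip_at_top {x. \<bar>x\<bar><=3/2 * pi - d})"
  proof (rule tendsto_mono[OF strip_at_top_mono, rotated])
   show "{x. \<bar>x\<bar><=3/2 * pi - d}\<subseteq>{x. \<bar>x-0\<bar><=pi/2 - e/4}\<union>({x. \<bar>x - pi/2\<bar><=pi/2 - e/4} \<union>
    ({x. \<bar>x-(-pi/2)\<bar><=pi/2 - e/4}\<union>({x. \<bar>x-(pi - e/2)\<bar><=pi/2 - e/4}\<union>{x. \<bar>x-(-(pi - e/2))\<bar><=pi/2 - e/4})))"
    using e pi3 unfolding subset_iff mem_Collect_eq Un_iff by (auto simp: abs_if split: if_splits)
  qed
 qed
 have uniq: "X=Y" if "?P X" "?P Y" for X Y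
 proof
  fix w
  have le: "strip_at_top {x. \<bar>x-0\<bar><=2*(1/4)}<=strip_at_top {x. \<bar>x\<bar><=3/2 * pi-1}"
   using pi_gt3 by (intro strip_at_top_mono) auto
  have L: "((%v. X v/?E v)\<longlongrightarrow>1) (strip_at_top {x. \<bar>x-0\<bar><=2*(1/4)})"
   "((%v. Y v/?E v)\<longlongrightarrow>1) (strip_at_top {x. \<bar>x-0\<bar><=2*(1/4)})"
   by (rule tendsto_mono[OF le conjunct2[OF that(1)[unfolded P], rule_format, OF zero_less_one]],
    rule tendsto_mono[OF le conjunct2[OF that(2)[unfolded P], rule_format, OF zero_less_one]])
  show "X w=Y w"
   by (rule W_unique[OF open_UNIV connected_UNIV _ _ _ _ _ L])
    (use pi_gt3 conjunct1[OF that(1)[unfolded P]] conjunct1[OF that(2)[unfolded P]] in auto)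
 qed
 have "\<exists>!Y. ?P Y"
 proof (rule ex1I[of ?P Y, OF PY])
  show "X=Y" if "?P X" for X by (rule uniq[OF that PY])
 qed
 from theI'[OF this] have "?P (whittaker_W \<kappa> mu)" unfolding whittaker_W_def .
 thus "whit_on \<kappa> mu UNIV (whittaker_W \<kappa> mu)"
  "0<d==>((%v. whittaker_W \<kappa> mu v/?E v)\<longlongrightarrow>1) (strip_at_top {x. \<bar>x\<bar><=3/2 * pi - d})"
  unfolding P by auto
qed

section \<open>Branches of the Liouville variable\<close>

text \<open>Logarithm cut along the negative imaginary axis. It is holomorphic at every nonzero
  point of the closed upper half plane, including the negative real axis, where \<open>Ln\<close>
  jumps.\<close>

definition ulog :: "complex=>complex" where
 "ulog w=Ln (- \<i> * w)+\<i> * of_real (pi/2)"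

lemma exp_ulog: "w~=0==>exp (ulog w)=w"
proof -
 assume "w~=0"
 hence 1: "exp (Ln (- \<i> * w)) = - \<i> * w" by (intro exp_Ln) auto
 have 2: "exp (\<i> * of_real (pi/2))=\<i>" using cis_conv_exp[of "pi/2"] cis_pi_half by simp
 show ?thesis unfolding ulog_def exp_add 1 2 by (simp add: complex_eq_iff)
qed

lemma Re_ulog: "w~=0==>Re (ulog w)=ln (norm w)"
 unfolding ulog_def by (simp add: Re_Ln norm_mult)

lemma Im_ulog: "0<=Im w==>w~=0==>0<=Im (ulog w)&Im (ulog w)<=pi"
 using Re_Ln_pos_le[of "- \<i> * w"] by (auto simp: ulog_def abs_le_iff)

lemma ulog_slit: "0<=Im w==>w~=0==>- \<i> * w\<notin>\<real>\<^sub>\<le>\<^sub>0"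
 by (auto simp: complex_nonpos_Reals_iff complex_eq_iff)

lemma ulog_has_derivative:
 assumes "0<=Im w" "w~=0"
 shows "(ulog has_field_derivative 1/w) (at w within A)"
 unfolding ulog_def using ulog_slit[OF assms] assms
 by (auto intro!: derivative_eq_intros simp: field_simps)

lemma ulog_unique:
 assumes "exp a=w" "0<=Im w" "- pi<Im a" "Im a<2 * pi"
 shows "ulog w=a"
proof -
 have "w~=0" using assms(1) by auto
 with Im_ulog[OF assms(2)] have "\<bar>Im (ulog w) - Im a\<bar><2 * pi" using assms by auto
 thus ?thesis using exp_ulog[OF \<open>w \<noteq> 0\<close>] assms(1) by (simp add: exp_complex_eqI)
qed

lemma ulog_real: "0<x==>ulog (of_real x) = of_real (ln x)"
 by (rule ulog_unique) (auto simp: exp_of_real)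

text \<open>The map w -> -r/w preserves the closed upper half plane. It is what the arguments of the
  logarithms in xi undergo when Z changes sign.\<close>

lemma ulog_neg_inverse:
 assumes "0<=Im w" "w~=0" "0<r"
 shows "ulog (- of_real r/w) = of_real (ln r)+\<i> * of_real pi - ulog w"
proof (rule ulog_unique)
 show "exp (of_real (ln r)+\<i> * of_real pi - ulog w) = - of_real r/w"
  using assms by (simp add: exp_diff exp_add exp_ulog exp_of_real)
 have "Im (- of_real r/w)=r * Im w/(norm w)\<^sup>2"
  by (simp add: Im_divide cmod_power2)
 thus "0<=Im (- of_real r/w)" using assms by simp
 have "0<=Im (ulog w)" "Im (ulog w)<=pi" "0<pi" using Im_ulog[OF assms(1,2)] by auto
 thus "- pi<Im (of_real (ln r)+\<i> * of_real pi - ulog w)"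
  "Im (of_real (ln r)+\<i> * of_real pi - ulog w)<2 * pi" by (simp_all, linarith+)
qed

text \<open>In this form the root is visibly continuous up to the negative real axis when that axis
  is approached from above.\<close>

lemma csqrt_upper: "0<=Im w==>csqrt w=Complex (sqrt ((norm w + Re w)/2)) (sqrt ((norm w - Re w)/2))"
 by (auto simp: complex_eq_iff sgn_if)

lemma csqrt_continuous_upper: "continuous_on {w. 0<=Im w} csqrt"
proof -
 have "continuous_on {w. 0<=Im w} (%w. Complex (sqrt ((norm w + Re w)/2)) (sqrt ((norm w - Re w)/2)))"
  unfolding Complex_eq by (intro continuous_intros) auto
 thus ?thesis by (rule continuous_on_eq) (simp only: mem_Collect_eq csqrt_upper)
qed

lemma Re_csqrt_pos: "w\<notin>\<real>\<^sub>\<le>\<^sub>0==>0<Re (csqrt w)"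
proof -
 assume w: "w\<notin>\<real>\<^sub>\<le>\<^sub>0"
 have "0<norm w + Re w"
 proof (cases "Im w=0")
  case True
  hence "0<Re w" using w by (auto simp: complex_nonpos_Reals_iff)
  thus ?thesis by (smt (verit) norm_ge_zero)
 next
  case False
  hence "\<bar>Re w\<bar><norm w" using abs_Re_le_cmod[of w] abs_sqrt_wlog
   by (metis abs_Re_le_cmod cmod_eq_Re less_eq_real_def cmod_Re_le_iff cmod_power2 add_cancel_right_right power2_abs zero_eq_power2)
  thus ?thesis by linarith
 qed
 thus ?thesis by simp
qed

lemma Im_csqrt_pos: "0<Im w\<or>(Im w=0&Re w<0)==>0<Im (csqrt w)"
proof -
 assume w: "0<Im w\<or>(Im w=0&Re w<0)"
 hence "0<norm w - Re w"
 proof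
  assume "0<Im w"
  hence "Re w~=norm w" by (metis cmod_eq_Re complex_is_Real_iff norm_ge_zero abs_of_nonneg less_irrefl cmod_Re_le_iff add_cancel_right_right cmod_power2 power2_eq_square zero_eq_power2)
  thus ?thesis using complex_Re_le_cmod[of w] by linarith
 qed (smt (verit) norm_ge_zero)
 thus ?thesis using w by (auto simp: sgn_if)
qed

definition csq :: "real=>complex=>complex" where
 "csq lam z=csqrt (Zsq lam z)"

text \<open>The Liouville variable with the value \<open>Z\<close> of the root as a separate
  argument, so that it can be used on any branch. The second logarithm is taken of the inverted
  quotient because that argument stays in the closed upper half plane.\<close>

definition xiB :: "real=>complex=>complex=>complex" where
 "xiB lam Z z=Z/2 - of_real lam * ulog (Z + z-2 * of_real lam) + ulog (z/(Z - of_real lam * z+2))"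

text \<open>Signed version of the level condition. Its sign depends on the root chosen, and
  \<open>csq\<close> jumps on the vertical half-line above the turning point.\<close>

definition lev :: "real=>complex=>real" where
 "lev lam z=Re (xi_formula lam (csq lam z) z) - Re (xi_formula lam 0 (turning_pt lam))"

lemma level_set_lev: "level_set lam={z\<in>Cplus. lev lam z=0}"
 by (simp add: level_set_def lev_def csq_def)

locale lam_range =
 fixes lam :: real
 assumes lam0: "0<=lam" and lam1: "lam<1"
begin

abbreviation "tp \<equiv> turning_pt lam"
abbreviation "Q \<equiv> Zsq lam"

definition yt :: real where "yt=2 * sqrt (1 - lam\<^sup>2)"

lemma lam_sq: "0<1 - lam\<^sup>2"
 using lam0 lam1 by (simp add: power_less_one_iff)

lemma yt: "0<yt" "yt\<^sup>2=4-4 * lam\<^sup>2" "yt * yt=4-4*(lam * lam)"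
proof -
 show 1: "0<yt" "yt\<^sup>2=4-4 * lam\<^sup>2" using lam_sq by (auto simp: yt_def power_mult_distrib)
 show "yt * yt=4-4*(lam * lam)" using 1(2) by (simp add: power2_eq_square)
qed

lemma Re_tp [simp]: "Re tp=2 * lam" and Im_tp [simp]: "Im tp=yt"
 by (auto simp: turning_pt_def yt_def)

lemma norm_tp: "norm tp=2"
proof -
 have "(norm tp)\<^sup>2=2\<^sup>2" unfolding cmod_power2 by (simp add: yt power2_eq_square)
 thus ?thesis using power2_eq_iff_nonneg[of "norm tp" 2] by simp
qed

lemma tp_Cplus: "tp\<in>Cplus"
 using norm_tp yt by (auto simp: Cplus_def)

lemma Re_Q: "Re (Q z)=(Re z)\<^sup>2-(Im z)\<^sup>2-4 * lam * Re z+4"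
 and Im_Q: "Im (Q z)=2 * Im z*(Re z-2 * lam)"
 by (simp_all add: Zsq_def power2_eq_square algebra_simps)

lemma Q_tp: "Q tp=0"
 by (simp add: complex_eq_iff Re_Q Im_Q yt power2_eq_square)

lemma Q_zero_iff: "z\<in>Cplus==>Q z=0\<longleftrightarrow>z=tp"
proof
 assume z: "z\<in>Cplus" and "Q z=0"
 hence 1: "(Re z)\<^sup>2-(Im z)\<^sup>2-4 * lam * Re z+4=0" "Im z*(Re z-2 * lam)=0"
  using Re_Q[of z] Im_Q[of z] by auto
 have "Im z~=0"
 proof
  assume "Im z=0"
  hence "(Re z-2 * lam)\<^sup>2 + yt\<^sup>2=0" using 1 by (simp add: yt power2_eq_square algebra_simps)
  thus False using zero_le_power2[of "Re z-2 * lam"] zero_less_power[OF yt(1), of 2] by linarith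
 qed
 hence "Re z=2 * lam" using 1 by auto
 moreover from this 1 have "(Im z)\<^sup>2=yt\<^sup>2" by (simp add: yt power2_eq_square algebra_simps)
 hence "Im z=yt" using z yt(1) power2_eq_iff_nonneg[of "Im z" yt] by (auto simp: Cplus_def)
 ultimately show "z=tp" by (simp add: complex_eq_iff)
qed (use Q_tp in auto)

text \<open>Locates the jump of \<open>csq\<close>: the vertical half-line that starts at the
  turning point.\<close>

lemma Q_nonpos:
 assumes z: "z\<in>Cplus" and "Q z\<in>\<real>\<^sub>\<le>\<^sub>0"
 shows "Re z=2 * lam&yt<=Im z"
proof -
 have 1: "Re (Q z)<=0" "Im (Q z)=0" using assms by (auto simp: complex_nonpos_Reals_iff)
 have "Im z~=0"
 proof
  assume "Im z=0"
  hence "(Re z-2 * lam)\<^sup>2 + yt\<^sup>2<=0" using 1 by (simp add: yt Re_Q power2_eq_square algebra_simps)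
  thus False using zero_le_power2[of "Re z-2 * lam"] zero_less_power[OF yt(1), of 2] by linarith
 qed
 hence R: "Re z=2 * lam" using 1 by (auto simp: Im_Q)
 with 1 have "yt\<^sup>2<=(Im z)\<^sup>2" by (simp add: Re_Q yt power2_eq_square algebra_simps)
 thus ?thesis using R z yt by (auto simp: Cplus_def intro: power2_le_imp_le)
qed

lemma norm_on_line:
 assumes "Re z=2 * lam" "0<=Im z"
 shows "norm z<2\<longleftrightarrow>Im z<yt" "2<norm z\<longleftrightarrow>yt<Im z"
proof -
 have "(norm z)\<^sup>2-2\<^sup>2=(Im z)\<^sup>2 - yt\<^sup>2" 
  unfolding cmod_power2 yt(2) using assms by (simp add: power2_eq_square algebra_simps)
 thus "norm z<2\<longleftrightarrow>Im z<yt" "2<norm z\<longleftrightarrow>yt<Im z"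
  using abs_le_square_iff[of "norm z" 2] abs_le_square_iff[of 2 "norm z"]
   abs_le_square_iff[of "Im z" yt] abs_le_square_iff[of yt "Im z"] assms yt by auto
qed

text \<open>Both products are differences of squares. They show that the arguments of the logarithms
  in xi do not vanish, and that a change of sign of Z replaces each of them by minus its inverse up
  to a positive factor.\<close>

lemma branch_factors:
 assumes "Z^2=Q z"
 shows "(Z + z-2 * of_real lam)*(Z - z+2 * of_real lam) = of_real (4*(1 - lam\<^sup>2))"
  "(Z - of_real lam * z+2)*(Z + of_real lam * z-2) = of_real (1 - lam\<^sup>2) * z\<^sup>2"
proof -
 have "(Z + z-2 * of_real lam)*(Z - z+2 * of_real lam)=Z^2-(z-2 * of_real lam)^2"
  by (simp add: algebra_simps power2_eq_square)
 thus "(Z + z-2 * of_real lam)*(Z - z+2 * of_real lam) = of_real (4*(1 - lam\<^sup>2))"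
  unfolding assms Zsq_def by (simp add: algebra_simps power2_eq_square)
 have "(Z - of_real lam * z+2)*(Z + of_real lam * z-2)=Z^2-(of_real lam * z-2)^2"
  by (simp add: algebra_simps power2_eq_square)
 thus "(Z - of_real lam * z+2)*(Z + of_real lam * z-2) = of_real (1 - lam\<^sup>2) * z\<^sup>2"
  unfolding assms Zsq_def by (simp add: algebra_simps power2_eq_square)
qed

lemma of_real_lam_nz: "complex_of_real (1 - lam\<^sup>2)~=0" "complex_of_real (4*(1 - lam\<^sup>2))~=0"
 using lam_sq by (simp_all only: of_real_eq_0_iff) auto

lemma branch_nonzero:
 assumes "Z^2=Q z" "z~=0"
 shows "Z + z-2 * of_real lam~=0" "Z - of_real lam * z+2~=0" "Z - z+2 * of_real lam~=0" "Z + of_real lam * z-2~=0"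
 using branch_factors[OF assms(1)] of_real_lam_nz assms(2) by auto

text \<open>Both arguments of \<open>ulog\<close> in \<open>xiB\<close> lie in the closed upper half plane, whatever the branch of \<open>Z\<close>:
 for \<open>w = Z + z - 2 lam\<close> one has \<open>w - 4 (1 - lam\<^sup>2) / w = 2 (z - 2 lam)\<close>, and for \<open>t = z / (Z - lam z + 2)\<close>
 one has \<open>1/t - (1 - lam\<^sup>2) t = 4/z - 2 lam\<close>.\<close>

lemma branch_upper:
 assumes Z: "Z^2=Q z" and z: "z\<in>Cplus"
 shows "0<=Im (Z + z-2 * of_real lam)" "0<=Im (z/(Z - of_real lam * z+2))"
proof -
 have z0: "z~=0" and y: "0<=Im z" using z by (auto simp: Cplus_def)
 note nz = branch_nonzero[OF Z z0] and fac = branch_factors[OF Z]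
 define w where "w=Z + z-2 * of_real lam"
 have w: "w~=0" using nz by (simp add: w_def)
 have "w - of_real (4*(1 - lam\<^sup>2))/w=2*(z-2 * of_real lam)"
  using fac(1) nz unfolding w_def by (simp add: divide_simps) (simp add: algebra_simps)
 hence "Im (w - of_real (4*(1 - lam\<^sup>2))/w)=2 * Im z" by simp
 moreover have wc: "Im (w - of_real c/w)=Im w*(1 + c/(norm w)\<^sup>2)" for c
 proof -
  have "Im (of_real c/w) = - (c * Im w/(norm w)\<^sup>2)" by (simp add: Im_divide cmod_power2)
  thus ?thesis by (simp add: algebra_simps)
 qed
 ultimately have "0<=Im w*(1+4*(1 - lam\<^sup>2)/(norm w)\<^sup>2)" using y wc[of "4*(1 - lam\<^sup>2)"] by linarith
 moreover have "0<1+4*(1 - lam\<^sup>2)/(norm w)\<^sup>2" using lam_sq by (intro add_pos_nonneg) auto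
 ultimately show "0<=Im (Z + z-2 * of_real lam)" unfolding w_def[symmetric] by (simp add: zero_le_mult_iff)
 define t where "t=z/(Z - of_real lam * z+2)"
 have t: "t~=0" using nz z0 by (simp add: t_def)
 have "1/t - of_real (1 - lam\<^sup>2) * t=4/z-2 * of_real lam"
 proof -
  have "of_real (1 - lam\<^sup>2) * t=(Z + of_real lam * z-2)/z"
   using fac(2) nz z0 unfolding t_def by (simp add: divide_simps power2_eq_square mult.commute)
  thus ?thesis using z0 nz unfolding t_def by (simp add: divide_simps) (simp add: algebra_simps)
 qed
 hence "Im (1/t - of_real (1 - lam\<^sup>2) * t)=Im (4/z)" by simp
 moreover have "Im (1/t - of_real (1 - lam\<^sup>2) * t) = - Im t*(1/(norm t)\<^sup>2+(1 - lam\<^sup>2))"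
 proof -
  have "Im (1/t) = - (Im t/(norm t)\<^sup>2)" by (simp add: Im_divide cmod_power2)
  thus ?thesis by (simp add: algebra_simps)
 qed
 moreover have "Im (4/z)<=0" using y by (simp add: Im_divide divide_nonneg_nonneg)
 ultimately have "0<=Im t*(1/(norm t)\<^sup>2+(1 - lam\<^sup>2))" by simp
 moreover have "0<1/(norm t)\<^sup>2+(1 - lam\<^sup>2)" using lam_sq by (intro add_nonneg_pos) auto
 ultimately show "0<=Im (z/(Z - of_real lam * z+2))" unfolding t_def[symmetric] by (simp add: zero_le_mult_iff)
qed

lemma Re_xiB:
 assumes Z: "Z^2=Q z" and z: "z~=0"
 shows "Re (xiB lam Z z)=Re (xi_formula lam Z z)"
proof -
 note nz = branch_nonzero[OF Z z]
 show ?thesis unfolding xiB_def xi_formula_def using nz z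
  by (simp add: Re_ulog Re_Ln norm_divide ln_div)
qed

text \<open>In both logarithms w becomes -r/w, with r = 4 (1 - lam^2) and r = 1/(1 - lam^2) by
  \<open>branch_factors\<close>, and \<open>ulog_neg_inverse\<close> applies. The constants found
  here become the prefactors of the theorem.\<close>

lemma xiB_uminus:
 assumes Z: "Z^2=Q z" and z: "z\<in>Cplus"
 shows "xiB lam (- Z) z = - xiB lam Z z - of_real (lam * ln (4*(1 - lam\<^sup>2)) + ln (1 - lam\<^sup>2))+\<i> * of_real (pi*(1 - lam))"
proof -
 have z0: "z~=0" using z by (auto simp: Cplus_def)
 note nz = branch_nonzero[OF Z z0] and fac = branch_factors[OF Z] and up = branch_upper[OF Z z]
 have c: "0<4*(1 - lam\<^sup>2)" "0<1/(1 - lam\<^sup>2)" using lam_sq by auto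
 have 1: "- Z + z-2 * of_real lam = - of_real (4*(1 - lam\<^sup>2))/(Z + z-2 * of_real lam)"
  using fac(1) nz by (simp add: field_simps)
 have 2: "z/(- Z - of_real lam * z+2) = - of_real (1/(1 - lam\<^sup>2))/(z/(Z - of_real lam * z+2))"
 proof -
  have n: "- Z - of_real lam * z+2~=0" using nz(4) by (simp add: algebra_simps)
  have "(- Z - of_real lam * z+2)*(Z - of_real lam * z+2) = - of_real (1 - lam\<^sup>2) * z\<^sup>2"
   using fac(2) by (simp add: algebra_simps)
  hence "z * z * of_real (1 - lam\<^sup>2) = - (Z - of_real lam * z+2)*(- Z - of_real lam * z+2)"
   by (simp add: power2_eq_square algebra_simps)
  hence "z/(- Z - of_real lam * z+2) = - (Z - of_real lam * z+2)/(z * of_real (1 - lam\<^sup>2))"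
   using n z0 of_real_lam_nz(1) by (simp add: frac_eq_eq mult_ac)
  also have "\<dots> = - of_real (1/(1 - lam\<^sup>2))/(z/(Z - of_real lam * z+2))"
   using nz z0 by (simp add: divide_simps)
  finally show ?thesis .
 qed
 have 3: "ulog (- Z + z-2 * of_real lam) = of_real (ln (4*(1 - lam\<^sup>2)))+\<i> * of_real pi - ulog (Z + z-2 * of_real lam)"
  unfolding 1 by (rule ulog_neg_inverse[OF up(1) nz(1) c(1)])
 have 4: "ulog (z/(- Z - of_real lam * z+2)) = of_real (ln (1/(1 - lam\<^sup>2)))+\<i> * of_real pi - ulog (z/(Z - of_real lam * z+2))"
  unfolding 2 by (rule ulog_neg_inverse[OF up(2) _ c(2)]) (use nz z0 in auto)
 show ?thesis unfolding xiB_def 3 4 using lam_sq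
  by (simp add: ln_div algebra_simps)
qed

text \<open>At the turning point Z = 0 = -Z, so the reflection formula \<open>xiB_uminus\<close>
  determines the real part.\<close>

lemma Re_xi_tp: "Re (xi_formula lam 0 tp) = - (lam * ln (4*(1 - lam\<^sup>2)) + ln (1 - lam\<^sup>2))/2"
proof -
 have "0^2=Q tp" by (simp add: Q_tp)
 from arg_cong[OF xiB_uminus[OF this tp_Cplus], of Re] Re_xiB[OF this] tp_Cplus
 show ?thesis by (simp add: Cplus_def)
qed

text \<open>The level relative to an arbitrary root. It is odd in \<open>Z\<close>, so a level known
  for one root is known for the other.\<close>

definition levB :: "complex=>complex=>real" where
 "levB Z z=Re (xiB lam Z z) - Re (xi_formula lam 0 tp)"

lemma csq_sq: "csq lam z^2=Q z" by (simp add: csq_def)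

lemma lev_levB: "z\<in>Cplus==>lev lam z=levB (csq lam z) z"
 unfolding lev_def levB_def using Re_xiB[OF csq_sq] by (simp add: Cplus_def)

lemma levB_uminus: "Z^2=Q z==>z\<in>Cplus==>levB (- Z) z = - levB Z z"
 unfolding levB_def Re_xi_tp by (simp add: xiB_uminus) (simp add: field_simps)

lemma lev_tp: "lev lam tp=0"
 by (simp add: lev_def csq_def Q_tp)

text \<open>For a continuous root, (Z t - Z z)(Z t + Z z) = Q t - Q z gives the difference quotient.
  The derivative is taken within \<open>S\<close> because the domains contain points of the real
  axis, the boundary of \<open>Cplus\<close>.\<close>

lemma branch_deriv:
 assumes c: "continuous (at z within S) Z" and Z: "!!t. t\<in>S==>Z t^2=Q t" and z: "z\<in>S" "Z z~=0"
 shows "(Z has_field_derivative (z-2 * of_real lam)/Z z) (at z within S)"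
proof -
 have lim: "((%t. Z t)\<longlongrightarrow>Z z) (at z within S)" using c by (simp add: continuous_within)
 have "((%t. (t + z-4 * of_real lam)/(Z t + Z z))\<longlongrightarrow>(z + z-4 * of_real lam)/(Z z + Z z)) (at z within S)"
  using z by (intro tendsto_intros lim) auto
 moreover have "\<forall>\<^sub>F t in at z within S. (t + z-4 * of_real lam)/(Z t + Z z)=(Z t - Z z)/(t - z)"
 proof -
  have "((%t. Z t + Z z)\<longlongrightarrow>Z z + Z z) (at z within S)" by (intro tendsto_intros lim)
  hence "\<forall>\<^sub>F t in at z within S. Z t + Z z~=0"
   by (rule tendsto_imp_eventually_ne) (use z in auto)
  moreover have "\<forall>\<^sub>F t in at z within S. t\<in>S&t~=z" by (auto simp: eventually_at_filter)
  ultimately show ?thesis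
  proof eventually_elim
   case (elim t)
   have "(Z t - Z z)*(Z t + Z z)=Q t - Q z"
    using Z[of t] Z[OF z(1)] elim by (simp add: algebra_simps power2_eq_square)
   also have "\<dots>=(t + z-4 * of_real lam)*(t - z)" by (simp add: Zsq_def algebra_simps power2_eq_square)
   finally show ?case using elim by (simp add: frac_eq_eq)
  qed
 qed
 ultimately have "((%t. (Z t - Z z)/(t - z))\<longlongrightarrow>(z + z-4 * of_real lam)/(Z z + Z z)) (at z within S)"
  by (rule Lim_transform_eventually)
 moreover have "(z + z-4 * of_real lam)/(Z z + Z z)=(z-2 * of_real lam)/Z z"
  using z by (simp add: field_simps)
 ultimately show ?thesis by (simp add: has_field_derivative_iff)
qed

lemma branch_xi_continuous:
 assumes c: "continuous (at z within S) Z" and Z: "!!t. t\<in>S==>Z t^2=Q t" and z: "z\<in>S" and S: "S\<subseteq>Cplus"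
 shows "continuous (at z within S) (%t. xiB lam (Z t) t)"
proof -
 have zC: "z\<in>Cplus" using z S by auto
 hence z0: "z~=0" by (auto simp: Cplus_def)
 note nz = branch_nonzero[OF Z[OF z] z0] and up = branch_upper[OF Z[OF z] zC]
 have u1: "isCont ulog (Z z + z-2 * of_real lam)"
  by (rule DERIV_isCont[OF ulog_has_derivative]) (use nz up in auto)
 have u2: "isCont ulog (z/(Z z - of_real lam * z+2))"
  by (rule DERIV_isCont[OF ulog_has_derivative]) (use nz up z0 in auto)
 show ?thesis unfolding xiB_def
  by (intro continuous_intros c continuous_within_compose3[where f = "%t. Z t + t-2 * of_real lam", OF u1]
    continuous_within_compose3[where f = "%t. t/(Z t - of_real lam * t+2)", OF u2]) (use nz in auto)
qed

lemma branch_xi_deriv: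
 assumes c: "continuous (at z within S) Z" and Z: "!!t. t\<in>S==>Z t^2=Q t" and z: "z\<in>S" "Z z~=0" and S: "S\<subseteq>Cplus"
 shows "((%t. xiB lam (Z t) t) has_field_derivative Z z/(2 * z)) (at z within S)"
proof -
 have zC: "z\<in>Cplus" using z S by auto
 hence z0: "z~=0" by (auto simp: Cplus_def)
 note nz = branch_nonzero[OF Z[OF z(1)] z0] and up = branch_upper[OF Z[OF z(1)] zC]
 define Z' where "Z'=(z-2 * of_real lam)/Z z"
 have dZ: "(Z has_field_derivative Z') (at z within S)" unfolding Z'_def by (rule branch_deriv[OF c Z z])
 define w v where "w=Z z + z-2 * of_real lam" and "v=Z z - of_real lam * z+2"
 have wv: "w~=0" "v~=0" using nz by (auto simp: w_def v_def)
 have d1: "((%t. Z t + t-2 * of_real lam) has_field_derivative Z'+1) (at z within S)"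
  by (auto intro!: derivative_eq_intros dZ)
 have d2: "((%t. t/(Z t - of_real lam * t+2)) has_field_derivative (v - z*(Z' - of_real lam))/(v * v)) (at z within S)"
  using wv by (auto intro!: derivative_eq_intros dZ simp: v_def)
 have e1: "((%t. ulog (Z t + t-2 * of_real lam)) has_field_derivative 1/w*(Z'+1)) (at z within S)"
  by (rule DERIV_chain2[OF _ d1]) (use ulog_has_derivative[of w UNIV] up wv in "auto simp: w_def")
 have e2: "((%t. ulog (t/(Z t - of_real lam * t+2))) has_field_derivative 1/(z/v)*((v - z*(Z' - of_real lam))/(v * v))) (at z within S)"
  by (rule DERIV_chain2[OF _ d2]) (use ulog_has_derivative[of "z/v" UNIV] up wv z0 in "auto simp: v_def")
 have "((%t. xiB lam (Z t) t) has_field_derivative Z'/2 - of_real lam*(1/w*(Z'+1))+1/(z/v)*((v - z*(Z' - of_real lam))/(v * v))) (at z within S)"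
  unfolding xiB_def by (intro DERIV_add DERIV_diff DERIV_cmult e1 e2 DERIV_cdivide dZ)
 moreover have "Z'/2 - of_real lam*(1/w*(Z'+1))+1/(z/v)*((v - z*(Z' - of_real lam))/(v * v))=Z z/(2 * z)"
 proof -
  have a: "1/w*(Z'+1)=1/Z z" using wv z unfolding Z'_def w_def by (simp add: divide_simps)
  have "(z-2 * of_real lam - of_real lam * Z z) * z=(Z z-2) * v"
  proof -
   have "(Z z-2) * v=Z z^2 - of_real lam * z * Z z+2 * of_real lam * z-4"
    by (simp add: v_def power2_eq_square algebra_simps)
   thus ?thesis unfolding Z[OF z(1)] by (simp add: Zsq_def power2_eq_square algebra_simps)
  qed
  hence b: "(Z' - of_real lam) * z=(Z z-2) * v/Z z" using z unfolding Z'_def by (simp add: field_simps)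
  have "1/(z/v)*((v - z*(Z' - of_real lam))/(v * v))=(v-(Z' - of_real lam) * z)/(z * v)"
   using wv z0 by (simp add: field_simps)
  also have "\<dots>=(1-(Z z-2)/Z z)/z" unfolding b using wv z0 z by (simp add: field_simps)
  also have "\<dots>=2/(z * Z z)" using z z0 by (simp add: field_simps)
  finally have d: "1/(z/v)*((v - z*(Z' - of_real lam))/(v * v))=2/(z * Z z)" .
  have "z*(z-2 * of_real lam)-2 * of_real lam * z+4=Z z * Z z"
   using Z[OF z(1)] by (simp add: Zsq_def power2_eq_square algebra_simps)
  moreover have "(z-2 * l)/x/2 - l*(1/x)+2/(z * x)=(z*(z-2 * l)-2 * l * z+4)/(2 * z * x)"
   if "x~=0" for l x using that z0 by (simp add: field_simps)
  ultimately show ?thesis unfolding a d unfolding Z'_def using z z0 by simp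
 qed
 ultimately show ?thesis by (simp only:)
qed

end

lemma sq_eq_Re_pos: "a^2=b^2==>0<Re a==>0<Re b==>a=(b::complex)"
 by (auto simp: power2_eq_iff)

section \<open>Monotonicity of the level along arcs, rays and the vertical line\<close>

context lam_range
begin

text \<open>The root that is continuous on the closed side Re z <= 2 lam. Conjugation exchanges the
  two sides of the cut of \<open>csqrt\<close>, so on the vertical half-line it takes the limit from
  the left.\<close>

definition csL :: "complex=>complex" where
 "csL z=cnj (csqrt (cnj (Q z)))"

lemma csL_sq: "csL z^2=Q z"
 by (simp add: csL_def flip: complex_cnj_power)

lemma Q_slit: "z\<in>Cplus==>Re z~=2 * lam\<or>norm z<2==>Q z\<notin>\<real>\<^sub>\<le>\<^sub>0"
 using Q_nonpos[of z] norm_on_line(1)[of z] by (auto simp: Cplus_def)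

lemma Re_csq_pos: "z\<in>Cplus==>Re z~=2 * lam\<or>norm z<2==>0<Re (csq lam z)"
 unfolding csq_def by (rule Re_csqrt_pos[OF Q_slit])

lemma csL_csq: "z\<in>Cplus==>Re z~=2 * lam\<or>norm z<2==>csL z=csq lam z"
proof (rule sq_eq_Re_pos)
 assume z: "z\<in>Cplus" "Re z~=2 * lam\<or>norm z<2"
 show "csL z^2=csq lam z^2" by (simp add: csL_sq csq_sq)
 show "0<Re (csq lam z)" by (rule Re_csq_pos[OF z])
 have "cnj (Q z)\<notin>\<real>\<^sub>\<le>\<^sub>0" using Q_slit[OF z] by (auto simp: complex_nonpos_Reals_iff)
 hence "0<Re (csqrt (cnj (Q z)))" by (rule Re_csqrt_pos)
 thus "0<Re (csL z)" unfolding csL_def by (simp only: cnj.simps)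
qed

lemma csq_cut:
 assumes "Re z=2 * lam" "yt<Im z"
 shows "Re (csq lam z)=0" "0<Im (csq lam z)" "csL z = - csq lam z" "csq lam z=\<i> * of_real (Im (csq lam z))"
proof -
 have "yt\<^sup>2<(Im z)\<^sup>2" using assms yt(1) by (intro power_strict_mono) auto
 moreover have "Re (Q z)=yt\<^sup>2-(Im z)\<^sup>2" 
  unfolding Re_Q yt(2) using assms by (simp add: power2_eq_square algebra_simps)
 ultimately have Qz: "Im (Q z)=0" "Re (Q z)<0" using assms by (simp_all add: Im_Q)
 have nQ: "norm (Q z) = - Re (Q z)" using Qz by (simp add: cmod_eq_Re)
 show 1: "Re (csq lam z)=0" unfolding csq_def using nQ by simp
 show "0<Im (csq lam z)" unfolding csq_def by (rule Im_csqrt_pos) (use Qz in auto)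
 have "cnj (Q z)=Q z" using Qz by (simp add: complex_eq_iff)
 hence "csL z=cnj (csq lam z)" unfolding csL_def csq_def by simp
 thus "csL z = - csq lam z" using 1 by (simp add: complex_eq_iff)
 show "csq lam z=\<i> * of_real (Im (csq lam z))" using 1 by (simp add: complex_eq_iff)
qed

lemma Im_csq_right: "z\<in>Cplus==>0<Im z==>2 * lam<Re z==>0<Im (csq lam z)"
 unfolding csq_def by (rule Im_csqrt_pos) (simp add: Im_Q)

lemma Im_csq_left: "z\<in>Cplus==>0<Im z==>Re z<2 * lam==>Im (csq lam z)<0"
proof -
 assume z: "z\<in>Cplus" "0<Im z" "Re z<2 * lam"
 have "2*(Re (csq lam z) * Im (csq lam z))=Im (Q z)"
  using arg_cong[OF csq_sq[of z], of Im] by (simp add: power2_eq_square mult.commute)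
 also have "\<dots><0" using z by (simp add: Im_Q mult_pos_neg)
 finally show ?thesis using Re_csq_pos[of z] z by (simp add: mult_less_0_iff)
qed

lemma continuous_csq_right: "continuous_on {z\<in>Cplus. 2 * lam<=Re z} (csq lam)"
 unfolding csq_def
proof (rule continuous_on_compose2[OF csqrt_continuous_upper])
 show "continuous_on {z\<in>Cplus. 2 * lam<=Re z} Q" unfolding Zsq_def by (intro continuous_intros)
qed (auto simp: Im_Q Cplus_def)

lemma continuous_csL: "continuous_on {z\<in>Cplus. Re z<=2 * lam} csL"
 unfolding csL_def
proof (rule continuous_on_cnj, rule continuous_on_compose2[OF csqrt_continuous_upper])
 show "continuous_on {z\<in>Cplus. Re z<=2 * lam} (%z. cnj (Q z))" unfolding Zsq_def by (intro continuous_intros)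
qed (auto simp: Im_Q Cplus_def mult_nonneg_nonpos)

lemma levB_continuous:
 assumes "continuous_on S Z" "!!t. t\<in>S==>Z t^2=Q t" "S\<subseteq>Cplus"
 shows "continuous_on S (%z. levB (Z z) z)"
 unfolding levB_def using branch_xi_continuous[of _ S Z] assms
 by (intro continuous_intros) (auto simp: continuous_on_eq_continuous_within)

text \<open>Chain rule with dxi/dz = Z/(2 z): the sign of Re (Z g'/(2 g)) decides whether the level
  rises along a curve \<open>g\<close>.\<close>

lemma levB_curve_deriv:
 assumes Z: "continuous_on S Z" "!!t. t\<in>S==>Z t^2=Q t" "S\<subseteq>Cplus"
  and g: "!!t. t\<in>{a<..<b}==>g t\<in>S" and t: "t\<in>{a<..<b}" "Z (g t)~=0"
  and d: "(g has_vector_derivative g') (at t)"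
 shows "((%t. levB (Z (g t)) (g t)) has_real_derivative Re (Z (g t)/(2 * g t) * g')) (at t)"
proof -
 have "((%z. xiB lam (Z z) z) has_field_derivative Z (g t)/(2 * g t)) (at (g t) within S)"
  using Z g t by (intro branch_xi_deriv) (auto simp: continuous_on_eq_continuous_within)
 hence "((%z. xiB lam (Z z) z) has_field_derivative Z (g t)/(2 * g t)) (at (g t) within g ` {a<..<b})"
  by (rule DERIV_subset) (use g in auto)
 from field_vector_diff_chain_within[OF has_vector_derivative_at_within[OF d] this]
 have "((%t. xiB lam (Z (g t)) (g t)) has_vector_derivative g'*(Z (g t)/(2 * g t))) (at t within {a<..<b})"
  by (simp add: o_def)
 hence "((%t. xiB lam (Z (g t)) (g t)) has_vector_derivative g'*(Z (g t)/(2 * g t))) (at t)"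
  by (simp only: at_within_open[OF t(1) open_greaterThanLessThan])
 from bounded_linear.has_vector_derivative[OF bounded_linear_Re this]
 have "((%t. Re (xiB lam (Z (g t)) (g t))) has_real_derivative Re (Z (g t)/(2 * g t) * g')) (at t)"
  by (simp add: has_real_derivative_iff_has_vector_derivative mult.commute)
 from DERIV_diff[OF this DERIV_const[of "Re (xi_formula lam 0 tp)"]] show ?thesis unfolding levB_def by simp
qed

lemma levB_curve_decreasing:
 assumes Z: "continuous_on S Z" "!!t. t\<in>S==>Z t^2=Q t" "S\<subseteq>Cplus"
  and ab: "a<b" and g: "!!t. t\<in>{a..b}==>g t\<in>S" "continuous_on {a..b} g"
  and d: "!!t. t\<in>{a<..<b}==>Z (g t)~=0&(g has_vector_derivative g' t) (at t)&Re (Z (g t)/(2 * g t) * g' t)<0"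
 shows "levB (Z (g b)) (g b)<levB (Z (g a)) (g a)"
proof (rule DERIV_neg_imp_decreasing_open[OF ab, of "%t. levB (Z (g t)) (g t)"])
 show "\<exists>y. ((%t. levB (Z (g t)) (g t)) has_real_derivative y) (at t)&y<0" if "a<t" "t<b" for t
  using levB_curve_deriv[OF Z, of a b g t "g' t"] d[of t] g(1) that by auto
 show "continuous_on {a..b} (%t. levB (Z (g t)) (g t))"
  by (rule continuous_on_compose2[OF levB_continuous[OF Z] g(2)]) (use g in auto)
qed

lemma levB_curve_increasing:
 assumes Z: "continuous_on S Z" "!!t. t\<in>S==>Z t^2=Q t" "S\<subseteq>Cplus"
  and ab: "a<b" and g: "!!t. t\<in>{a..b}==>g t\<in>S" "continuous_on {a..b} g"
  and d: "!!t. t\<in>{a<..<b}==>Z (g t)~=0&(g has_vector_derivative g' t) (at t)&0<Re (Z (g t)/(2 * g t) * g' t)"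
 shows "levB (Z (g a)) (g a)<levB (Z (g b)) (g b)"
proof -
 have "levB (- Z (g b)) (g b)<levB (- Z (g a)) (g a)"
 proof (rule levB_curve_decreasing[of S "%z. - Z z", OF _ _ Z(3) ab g])
  show "- Z (g t)~=0&(g has_vector_derivative g' t) (at t)&Re (- Z (g t)/(2 * g t) * g' t)<0" if "t\<in>{a<..<b}" for t
   using d[OF that] by simp
 qed (use Z in "auto intro!: continuous_intros")
 moreover have S: "g a\<in>S" "g b\<in>S" using ab g by auto
 ultimately show ?thesis
  using levB_uminus[OF Z(2)[OF S(1)] subsetD[OF Z(3) S(1)]] levB_uminus[OF Z(2)[OF S(2)] subsetD[OF Z(3) S(2)]] by simp
qed

definition pol :: "real=>real=>complex" where
 "pol r th = of_real r * cis th"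

lemma pol_simps [simp]: "Re (pol r th)=r * cos th" "Im (pol r th)=r * sin th" "norm (pol r th)=\<bar>r\<bar>"
 by (auto simp: pol_def norm_mult)

lemma pol_eq_0 [simp]: "pol r th=0\<longleftrightarrow>r=0"
 by (simp add: pol_def)

lemma pol_Cplus: "0<r==>0<=th==>th<=pi==>pol r th\<in>Cplus"
 by (auto simp: Cplus_def sin_ge_zero)

lemma polar:
 assumes "z\<in>Cplus"
 obtains th where "0<=th" "th<=pi" "z=pol (norm z) th" "0<norm z"
proof
 show "z=pol (norm z) (Arg z)" unfolding pol_def
  by (metis rcis_cmod_Arg rcis_def)
 show "0<=Arg z" using assms Arg_less_0[of z] by (auto simp: Cplus_def)
qed (use assms Arg_le_pi in "auto simp: Cplus_def")

lemma pol_arc_deriv: "(pol r has_vector_derivative \<i> * pol r th) (at th)"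
proof -
 have "((%t. of_real r * exp (\<i> * t)) has_field_derivative of_real r*(exp (\<i> * of_real th)*\<i>)) (at (of_real th))"
  by (auto intro!: derivative_eq_intros)
 from has_vector_derivative_real_field[OF this] show ?thesis
  by (simp add: pol_def[abs_def] o_def cis_conv_exp mult_ac)
qed

lemma pol_ray_deriv: "((%r. pol r th) has_vector_derivative cis th) (at r)"
 unfolding pol_def by (auto intro!: derivative_eq_intros)

lemma pol_continuous: "continuous_on A (pol r)" "continuous_on A (%r. pol r th)"
 by (intro continuous_at_imp_continuous_on ballI has_vector_derivative_continuous[OF pol_arc_deriv],
   intro continuous_at_imp_continuous_on ballI has_vector_derivative_continuous[OF pol_ray_deriv])

text \<open>On a circle about 0 one has g' = i g, so the level has derivative -Im Z/2, and Im
  \<open>csq\<close> is positive to the right of the line Re z = 2 lam. To the left of it the sign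
  is reversed, whence \<open>arc_left\<close>.\<close>

lemma arc_right:
 assumes "0<r" "0<=a" "a<b" "b<=pi" "2 * lam<=r * cos b"
 shows "lev lam (pol r b)<lev lam (pol r a)"
proof -
 have mono: "r * cos b<r * cos t" if "a<=t" "t<b" for t
  using assms that by (simp add: cos_monotone_0_pi)
 have "levB (csq lam (pol r b)) (pol r b)<levB (csq lam (pol r a)) (pol r a)"
 proof (rule levB_curve_decreasing[OF continuous_csq_right csq_sq _ assms(3) _ pol_continuous(1)])
  show "pol r t\<in>{z\<in>Cplus. 2 * lam<=Re z}" if "t\<in>{a..b}" for t
  proof -
   have "2 * lam<=r * cos t"
   proof (cases "t=b")
    case False
    hence "a<=t" "t<b" using that by auto
    from mono[OF this] assms(5) show ?thesis by linarith
   qed (use assms in simp)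
   thus ?thesis using that assms pol_Cplus[of r t] by simp
  qed
  fix t assume t: "t\<in>{a<..<b}"
  have C: "pol r t\<in>Cplus" using t assms by (intro pol_Cplus) auto
  have y: "0<Im (pol r t)" using t assms sin_gt_zero[of t] by simp
  have "a<=t" "t<b" using t by auto
  from mono[OF this] have x: "2 * lam<Re (pol r t)" unfolding pol_simps using assms(5) by linarith
  have im: "0<Im (csq lam (pol r t))" by (rule Im_csq_right[OF C y x])
  have eq: "csq lam (pol r t)/(2 * pol r t)*(\<i> * pol r t)=\<i> * csq lam (pol r t)/2" using assms by simp
  have "Re (csq lam (pol r t)/(2 * pol r t)*(\<i> * pol r t))<0" unfolding eq using im by simp
  moreover have "csq lam (pol r t)~=0" using im by auto
  ultimately show "csq lam (pol r t)~=0&(pol r has_vector_derivative \<i> * pol r t) (at t)&Re (csq lam (pol r t)/(2 * pol r t)*(\<i> * pol r t))<0"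
   using pol_arc_deriv by blast
 qed auto
 moreover have "pol r a\<in>Cplus" "pol r b\<in>Cplus" using assms by (auto intro!: pol_Cplus)
 ultimately show ?thesis by (simp add: lev_levB)
qed

lemma arc_left:
 assumes "0<r" "0<=a" "a<b" "b<=pi" "r * cos a<=2 * lam"
 shows "levB (csL (pol r a)) (pol r a)<levB (csL (pol r b)) (pol r b)"
proof (rule levB_curve_increasing[OF continuous_csL csL_sq _ assms(3) _ pol_continuous(1)])
 have mono: "r * cos t<r * cos a" if "a<t" "t<=b" for t
  using assms that by (simp add: cos_monotone_0_pi)
 show "pol r t\<in>{z\<in>Cplus. Re z<=2 * lam}" if "t\<in>{a..b}" for t
 proof -
  have "r * cos t<=2 * lam"
  proof (cases "t=a")
   case False
   hence "a<t" "t<=b" using that by auto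
   from mono[OF this] assms(5) show ?thesis by linarith
  qed (use assms in simp)
  thus ?thesis using that assms pol_Cplus[of r t] by simp
 qed
 fix t assume t: "t\<in>{a<..<b}"
 have C: "pol r t\<in>Cplus" using t assms by (intro pol_Cplus) auto
 have y: "0<Im (pol r t)" using t assms sin_gt_zero[of t] by simp
 have "a<t" "t<=b" using t by auto
 from mono[OF this] have x: "Re (pol r t)<2 * lam" unfolding pol_simps using assms(5) by linarith
 have im: "Im (csL (pol r t))<0" using Im_csq_left[OF C y x] csL_csq[OF C] x by simp
 have eq: "csL (pol r t)/(2 * pol r t)*(\<i> * pol r t)=\<i> * csL (pol r t)/2" using assms by simp
 have "0<Re (csL (pol r t)/(2 * pol r t)*(\<i> * pol r t))" unfolding eq using im by simp
 moreover have "csL (pol r t)~=0" using im by auto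
 ultimately show "csL (pol r t)~=0&(pol r has_vector_derivative \<i> * pol r t) (at t)&0<Re (csL (pol r t)/(2 * pol r t)*(\<i> * pol r t))"
  using pol_arc_deriv by blast
qed auto

text \<open>On a ray g' = g/r, so the level has derivative Re Z/(2 r), which is positive for the
  principal root.\<close>

lemma ray_right:
 assumes "0<=th" "th<=pi" "0<r" "r<s" "2 * lam<=r * cos th" "0<cos th"
 shows "lev lam (pol r th)<lev lam (pol s th)"
proof -
 have mono: "r * cos th<t * cos th" if "r<t" for t
  using assms that by simp
 have "levB (csq lam (pol r th)) (pol r th)<levB (csq lam (pol s th)) (pol s th)"
 proof (rule levB_curve_increasing[OF continuous_csq_right csq_sq _ assms(4) _ pol_continuous(2)])
  show "pol t th\<in>{z\<in>Cplus. 2 * lam<=Re z}" if "t\<in>{r..s}" for t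
  proof -
   have "2 * lam<=t * cos th"
   proof (cases "t=r")
    case False
    hence "r<t" using that by auto
    from mono[OF this] assms(5) show ?thesis by linarith
   qed (use assms in simp)
   thus ?thesis using that assms pol_Cplus[of t th] by simp
  qed
  fix t assume t: "t\<in>{r<..<s}"
  hence t0: "0<t" using assms by simp
  have C: "pol t th\<in>Cplus" using t0 assms by (intro pol_Cplus) auto
  have "r<t" using t by auto
  from mono[OF this] have x: "2 * lam<Re (pol t th)" unfolding pol_simps using assms(5) by linarith
  have re: "0<Re (csq lam (pol t th))" by (rule Re_csq_pos[OF C]) (use x in auto)
  have "csq lam (pol t th)/(2 * pol t th) * cis th=csq lam (pol t th)/of_real (2 * t)"
   using t0 by (simp add: pol_def)
  hence "0<Re (csq lam (pol t th)/(2 * pol t th) * cis th)" using re t0 by (simp only: Re_divide_of_real) simp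
  moreover have "csq lam (pol t th)~=0" using re by auto
  ultimately show "csq lam (pol t th)~=0&((%r. pol r th) has_vector_derivative cis th) (at t)&0<Re (csq lam (pol t th)/(2 * pol t th) * cis th)"
   using pol_ray_deriv by blast
 qed auto
 moreover have "pol r th\<in>Cplus" "pol s th\<in>Cplus" using assms by (auto intro!: pol_Cplus)
 ultimately show ?thesis by (simp add: lev_levB)
qed

lemma ray_left:
 assumes "0<=th" "th<=pi" "0<r" "r<s" "r * cos th<2 * lam" "s * cos th<=2 * lam"
 shows "levB (csL (pol r th)) (pol r th)<levB (csL (pol s th)) (pol s th)"
proof (rule levB_curve_increasing[OF continuous_csL csL_sq _ assms(4) _ pol_continuous(2)])
 have lt: "t * cos th<2 * lam" if "r<=t" "t<s" for t
 proof (cases "0<cos th")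
  case True
  hence "t * cos th<s * cos th" using that by simp
  thus ?thesis using assms by linarith
 next
  case False
  hence "t * cos th<=r * cos th" using that by (intro mult_right_mono_neg) auto
  thus ?thesis using assms by linarith
 qed
 show "pol t th\<in>{z\<in>Cplus. Re z<=2 * lam}" if "t\<in>{r..s}" for t
  using lt[of t] that assms pol_Cplus[of t th] by (cases "t=s") auto
 fix t assume t: "t\<in>{r<..<s}"
 hence t0: "0<t" using assms by simp
 have C: "pol t th\<in>Cplus" using t0 assms by (intro pol_Cplus) auto
 have x: "Re (pol t th)<2 * lam" using lt[of t] t by auto
 have re: "0<Re (csL (pol t th))" using Re_csq_pos[OF C] csL_csq[OF C] x by simp
 have "csL (pol t th)/(2 * pol t th) * cis th=csL (pol t th)/of_real (2 * t)"
  using t0 by (simp add: pol_def)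
 hence "0<Re (csL (pol t th)/(2 * pol t th) * cis th)" using re t0 by (simp only: Re_divide_of_real) simp
 moreover have "csL (pol t th)~=0" using re by auto
 ultimately show "csL (pol t th)~=0&((%r. pol r th) has_vector_derivative cis th) (at t)&0<Re (csL (pol t th)/(2 * pol t th) * cis th)"
  using pol_ray_deriv by blast
qed auto

lemma Complex_line_deriv: "(Complex x has_vector_derivative \<i>) (at y)"
proof -
 have "((%y. of_real x+\<i> * of_real y) has_vector_derivative \<i>) (at y)"
  by (auto intro!: derivative_eq_intros)
 moreover have "Complex x=(%y. of_real x+\<i> * of_real y)" by (auto simp: complex_eq_iff)
 ultimately show ?thesis by simp
qed

lemma Complex_line_continuous: "continuous_on A (Complex x)"
 using Complex_line_deriv by (auto intro!: continuous_at_imp_continuous_on dest: has_vector_derivative_continuous)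

lemma Complex_tp: "Complex (2 * lam) yt=tp"
 by (simp add: complex_eq_iff)

text \<open>On this segment Z is positive and Re (i/z) = Im z/|z|^2, so the level increases upwards
  to its value 0 at the turning point.\<close>

lemma lev_line_below:
 assumes z: "z\<in>Cplus" "Re z=2 * lam" "norm z<2"
 shows "lev lam z<0"
proof -
 have y: "0<=Im z" "Im z<yt" and zc: "z=Complex (2 * lam) (Im z)"
  using z norm_on_line by (auto simp: Cplus_def complex_eq_iff)
 have "levB (csq lam (Complex (2 * lam) (Im z))) (Complex (2 * lam) (Im z))<levB (csq lam (Complex (2 * lam) yt)) (Complex (2 * lam) yt)"
 proof (rule levB_curve_increasing[OF continuous_csq_right csq_sq _ y(2) _ Complex_line_continuous])
  show "Complex (2 * lam) t\<in>{z\<in>Cplus. 2 * lam<=Re z}" if "t\<in>{Im z..yt}" for t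
   using that y z zc by (auto simp: Cplus_def complex_eq_iff)
  fix t assume t: "t\<in>{Im z<..<yt}"
  define s where "s=Complex (2 * lam) t"
  have s: "s\<in>Cplus" "norm s<2" "Re s=2 * lam" "Im s=t" "s~=0" using t y norm_on_line[of s] by (auto simp: s_def Cplus_def complex_eq_iff)
  have re: "0<Re (csq lam s)" using Re_csq_pos s by auto
  have "Im (Q s)=0" using s by (simp add: Im_Q)
  hence im: "Im (csq lam s)=0" using arg_cong[OF csq_sq[of s], of Im] re by (simp add: power2_eq_square)
  define a where "a=Re (csq lam s)"
  have e: "csq lam s = of_real a" using im by (simp add: complex_eq_iff a_def)
  have A: "csq lam s/(2 * s)*\<i> = of_real (a/2)*(\<i>/s)" unfolding e by simp
  have B: "Re (of_real (a/2)*(\<i>/s))=a/2 * Re (\<i>/s)" by (simp only: Re_complex_of_real Im_complex_of_real times_complex.simps)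
  have C: "Re (\<i>/s)=t/(norm s)\<^sup>2" using s by (simp add: Re_divide cmod_power2)
  have "Re (csq lam s/(2 * s)*\<i>)=Re (csq lam s) * t/(2*(norm s)\<^sup>2)"
   unfolding A B C a_def[symmetric] by simp
  also have "\<dots> > 0" using re t y s by (intro divide_pos_pos mult_pos_pos) auto
  finally show "csq lam (Complex (2 * lam) t)~=0&(Complex (2 * lam) has_vector_derivative \<i>) (at t)&0<Re (csq lam (Complex (2 * lam) t)/(2 * Complex (2 * lam) t)*\<i>)"
   using Complex_line_deriv re unfolding s_def by auto
 qed auto
 thus ?thesis using zc z lev_levB[OF tp_Cplus] lev_tp by (simp add: Complex_tp lev_levB)
qed

text \<open>On the half-line Z = i b with b > 0, and the level has derivative -b lam/|z|^2 upwards.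
  For lam = 0 it remains 0: the half-line is then the curve gamma_1 itself, a degenerate case that
  recurs below.\<close>

lemma lev_line_above:
 assumes z: "z\<in>Cplus" "Re z=2 * lam" "2<norm z"
 shows "lev lam z<=0" "lev lam z=0\<longleftrightarrow>lam=0"
proof -
 have y: "0<=Im z" "yt<Im z" and zc: "z=Complex (2 * lam) (Im z)"
  using z norm_on_line by (auto simp: Cplus_def complex_eq_iff)
 have neg: "lev lam z<0" if lam: "0<lam"
 proof -
  have "levB (csq lam (Complex (2 * lam) (Im z))) (Complex (2 * lam) (Im z))<levB (csq lam (Complex (2 * lam) yt)) (Complex (2 * lam) yt)"
  proof (rule levB_curve_decreasing[OF continuous_csq_right csq_sq _ y(2) _ Complex_line_continuous])
   show "Complex (2 * lam) t\<in>{z\<in>Cplus. 2 * lam<=Re z}" if "t\<in>{yt..Im z}" for t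
    using that yt by (auto simp: Cplus_def complex_eq_iff)
   fix t assume t: "t\<in>{yt<..<Im z}"
   define s where "s=Complex (2 * lam) t"
   have s: "s\<in>Cplus" "Re s=2 * lam" "Im s=t" "s~=0" using t yt(1) by (auto simp: s_def Cplus_def complex_eq_iff)
   note cut = csq_cut[of s]
   define b where "b=Im (csq lam s)"
   have b: "0<b" "csq lam s=\<i> * of_real b" using cut s t by (auto simp: b_def)
   have "\<i> * x*\<i> = - x" for x by (simp add: complex_eq_iff)
   hence "csq lam s/(2 * s)*\<i> = - of_real b/(2 * s)" unfolding b(2) by simp
   also have "Re (- of_real b/(2 * s)) = - (b * lam/(norm s)\<^sup>2)"
    using s by (simp add: Re_divide cmod_power2) (simp add: power2_eq_square divide_simps)
   also have "\<dots><0" using b lam s by (simp add: divide_pos_pos)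
   finally show "csq lam (Complex (2 * lam) t)~=0&(Complex (2 * lam) has_vector_derivative \<i>) (at t)&Re (csq lam (Complex (2 * lam) t)/(2 * Complex (2 * lam) t)*\<i>)<0"
    using Complex_line_deriv b unfolding s_def by auto
  qed auto
  thus ?thesis using zc z lev_levB[OF tp_Cplus] lev_tp by (simp add: Complex_tp lev_levB)
 qed
 have zero: "lev lam z=0" if lam: "lam=0"
 proof -
  define b where "b=Im (csq lam z)"
  have b: "0<b" "csq lam z=\<i> * of_real b" using csq_cut[of z] z y by (auto simp: b_def)
  have z': "z=\<i> * of_real (Im z)" using zc lam by (simp add: complex_eq_iff)
  have "(csq lam z)^2=Q z" by (rule csq_sq)
  hence "complex_of_real (- (b^2)) = of_real (4-(Im z)\<^sup>2)" unfolding b(2)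
   by (subst (asm) z') (simp add: Zsq_def lam power_mult_distrib)
  hence bb: "4 + b^2=(Im z)\<^sup>2" unfolding of_real_eq_iff by simp
  \<comment> \<open>Since |Z + 2|^2 = 4 + b^2 = |z|^2, the logarithm left in xi has an argument of
    modulus 1 and Re xi is 0.\<close>
  have "norm (csq lam z+2)=Im z"
  proof -
   have "(norm (csq lam z+2))\<^sup>2=(Im z)\<^sup>2" unfolding b(2) cmod_power2 using bb by simp
   thus ?thesis using y(1) power2_eq_iff_nonneg[of "norm (csq lam z+2)" "Im z"] by simp
  qed
  moreover have "norm z=Im z" using z' y(1) by (metis abs_of_nonneg norm_ii norm_mult norm_of_real mult_1)
  moreover have "csq lam z+2~=0" using b by (auto simp: complex_eq_iff)
  moreover have "z~=0" "0<Im z" using z y yt(1) by (auto simp: Cplus_def)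
  ultimately have "Re (Ln ((csq lam z+2)/z))=0" by (simp add: Re_Ln norm_divide)
  hence "Re (xi_formula lam (csq lam z) z)=0" 
   unfolding xi_formula_def lam using b(2)[unfolded lam] by simp
  moreover have "Re (xi_formula lam 0 tp)=0" unfolding Re_xi_tp by (simp add: lam)
  ultimately show ?thesis by (simp add: lev_def)
 qed
 show "lev lam z<=0" "lev lam z=0\<longleftrightarrow>lam=0" using neg zero lam0 by fastforce+
qed

end

section \<open>The three regions\<close>

lemma connected_glue:
 assumes "connected B" "B\<subseteq>A" "!!z. z\<in>A==>\<exists>C. connected C&C\<subseteq>A&z\<in>C&C\<inter>B~={}"
 shows "connected A"
proof (cases "A={}")
 case False
 from assms(3) obtain C where C: "!!z. z\<in>A==>connected (C z)&C z\<subseteq>A&z\<in>C z&C z\<inter>B~={}" by metis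
 hence B: "B~={}" using False by blast
 have "connected (\<Union>((%z. C z\<union>B) ` A))"
 proof (rule connected_Union)
  show "connected s" if "s\<in>(%z. C z\<union>B) ` A" for s using that C assms(1) by (auto intro!: connected_Un)
  show "\<Inter> ((%z. C z\<union>B) ` A)~={}" using B by auto
 qed
 moreover have "\<Union>((%z. C z\<union>B) ` A)=A" using C assms(2) False by blast
 ultimately show ?thesis by simp
qed simp

lemma component_clopen:
 assumes A: "openin (top_of_set U) A" "openin (top_of_set U) (U - A)" "connected A" "A~={}"
  and C: "C\<in>components U"
 shows "C\<inter>A~={}\<longleftrightarrow>C=A"
proof
 assume CA: "C\<inter>A~={}"
 have AU: "A\<subseteq>U" using A(1) openin_imp_subset by blast
 have CU: "C\<subseteq>U" "connected C" using C in_components_subset in_components_connected by blast+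
 have "openin (top_of_set C) (C\<inter>A)" "openin (top_of_set C) (C\<inter>(U - A))"
  using A(1,2) CU openin_subtopology_Int_subset by (metis inf.commute openin_subtopology_Int2 openin_open_Int openin_subtopology subtopology_subtopology inf.absorb_iff2 Int_commute)+
 hence "C\<inter>(U - A)={}"
  using CU CA unfolding connected_openin by blast
 hence "C\<subseteq>A" using CU by blast
 moreover have "A\<subseteq>C" using C A(3) AU CA components_maximal by (metis Int_commute)
 ultimately show "C=A" by blast
qed (use A in auto)

lemma in_closure_curve:
 fixes g :: "real=>'a::metric_space"
 assumes g: "isCont g t0" and A: "!!e. 0<e==>\<exists>t. \<bar>t - t0\<bar><e&g t\<in>A"
 shows "g t0\<in>closure A"
 unfolding closure_approachable
proof (intro allI impI)
 fix e :: real assume "0<e"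
 then obtain d where d: "0<d" "!!t. dist t t0<d==>dist (g t) (g t0)<e"
  using g unfolding continuous_at_eps_delta by blast
 from A[OF d(1)] obtain t where t: "\<bar>t - t0\<bar><d" "g t\<in>A" by blast
 thus "\<exists>y\<in>A. dist y (g t0)<e" using d(2)[of t] by (auto simp: dist_real_def)
qed

context lam_range
begin

lemma isCont_pol: "isCont (pol r) t" "isCont (%r. pol r th) r"
 using has_vector_derivative_continuous[OF pol_arc_deriv] has_vector_derivative_continuous[OF pol_ray_deriv] by auto

definition th0 :: real where "th0=arccos lam"

lemma th0: "0<th0" "th0<=pi/2" "cos th0=lam" "pol 2 th0=tp"
proof -
 show c: "cos th0=lam" unfolding th0_def using lam0 lam1 by simp
 show "0<th0" unfolding th0_def using arccos_lt_bounded[of lam] lam0 lam1 by simp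
 show "th0<=pi/2" unfolding th0_def using lam0 lam1 by (intro arccos_le_pi2) auto
 have "sin th0=sqrt (1 - lam\<^sup>2)" unfolding th0_def using lam0 lam1 by (intro sin_arccos) auto
 thus "pol 2 th0=tp" using c by (simp add: complex_eq_iff yt_def)
qed

lemma csL_tp: "levB (csL tp) tp=0"
 using lev_levB[OF tp_Cplus] lev_tp by (simp add: csL_def csq_def Q_tp)

lemma lev_csL: "z\<in>Cplus==>Re z~=2 * lam\<or>norm z<2==>levB (csL z) z=lev lam z"
 by (simp add: lev_levB csL_csq)

text \<open>The circle |z| = 2 passes through the turning point, and the level rises along both arcs
  leading away from it. So the circle separates gamma_1 from the other two curves except for their
  common end point.\<close>

lemma lev_circle:
 assumes z: "z\<in>Cplus" "norm z=2" "z~=tp"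
 shows "0<lev lam z"
proof -
 obtain th where t: "0<=th" "th<=pi" "z=pol 2 th" using polar[OF z(1)] z(2) by metis
 hence "th~=th0" using z th0 by auto
 then consider "th<th0" | "th0<th" by linarith
 thus ?thesis
 proof cases
  case 1
  thus ?thesis using arc_right[of 2 th th0] t th0 pi_gt_zero lev_tp by simp
 next
  case 2
  hence "levB (csL tp) tp<levB (csL z) z" using arc_left[of 2 th0 th] t th0 by simp
  moreover have "cos th<cos th0" using 2 t th0 by (intro cos_monotone_0_pi) auto
  hence "Re z<2 * lam" using t th0 by simp
  ultimately show ?thesis using lev_csL[OF z(1)] csL_tp by simp
 qed
qed

lemma line_angle:
 assumes "2 * lam<=r" "0<r"
 obtains b where "0<=b" "b<=pi/2" "r * cos b=2 * lam"
proof
 have d: "0<=2 * lam/r" "2 * lam/r<=1" using assms lam0 by auto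
 show "0<=arccos (2 * lam/r)" using d by (intro arccos_lbound) auto
 show "arccos (2 * lam/r)<=pi/2" using d by (intro arccos_le_pi2) auto
 have "cos (arccos (2 * lam/r))=2 * lam/r" using d by (intro cos_arccos) auto
 thus "r * cos (arccos (2 * lam/r))=2 * lam" using assms by simp
qed

lemma cos_less_iff_angle: "0<=a==>a<=pi==>0<=b==>b<=pi==>0<r==>r * cos a<r * cos b\<longleftrightarrow>b<a"
 by (simp add: cos_mono_less_eq)

lemma cos_le_iff_angle: "0<=a==>a<=pi==>0<=b==>b<=pi==>0<r==>r * cos a<=r * cos b\<longleftrightarrow>b<=a"
 by (simp add: cos_mono_le_eq)

text \<open>A circle of radius greater than 2 meets the vertical half-line, where \<open>csL\<close>
  = -\<open>csq\<close> has a nonnegative level; from there on \<open>arc_left\<close> increases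
  it.\<close>

lemma lev_outside_left:
 assumes z: "z\<in>Cplus" "2<norm z" "Re z<2 * lam"
 shows "0<lev lam z"
proof -
 define r where "r=norm z"
 obtain th where t: "0<=th" "th<=pi" "z=pol r th" using polar[OF z(1)] unfolding r_def by metis
 have r: "2<r" "2 * lam<=r" using z lam1 by (auto simp: r_def)
 obtain b where b: "0<=b" "b<=pi/2" "r * cos b=2 * lam" using line_angle[of r] r by auto
 have bt: "b<th" using cos_less_iff_angle[of th b r] t b r z by auto
 define p where "p=pol r b"
 have p: "p\<in>Cplus" "Re p=2 * lam" "2<norm p" using b r pol_Cplus[of r b] by (auto simp: p_def)
 have "yt<Im p" using norm_on_line[of p] p by (auto simp: Cplus_def)
 hence "levB (csL p) p = - lev lam p"
  using csq_cut(3)[OF p(2)] levB_uminus[OF csq_sq p(1)] lev_levB[OF p(1)] by simp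
 hence "0<=levB (csL p) p" using lev_line_above[OF p] by simp
 also have "\<dots><levB (csL z) z" unfolding p_def t(3) by (rule arc_left) (use r b bt t in auto)
 finally show ?thesis using lev_csL[OF z(1)] z by simp
qed

lemma of_real_pol: "complex_of_real x=pol x 0" "complex_of_real (- x)=pol x pi"
 by (auto simp: pol_def)

lemma of_real_Cplus: "x~=0==>complex_of_real x\<in>Cplus"
 by (simp add: Cplus_def)

lemma lev_real_ge_2: "2<=x==>0<lev lam (of_real x)"
proof -
 assume x: "2<=x"
 have 2: "0<lev lam (of_real 2)"
  by (rule lev_circle) (use yt in "auto simp: Cplus_def complex_eq_iff")
 show ?thesis
 proof (cases "x=2")
  case False
  hence "lev lam (of_real 2)<lev lam (of_real x)" unfolding of_real_pol
   by (intro ray_right) (use x lam1 in auto)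
  thus ?thesis using 2 by linarith
 qed (use 2 in simp)
qed

text \<open>These sets will turn out to be S_{-1}, S_0 and S_1. They are described by the sign of
  the level and by the side of the jump of \<open>csq\<close>. For lam > 0 the jump line runs
  through \<open>RC\<close>, so this region consists of two pieces with opposite signs of
  \<open>lev\<close>.\<close>

definition RA :: "complex set" where "RA={z\<in>Cplus. norm z<2&lev lam z<0}"
definition RB :: "complex set" where "RB={z\<in>Cplus. 2 * lam<Re z&0<lev lam z}"
definition RC :: "complex set" where
 "RC={z\<in>Cplus. (Re z<2 * lam&0<lev lam z)\<or>(2 * lam<=Re z&2<norm z&lev lam z<0)}"

lemma region_cases:
 assumes z: "z\<in>Cplus" "lev lam z~=0"
 shows "z\<in>RA\<or>z\<in>RB\<or>z\<in>RC"
proof -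
 have "z~=tp" using z lev_tp by auto
 consider "2 * lam<Re z" | "Re z<2 * lam" | "Re z=2 * lam" by linarith
 thus ?thesis
 proof cases
  case 1
  thus ?thesis using z lev_circle[OF z(1) _ \<open>z \<noteq> tp\<close>]
   unfolding RA_def RB_def RC_def by (cases "0<lev lam z"; cases "norm z<2"; cases "norm z=2") auto
 next
  case 2
  thus ?thesis using z lev_circle[OF z(1) _ \<open>z \<noteq> tp\<close>] lev_outside_left[OF z(1)]
   unfolding RA_def RB_def RC_def by (cases "0<lev lam z"; cases "norm z<2"; cases "norm z=2") auto
 next
  case 3
  have "norm z~=2"
  proof
   assume "norm z=2"
   hence "Im z=yt" using norm_on_line[OF 3] z by (auto simp: Cplus_def)
   thus False using 3 \<open>z \<noteq> tp\<close> by (simp add: complex_eq_iff)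
  qed
  thus ?thesis using lev_line_below[OF z(1) 3] lev_line_above(1)[OF z(1) 3] z 3
   unfolding RA_def RB_def RC_def by (cases "norm z<2") auto
 qed
qed

lemma region_union: "RA\<union>RB\<union>RC=Cplus - level_set lam"
 using region_cases unfolding level_set_lev by (auto simp: RA_def RB_def RC_def)

lemma region_disjoint: "RA\<inter>RB={}" "RA\<inter>RC={}" "RB\<inter>RC={}"
 by (auto simp: RA_def RB_def RC_def)

lemma continuous_csqrt_slit: "continuous_on (- \<real>\<^sub>\<le>\<^sub>0) csqrt"
 by (intro continuous_at_imp_continuous_on ballI continuous_at_csqrt) auto

lemma continuous_Q: "continuous_on S Q"
 unfolding Zsq_def by (intro continuous_intros)

lemma continuous_csq_slit: "continuous_on {z\<in>Cplus. Re z~=2 * lam\<or>norm z<2} (csq lam)"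
 unfolding csq_def by (rule continuous_on_compose2[OF continuous_csqrt_slit continuous_Q]) (auto dest: Q_slit)

text \<open>The root that is continuous across the vertical half-line, because -Q avoids the cut of
  \<open>csqrt\<close> in the part of the half plane outside |z| = 2.\<close>

definition icsq :: "complex=>complex" where "icsq z=\<i> * csqrt (- Q z)"

lemma icsq_sq: "icsq z^2=Q z"
 by (simp add: icsq_def power_mult_distrib)

lemma top_slit: "z\<in>Cplus==>0<Im z==>2<norm z==>- Q z\<notin>\<real>\<^sub>\<le>\<^sub>0"
proof
 assume z: "z\<in>Cplus" "0<Im z" "2<norm z" and "- Q z\<in>\<real>\<^sub>\<le>\<^sub>0"
 hence 1: "0<=Re (Q z)" "Im (Q z)=0" by (auto simp: complex_nonpos_Reals_iff)
 hence R: "Re z=2 * lam" using z by (auto simp: Im_Q)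
 hence "(Im z)\<^sup>2<=yt\<^sup>2" using 1 unfolding Re_Q yt(2) by (simp add: power2_eq_square algebra_simps)
 hence "Im z<=yt" by (rule power2_le_imp_le) (use yt(1) in simp)
 thus False using norm_on_line(2)[OF R] z by auto
qed

lemma continuous_icsq: "continuous_on {z\<in>Cplus. 0<Im z&2<norm z} icsq"
 unfolding icsq_def
 by (intro continuous_on_mult continuous_on_const continuous_on_compose2[OF continuous_csqrt_slit]
   continuous_on_minus continuous_Q) (auto dest: top_slit)

lemma icsq_right: "z\<in>Cplus==>0<Im z==>2<norm z==>2 * lam<=Re z==>icsq z=csq lam z"
proof -
 assume z: "z\<in>Cplus" "0<Im z" "2<norm z" "2 * lam<=Re z"
 have "Im (- Q z)<0\<or>(Im (- Q z)=0&0<=Re (- Q z))"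
 proof (cases "Re z=2 * lam")
  case True
  hence "yt<Im z" using norm_on_line(2) z by auto
  hence "yt\<^sup>2<(Im z)\<^sup>2" using yt(1) by (intro power_strict_mono) auto
  moreover have "Re (Q z)=yt\<^sup>2-(Im z)\<^sup>2" unfolding Re_Q yt(2) using True by (simp add: power2_eq_square algebra_simps)
  ultimately show ?thesis using True by (simp add: Im_Q)
 qed (use z in "auto simp: Im_Q")
 from csqrt_minus[OF this] show ?thesis by (simp add: icsq_def csq_def)
qed

lemma icsq_left: "z\<in>Cplus==>0<Im z==>2<norm z==>Re z<2 * lam==>icsq z = - csq lam z"
proof -
 assume z: "z\<in>Cplus" "0<Im z" "2<norm z" "Re z<2 * lam"
 have "Im (Q z)<0" using z by (simp add: Im_Q mult_pos_neg)
 hence "csqrt (- Q z)=\<i> * csqrt (Q z)" by (intro csqrt_minus) auto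
 thus ?thesis by (simp add: icsq_def csq_def flip: mult.assoc)
qed

lemma openin_lev:
 assumes "continuous_on S Z" "!!t. t\<in>S==>Z t^2=Q t" "S=Cplus\<inter>T" "open T" "open I"
 shows "openin (top_of_set Cplus) {z\<in>S. levB (Z z) z\<in>I}"
proof -
 have "openin (top_of_set S) (S\<inter>(%z. levB (Z z) z) -` I)"
  using levB_continuous[OF assms(1,2)] assms(3,5) by (intro continuous_openin_preimage_gen) auto
 moreover have "openin (top_of_set Cplus) S" unfolding assms(3) using assms(4) by (rule openin_open_Int)
 ultimately have "openin (top_of_set Cplus) (S\<inter>(%z. levB (Z z) z) -` I)" by (rule openin_trans)
 thus ?thesis by (simp add: Int_def vimage_def)
qed

lemma open_parts: "open {z. norm z<(r::real)}" "open {z. r<norm z}" "open {z. r<Re z}" "open {z. Re z<r}" "open {z. r<Im z}"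
 by (intro open_Collect_less continuous_intros)+

text \<open>For \<open>RC\<close> the two signs of \<open>lev\<close> are reconciled by
  \<open>icsq\<close>, relative to which the level is negative on both sides of the
  half-line.\<close>

lemma region_open: "openin (top_of_set Cplus) RA" "openin (top_of_set Cplus) RB" "openin (top_of_set Cplus) RC"
proof -
 have "openin (top_of_set Cplus) {z\<in>{z\<in>Cplus. norm z<2}. levB (csq lam z) z\<in>{..<0}}"
  by (rule openin_lev[OF continuous_on_subset[OF continuous_csq_slit] csq_sq, where T = "{z. norm z<2}"])
    (auto simp: open_parts)
 moreover have "{z\<in>{z\<in>Cplus. norm z<2}. levB (csq lam z) z\<in>{..<0}}=RA"
  by (auto simp: RA_def lev_levB)
 ultimately show "openin (top_of_set Cplus) RA" by simp
 have "openin (top_of_set Cplus) {z\<in>{z\<in>Cplus. 2 * lam<Re z}. levB (csq lam z) z\<in>{0<..}}"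
  by (rule openin_lev[OF continuous_on_subset[OF continuous_csq_slit] csq_sq, where T = "{z. 2 * lam<Re z}"])
    (auto simp: open_parts)
 moreover have "{z\<in>{z\<in>Cplus. 2 * lam<Re z}. levB (csq lam z) z\<in>{0<..}}=RB"
  by (auto simp: RB_def lev_levB)
 ultimately show "openin (top_of_set Cplus) RB" by simp
 have 1: "openin (top_of_set Cplus) {z\<in>{z\<in>Cplus. Re z<2 * lam}. levB (csq lam z) z\<in>{0<..}}"
  by (rule openin_lev[OF continuous_on_subset[OF continuous_csq_slit] csq_sq, where T = "{z. Re z<2 * lam}"])
    (auto simp: open_parts)
 have 2: "openin (top_of_set Cplus) {z\<in>{z\<in>Cplus. 0<Im z&2<norm z}. levB (icsq z) z\<in>{..<0}}"
  by (rule openin_lev[OF continuous_icsq icsq_sq, where T = "{z. 0<Im z}\<inter>{z. 2<norm z}"])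
    (auto intro!: open_Int simp: open_parts)
 have "{z\<in>{z\<in>Cplus. Re z<2 * lam}. levB (csq lam z) z\<in>{0<..}} \<union>
   {z\<in>{z\<in>Cplus. 0<Im z&2<norm z}. levB (icsq z) z\<in>{..<0}}=RC" (is "?A\<union>?B=_")
 proof
  have "?B\<subseteq>RC"
  proof
   fix z assume "z\<in>?B"
   hence z: "z\<in>Cplus" "0<Im z" "2<norm z" "levB (icsq z) z<0" by auto
   show "z\<in>RC"
   proof (cases "2 * lam<=Re z")
    case True
    thus ?thesis using z icsq_right[OF z(1-3)] by (auto simp: RC_def lev_levB)
   next
    case False
    thus ?thesis using z icsq_left[OF z(1-3)] levB_uminus[OF csq_sq z(1)] by (auto simp: RC_def lev_levB)
   qed
  qed
  moreover have "?A\<subseteq>RC" by (auto simp: RC_def lev_levB)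
  ultimately show "?A\<union>?B\<subseteq>RC" by blast
  show "RC\<subseteq>?A\<union>?B"
  proof
   fix z assume z: "z\<in>RC"
   hence zC: "z\<in>Cplus" by (simp add: RC_def)
   show "z\<in>?A\<union>?B"
   proof (cases "Re z<2 * lam")
    case False
    hence z': "2 * lam<=Re z" "2<norm z" "lev lam z<0" using z by (auto simp: RC_def)
    have "Im z~=0"
    proof
    assume "Im z=0"
    hence zr: "z = of_real (Re z)" by (simp add: complex_eq_iff)
    hence "2<\<bar>Re z\<bar>" using z'(2) by (metis norm_of_real)
    thus False using lev_real_ge_2[of "Re z"] zr z' lam0 by auto
    qed
    hence "0<Im z" using zC by (simp add: Cplus_def)
    thus ?thesis using z' zC icsq_right by (simp add: lev_levB)
   qed (use z in "auto simp: RC_def lev_levB")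
  qed
 qed
 thus "openin (top_of_set Cplus) RC" using openin_Un[OF 1 2] by simp
qed

lemma connected_arc: "connected (pol r ` {a..b})"
 by (rule connected_continuous_image[OF pol_continuous(1)]) simp

text \<open>Moving along a circle towards the positive axis increases the level, so the arc stays in
  the region. On the axis the region is an interval by \<open>ray_right\<close>.\<close>

lemma connected_RB: "connected RB"
proof (rule connected_glue)
 let ?I = "{x. 2 * lam<x&0<lev lam (of_real x)}"
 have "is_interval ?I"
  unfolding is_interval_1
 proof (intro allI impI ballI)
  fix a b x assume a: "a\<in>?I" and "b\<in>?I" and x: "a<=x&x<=b"
  show "x\<in>?I"
  proof (cases "x=a")
   case False
   hence "lev lam (of_real a)<lev lam (of_real x)" unfolding of_real_pol
    by (intro ray_right) (use a x lam0 in auto)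
   thus ?thesis using a x by auto
  qed (use a in simp)
 qed
 thus "connected (complex_of_real ` ?I)"
  by (intro connected_continuous_image continuous_intros) (simp add: is_interval_connected_1)
 show "complex_of_real ` ?I\<subseteq>RB" using lam0 by (auto simp: RB_def Cplus_def)
 fix z assume z: "z\<in>RB"
 hence zC: "z\<in>Cplus" by (simp add: RB_def)
 define r where "r=norm z"
 obtain th where t: "0<=th" "th<=pi" "z=pol r th" "0<r" using polar[OF zC] unfolding r_def by metis
 have "pol r s\<in>RB" if s: "0<=s" "s<=th" for s
 proof (cases "s=th")
  case False
  hence "lev lam (pol r th)<lev lam (pol r s)"
   using arc_right[of r s th] z s t by (auto simp: RB_def)
  moreover have "r * cos th<=r * cos s" using cos_le_iff_angle[of th s r] s t by auto
  moreover have "pol r s\<in>Cplus" using s t by (intro pol_Cplus) auto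
  moreover have "2 * lam<r * cos th" "0<lev lam (pol r th)" using z t by (auto simp: RB_def)
  ultimately have "2 * lam<r * cos s" "0<lev lam (pol r s)" "pol r s\<in>Cplus" by linarith+
  thus ?thesis unfolding RB_def by simp
 qed (use z t in simp)
 hence sub: "pol r ` {0..th}\<subseteq>RB" by auto
 moreover have "z\<in>pol r ` {0..th}" using t by auto
 moreover have "pol r 0\<in>pol r ` {0..th}\<inter>complex_of_real ` ?I"
 proof -
  have "pol r 0\<in>pol r ` {0..th}" using t by auto
  moreover have "pol r 0\<in>RB" using sub t by auto
  hence "r\<in>?I" by (simp add: RB_def of_real_pol)
  ultimately show ?thesis by (auto simp: of_real_pol)
 qed
 ultimately show "\<exists>C. connected C&C\<subseteq>RB&z\<in>C&C\<inter>complex_of_real ` ?I~={}"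
  using connected_arc by blast
qed

text \<open>Here the arcs run to the negative axis. An arc starting to the right of the line passes
  from the piece with negative \<open>lev\<close> to the one with positive
  \<open>lev\<close>.\<close>

lemma connected_RC: "connected RC"
proof (rule connected_glue)
 let ?I = "{x. x<0&0<lev lam (of_real x)}"
 have "is_interval ?I"
  unfolding is_interval_1
 proof (intro allI impI ballI)
  fix a b x assume a: "a\<in>?I" and b: "b\<in>?I" and x: "a<=x&x<=b"
  show "x\<in>?I"
  proof (cases "x=b")
   case False
   have "levB (csL (pol (- b) pi)) (pol (- b) pi)<levB (csL (pol (- x) pi)) (pol (- x) pi)"
    by (rule ray_left) (use False b x lam0 in auto)
   moreover have "levB (csL (of_real y)) (of_real y)=lev lam (of_real y)" if "y<0" for y
    using that lam0 by (intro lev_csL) (auto simp: Cplus_def)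
   ultimately show ?thesis using b x False by (simp flip: of_real_pol)
  qed (use b in simp)
 qed
 thus "connected (complex_of_real ` ?I)"
  by (intro connected_continuous_image continuous_intros) (simp add: is_interval_connected_1)
 show "complex_of_real ` ?I\<subseteq>RC" using lam0 by (auto simp: RC_def Cplus_def)
 fix z assume z: "z\<in>RC"
 hence zC: "z\<in>Cplus" by (simp add: RC_def)
 define r where "r=norm z"
 obtain th where t: "0<=th" "th<=pi" "z=pol r th" "0<r" using polar[OF zC] unfolding r_def by metis
 have "pol r s\<in>RC" if s: "th<=s" "s<=pi" for s
 proof (cases "s=th")
  case False
  have sC: "pol r s\<in>Cplus" using s t by (intro pol_Cplus) auto
  have dec: "r * cos s<r * cos th" using cos_less_iff_angle[of s th r] s t False by auto
  show ?thesis
  proof (cases "Re z<2 * lam")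
   case True
   have "levB (csL (pol r th)) (pol r th)<levB (csL (pol r s)) (pol r s)"
    using arc_left[of r th s] s t False True by auto
   moreover have "r * cos th<2 * lam" using True t by simp
   hence "Re (pol r s)<2 * lam" using dec unfolding pol_simps by linarith
   ultimately show ?thesis using z lev_csL[OF zC] lev_csL[OF sC] True t sC by (auto simp: RC_def)
  next
   case zr: False
   hence z': "2<r" "lev lam z<0" using z by (auto simp: RC_def r_def)
   show ?thesis
   proof (cases "Re (pol r s)<2 * lam")
    case True
    hence "0<lev lam (pol r s)" by (intro lev_outside_left sC) (use z' in auto)
    thus ?thesis using True sC by (auto simp: RC_def)
   next
    case False
    hence "lev lam (pol r s)<lev lam (pol r th)"
    by (intro arc_right) (use s t \<open>s \<noteq> th\<close> in auto)
    thus ?thesis using False sC z' t by (auto simp: RC_def)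
   qed
  qed
 qed (use z t in simp)
 hence sub: "pol r ` {th..pi}\<subseteq>RC" by auto
 moreover have "z\<in>pol r ` {th..pi}" using t by auto
 moreover have "pol r pi\<in>pol r ` {th..pi}\<inter>complex_of_real ` ?I"
 proof -
  have "pol r pi\<in>pol r ` {th..pi}" using t by auto
  moreover have "pol r pi\<in>RC" using sub t by auto
  hence "- r\<in>?I" using t lam0 unfolding of_real_pol(2)[symmetric] by (auto simp: RC_def)
  hence "pol r pi\<in>complex_of_real ` ?I" unfolding of_real_pol(2)[symmetric] by blast
  ultimately show ?thesis by blast
 qed
 ultimately show "\<exists>C. connected C&C\<subseteq>RC&z\<in>C&C\<inter>complex_of_real ` ?I~={}"
  using connected_arc by blast
qed

lemma lev_real_small:
 assumes "0<x" "x<=2 * lam"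
 shows "lev lam (of_real x)<0"
proof -
 have l: "lev lam (of_real (2 * lam))<0"
  by (rule lev_line_below) (use assms lam1 in "auto simp: Cplus_def")
 show ?thesis
 proof (cases "x=2 * lam")
  case False
  have "levB (csL (pol x 0)) (pol x 0)<levB (csL (pol (2 * lam) 0)) (pol (2 * lam) 0)"
   by (rule ray_left) (use False assms in auto)
  moreover have "levB (csL (of_real y)) (of_real y)=lev lam (of_real y)" if "0<y" "y<=2 * lam" for y
   using that lam1 by (intro lev_csL) (auto simp: Cplus_def)
  ultimately show ?thesis using l assms by (simp flip: of_real_pol del: of_real_mult of_real_numeral)
 qed (use l in simp)
qed

text \<open>A circle that meets the line Re z = 2 lam leads to the vertical segment below the
  turning point. A smaller circle leads to the real interval up to 2 lam. Both lie in the region and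
  meet at 2 lam.\<close>

lemma connected_RA: "connected RA"
proof (rule connected_glue)
 \<comment> \<open>For lam = 0 the lower end of the segment is 0, which is not in
   \<open>Cplus\<close>; hence the extra condition on y = 0.\<close>
 define J where "J={y. 0<=y&y<yt&(0<lam\<or>0<y)}"
 let ?V = "Complex (2 * lam) ` J" and ?H = "complex_of_real ` {0<..2 * lam}"
 have J: "J=(if 0<lam then {0..<yt} else {0<..<yt})" by (auto simp: J_def)
 have cV: "connected ?V" by (rule connected_continuous_image[OF Complex_line_continuous]) (auto simp: J)
 have cH: "connected ?H" by (rule connected_continuous_image) (auto intro!: continuous_intros)
 show "connected (?V\<union>?H)"
 proof (cases "0<lam")
  case True
  have "complex_of_real (2 * lam)\<in>?V" using True yt by (auto simp: J_def complex_eq_iff intro!: image_eqI[of _ _ 0])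
  moreover have "complex_of_real (2 * lam)\<in>?H" using True by (intro imageI) auto
  ultimately show ?thesis using cV cH by (intro connected_Un) blast+
 next
  case False
  hence "?H={}" by auto
  thus ?thesis using cV by simp
 qed
 have V: "?V={z\<in>Cplus. Re z=2 * lam&norm z<2}"
 proof -
  have "z\<in>?V" if z: "z\<in>Cplus" "Re z=2 * lam" "norm z<2" for z
  proof -
   have "Im z\<in>J" using z norm_on_line[of z] lam0 by (auto simp: J_def Cplus_def complex_eq_iff)
   moreover have "z=Complex (2 * lam) (Im z)" using z by (simp add: complex_eq_iff)
   ultimately show ?thesis by blast
  qed
  moreover have "Complex (2 * lam) y\<in>{z\<in>Cplus. Re z=2 * lam&norm z<2}" if "y\<in>J" for y
   using that norm_on_line[of "Complex (2 * lam) y"] by (auto simp: J_def Cplus_def complex_eq_iff)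
  ultimately show ?thesis by blast
 qed
 show "?V\<union>?H\<subseteq>RA"
  using lev_line_below lev_real_small lam1 unfolding V by (auto simp: RA_def Cplus_def)
 fix z assume z: "z\<in>RA"
 hence zC: "z\<in>Cplus" by (simp add: RA_def)
 define r where "r=norm z"
 obtain th where t: "0<=th" "th<=pi" "z=pol r th" "0<r" using polar[OF zC] unfolding r_def by metis
 have r2: "r<2" "lev lam z<0" using z by (auto simp: RA_def r_def)
 have left: "pol r s\<in>RA" if s: "0<=s" "s<=th" "r * cos s<=2 * lam" for s
 proof (cases "s=th")
  case False
  have sC: "pol r s\<in>Cplus" using s t by (intro pol_Cplus) auto
  have "levB (csL (pol r s)) (pol r s)<levB (csL (pol r th)) (pol r th)"
   by (rule arc_left) (use s t False in auto)
  thus ?thesis using lev_csL[OF sC] lev_csL[OF zC] r2 t sC by (auto simp: RA_def)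
 qed (use z t in simp)
 have right: "pol r s\<in>RA" if s: "th<=s" "s<=pi" "2 * lam<=r * cos s" for s
 proof (cases "s=th")
  case False
  have sC: "pol r s\<in>Cplus" using s t by (intro pol_Cplus) auto
  have "lev lam (pol r s)<lev lam (pol r th)"
   by (rule arc_right) (use s t False in auto)
  thus ?thesis using r2 t sC by (auto simp: RA_def)
 qed (use z t in simp)
 show "\<exists>C. connected C&C\<subseteq>RA&z\<in>C&C\<inter>(?V\<union>?H)~={}"
 proof (cases "2 * lam<=r")
  case True
  obtain b where b: "0<=b" "b<=pi/2" "r * cos b=2 * lam" using line_angle[OF True t(4)] by auto
  have bV: "pol r b\<in>?V" unfolding V using b t r2 pol_Cplus[of r b] by auto
  show ?thesis
  proof (cases "th<=b")
   case True
   have "pol r ` {th..b}\<subseteq>RA"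
   proof
    fix x assume "x\<in>pol r ` {th..b}"
    then obtain s where s: "th<=s" "s<=b" "x=pol r s" by auto
    hence "r * cos b<=r * cos s" using cos_le_iff_angle[of b s r] b t by auto
    thus "x\<in>RA" using right[of s] s b by auto
   qed
   moreover have "z\<in>pol r ` {th..b}" "pol r b\<in>pol r ` {th..b}" using t True by auto
   ultimately show ?thesis using bV connected_arc by blast
  next
   case False
   have "pol r ` {b..th}\<subseteq>RA"
   proof
    fix x assume "x\<in>pol r ` {b..th}"
    then obtain s where s: "b<=s" "s<=th" "x=pol r s" by auto
    hence "r * cos s<=r * cos b" using cos_le_iff_angle[of s b r] b t by auto
    thus "x\<in>RA" using left[of s] s b by auto
   qed
   moreover have "z\<in>pol r ` {b..th}" "pol r b\<in>pol r ` {b..th}" using t False by auto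
   ultimately show ?thesis using bV connected_arc by blast
  qed
 next
  case False
  have "pol r ` {0..th}\<subseteq>RA"
  proof
   fix x assume "x\<in>pol r ` {0..th}"
   then obtain s where s: "0<=s" "s<=th" "x=pol r s" by auto
   have "r * cos s<=r*1" using t by (intro mult_left_mono) auto
   thus "x\<in>RA" using left[of s] s False by auto
  qed
  moreover have "z\<in>pol r ` {0..th}" "pol r 0\<in>pol r ` {0..th}" using t by auto
  moreover have "pol r 0\<in>?H" unfolding of_real_pol(1)[symmetric] using False t by auto
  ultimately show ?thesis using connected_arc by blast
 qed
qed

end

lemma continuous_within_local:
 assumes g: "continuous (at z within T) g" and U: "open U" "z\<in>U"
  and eq: "!!t. t\<in>U==>t\<in>S==>t\<in>T&f t=g t" and fz: "f z=g z"
 shows "continuous (at z within S) f"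
 unfolding continuous_within
proof (rule topological_tendstoI)
 fix B assume B: "open B" "f z\<in>B"
 hence "\<forall>\<^sub>F t in at z within T. g t\<in>B"
  using g fz unfolding continuous_within by (metis topological_tendstoD)
 then obtain V where V: "open V" "z\<in>V" "!!t. t\<in>V==>t~=z==>t\<in>T==>g t\<in>B"
  unfolding eventually_at_topological by blast
 show "\<forall>\<^sub>F t in at z within S. f t\<in>B"
  unfolding eventually_at_topological
  by (rule exI[of _ "V\<inter>U"]) (use V U eq in auto)
qed

context lam_range
begin

text \<open>All terms of Re xi have finite limits at 0 except for ln |z|.\<close>

lemma lev_at_0: "filterlim (lev lam) at_bot (at 0 within Cplus)"
proof -
 define c where "c=Re (xi_formula lam 0 tp)"
 have csq0: "(csq lam\<longlongrightarrow>2) (at 0 within Cplus)"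
 proof -
  have "isCont csqrt (Q 0)" by (rule continuous_at_csqrt) (auto simp: Zsq_def complex_nonpos_Reals_iff)
  moreover have "(Q\<longlongrightarrow>Q 0) (at 0 within Cplus)" unfolding Zsq_def by (intro tendsto_intros)
  ultimately have "((%z. csqrt (Q z))\<longlongrightarrow>csqrt (Q 0)) (at 0 within Cplus)" by (rule isCont_tendsto_compose)
  moreover have "csqrt (Q 0)=2" using csqrt_of_real_nonneg[of 4] by (simp add: Zsq_def)
  ultimately show ?thesis by (simp add: csq_def[abs_def])
 qed
 have nz: "norm (2+0-2 * complex_of_real lam)~=0" "norm (2 - complex_of_real lam*0+2)~=0"
  using lam1 by (auto simp: complex_eq_iff)
 have "((%z. Re (csq lam z)/2 - lam * ln (norm (csq lam z + z-2 * of_real lam)) - ln (norm (csq lam z - of_real lam * z+2)) - c) \<longlongrightarrow>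
   Re 2/2 - lam * ln (norm (2+0-2 * complex_of_real lam)) - ln (norm (2 - complex_of_real lam*0+2)) - c) (at 0 within Cplus)"
  by (intro tendsto_intros csq0 nz) auto
 moreover have "filterlim (%z::complex. ln (norm z)) at_bot (at 0 within Cplus)"
 proof (rule filterlim_compose[OF ln_at_0])
  show "filterlim (norm::complex=>real) (at_right 0) (at 0 within Cplus)"
   unfolding filterlim_at by (auto simp: eventually_at_filter intro!: tendsto_eq_intros)
 qed
 hence "filterlim (%z::complex. - ln (norm z)) at_top (at 0 within Cplus)" by (simp add: filterlim_uminus_at_top)
 ultimately have "filterlim (%z. - (Re (csq lam z)/2 - lam * ln (norm (csq lam z + z-2 * of_real lam)) - ln (norm (csq lam z - of_real lam * z+2)) - c) + - ln (norm z)) at_top (at 0 within Cplus)"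
  by (intro filterlim_tendsto_add_at_top[OF tendsto_minus])
 hence "filterlim (%z. (Re (csq lam z)/2 - lam * ln (norm (csq lam z + z-2 * of_real lam)) - ln (norm (csq lam z - of_real lam * z+2)) - c) + ln (norm z)) at_bot (at 0 within Cplus)"
  unfolding filterlim_uminus_at_bot by (simp add: add.commute)
 thus ?thesis
 proof (rule filterlim_cong[OF refl refl, THEN iffD1, rotated])
  have "lev lam z=(Re (csq lam z)/2 - lam * ln (norm (csq lam z + z-2 * of_real lam)) - ln (norm (csq lam z - of_real lam * z+2)) - c) + ln (norm z)"
   if "z\<in>Cplus" for z
  proof -
   have z: "z~=0" using that by (auto simp: Cplus_def)
   note nz = branch_nonzero[OF csq_sq z]
   show ?thesis unfolding lev_def xi_formula_def[of _ "csq lam z"] c_def using nz z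
    by (simp add: Re_Ln norm_divide ln_div)
  qed
  thus "\<forall>\<^sub>F z in at 0 within Cplus. (Re (csq lam z)/2 - lam * ln (norm (csq lam z + z-2 * of_real lam)) - ln (norm (csq lam z - of_real lam * z+2)) - c) + ln (norm z)=lev lam z"
   by (simp add: eventually_at_filter)
 qed
qed

lemma lev_neg_near_0: "\<exists>e>0. e<2&(\<forall>z\<in>Cplus. norm z<e-->lev lam z<0)"
proof -
 have "\<forall>\<^sub>F z in at 0 within Cplus. lev lam z<0"
  using lev_at_0 by (simp add: filterlim_at_bot_dense)
 then obtain e where "0<e" "!!z. z\<in>Cplus==>z~=0==>norm z<e==>lev lam z<0"
  unfolding eventually_at by auto
 thus ?thesis by (intro exI[of _ "min e 1"]) (auto simp: Cplus_def)
qed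

lemma zero_closure_RA: "0\<in>closure RA"
 unfolding closure_approachable
proof (intro allI impI)
 fix e :: real assume e: "0<e"
 obtain d where d: "0<d" "d<2" "!!z. z\<in>Cplus==>norm z<d==>lev lam z<0" using lev_neg_near_0 by blast
 define x where "x=min e d/2"
 have x: "0<x" "x<e" "x<d" using e d by (auto simp: x_def)
 hence "complex_of_real x\<in>RA" using d by (auto simp: RA_def Cplus_def)
 moreover have "dist (complex_of_real x) 0<e" using x by simp
 ultimately show "\<exists>y\<in>RA. dist y 0<e" by blast
qed

lemma real_in_RB: "2<=x==>complex_of_real x\<in>RB"
 using lev_real_ge_2[of x] lam1 by (auto simp: RB_def Cplus_def)

lemma real_in_RC: "x < - 2==>complex_of_real x\<in>RC"
 using lev_outside_left[of "of_real x"] lam0 by (auto simp: RC_def Cplus_def)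

lemma regions_nonempty: "RA~={}" "RB~={}" "RC~={}"
 using zero_closure_RA real_in_RB[of 2] real_in_RC[of "-3"] by auto

text \<open>Three disjoint nonempty sets, connected and relatively open, that exhaust a set are its
  components.\<close>

lemma components_level: "components (Cplus - level_set lam)={RA,RB,RC}"
proof -
 let ?U = "Cplus - level_set lam"
 have U: "?U=RA\<union>RB\<union>RC" using region_union by simp
 have op: "openin (top_of_set ?U) R" if "openin (top_of_set Cplus) R" "R\<subseteq>?U" for R
  by (rule openin_subset_trans[OF that]) auto
 have oA: "openin (top_of_set ?U) RA" and oB: "openin (top_of_set ?U) RB" and oC: "openin (top_of_set ?U) RC"
  using op region_open region_union by blast+
 have dA: "?U - RA=RB\<union>RC" and dB: "?U - RB=RA\<union>RC" and dC: "?U - RC=RA\<union>RB"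
  unfolding U using region_disjoint by blast+
 have A: "C\<inter>RA~={}\<longleftrightarrow>C=RA" and B: "C\<inter>RB~={}\<longleftrightarrow>C=RB" and C: "C\<inter>RC~={}\<longleftrightarrow>C=RC"
  if "C\<in>components ?U" for C
  using component_clopen[OF oA _ connected_RA regions_nonempty(1) that] component_clopen[OF oB _ connected_RB regions_nonempty(2) that]
   component_clopen[OF oC _ connected_RC regions_nonempty(3) that] openin_Un[OF oB oC] openin_Un[OF oA oC] openin_Un[OF oA oB]
  unfolding dA dB dC by blast+
 show ?thesis
 proof
  show "components ?U\<subseteq>{RA,RB,RC}"
  proof
   fix C assume C': "C\<in>components ?U"
   hence "C~={}" "C\<subseteq>RA\<union>RB\<union>RC" using in_components_nonempty in_components_subset U by blast+
   thus "C\<in>{RA,RB,RC}" using A[OF C'] B[OF C'] C[OF C'] by blast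
  qed
  have "R\<in>components ?U" if R: "R\<in>{RA,RB,RC}" for R
  proof -
   have "R~={}" "R\<subseteq>?U" using R regions_nonempty U by auto
   then obtain z where z: "z\<in>R" "z\<in>?U" by blast
   hence K: "connected_component_set ?U z\<in>components ?U" by (auto simp: components_def)
   moreover have "z\<in>connected_component_set ?U z" using z by simp
   ultimately have "connected_component_set ?U z=R" using R z A[OF K] B[OF K] C[OF K] by blast
   thus ?thesis using K by simp
  qed
  thus "{RA,RB,RC}\<subseteq>components ?U" by blast
 qed
qed

lemma unbounded_RB: "\<not> bounded RB"
proof
 assume "bounded RB"
 then obtain B where "!!z. z\<in>RB==>norm z<=B" unfolding bounded_iff by blast
 from this[OF real_in_RB[of "\<bar>B\<bar> + 2"]] show False by (simp only: norm_of_real) linarith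
qed

lemma unbounded_RC: "\<not> bounded RC"
proof
 assume "bounded RC"
 then obtain B where "!!z. z\<in>RC==>norm z<=B" unfolding bounded_iff by blast
 from this[OF real_in_RC[of "- (\<bar>B\<bar> + 3)"]] show False by (simp only: norm_of_real) linarith
qed

lemma Sm1_eq: "Sm1 lam=RA"
proof -
 have "bounded RA" unfolding bounded_iff by (intro exI[of _ 2]) (auto simp: RA_def)
 hence "{C\<in>components (Cplus - level_set lam). bounded C&0\<in>closure C}={RA}"
  unfolding components_level using unbounded_RB unbounded_RC zero_closure_RA by auto
 thus ?thesis unfolding Sm1_def by simp
qed

lemma S0_eq: "S0 lam=RB"
proof -
 have ev: "\<forall>\<^sub>F x::real in at_top. of_real x\<in>RB"
  using eventually_ge_at_top[of 2] by eventually_elim (rule real_in_RB)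
 have "\<not> (\<forall>\<^sub>F x::real in at_top. of_real x\<in>R)" if "R\<inter>RB={}" for R
 proof
  assume "\<forall>\<^sub>F x::real in at_top. of_real x\<in>R"
  with ev have "\<forall>\<^sub>F x::real in at_top. False" by eventually_elim (use that in blast)
  thus False by simp
 qed
 hence "{C\<in>components (Cplus - level_set lam). \<forall>\<^sub>F x::real in at_top. of_real x\<in>C}={RB}"
  unfolding components_level using ev region_disjoint by blast
 thus ?thesis unfolding S0_def by simp
qed

lemma S1_eq: "S1 lam=RC"
proof -
 have ev: "\<forall>\<^sub>F x::real in at_bot. of_real x\<in>RC"
  using eventually_gt_at_bot[of "-2"] by eventually_elim (rule real_in_RC)
 have "\<not> (\<forall>\<^sub>F x::real in at_bot. of_real x\<in>R)" if "R\<inter>RC={}" for R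
 proof
  assume "\<forall>\<^sub>F x::real in at_bot. of_real x\<in>R"
  with ev have "\<forall>\<^sub>F x::real in at_bot. False" by eventually_elim (use that in blast)
  thus False by simp
 qed
 hence "{C\<in>components (Cplus - level_set lam). \<forall>\<^sub>F x::real in at_bot. of_real x\<in>C}={RC}"
  unfolding components_level using ev region_disjoint by blast
 thus ?thesis unfolding S1_def by simp
qed

section \<open>The level curves as common boundaries of the regions\<close>

definition g1 :: "complex set" where "g1={z\<in>Cplus. lev lam z=0&2<=norm z&2 * lam<=Re z}"
definition g2 :: "complex set" where "g2={z\<in>Cplus. lev lam z=0&norm z<=2&Re z<=2 * lam}"
definition g3 :: "complex set" where "g3={z\<in>Cplus. lev lam z=0&norm z<=2&2 * lam<=Re z}"

lemma tp_g: "tp\<in>g1" "tp\<in>g2" "tp\<in>g3"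
 using tp_Cplus lev_tp norm_tp by (auto simp: g1_def g2_def g3_def)

text \<open>The turning point is approached from \<open>RA\<close> along the vertical segment, and
  from \<open>RB\<close> and \<open>RC\<close> along the two arcs of the circle |z| = 2.\<close>

lemma tp_closure: "tp\<in>closure RA" "tp\<in>closure RB" "tp\<in>closure RC"
proof -
 have "Complex (2 * lam) yt\<in>closure RA"
 proof (rule in_closure_curve[OF has_vector_derivative_continuous[OF Complex_line_deriv]])
  fix e :: real assume "0<e"
  define t where "t=yt - min e yt/2"
  have t: "0<t" "t<yt" "\<bar>t - yt\<bar><e" using yt(1) \<open>0 < e\<close> by (auto simp: t_def)
  have "Complex (2 * lam) t\<in>Cplus" "norm (Complex (2 * lam) t)<2"
   using t norm_on_line[of "Complex (2 * lam) t"] by (auto simp: Cplus_def complex_eq_iff)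
  hence "Complex (2 * lam) t\<in>RA" using lev_line_below[of "Complex (2 * lam) t"] by (simp add: RA_def)
  thus "\<exists>t. \<bar>t - yt\<bar><e&Complex (2 * lam) t\<in>RA" using t by blast
 qed
 thus "tp\<in>closure RA" by (simp add: Complex_tp)
 have "pol 2 th0\<in>closure RB"
 proof (rule in_closure_curve[OF isCont_pol(1)])
  fix e :: real assume "0<e"
  define t where "t=th0 - min e th0/2"
  have t: "0<t" "t<th0" "\<bar>t - th0\<bar><e" using th0(1) \<open>0 < e\<close> by (auto simp: t_def)
  have C: "pol 2 t\<in>Cplus" using t th0 by (intro pol_Cplus) auto
  have "cos th0<cos t" using t th0 by (intro cos_monotone_0_pi) auto
  hence x: "2 * lam<Re (pol 2 t)" using th0 by simp
  hence "pol 2 t~=tp" by (metis Re_tp less_irrefl)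
  hence "0<lev lam (pol 2 t)" by (intro lev_circle C) auto
  hence "pol 2 t\<in>RB" using C x by (simp add: RB_def)
  thus "\<exists>t. \<bar>t - th0\<bar><e&pol 2 t\<in>RB" using t by blast
 qed
 thus "tp\<in>closure RB" by (simp add: th0)
 have "pol 2 th0\<in>closure RC"
 proof (rule in_closure_curve[OF isCont_pol(1)])
  fix e :: real assume "0<e"
  define t where "t=th0 + min e 1/2"
  have t: "th0<t" "t<pi" "\<bar>t - th0\<bar><e" using th0(1,2) \<open>0 < e\<close> pi_gt3 by (auto simp: t_def)
  have C: "pol 2 t\<in>Cplus" using t th0 by (intro pol_Cplus) auto
  have "cos t<cos th0" using t th0 by (intro cos_monotone_0_pi) auto
  hence x: "Re (pol 2 t)<2 * lam" using th0 by simp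
  hence "pol 2 t~=tp" by (metis Re_tp less_irrefl)
  hence "0<lev lam (pol 2 t)" by (intro lev_circle C) auto
  hence "pol 2 t\<in>RC" using C x by (simp add: RC_def)
  thus "\<exists>t. \<bar>t - th0\<bar><e&pol 2 t\<in>RC" using t by blast
 qed
 thus "tp\<in>closure RC" by (simp add: th0)
qed

text \<open>The level is strictly increasing along the ray through \<open>z\<close>. Points slightly
  further out have positive level, points slightly further in have negative level, and the norm
  tells whether the latter belong to \<open>RA\<close> or to \<open>RC\<close>.\<close>

lemma right_closure:
 assumes z: "z\<in>Cplus" "lev lam z=0" "2 * lam<Re z"
 shows "z\<in>closure RB" "norm z<2==>z\<in>closure RA" "2<norm z==>z\<in>closure RC"
proof -
 define r where "r=norm z"
 obtain th where t: "0<=th" "th<=pi" "z=pol r th" "0<r" using polar[OF z(1)] unfolding r_def by metis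
 have rc: "2 * lam<r * cos th" using z t by simp
 hence "0<r * cos th" using lam0 by linarith
 hence c: "0<cos th" using t by (simp add: zero_less_mult_iff)
 have outer: "pol s th\<in>RB" if "r<s" for s
 proof -
  have "lev lam (pol r th)<lev lam (pol s th)" by (rule ray_right) (use t rc c that in auto)
  moreover have "r * cos th<s * cos th" using that c by simp
  hence "2 * lam<s * cos th" using rc by linarith
  ultimately show ?thesis using pol_Cplus[of s th] t that z by (auto simp: RB_def)
 qed
 show "z\<in>closure RB" unfolding t(3)
 proof (rule in_closure_curve[OF isCont_pol(2)])
  fix e :: real assume "0<e"
  thus "\<exists>s. \<bar>s - r\<bar><e&pol s th\<in>RB" by (intro exI[of _ "r + e/2"]) (auto intro: outer)
 qed
 have inner: "lev lam (pol s th)<0&2 * lam<=s * cos th&0<s&pol s th\<in>Cplus" if s: "max (2 * lam/cos th) 0<s" "s<r" for s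
 proof -
  have "2 * lam/cos th<s" using s by simp
  hence sc: "2 * lam<=s * cos th" using c by (simp add: pos_divide_less_eq less_imp_le)
  hence "lev lam (pol s th)<lev lam (pol r th)" by (intro ray_right) (use t c s in auto)
  thus ?thesis using sc s t z pol_Cplus[of s th] by auto
 qed
 have near: "\<exists>s. \<bar>s - r\<bar><e&max (2 * lam/cos th) 0<s&s<r&b<s" if "0<e" "b<r" for e b
 proof -
  have "2 * lam/cos th<r" using rc c by (simp add: pos_divide_less_eq)
  hence "max (max (2 * lam/cos th) 0) (max (r - e) b)<r" using that t by auto
  then obtain s where "max (max (2 * lam/cos th) 0) (max (r - e) b)<s" "s<r" using dense by blast
  thus ?thesis by (intro exI[of _ s]) auto
 qed
 show "z\<in>closure RA" if "norm z<2" unfolding t(3)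
 proof (rule in_closure_curve[OF isCont_pol(2)])
  fix e :: real assume "0<e"
  then obtain s where s: "\<bar>s - r\<bar><e" "max (2 * lam/cos th) 0<s" "s<r" using near[of e 0] t by auto
  hence "pol s th\<in>RA" using inner[OF s(2,3)] that by (auto simp: RA_def r_def)
  thus "\<exists>s. \<bar>s - r\<bar><e&pol s th\<in>RA" using s by blast
 qed
 show "z\<in>closure RC" if "2<norm z" unfolding t(3)
 proof (rule in_closure_curve[OF isCont_pol(2)])
  fix e :: real assume "0<e"
  moreover have "2<r" using that by (simp add: r_def)
  ultimately obtain s where s: "\<bar>s - r\<bar><e" "max (2 * lam/cos th) 0<s" "s<r" "2<s" using near by blast
  hence "pol s th\<in>RC" using inner[OF s(2,3)] by (auto simp: RC_def)
  thus "\<exists>s. \<bar>s - r\<bar><e&pol s th\<in>RC" using s by blast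
 qed
qed

lemma left_closure:
 assumes z: "z\<in>Cplus" "lev lam z=0" "Re z<2 * lam" "norm z<2"
 shows "z\<in>closure RA" "z\<in>closure RC"
proof -
 define r where "r=norm z"
 obtain th where t: "0<=th" "th<=pi" "z=pol r th" "0<r" using polar[OF z(1)] unfolding r_def by metis
 have rc: "r * cos th<2 * lam" using z t by simp
 have inner: "pol s th\<in>RA" if s: "0<s" "s<r" for s
 proof -
  have sc: "s * cos th<2 * lam"
  proof (cases "0<cos th")
   case True
   hence "s * cos th<r * cos th" using s by simp
   thus ?thesis using rc by linarith
  next
   case False
   show ?thesis
   proof (cases "cos th=0")
    case False
    hence "s * cos th<0" using s \<open>\<not> 0 < cos th\<close> by (simp add: mult_less_0_iff)
    thus ?thesis using lam0 by linarith
   qed (use rc in simp)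
  qed
  have "levB (csL (pol s th)) (pol s th)<levB (csL (pol r th)) (pol r th)"
   by (rule ray_left) (use s t sc rc in auto)
  moreover have C: "pol s th\<in>Cplus" using s t by (intro pol_Cplus) auto
  ultimately have "lev lam (pol s th)<0" using lev_csL[OF z(1)] lev_csL[OF C] sc z t by simp
  thus ?thesis using C s z by (auto simp: RA_def r_def)
 qed
 show "z\<in>closure RA" unfolding t(3)
 proof (rule in_closure_curve[OF isCont_pol(2)])
  fix e :: real assume "0<e"
  thus "\<exists>s. \<bar>s - r\<bar><e&pol s th\<in>RA" using t(4)
   by (intro exI[of _ "r - min e r/2"]) (auto intro!: inner)
 qed
 have outer: "pol s th\<in>RC" if s: "r<s" "s * cos th<2 * lam" for s
 proof -
  have "levB (csL (pol r th)) (pol r th)<levB (csL (pol s th)) (pol s th)"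
   by (rule ray_left) (use s t rc in auto)
  moreover have C: "pol s th\<in>Cplus" using s t by (intro pol_Cplus) auto
  ultimately have "0<lev lam (pol s th)" using lev_csL[OF z(1)] lev_csL[OF C] s z t by simp
  thus ?thesis using C s by (auto simp: RC_def)
 qed
 show "z\<in>closure RC" unfolding t(3)
 proof (rule in_closure_curve[OF isCont_pol(2)])
  fix e :: real assume e: "0<e"
  define d where "d=min (e/2) ((2 * lam - r * cos th)/2)"
  have d: "0<d" "d<e" "d<2 * lam - r * cos th" using e rc by (auto simp: d_def min_def)
  have "d * cos th<=d*1" using d by (intro mult_left_mono) auto
  moreover have "(r + d) * cos th=r * cos th + d * cos th" by (simp add: algebra_simps)
  ultimately have "(r + d) * cos th<2 * lam" using d(3) by linarith
  hence "pol (r + d) th\<in>RC" using d by (intro outer) simp_all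
  thus "\<exists>s. \<bar>s - r\<bar><e&pol s th\<in>RC" using d by (intro exI[of _ "r + d"]) simp
 qed
qed

text \<open>This happens for lam = 0 only. The ray through \<open>z\<close> then runs inside the
  level set, so neighbours are found along the circle instead.\<close>

lemma axis_closure:
 assumes z: "z\<in>Cplus" "lev lam z=0" "Re z=2 * lam" "2<norm z"
 shows "z\<in>closure RB" "z\<in>closure RC"
proof -
 have l: "lam=0" using lev_line_above(2)[OF z(1,3,4)] z by simp
 define r where "r=norm z"
 obtain th where t: "0<=th" "th<=pi" "z=pol r th" "0<r" using polar[OF z(1)] unfolding r_def by metis
 have c: "cos th=0" using z t l by simp
 hence th: "th=pi/2" using t by (metis cos_pi_half cos_inj_pi pi_half_ge_zero pi_ge_zero le_divide_eq_1 field_sum_of_halves le_add_same_cancel1)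
 show "z\<in>closure RB" unfolding t(3)
 proof (rule in_closure_curve[OF isCont_pol(1)])
  fix e :: real assume e: "0<e"
  define s where "s=th - min e 1/2"
  have s: "0<s" "s<th" "\<bar>s-th\<bar><e" using e th pi_gt3 by (auto simp: s_def)
  have "lev lam (pol r th)<lev lam (pol r s)" by (rule arc_right) (use s t c l in auto)
  moreover have "0<cos s" using s th by (intro cos_gt_zero) auto
  ultimately have "2 * lam<Re (pol r s)" "0<lev lam (pol r s)" using l t z(2) by auto
  moreover have "pol r s\<in>Cplus" using s t by (intro pol_Cplus) auto
  ultimately have "pol r s\<in>RB" unfolding RB_def by blast
  thus "\<exists>s. \<bar>s-th\<bar><e&pol r s\<in>RB" using s by blast
 qed
 show "z\<in>closure RC" unfolding t(3)
 proof (rule in_closure_curve[OF isCont_pol(1)])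
  fix e :: real assume e: "0<e"
  define s where "s=th + min e 1/2"
  have s: "th<s" "s<pi" "\<bar>s-th\<bar><e" using e th pi_gt3 by (auto simp: s_def)
  have C: "pol r s\<in>Cplus" using s t by (intro pol_Cplus) auto
  have "cos s<cos th" using s t by (intro cos_monotone_0_pi) auto
  hence x: "Re (pol r s)<2 * lam" using c l t by (simp add: mult_less_0_iff)
  hence "0<lev lam (pol r s)" by (intro lev_outside_left C) (use z t in auto)
  hence "pol r s\<in>RC" using C x by (auto simp: RC_def)
  thus "\<exists>s. \<bar>s-th\<bar><e&pol r s\<in>RC" using s by blast
 qed
qed

lemma closed_bounds:
 "z\<in>closure RA==>norm z<=2" "z\<in>closure RB==>2 * lam<=Re z"
 "z\<in>closure RC==>norm z<2==>Re z<=2 * lam"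
proof -
 have c: "closed {z::complex. norm z<=2}" "closed {z. 2 * lam<=Re z}" "closed {z. Re z<=2 * lam\<or>2<=norm z}"
  by (intro closed_Collect_le closed_Collect_disj continuous_intros)+
 have "RA\<subseteq>{z. norm z<=2}" "RB\<subseteq>{z. 2 * lam<=Re z}" "RC\<subseteq>{z. Re z<=2 * lam\<or>2<=norm z}"
  by (auto simp: RA_def RB_def RC_def)
 from closure_minimal[OF this(1) c(1)] closure_minimal[OF this(2) c(2)] closure_minimal[OF this(3) c(3)]
 show "z\<in>closure RA==>norm z<=2" "z\<in>closure RB==>2 * lam<=Re z"
  "z\<in>closure RC==>norm z<2==>Re z<=2 * lam" by auto
qed

lemma not_on_circle: "z\<in>Cplus==>lev lam z=0==>z~=tp==>norm z~=2"
 using lev_circle[of z] by auto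

lemma gamma1_eq: "gamma1 lam=g1"
proof
 show "gamma1 lam\<subseteq>g1"
 proof
  fix z assume "z\<in>gamma1 lam"
  hence z: "z\<in>Cplus" "lev lam z=0" "z\<in>closure RB" "z\<in>closure RC"
   by (auto simp: gamma1_def level_set_lev S0_eq S1_eq)
  have "2<=norm z"
  proof (rule ccontr)
   assume "\<not> 2<=norm z"
   hence "Re z=2 * lam" using closed_bounds(2)[OF z(3)] closed_bounds(3)[OF z(4)] by auto
   thus False using lev_line_below[OF z(1)] z \<open>\<not> 2 \<le> norm z\<close> by auto
  qed
  thus "z\<in>g1" using z closed_bounds(2)[OF z(3)] by (auto simp: g1_def)
 qed
 show "g1\<subseteq>gamma1 lam"
 proof
  fix z assume "z\<in>g1"
  hence z: "z\<in>Cplus" "lev lam z=0" "2<=norm z" "2 * lam<=Re z" by (auto simp: g1_def)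
  have "z\<in>closure RB&z\<in>closure RC"
  proof (cases "z=tp")
   case False
   hence n: "2<norm z" using not_on_circle z by force
   show ?thesis
   proof (cases "Re z=2 * lam")
    case True
    thus ?thesis using axis_closure z n by auto
   next
    case False
    thus ?thesis using right_closure z n by auto
   qed
  qed (use tp_closure in auto)
  thus "z\<in>gamma1 lam" using z by (auto simp: gamma1_def level_set_lev S0_eq S1_eq)
 qed
qed

lemma gamma2_eq: "gamma2 lam=g2"
proof
 show "gamma2 lam\<subseteq>g2"
 proof
  fix z assume "z\<in>gamma2 lam"
  hence z: "z\<in>Cplus" "lev lam z=0" "z\<in>closure RA" "z\<in>closure RC"
   by (auto simp: gamma2_def level_set_lev Sm1_eq S1_eq)
  have "Re z<=2 * lam"
  proof (cases "z=tp")
   case False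
   thus ?thesis using not_on_circle[OF z(1,2)] closed_bounds(1)[OF z(3)] closed_bounds(3)[OF z(4)] by auto
  qed auto
  thus "z\<in>g2" using z closed_bounds(1)[OF z(3)] by (auto simp: g2_def)
 qed
 show "g2\<subseteq>gamma2 lam"
 proof
  fix z assume "z\<in>g2"
  hence z: "z\<in>Cplus" "lev lam z=0" "norm z<=2" "Re z<=2 * lam" by (auto simp: g2_def)
  have "z\<in>closure RA&z\<in>closure RC"
  proof (cases "z=tp")
   case False
   hence n: "norm z<2" using not_on_circle z by force
   hence "Re z~=2 * lam" using lev_line_below[OF z(1)] z by auto
   thus ?thesis using left_closure z n by auto
  qed (use tp_closure in auto)
  thus "z\<in>gamma2 lam" using z by (auto simp: gamma2_def level_set_lev Sm1_eq S1_eq)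
 qed
qed

lemma gamma3_eq: "gamma3 lam=g3"
proof
 show "gamma3 lam\<subseteq>g3"
  using closed_bounds by (auto simp: gamma3_def level_set_lev Sm1_eq S0_eq g3_def)
 show "g3\<subseteq>gamma3 lam"
 proof
  fix z assume "z\<in>g3"
  hence z: "z\<in>Cplus" "lev lam z=0" "norm z<=2" "2 * lam<=Re z" by (auto simp: g3_def)
  have "z\<in>closure RA&z\<in>closure RB"
  proof (cases "z=tp")
   case False
   hence n: "norm z<2" using not_on_circle z by force
   hence "Re z~=2 * lam" using lev_line_below[OF z(1)] z by auto
   thus ?thesis using right_closure z n by auto
  qed (use tp_closure in auto)
  thus "z\<in>gamma3 lam" using z by (auto simp: gamma3_def level_set_lev Sm1_eq S0_eq)
 qed
qed

section \<open>Continuous branches on the cut half planes\<close>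

text \<open>Both \<open>z\<close> and \<open>csq lam z\<close> lie in the closed first quadrant, so
  their quotient cannot be negative.\<close>

lemma rho_right:
 assumes z: "z\<in>Cplus" "2 * lam<=Re z" "z~=tp"
 shows "z/csq lam z\<notin>\<real>\<^sub>\<le>\<^sub>0"
proof
 define Z where "Z=csq lam z"
 have Z0: "Z~=0" using Q_zero_iff[OF z(1)] z(3) csq_sq[of z] by (auto simp: Z_def)
 assume "z/csq lam z\<in>\<real>\<^sub>\<le>\<^sub>0"
 then obtain t where t: "t<=0" "z/Z = of_real t" unfolding Z_def by (auto elim: nonpos_Reals_cases)
 hence zt: "z = of_real t * Z" using Z0 by (simp add: field_simps)
 have "0<=Im (Q z)" using z by (simp add: Im_Q Cplus_def)
 hence "0<=Re Z" "0<=Im Z" unfolding Z_def csq_def csqrt_upper[OF \<open>0 \<le> Im (Q z)\<close>]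
  using abs_Re_le_cmod[of "Q z"] by auto
 hence "Re z<=0" "Im z<=0" using t(1) arg_cong[OF zt, of Re] arg_cong[OF zt, of Im]
  by (simp_all add: mult_nonpos_nonneg)
 thus False using z lam0 by (auto simp: Cplus_def complex_eq_iff)
qed

text \<open>For Im z > 0 the sign is that of a^2 - x (x - 2 lam) with a = Re \<open>csq\<close>. If
  x >= 0 it is positive because x < 2 lam. If x < 0 it amounts to |Q| > |z|^2 - 4, where the
  difference of the squares is a sum of nonnegative terms.\<close>

lemma rho_left:
 assumes z: "z\<in>Cplus" "Re z<2 * lam"
 shows "0<=Im (z/csq lam z)" "0<Im z==>0<Im (z/csq lam z)"
proof -
 define a b x y where "a=Re (csq lam z)" and "b=Im (csq lam z)" and "x=Re z" and "y=Im z"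
 have a: "0<a" unfolding a_def by (rule Re_csq_pos[OF z(1)]) (use z in auto)
 have y: "0<=y" using z by (simp add: y_def Cplus_def)
 have xl: "x<2 * lam" using z by (simp add: x_def)
 have ab: "a * b=y*(x-2 * lam)"
  using arg_cong[OF csq_sq[of z], of Im] by (simp add: Im_Q a_def b_def x_def y_def power2_eq_square mult.commute)
 have a2: "2 * a\<^sup>2=norm (Q z) + Re (Q z)"
 proof -
  have "(norm (csq lam z))\<^sup>2=norm (Q z)" by (simp add: csq_sq flip: norm_power)
  moreover have "a\<^sup>2 - b\<^sup>2=Re (Q z)" using arg_cong[OF csq_sq[of z], of Re] by (simp add: a_def b_def power2_eq_square)
  ultimately show ?thesis by (simp add: cmod_power2 a_def b_def)
 qed
 have key: "0<a\<^sup>2 - x*(x-2 * lam)" if "0<y"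
 proof (cases "0<=x")
  case True
  hence "x*(x-2 * lam)<=0" using xl by (simp add: mult_nonneg_nonpos)
  moreover have "0<a\<^sup>2" using a by simp
  ultimately show ?thesis by linarith
 next
  case False
  have "(norm (Q z))\<^sup>2-(x\<^sup>2 + y\<^sup>2-4)\<^sup>2=16 * x\<^sup>2-8 * lam * x*(x\<^sup>2 + y\<^sup>2+4)+16 * lam\<^sup>2*(x\<^sup>2 + y\<^sup>2)"
   unfolding cmod_power2 Re_Q Im_Q x_def[symmetric] y_def[symmetric] by (simp add: power2_eq_square algebra_simps)
  moreover have "0<16 * x\<^sup>2" using False by simp
  moreover have "0<=- (8 * lam * x*(x\<^sup>2 + y\<^sup>2+4))"
  proof -
   have "8 * lam * x<=0" using False lam0 by (simp add: mult_nonneg_nonpos)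
   moreover have "0<=x\<^sup>2 + y\<^sup>2+4" by simp
   ultimately show ?thesis by (simp only: neg_0_le_iff_le mult_nonpos_nonneg)
  qed
  moreover have "0<=16 * lam\<^sup>2*(x\<^sup>2 + y\<^sup>2)" by simp
  ultimately have "(x\<^sup>2 + y\<^sup>2-4)\<^sup>2<(norm (Q z))\<^sup>2" by linarith
  hence "x\<^sup>2 + y\<^sup>2-4<norm (Q z)" by (rule power2_less_imp_less) simp
  hence "0<norm (Q z)-(x\<^sup>2 + y\<^sup>2-4)" by simp
  moreover have "2*(a\<^sup>2 - x*(x-2 * lam))=norm (Q z)-(x\<^sup>2 + y\<^sup>2-4)"
   using a2 unfolding Re_Q x_def[symmetric] y_def[symmetric] by (simp add: power2_eq_square algebra_simps)
  ultimately have "0<2*(a\<^sup>2 - x*(x-2 * lam))" by (simp only:)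
  thus ?thesis by (rule zero_less_mult_pos) simp
 qed
 have "Im (z/csq lam z)=(y * a - x * b)/(norm (csq lam z))\<^sup>2"
  by (simp add: Im_divide cmod_power2 a_def b_def x_def y_def)
 also have "y * a - x * b=y*(a\<^sup>2 - x*(x-2 * lam))/a"
 proof -
  have "(y * a - x * b) * a=y * a\<^sup>2 - x*(a * b)" by (simp add: power2_eq_square algebra_simps)
  also have "\<dots>=y*(a\<^sup>2 - x*(x-2 * lam))" unfolding ab by (simp add: algebra_simps)
  finally show ?thesis using a by (simp add: field_simps)
 qed
 finally have eq: "Im (z/csq lam z)=y*(a\<^sup>2 - x*(x-2 * lam))/a/(norm (csq lam z))\<^sup>2" .
 have nz: "0<(norm (csq lam z))\<^sup>2" using a by (auto simp: a_def)
 show pos: "0<Im (z/csq lam z)" if "0<Im z"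
  unfolding eq using key that a nz by (simp add: y_def)
 show "0<=Im (z/csq lam z)"
 proof (cases "y=0")
  case False
  thus ?thesis using pos y by (simp add: y_def)
 qed (simp add: eq)
qed

definition q0 :: "complex=>complex" where "q0 z=csqrt (z/csq lam z)"
definition qT :: "complex=>complex" where "qT z=csqrt (z/icsq z)"

lemma q0_sq: "q0 z^2=z/csq lam z" by (simp add: q0_def)

lemma qT_right: "z\<in>Cplus==>0<Im z==>2<norm z==>2 * lam<=Re z==>qT z=q0 z"
 by (simp add: qT_def q0_def icsq_right)

lemma qT_left: "z\<in>Cplus==>0<Im z==>2<norm z==>Re z<2 * lam==>qT z = - \<i> * q0 z"
proof -
 assume z: "z\<in>Cplus" "0<Im z" "2<norm z" "Re z<2 * lam"
 have "Im (- (z/csq lam z))<0" using rho_left(2)[OF z(1,4,2)] by (simp only: uminus_complex.simps neg_less_0_iff_less)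
 hence "csqrt (- (- (z/csq lam z)))=\<i> * csqrt (- (z/csq lam z))" by (intro csqrt_minus) blast
 thus ?thesis unfolding qT_def q0_def icsq_left[OF z] by (simp add: mult.assoc[symmetric])
qed

lemma csq_nz: "z\<in>Cplus==>z~=tp==>csq lam z~=0"
 using Q_zero_iff[of z] csq_sq[of z] by auto

lemma continuous_q0_right:
 assumes "z\<in>Cplus" "2 * lam<=Re z" "z~=tp" "continuous (at z within S) (csq lam)"
 shows "continuous (at z within S) q0"
proof -
 have "continuous (at z within S) (%t. t/csq lam t)"
  by (intro continuous_intros assms csq_nz)
 thus ?thesis unfolding q0_def
  by (rule continuous_within_compose3[rotated]) (use rho_right[OF assms(1-3)] in "auto intro: continuous_at_csqrt")
qed

lemma continuous_q0_left: "continuous_on {z\<in>Cplus. Re z<2 * lam} q0"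
 unfolding q0_def
proof (rule continuous_on_compose2[OF csqrt_continuous_upper])
 have "continuous_on {z\<in>Cplus. Re z<2 * lam} (csq lam)"
  by (rule continuous_on_subset[OF continuous_csq_slit]) auto
 moreover have "csq lam z~=0" if "z\<in>Cplus" "Re z<2 * lam" for z using that by (intro csq_nz) auto
 ultimately show "continuous_on {z\<in>Cplus. Re z<2 * lam} (%z. z/csq lam z)"
  by (intro continuous_intros) auto
 show "(%z. z/csq lam z) ` {z\<in>Cplus. Re z<2 * lam}\<subseteq>{w. 0<=Im w}" using rho_left(1) by auto
qed

lemma continuous_qT: "continuous_on {z\<in>Cplus. 0<Im z&2<norm z} qT"
proof -
 let ?T = "{z\<in>Cplus. 0<Im z&2<norm z}"
 have tp: "z~=tp" if "z\<in>?T" for z using that norm_tp by auto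
 have nz: "icsq z~=0" if "z\<in>?T" for z using that Q_zero_iff[of z] icsq_sq[of z] tp[OF that] by auto
 have slit: "z/icsq z\<notin>\<real>\<^sub>\<le>\<^sub>0" if z: "z\<in>?T" for z
 proof (cases "2 * lam<=Re z")
  case True
  thus ?thesis using rho_right[of z] icsq_right[of z] tp[OF z] z by auto
 next
  case False
  hence "Im (z/icsq z)<0" using rho_left(2)[of z] icsq_left[of z] z by auto
  thus ?thesis by (auto simp: complex_nonpos_Reals_iff)
 qed
 show ?thesis unfolding qT_def
  by (rule continuous_on_compose2[OF continuous_csqrt_slit])
    (use nz slit in "auto intro!: continuous_intros continuous_icsq")
qed

text \<open>Crossing the discontinuity of \<open>csq\<close> above the turning point from right to left, \<open>q\<close> has to be multiplied by \<open>- \<i>\<close>.\<close>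

lemma multiplier_continuous:
 assumes S: "S\<subseteq>Cplus" "tp\<notin>S" and z: "z\<in>S"
  and A: "Re z~=2 * lam\<or>norm z<2==>\<exists>U. open U&z\<in>U&(\<forall>t\<in>U\<inter>S. m t=m z)"
  and B: "Re z=2 * lam==>2<norm z==>\<exists>U. open U&z\<in>U&(\<forall>t\<in>U\<inter>S. m t=(if Re t<2 * lam then-\<i> * m z else m z))"
 shows "continuous (at z within S) (%z. m z^2 * csq lam z)" "continuous (at z within S) (%z. m z * q0 z)"
proof -
 have zC: "z\<in>Cplus" and ztp: "z~=tp" using z S by auto
 have "norm z~=2\<or>Re z~=2 * lam"
 proof (rule ccontr)
  assume "\<not> ?thesis"
  hence "Re z=2 * lam" "norm z=2" by auto
  hence "Im z=yt" using norm_on_line[of z] zC by (auto simp: Cplus_def)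
  thus False using ztp \<open>Re z = 2 * lam\<close> by (simp add: complex_eq_iff)
 qed
 then consider (a) "Re z~=2 * lam\<or>norm z<2" | (b) "Re z=2 * lam" "2<norm z" by linarith
 hence "continuous (at z within S) (%z. m z^2 * csq lam z)&continuous (at z within S) (%z. m z * q0 z)"
 proof cases
  case a
  from A[OF a] obtain U where U: "open U" "z\<in>U" "!!t. t\<in>U==>t\<in>S==>m t=m z" by blast
  let ?T = "{z\<in>Cplus. Re z~=2 * lam\<or>norm z<2}"
  obtain V where V: "open V" "z\<in>V" "V\<inter>Cplus\<subseteq>?T" "Re z<2 * lam==>V\<subseteq>{t. Re t<2 * lam}"
  proof -
   consider "Re z<2 * lam" | "\<not> Re z<2 * lam" "2 * lam<Re z" | "\<not> Re z<2 * lam" "norm z<2" using a by linarith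
   thus ?thesis
   proof cases
    case 1
    show ?thesis by (rule that[of "{t. Re t<2 * lam}"]) (use 1 in "auto simp: open_parts")
   next
    case 2
    show ?thesis by (rule that[of "{t. 2 * lam<Re t}"]) (use 2 in "auto simp: open_parts")
   next
    case 3
    show ?thesis by (rule that[of "{t. norm t<2}"]) (use 3 in "auto simp: open_parts")
   qed
  qed
  have c1: "continuous (at z within ?T) (csq lam)"
   using continuous_csq_slit zC a by (auto simp: continuous_on_eq_continuous_within)
  have 1: "continuous (at z within S) (%z. m z^2 * csq lam z)"
   by (rule continuous_within_local[of z ?T "%t. m z^2 * csq lam t" "U\<inter>V"])
    (use U V S c1 in "auto intro!: continuous_intros")
  have "continuous (at z within S) (%z. m z * q0 z)"
  proof (cases "Re z<2 * lam")
   case True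
   have c2: "continuous (at z within {z\<in>Cplus. Re z<2 * lam}) q0"
    using continuous_q0_left zC True by (auto simp: continuous_on_eq_continuous_within)
   show ?thesis
    by (rule continuous_within_local[of z "{z\<in>Cplus. Re z<2 * lam}" "%t. m z * q0 t" "U\<inter>V"])
    (use c2 U V(1,2) V(4)[OF True] S in "auto intro!: continuous_intros")
  next
   case False
   hence c2: "continuous (at z within ?T) q0" by (intro continuous_q0_right[OF zC _ ztp c1]) auto
   show ?thesis
    by (rule continuous_within_local[of z ?T "%t. m z * q0 t" "U\<inter>V"])
    (use c2 U V S in "auto intro!: continuous_intros")
  qed
  with 1 show ?thesis by blast
 next
  case b
  from B[OF b] obtain U where U: "open U" "z\<in>U" "!!t. t\<in>U==>t\<in>S==>m t=(if Re t<2 * lam then-\<i> * m z else m z)" by blast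
  let ?T = "{z\<in>Cplus. 0<Im z&2<norm z}"
  define V where "V={t. 0<Im t}\<inter>{t. 2<norm t}"
  have "yt<Im z" using norm_on_line(2)[OF b(1)] zC b by (simp add: Cplus_def)
  hence zT: "z\<in>?T" using yt(1) b zC by simp
  have V: "open V" "z\<in>V" "V\<inter>Cplus\<subseteq>?T" using zT by (auto simp: V_def intro!: open_Int open_parts)
  have c: "continuous (at z within ?T) icsq" "continuous (at z within ?T) qT"
   using continuous_icsq continuous_qT zT unfolding continuous_on_eq_continuous_within by blast+
  have e: "m t^2 * csq lam t=m z^2 * icsq t&m t * q0 t=m z * qT t" if t: "t\<in>U\<inter>V" "t\<in>S" for t
  proof -
   have tT: "t\<in>Cplus" "0<Im t" "2<norm t" using t S V by auto
   show ?thesis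
   proof (cases "Re t<2 * lam")
    case True
    hence "m t = - \<i> * m z" using U(3) t by simp
    thus ?thesis using icsq_left[OF tT True] qT_left[OF tT True] by (simp add: power_mult_distrib)
   next
    case False
    hence "m t=m z" using U(3) t by simp
    thus ?thesis using icsq_right[OF tT] qT_right[OF tT] False by simp
   qed
  qed
  have ez: "m z^2 * csq lam z=m z^2 * icsq z" "m z * q0 z=m z * qT z" using e[of z] U V z by auto
  have oUV: "open (U\<inter>V)" "z\<in>U\<inter>V" using U V by auto
  have eT: "t\<in>?T&m t^2 * csq lam t=m z^2 * icsq t" "t\<in>?T&m t * q0 t=m z * qT t"
   if t: "t\<in>U\<inter>V" "t\<in>S" for t
  proof -
   have "t\<in>?T" using V(3) S(1) t by blast
   thus "t\<in>?T&m t^2 * csq lam t=m z^2 * icsq t" "t\<in>?T&m t * q0 t=m z * qT t"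
    using e[OF t] by blast+
  qed
  have "continuous (at z within S) (%z. m z^2 * csq lam z)"
   by (rule continuous_within_local[OF _ oUV eT(1) ez(1)]) (intro continuous_intros c)
  moreover have "continuous (at z within S) (%z. m z * q0 z)"
   by (rule continuous_within_local[OF _ oUV eT(2) ez(2)]) (intro continuous_intros c)
  ultimately show ?thesis by blast
 qed
 thus "continuous (at z within S) (%z. m z^2 * csq lam z)" "continuous (at z within S) (%z. m z * q0 z)" by auto
qed

text \<open>Multipliers for the half plane cut along gamma_2, gamma_1 and gamma_3 respectively: m^2
  \<open>csq\<close> and m \<open>q0\<close> become continuous branches of Z and (z/Z)^(1/2). On the
  region where the corresponding paths start, S_{-1} for \<open>m1\<close> and S_1 for
  \<open>m3\<close>, they agree with \<open>mpv\<close>.\<close>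

definition mpv :: "complex=>complex" where
 "mpv z=(if Re z<2 * lam&0<lev lam z then-\<i> else 1)"
definition m1 :: "complex=>complex" where
 "m1 z=(if 2 * lam<=Re z&2<norm z&lev lam z<0 then \<i> else 1)"
definition m3 :: "complex=>complex" where
 "m3 z=(if Re z<2 * lam\<or>(norm z<2&lev lam z<0) then-\<i> else 1)"

lemma lev_nbhd:
 assumes z: "z\<in>Cplus" "Re z~=2 * lam\<or>norm z<2" and I: "open I" "lev lam z\<in>I"
 shows "\<exists>U. open U&z\<in>U&(\<forall>t\<in>U\<inter>Cplus. lev lam t\<in>I&(Re z<2 * lam-->Re t<2 * lam) &
  (2 * lam<Re z-->2 * lam<Re t)&(norm z<2-->norm t<2)&(2<norm z-->2<norm t))"
proof -
 let ?T = "{t. Re t<2 * lam}\<union>{t. 2 * lam<Re t}\<union>{t. norm t<2}"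
 let ?S = "{z\<in>Cplus. Re z~=2 * lam\<or>norm z<2}"
 have "openin (top_of_set Cplus) {z\<in>?S. levB (csq lam z) z\<in>I}"
  by (rule openin_lev[OF continuous_csq_slit csq_sq, where T = ?T]) (use I in "auto intro!: open_Un open_parts")
 then obtain V where V: "open V" "{z\<in>?S. levB (csq lam z) z\<in>I}=Cplus\<inter>V" by (auto simp: openin_open)
 define W where "W=(if Re z<2 * lam then {t. Re t<2 * lam} else UNIV)\<inter>(if 2 * lam<Re z then {t. 2 * lam<Re t} else UNIV)
  \<inter>(if norm z<2 then {t. norm t<2} else UNIV)\<inter>(if 2<norm z then {t. 2<norm t} else UNIV)"
 have W: "open W" "z\<in>W" unfolding W_def by (auto intro!: open_Int open_parts)
 have "z\<in>V" using V(2) z I lev_levB by auto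
 moreover have "lev lam t\<in>I" if "t\<in>V" "t\<in>Cplus" for t using that V(2) lev_levB by auto
 ultimately show ?thesis using V(1) W by (intro exI[of _ "V\<inter>W"]) (auto simp: W_def split: if_splits)
qed

lemma lev_local:
 assumes z: "z\<in>Cplus" "Re z~=2 * lam\<or>norm z<2" and I: "open I" "lev lam z\<in>I"
  and m: "!!t. t\<in>Cplus==>lev lam t\<in>I==>(Re z<2 * lam-->Re t<2 * lam) ==>
   (2 * lam<Re z-->2 * lam<Re t)==>(norm z<2-->norm t<2)==>(2<norm z-->2<norm t)==>m t=m z"
 shows "\<exists>U. open U&z\<in>U&(\<forall>t\<in>U\<inter>(Cplus - g). m t=m z)"
proof -
 obtain U where U: "open U" "z\<in>U" "!!t. t\<in>U\<inter>Cplus==>lev lam t\<in>I&(Re z<2 * lam-->Re t<2 * lam) &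
  (2 * lam<Re z-->2 * lam<Re t)&(norm z<2-->norm t<2)&(2<norm z-->2<norm t)"
  using lev_nbhd[OF z I] by blast
 show ?thesis
 proof (intro exI[of _ U] conjI U ballI)
  fix t assume "t\<in>U\<inter>(Cplus - g)"
  thus "m t=m z" using U(3)[of t] m[of t] by blast
 qed
qed

lemma lev_nbhd_right:
 assumes z: "z\<in>Cplus" "2 * lam<=Re z" and I: "open I" "lev lam z\<in>I"
 shows "\<exists>U. open U&z\<in>U&(\<forall>t\<in>U\<inter>Cplus. 2 * lam<=Re t-->lev lam t\<in>I)"
proof -
 let ?S = "{z\<in>Cplus. 2 * lam<=Re z}"
 have "openin (top_of_set ?S) (?S\<inter>(%z. levB (csq lam z) z) -` I)"
  by (intro continuous_openin_preimage_gen levB_continuous continuous_csq_right csq_sq I) auto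
 then obtain V where V: "open V" "?S\<inter>(%z. levB (csq lam z) z) -` I=?S\<inter>V" by (auto simp: openin_open)
 hence "lev lam t\<in>I" if "t\<in>V" "t\<in>?S" for t using that lev_levB by auto
 moreover have "z\<in>V" using V(2) z I lev_levB by auto
 ultimately show ?thesis using V(1) by blast
qed

text \<open>Off the half-line the multiplier is locally constant, since to the left of it the two
  signs of the level are separated by gamma_2 (\<open>A\<close>). Across the half-line the level to
  the left is positive, which produces exactly the jump by -i (\<open>B\<close>).\<close>

lemma cont_pv: "z\<in>Cplus - g2==>continuous (at z within Cplus - g2) (%z. mpv z^2 * csq lam z)"
  "z\<in>Cplus - g2==>continuous (at z within Cplus - g2) (%z. mpv z * q0 z)"
proof -
 have A: "\<exists>U. open U&z\<in>U&(\<forall>t\<in>U\<inter>(Cplus - g2). mpv t=mpv z)"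
  if z: "z\<in>Cplus - g2" "Re z~=2 * lam\<or>norm z<2" for z
 proof (cases "Re z<2 * lam")
  case True
  have "lev lam z~=0" using z True lev_outside_left[of z] by (cases "norm z<=2") (auto simp: g2_def)
  then consider "lev lam z<0" | "0<lev lam z" by linarith
  thus ?thesis
  proof cases
   case 1
   show ?thesis by (rule lev_local[where I = "{..<0}"]) (use z True 1 in "auto simp: mpv_def")
  next
   case 2
   show ?thesis by (rule lev_local[where I = "{0<..}"]) (use z True 2 in "auto simp: mpv_def")
  qed
 next
  case False
  show ?thesis
  proof (cases "2 * lam<Re z")
   case True
   show ?thesis by (rule lev_local[where I = UNIV]) (use z True in "auto simp: mpv_def")
  next
   case False
   hence lt0: "lev lam z<0" using z \<open>\<not> Re z < 2 * lam\<close> by (intro lev_line_below) auto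
   show ?thesis by (rule lev_local[where I = "{..<0}"]) (use z \<open>\<not> Re z < 2 * lam\<close> lt0 in "auto simp: mpv_def")
  qed
 qed
 have B: "\<exists>U. open U&z\<in>U&(\<forall>t\<in>U\<inter>(Cplus - g2). mpv t=(if Re t<2 * lam then-\<i> * mpv z else mpv z))"
  if z: "z\<in>Cplus - g2" "Re z=2 * lam" "2<norm z" for z
  by (rule exI[of _ "{t. 2<norm t}"]) (use z lev_outside_left in "auto simp: mpv_def open_parts")
 show "z\<in>Cplus - g2==>continuous (at z within Cplus - g2) (%z. mpv z^2 * csq lam z)"
  "z\<in>Cplus - g2==>continuous (at z within Cplus - g2) (%z. mpv z * q0 z)"
  using multiplier_continuous[of "Cplus - g2" z mpv] A[of z] B[of z] tp_g by auto
qed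

lemma cont_m1: "z\<in>Cplus - g1==>continuous (at z within Cplus - g1) (%z. m1 z^2 * csq lam z)"
  "z\<in>Cplus - g1==>continuous (at z within Cplus - g1) (%z. m1 z * q0 z)"
proof -
 have A: "\<exists>U. open U&z\<in>U&(\<forall>t\<in>U\<inter>(Cplus - g1). m1 t=m1 z)"
  if z: "z\<in>Cplus - g1" "Re z~=2 * lam\<or>norm z<2" for z
 proof -
  consider "norm z<2" | "norm z=2" "2 * lam<Re z" | "2<norm z" "2 * lam<Re z" | "Re z<2 * lam" using z by linarith
  thus ?thesis
  proof cases
   case 1
   show ?thesis by (rule lev_local[where I = UNIV]) (use z 1 in "auto simp: m1_def")
  next
   case 2
   hence lt0: "0<lev lam z" using z by (intro lev_circle) auto
   show ?thesis by (rule lev_local[where I = "{0<..}"]) (use z lt0 in "auto simp: m1_def")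
  next
   case 3
   hence "lev lam z~=0" using z by (auto simp: g1_def)
   then consider "lev lam z<0" | "0<lev lam z" by linarith
   thus ?thesis
   proof cases
    case 1
    show ?thesis by (rule lev_local[where I = "{..<0}"]) (use z 3 1 in "auto simp: m1_def")
   next
    case 2
    show ?thesis by (rule lev_local[where I = "{0<..}"]) (use z 3 2 in "auto simp: m1_def")
   qed
  next
   case 4
   show ?thesis by (rule lev_local[where I = UNIV]) (use z 4 in "auto simp: m1_def")
  qed
 qed
 have B: "\<exists>U. open U&z\<in>U&(\<forall>t\<in>U\<inter>(Cplus - g1). m1 t=(if Re t<2 * lam then-\<i> * m1 z else m1 z))"
  if z: "z\<in>Cplus - g1" "Re z=2 * lam" "2<norm z" for z
 proof -
  have "lev lam z<0" using lev_line_above[of z] z by (force simp: g1_def)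
  moreover from this obtain U where U: "open U" "z\<in>U" "\<forall>t\<in>U\<inter>Cplus. 2 * lam<=Re t-->lev lam t\<in>{..<0}"
   using lev_nbhd_right[of z "{..<0}"] z by auto
  ultimately show ?thesis using z
   by (intro exI[of _ "U\<inter>{t. 2<norm t}"]) (auto simp: m1_def intro!: open_Int open_parts)
 qed
 show "z\<in>Cplus - g1==>continuous (at z within Cplus - g1) (%z. m1 z^2 * csq lam z)"
  "z\<in>Cplus - g1==>continuous (at z within Cplus - g1) (%z. m1 z * q0 z)"
  using multiplier_continuous[of "Cplus - g1" z m1] A[of z] B[of z] tp_g by auto
qed

lemma cont_m3: "z\<in>Cplus - g3==>continuous (at z within Cplus - g3) (%z. m3 z^2 * csq lam z)"
  "z\<in>Cplus - g3==>continuous (at z within Cplus - g3) (%z. m3 z * q0 z)"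
proof -
 have A: "\<exists>U. open U&z\<in>U&(\<forall>t\<in>U\<inter>(Cplus - g3). m3 t=m3 z)"
  if z: "z\<in>Cplus - g3" "Re z~=2 * lam\<or>norm z<2" for z
 proof -
  consider "norm z<2" "2 * lam<=Re z" | "norm z=2" "2 * lam<Re z" | "2<norm z" "2 * lam<Re z" | "Re z<2 * lam" using z by linarith
  thus ?thesis
  proof cases
   case 1
   hence "lev lam z~=0" using z by (auto simp: g3_def)
   then consider "lev lam z<0" | "0<lev lam z" by linarith
   thus ?thesis
   proof cases
    case 1
    show ?thesis by (rule lev_local[where I = "{..<0}"]) (use z \<open>norm z < 2\<close> 1 in "auto simp: m3_def")
   next
    case 2
    hence lt0: "2 * lam<Re z" using lev_line_below[of z] z 1 by force
    show ?thesis by (rule lev_local[where I = "{0<..}"]) (use z 1 2 lt0 in "auto simp: m3_def")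
   qed
  next
   case 2
   hence lt0: "0<lev lam z" using z by (intro lev_circle) auto
   show ?thesis by (rule lev_local[where I = "{0<..}"]) (use z 2 lt0 in "auto simp: m3_def")
  next
   case 3
   show ?thesis by (rule lev_local[where I = UNIV]) (use z 3 in "auto simp: m3_def")
  next
   case 4
   show ?thesis by (rule lev_local[where I = UNIV]) (use z 4 in "auto simp: m3_def")
  qed
 qed
 have B: "\<exists>U. open U&z\<in>U&(\<forall>t\<in>U\<inter>(Cplus - g3). m3 t=(if Re t<2 * lam then-\<i> * m3 z else m3 z))"
  if z: "z\<in>Cplus - g3" "Re z=2 * lam" "2<norm z" for z
  by (rule exI[of _ "{t. 2<norm t}"]) (use z in "auto simp: m3_def open_parts")
 show "z\<in>Cplus - g3==>continuous (at z within Cplus - g3) (%z. m3 z^2 * csq lam z)"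
  "z\<in>Cplus - g3==>continuous (at z within Cplus - g3) (%z. m3 z * q0 z)"
  using multiplier_continuous[of "Cplus - g3" z m3] A[of z] B[of z] tp_g by auto
qed

definition Zb :: "(complex=>complex)=>complex=>complex" where "Zb m z=m z^2 * csq lam z"
definition qb :: "(complex=>complex)=>complex=>complex" where "qb m z=m z * q0 z"

lemma Zb_sq: "m z^4=1==>Zb m z^2=Q z"
 by (simp add: Zb_def power_mult_distrib csq_sq flip: power_mult)

lemma qb_sq: "m z^4=1==>qb m z^2=z/Zb m z"
proof -
 assume m: "m z^4=1"
 hence "m z^2 * m z^2=1" by (simp flip: power_add)
 hence "m z^2=1/m z^2" by (metis mult_cancel_right nonzero_mult_div_cancel_right power_not_zero zero_neq_one mult_zero_left)
 thus ?thesis unfolding qb_def Zb_def power_mult_distrib q0_sq by (metis divide_divide_eq_left mult.commute mult.left_neutral times_divide_eq_right)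
qed

lemma m_power4: "mpv z^4=1" "m1 z^4=1" "m3 z^4=1"
 by (auto simp: mpv_def m1_def m3_def)

lemma m_RC: "z\<in>RC==>m1 z=\<i> * mpv z" "z\<in>RC==>m3 z=mpv z"
 by (auto simp: RC_def mpv_def m1_def m3_def)

lemma m_RA: "z\<in>RA==>m1 z=mpv z" "z\<in>RA==>m3 z = - \<i> * mpv z"
 by (auto simp: RA_def mpv_def m1_def m3_def)

lemma Zb_RC: "z\<in>RC==>Zb m1 z = - Zb mpv z" "z\<in>RC==>Zb m3 z=Zb mpv z"
 and Zb_RA: "z\<in>RA==>Zb m1 z=Zb mpv z" "z\<in>RA==>Zb m3 z = - Zb mpv z"
 and qb_RC: "z\<in>RC==>qb m1 z=\<i> * qb mpv z" "z\<in>RC==>qb m3 z=qb mpv z"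
 and qb_RA: "z\<in>RA==>qb m1 z=qb mpv z" "z\<in>RA==>qb m3 z = - \<i> * qb mpv z"
 by (auto simp: Zb_def qb_def m_RC m_RA power_mult_distrib)

end

section \<open>Relatively open subsets of the closed half plane\<close>

lemma Cplus_half_disc:
 assumes T: "openin (top_of_set Cplus) T" and z: "z\<in>T"
 shows "\<exists>e>0. ball z e\<inter>Cplus\<subseteq>T&convex (ball z e\<inter>Cplus)&ball z e\<inter>Cplus=ball z e\<inter>{z. 0<=Im z}"
proof -
 from T z obtain e where e: "0<e" "ball z e\<inter>Cplus\<subseteq>T" and zC: "z\<in>Cplus"
  by (metis openin_contains_ball subsetD)
 define d where "d=min e (norm z)"
 have d: "0<d" "d<=e" "d<=norm z" using e zC by (auto simp: d_def Cplus_def)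
 have "0\<notin>ball z d" using d by (auto simp: dist_norm)
 hence eq: "ball z d\<inter>Cplus=ball z d\<inter>{z. 0<=Im z}" by (auto simp: Cplus_def)
 have "convex (ball z d\<inter>{z. 0<=Im z})"
  by (intro convex_Int convex_ball convex_halfspace_Im_ge)
 thus ?thesis using e d eq by (intro exI[of _ d]) auto
qed

lemma half_disc_closure:
 assumes H: "H=ball a e\<inter>{z. 0<=Im z}" and x: "x\<in>H" and U: "open U" "x\<in>U"
 shows "\<exists>y\<in>H\<inter>U. 0<Im y"
proof -
 have "open (ball a e\<inter>U)" using U by auto
 then obtain d where d: "0<d" "ball x d\<subseteq>ball a e\<inter>U"
  using x H U open_contains_ball by (metis Int_iff)
 have "x+\<i> * of_real (d/2)\<in>ball x d" using d by (simp add: dist_norm norm_mult)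
 thus ?thesis using d x H by (intro bexI[of _ "x+\<i> * of_real (d/2)"]) auto
qed

text \<open>The identity theorem is applied in the open half disc, and continuity extends the result
  to the part on the real axis.\<close>

lemma half_disc_identity:
 assumes H: "H=ball a e\<inter>{z. 0<=Im z}" and h: "h holomorphic_on H"
  and A: "open A" "A\<inter>H~={}" "!!z. z\<in>A\<inter>H==>h z=0" and z: "z\<in>H"
 shows "h z=0"
proof -
 let ?I = "ball a e\<inter>{z. 0<Im z}"
 have I: "open ?I" by (intro open_Int open_ball open_halfspace_Im_gt)
 have IH: "?I\<subseteq>H" using H by auto
 have conn: "connected ?I" by (intro convex_connected convex_Int convex_ball convex_halfspace_Im_gt)
 obtain x where x: "x\<in>A" "x\<in>H" using A by auto
 obtain y where y: "y\<in>H\<inter>A" "0<Im y" using half_disc_closure[OF H x(2) A(1) x(1)] by auto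
 have yI: "y\<in>?I" using y H by auto
 have zero: "h w=0" if "w\<in>?I" for w
 proof (rule analytic_continuation_open[where s = "A\<inter>?I" and s' = ?I and f = h and g = "%_. 0"])
  show "open (A\<inter>?I)" using A(1) I by auto
  show "A\<inter>?I~={}" using y yI by blast
  show "h holomorphic_on ?I" using h IH holomorphic_on_subset by blast
  show "!!z. z\<in>A\<inter>?I==>h z=0" using A(3) IH by blast
 qed (use I conn that in auto)
 have c: "continuous_on H h" using h holomorphic_on_imp_continuous_on by blast
 show ?thesis
 proof (rule ccontr)
  assume nz: "h z~=0"
  have "open (- {0::complex})" by auto
  then obtain U where U: "open U" "U\<inter>H=h -` (- {0})\<inter>H"
   using c continuous_on_open_invariant by metis
  have "z\<in>U" using U nz z by auto
  then obtain y where "y\<in>H\<inter>U" "0<Im y" using half_disc_closure[OF H z U(1)] by auto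
  thus False using U(2) zero[of y] H by auto
 qed
qed

text \<open>Agreement near a point propagates from one half disc to the next through the connected
  set \<open>T\<close>. This is the uniqueness behind \<open>continue_from\<close>, whose functions
  are holomorphic up to the real axis.\<close>

lemma identity_Cplus:
 assumes T: "openin (top_of_set Cplus) T" "connected T" and fg: "f holomorphic_on T" "g holomorphic_on T"
  and A: "openin (top_of_set Cplus) A" "A~={}" "A\<subseteq>T" "!!z. z\<in>A==>f z=g z" and z: "z\<in>T"
 shows "f z=g z"
proof -
 let ?P = "%z. \<exists>U. open U&z\<in>U&(\<forall>t\<in>U\<inter>T. f t - g t=0)"
 obtain a where a: "a\<in>A" using A by auto
 obtain U where U: "open U" "A=Cplus\<inter>U" using A(1) by (auto simp: openin_open)
 have TC: "T\<subseteq>Cplus" using T(1) openin_imp_subset by blast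
 have Pa: "?P a" using U a A(4) TC by (intro exI[of _ U]) auto
 have "?P z"
 proof (rule connected_induction_simple[OF T(2), where P = ?P and a = a])
  show "a\<in>T" "z\<in>T" "?P a" using A a z Pa by auto
  fix b assume b: "b\<in>T"
  obtain e where e: "0<e" "ball b e\<inter>Cplus\<subseteq>T" "ball b e\<inter>Cplus=ball b e\<inter>{z. 0<=Im z}"
   using Cplus_half_disc[OF T(1) b] by auto
  let ?H = "ball b e\<inter>Cplus"
  have HT: "?H=T\<inter>ball b e" using e(2) TC by auto
  have op: "openin (top_of_set T) ?H" unfolding HT by (auto intro: openin_open_Int)
  have "?P y" if x: "x\<in>?H" and y: "y\<in>?H" and Px: "?P x" for x y
  proof -
   obtain U where U: "open U" "x\<in>U" "\<forall>t\<in>U\<inter>T. f t - g t=0" using Px by blast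
   have hol: "(%t. f t - g t) holomorphic_on ?H" using fg HT
    by (intro holomorphic_intros) (auto elim: holomorphic_on_subset)
   have "f t - g t=0" if "t\<in>?H" for t
    by (rule half_disc_identity[OF e(3) hol U(1) _ _ that]) (use U x e(2) in auto)
   thus ?thesis using y TC HT by (intro exI[of _ "ball b e"]) auto
  qed
  hence "\<forall>x\<in>?H. \<forall>y\<in>?H. ?P x-->?P y" by blast
  moreover have "b\<in>?H" using b TC e(1) by auto
  ultimately show "\<exists>S. openin (top_of_set T) S&b\<in>S&(\<forall>x\<in>S. \<forall>y\<in>S. ?P x-->?P y)"
   using op by blast
 qed
 thus ?thesis using z by auto
qed

text \<open>Convex local pieces are joined by segments, and being joined by a path is an equivalence
  relation. Thus the \<open>SOME p\<close> in \<open>hatE\<close> denotes a genuine path.\<close>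

lemma valid_path_Cplus:
 assumes T: "openin (top_of_set Cplus) T" "connected T" and ab: "a\<in>T" "b\<in>T"
 shows "\<exists>p. valid_path p&path_image p\<subseteq>T&pathstart p=a&pathfinish p=b"
proof (rule connected_equivalence_relation[OF T(2) ab, of "%a b. \<exists>p. valid_path p&path_image p\<subseteq>T&pathstart p=a&pathfinish p=b"])
 show "\<exists>p. valid_path p&path_image p\<subseteq>T&pathstart p=y&pathfinish p=x"
  if "\<exists>p. valid_path p&path_image p\<subseteq>T&pathstart p=x&pathfinish p=y" for x y
  using that by (metis path_image_reversepath pathfinish_reversepath pathstart_reversepath valid_path_imp_reverse)
 show "\<exists>p. valid_path p&path_image p\<subseteq>T&pathstart p=x&pathfinish p=w"
  if "\<exists>p. valid_path p&path_image p\<subseteq>T&pathstart p=x&pathfinish p=y"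
   "\<exists>p. valid_path p&path_image p\<subseteq>T&pathstart p=y&pathfinish p=w" for x y w
 proof -
  from that(1) obtain p where p: "valid_path p" "path_image p\<subseteq>T" "pathstart p=x" "pathfinish p=y" by (elim exE conjE)
  from that(2) obtain q where q: "valid_path q" "path_image q\<subseteq>T" "pathstart q=y" "pathfinish q=w" by (elim exE conjE)
  show ?thesis using p q by (intro exI[of _ "p +++ q"]) (simp add: valid_path_join path_image_join)
 qed
 fix c assume c: "c\<in>T"
 obtain e where e: "0<e" "ball c e\<inter>Cplus\<subseteq>T" "convex (ball c e\<inter>Cplus)" using Cplus_half_disc[OF T(1) c] by auto
 have TC: "T\<subseteq>Cplus" using T(1) openin_imp_subset by blast
 have HT: "ball c e\<inter>Cplus=T\<inter>ball c e" using e(2) TC by auto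
 have *: "\<exists>p. valid_path p&path_image p\<subseteq>T&pathstart p=x&pathfinish p=y"
  if "x\<in>ball c e\<inter>Cplus" "y\<in>ball c e\<inter>Cplus" for x y
  using e(2) closed_segment_subset[OF that e(3)] by (intro exI[of _ "linepath x y"]) auto
 have "openin (top_of_set T) (ball c e\<inter>Cplus)" unfolding HT by (auto intro: openin_open_Int)
 moreover have "c\<in>ball c e\<inter>Cplus" using c TC e(1) by auto
 ultimately show "\<exists>U. openin (top_of_set T) U&c\<in>U&(\<forall>y\<in>U. \<exists>p. valid_path p&path_image p\<subseteq>T&pathstart p=c&pathfinish p=y)"
  using * by blast
qed

text \<open>The quotient is continuous with values in {1, -1}, hence constant on a connected
  set.\<close>

lemma sqrt_branch_unique:
 fixes f g :: "complex=>complex"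
 assumes S: "connected S" and c: "continuous_on S f" "continuous_on S g"
  and sq: "!!z. z\<in>S==>f z^2=g z^2" "!!z. z\<in>S==>g z~=0" and a: "a\<in>S" "f a=g a" and z: "z\<in>S"
 shows "f z=g z"
proof -
 have "(f t/g t)^2=1" if "t\<in>S" for t using sq[OF that] by (simp add: power_divide)
 hence "f t/g t\<in>{1, -1}" if "t\<in>S" for t using that power2_eq_1_iff by blast
 hence "finite ((%t. f t/g t) ` S)" by (metis (no_types, lifting) finite.emptyI finite_insert finite_subset image_subsetI)
 moreover have "continuous_on S (%t. f t/g t)" using c sq(2) by (intro continuous_on_divide) auto
 ultimately have "(%t. f t/g t) constant_on S" using S continuous_finite_range_constant by blast
 hence "f z/g z=f a/g a" using a z unfolding constant_on_def by metis
 thus ?thesis using a sq(2)[OF z] sq(2)[OF a(1)] by (simp add: field_simps)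
qed

text \<open>The difference is continuous with values in the discrete set of multiples of 2 pi
  i.\<close>

lemma log_branch_unique:
 fixes f g :: "complex=>complex"
 assumes S: "connected S" and c: "continuous_on S f" "continuous_on S g"
  and ex: "!!z. z\<in>S==>exp (f z)=exp (g z)"
 shows "\<exists>r::real. \<forall>z\<in>S. f z=g z+\<i> * of_real r"
proof (cases "S={}")
 case False
 then obtain a where a: "a\<in>S" by auto
 have int: "\<exists>n::int. f t - g t=\<i> * of_real (2 * of_int n * pi)" if "t\<in>S" for t
  using ex[OF that] exp_eq by (auto simp: algebra_simps)
 have "(%t. f t - g t) constant_on S"
 proof (rule continuous_discrete_range_constant[OF S])
  show "continuous_on S (%t. f t - g t)" using c by (intro continuous_intros)
  fix x assume x: "x\<in>S"
  show "\<exists>e>0. \<forall>y. y\<in>S&f y - g y~=f x - g x-->e<=norm (f y - g y-(f x - g x))"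
  proof (intro exI[of _ 1] conjI allI impI)
   fix y assume y: "y\<in>S&f y - g y~=f x - g x"
   obtain m n where mn: "f y - g y=\<i> * of_real (2 * of_int m * pi)" "f x - g x=\<i> * of_real (2 * of_int n * pi)"
    using int x y by metis
   hence "m~=n" using y by auto
   hence mn1: "1<=\<bar>m - n\<bar>" by auto
   have "f y - g y-(f x - g x)=\<i> * of_real (2 * of_int (m - n) * pi)" unfolding mn by (simp add: algebra_simps)
   hence "norm (f y - g y-(f x - g x))=2 * real_of_int \<bar>m - n\<bar> * pi"
    by (simp add: norm_mult abs_mult del: of_int_diff of_real_mult)
   moreover have "1*1<=real_of_int \<bar>m - n\<bar> * pi" using mn1 pi_ge_two by (intro mult_mono) linarith+
   ultimately show "1<=norm (f y - g y-(f x - g x))" by linarith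
  qed auto
 qed
 hence "f t - g t=f a - g a" if "t\<in>S" for t using a that unfolding constant_on_def by metis
 moreover obtain n :: int where "f a - g a=\<i> * of_real (2 * of_int n * pi)" using int[OF a] by auto
 ultimately show ?thesis by (intro exI[of _ "2 * of_int n * pi"]) (simp add: algebra_simps)
qed auto

lemma continue_from_eqI:
 assumes C: "openin (top_of_set Cplus) (Cplus - C)" "connected (Cplus - C)"
  and S: "openin (top_of_set Cplus) S" "S~={}" "S\<subseteq>Cplus - C"
  and g: "g holomorphic_on (Cplus - C)" "!!z. z\<in>S==>g z=f z" and z: "z\<in>Cplus - C"
 shows "continue_from S C f z=g z"
proof -
 let ?P = "%g. g holomorphic_on (Cplus - C)&(\<forall>z\<in>S. g z=f z)"
 have "?P (continue_from S C f)" unfolding continue_from_def by (rule someI[of ?P g]) (use g in auto)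
 thus ?thesis by (intro identity_Cplus[OF C _ g(1) S _ z]) (use g(2) in auto)
qed

lemma from_region_eqI:
 assumes T: "continuous_on T g" "S\<subseteq>T" "!!z. z\<in>S==>g z=f z" and z: "z\<in>T" "z\<in>closure S"
 shows "from_region S f z=g z"
proof (cases "z\<in>S")
 case False
 hence "z islimpt S" using z by (simp add: closure_def)
 hence nt: "at z within S~=bot" by (simp add: trivial_limit_within)
 have "(g\<longlongrightarrow>g z) (at z within S)" using T z by (auto simp: continuous_on_def intro: tendsto_within_subset)
 hence "(f\<longlongrightarrow>g z) (at z within S)"
  by (rule Lim_transform_eventually) (auto simp: eventually_at_filter T(3))
 from tendsto_Lim[OF nt this] show ?thesis using False by (simp add: from_region_def)
qed (use T in "auto simp: from_region_def")

text \<open>A primitive gives the same difference of end values for every admissible path, so only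
  its limit along the positive axis remains to be known.\<close>

lemma contour_integral_to_infinity:
 assumes T: "openin (top_of_set Cplus) T" "connected T" and z: "z\<in>T"
  and e: "!!z. z\<in>T==>(e has_field_derivative f z) (at z within T)"
  and R: "\<forall>\<^sub>F R in at_top. complex_of_real R\<in>T" and lim: "((%R. e (complex_of_real R))\<longlongrightarrow>a) at_top"
 shows "Lim at_top (%R::real. contour_integral
   (SOME p. valid_path p&path_image p\<subseteq>T&pathstart p = of_real R&pathfinish p=z) f)=e z - a"
proof (rule tendsto_Lim)
 have "((%R. e z - e (complex_of_real R))\<longlongrightarrow>e z - a) at_top" by (intro tendsto_intros lim)
 thus "((%R::real. contour_integral
   (SOME p. valid_path p&path_image p\<subseteq>T&pathstart p = of_real R&pathfinish p=z) f)\<longlongrightarrow>e z - a) at_top"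
 proof (rule Lim_transform_eventually, use R in eventually_elim)
  fix R :: real assume R: "complex_of_real R\<in>T"
  define p where "p=(SOME p. valid_path p&path_image p\<subseteq>T&pathstart p = of_real R&pathfinish p=z)"
  have p: "valid_path p&path_image p\<subseteq>T&pathstart p = of_real R&pathfinish p=z"
   unfolding p_def using someI_ex[OF valid_path_Cplus[OF T R z]] .
  have "(f has_contour_integral e (pathfinish p) - e (pathstart p)) p"
   by (rule contour_integral_primitive[OF e]) (use p in auto)
  thus "e z - e (complex_of_real R)=contour_integral (SOME p. valid_path p&path_image p\<subseteq>T&pathstart p = of_real R&pathfinish p=z) f"
   unfolding p_def[symmetric] using p contour_integral_unique by force
 qed
qed simp

section \<open>Connectedness of the half plane cut along a level curve\<close>

context lam_range
begin

lemma level_closedin: "openin (top_of_set Cplus) (Cplus - level_set lam)"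
 using region_open by (simp flip: region_union add: openin_Un)

lemma gamma_open: "openin (top_of_set Cplus) (Cplus - g1)" "openin (top_of_set Cplus) (Cplus - g2)" "openin (top_of_set Cplus) (Cplus - g3)"
proof -
 have *: "openin (top_of_set Cplus) (Cplus - level_set lam\<inter>closure A\<inter>closure B)" for A B
 proof -
  have "Cplus - level_set lam\<inter>closure A\<inter>closure B =
    (Cplus - level_set lam)\<union>(Cplus\<inter>- (closure A\<inter>closure B))" by auto
  thus ?thesis using level_closedin by (auto intro!: openin_Un openin_open_Int)
 qed
 show "openin (top_of_set Cplus) (Cplus - g1)" "openin (top_of_set Cplus) (Cplus - g2)" "openin (top_of_set Cplus) (Cplus - g3)"
  using * by (simp_all flip: gamma1_eq gamma2_eq gamma3_eq add: gamma1_def gamma2_def gamma3_def)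
qed

lemma gamma_cover: "level_set lam=g1\<union>g2\<union>g3"
proof -
 have False if "z\<in>Cplus" "lev lam z=0" "2<norm z" "Re z<2 * lam" for z
  using lev_outside_left[OF that(1,3,4)] that(2) by simp
 thus ?thesis unfolding level_set_lev g1_def g2_def g3_def by force
qed

lemma gamma_inter: "g1\<inter>g2={tp}" "g1\<inter>g3={tp}" "g2\<inter>g3={tp}"
proof -
 have a: "z=tp" if "z\<in>g1" "norm z<=2" for z
  using that not_on_circle[of z] by (auto simp: g1_def)
 have b: "z=tp" if "z\<in>g2" "z\<in>g3" for z
 proof (rule ccontr)
  assume n: "z~=tp"
  have z: "z\<in>Cplus" "lev lam z=0" "Re z=2 * lam" "norm z<=2" using that by (auto simp: g2_def g3_def)
  hence "norm z<2" using not_on_circle[OF z(1,2) n] by simp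
  thus False using lev_line_below[OF z(1,3)] z(2) by simp
 qed
 have "g1\<inter>g2\<subseteq>{tp}" "g1\<inter>g3\<subseteq>{tp}" "g2\<inter>g3\<subseteq>{tp}" using a b by (auto simp: g2_def g3_def)
 thus "g1\<inter>g2={tp}" "g1\<inter>g3={tp}" "g2\<inter>g3={tp}" using tp_g by blast+
qed

lemma continuous_lev_slit: "continuous_on {z\<in>Cplus. Re z~=2 * lam\<or>norm z<2} (lev lam)"
proof -
 have "continuous_on {z\<in>Cplus. Re z~=2 * lam\<or>norm z<2} (%z. levB (csq lam z) z)"
  by (rule levB_continuous[OF continuous_csq_slit]) (auto simp: csq_sq)
 thus ?thesis by (rule continuous_on_eq) (simp add: lev_levB)
qed

text \<open>The intermediate value theorem finds zeros of the level on the positive axis, on the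
  negative axis and on the circle of radius 3. Such points other than \<open>tp\<close> are what
  links neighbouring regions once the cut has removed \<open>tp\<close>.\<close>

lemma gamma_nonempty: "\<exists>x. 0<x&x<2&complex_of_real x\<in>g3 - {tp}" "\<exists>x. x<0&complex_of_real x\<in>g2 - {tp}" "g1 - {tp}~={}"
proof -
 obtain e where e: "0<e" "e<2" "\<forall>z\<in>Cplus. norm z<e-->lev lam z<0" using lev_neg_near_0 by auto
 have ntp: "complex_of_real x~=tp" for x using yt(1) Im_tp by (metis Im_complex_of_real less_irrefl)
 have cont: "continuous_on {a..b} (%x. lev lam (complex_of_real x))" if "0<a\<or>b<0" for a b :: real
  by (rule continuous_on_compose2[OF continuous_lev_slit]) (use that lam0 lam1 in "auto intro!: continuous_intros of_real_Cplus")
 have neg: "lev lam (of_real (e/2))<0" "lev lam (of_real (-(e/2)))<0"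
  using e(3) of_real_Cplus[of "e/2"] of_real_Cplus[of "-(e/2)"] e(1) by auto
 have "\<exists>x\<ge>e/2. x<=2&lev lam (of_real x)=0"
  by (rule IVT') (use neg lev_real_ge_2[of 2] e lam1 in "auto intro!: cont")
 then obtain x where x: "e/2<=x" "x<=2" "lev lam (of_real x)=0" by auto
 have "2 * lam<=x"
 proof (rule ccontr)
  assume "\<not> 2 * lam<=x"
  thus False using lev_real_small[of x] x e by simp
 qed
 moreover have "x~=2" using x lev_real_ge_2[of 2] by auto
 ultimately show "\<exists>x. 0<x&x<2&complex_of_real x\<in>g3 - {tp}" using x e ntp[of x] of_real_Cplus[of x]
  by (intro exI[of _ x]) (simp add: g3_def)
 have l2: "0<lev lam (of_real (- 2))"
  by (rule lev_circle) (use ntp[of "-2"] of_real_Cplus[of "-2"] in auto)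
 have "\<exists>x\<ge>-2. x<=-(e/2)&lev lam (of_real x)=0"
  by (rule IVT2') (use neg l2 e lam0 in "auto intro!: cont")
 then obtain y where y: "-2<=y" "y<=-(e/2)" "lev lam (of_real y)=0" by auto
 thus "\<exists>x. x<0&complex_of_real x\<in>g2 - {tp}" using e ntp[of y] of_real_Cplus[of y] lam0
  by (intro exI[of _ y]) (simp add: g2_def)
 \<comment> \<open>The angle at which the circle of radius 3 meets the line Re z = 2 lam.\<close>
 obtain b where b: "0<b" "b<=pi" "3 * cos b=2 * lam"
 proof -
  have "2 * lam/3<=1" "-1<=2 * lam/3" "2 * lam/3<1" using lam0 lam1 by auto
  thus ?thesis using that[of "arccos (2 * lam/3)"] arccos_bounded[of "2 * lam/3"] cos_arccos[of "2 * lam/3"] cos_zero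
   by (metis less_eq_real_def less_irrefl nonzero_mult_div_cancel_left times_divide_eq_right zero_neq_numeral)
 qed
 have pC: "pol 3 t\<in>{z\<in>Cplus. 2 * lam<=Re z}" if "t\<in>{0..b}" for t
  using that b pol_Cplus[of 3 t] cos_monotone_0_pi_le[of t b] by auto
 have c: "continuous_on {0..b} (%t. lev lam (pol 3 t))"
 proof -
  have "continuous_on {z\<in>Cplus. 2 * lam<=Re z} (%z. levB (csq lam z) z)"
   by (rule levB_continuous[OF continuous_csq_right]) (auto simp: csq_sq)
  hence "continuous_on {z\<in>Cplus. 2 * lam<=Re z} (lev lam)" by (rule continuous_on_eq) (simp add: lev_levB)
  thus ?thesis by (rule continuous_on_compose2) (use pC in "auto intro: pol_continuous")
 qed
 have "\<exists>t\<ge>0. t<=b&lev lam (pol 3 t)=0"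
 proof (rule IVT2'[OF _ _ _ c])
  show "lev lam (pol 3 b)<=0" using lev_line_above(1)[of "pol 3 b"] pC[of b] b by auto
  show "0<=lev lam (pol 3 0)" using lev_real_ge_2[of 3] of_real_pol(1)[of 3] by simp
 qed (use b in auto)
 then obtain t where t: "0<=t" "t<=b" "lev lam (pol 3 t)=0" by auto
 have "norm (pol 3 t)=3" by simp
 hence "pol 3 t~=tp" using norm_tp by (metis numeral_eq_iff semiring_norm(88))
 moreover have "pol 3 t\<in>g1" using t pC[of t] by (auto simp: g1_def)
 ultimately show "g1 - {tp}~={}" by auto
qed

lemma g_closure: "g1 - {tp}\<subseteq>closure RB\<inter>closure RC" "g2 - {tp}\<subseteq>closure RA\<inter>closure RC" "g3 - {tp}\<subseteq>closure RA\<inter>closure RB"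
 using gamma1_eq gamma2_eq gamma3_eq by (auto simp: gamma1_def gamma2_def gamma3_def Sm1_eq S0_eq S1_eq)

text \<open>Adding boundary points to a connected set keeps it connected, so the sets G and H
  without \<open>tp\<close> glue the three regions in a row.\<close>

lemma connected_two_regions:
 assumes "connected A" "connected B" "connected C" "G - {tp}\<subseteq>closure A\<inter>closure B" "H - {tp}\<subseteq>closure B\<inter>closure C" "G - {tp}~={}" "H - {tp}~={}"
 shows "connected (A\<union>B\<union>C\<union>(G - {tp})\<union>(H - {tp}))"
proof -
 have 1: "connected (A\<union>(G - {tp}))" by (rule connected_intermediate_closure[OF assms(1)]) (use assms closure_subset in auto)
 have 2: "connected (B\<union>(G - {tp})\<union>(H - {tp}))" by (rule connected_intermediate_closure[OF assms(2)]) (use assms closure_subset in auto)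
 have 3: "connected (C\<union>(H - {tp}))" by (rule connected_intermediate_closure[OF assms(3)]) (use assms closure_subset in auto)
 have "connected (A\<union>(G - {tp})\<union>(B\<union>(G - {tp})\<union>(H - {tp})))" using assms(6) by (intro connected_Un[OF 1 2]) auto
 hence "connected (A\<union>(G - {tp})\<union>(B\<union>(G - {tp})\<union>(H - {tp}))\<union>(C\<union>(H - {tp})))" 
  using assms(7) by (intro connected_Un[OF _ 3]) auto
 moreover have "A\<union>(G - {tp})\<union>(B\<union>(G - {tp})\<union>(H - {tp}))\<union>(C\<union>(H - {tp}))=A\<union>B\<union>C\<union>(G - {tp})\<union>(H - {tp})" by auto
 ultimately show ?thesis by simp
qed

lemma cut_connected: "connected (Cplus - g1)" "connected (Cplus - g2)" "connected (Cplus - g3)"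
proof -
 have un: "Cplus=RA\<union>RB\<union>RC\<union>(g1\<union>g2\<union>g3)" using region_union gamma_cover level_set_def by auto
 have R: "(RA\<union>RB\<union>RC)\<inter>(g1\<union>g2\<union>g3)={}" using region_union gamma_cover by auto
 have "Cplus - g1=RB\<union>RA\<union>RC\<union>(g3 - {tp})\<union>(g2 - {tp})" "Cplus - g2=RA\<union>RB\<union>RC\<union>(g3 - {tp})\<union>(g1 - {tp})"
  "Cplus - g3=RA\<union>RC\<union>RB\<union>(g2 - {tp})\<union>(g1 - {tp})" 
  using un R gamma_inter tp_g by blast+
 moreover have "connected (RB\<union>RA\<union>RC\<union>(g3 - {tp})\<union>(g2 - {tp}))" "connected (RA\<union>RB\<union>RC\<union>(g3 - {tp})\<union>(g1 - {tp}))"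
  "connected (RA\<union>RC\<union>RB\<union>(g2 - {tp})\<union>(g1 - {tp}))"
  using connected_RA connected_RB connected_RC g_closure gamma_nonempty by (intro connected_two_regions; blast)+
 ultimately show "connected (Cplus - g1)" "connected (Cplus - g2)" "connected (Cplus - g3)" by simp_all
qed

lemma region_in_cut: "RA\<subseteq>Cplus - g1" "RA\<subseteq>Cplus - g2" "RA\<subseteq>Cplus - g3" "RC\<subseteq>Cplus - g1" "RC\<subseteq>Cplus - g2" "RC\<subseteq>Cplus - g3"
 by (auto simp: RA_def RC_def g1_def g2_def g3_def)

section \<open>Explicit principal values\<close>

lemma pdom_eq: "pdom lam=Cplus - g2" by (simp add: pdom_def gamma2_eq)

lemma positive_pdom: "0<x==>complex_of_real x\<in>pdom lam&mpv (of_real x)=1"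
proof -
 assume x: "0<x"
 have C: "complex_of_real x\<in>Cplus" using x of_real_Cplus by auto
 have "lev lam (of_real x)<0" if "x<=2 * lam" using lev_real_small x that by auto
 thus ?thesis using C by (force simp: pdom_eq g2_def mpv_def)
qed

lemma Zb_continuous: "continuous_on (Cplus - g2) (Zb mpv)" "continuous_on (Cplus - g1) (Zb m1)" "continuous_on (Cplus - g3) (Zb m3)"
 and qb_continuous: "continuous_on (Cplus - g2) (qb mpv)" "continuous_on (Cplus - g1) (qb m1)" "continuous_on (Cplus - g3) (qb m3)"
 using cont_pv cont_m1 cont_m3 unfolding continuous_on_eq_continuous_within Zb_def qb_def by blast+

text \<open>The two strict inequalities make both arguments of the logarithms in xi positive on the
  positive axis, so that xi is real there.\<close>

lemma positive_branch:
 assumes x: "0<x"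
 shows "Zb mpv (of_real x) = of_real (sqrt ((x-2 * lam)\<^sup>2+4*(1 - lam\<^sup>2)))"
  "\<bar>x-2 * lam\<bar><sqrt ((x-2 * lam)\<^sup>2+4*(1 - lam\<^sup>2))"
  "\<bar>lam * x-2\<bar><sqrt ((x-2 * lam)\<^sup>2+4*(1 - lam\<^sup>2))"
proof -
 have "Q (of_real x) = of_real ((x-2 * lam)\<^sup>2+4*(1 - lam\<^sup>2))"
  by (simp add: Zsq_def power2_eq_square algebra_simps)
 moreover have "0<=(x-2 * lam)\<^sup>2+4*(1 - lam\<^sup>2)" using lam_sq by (smt (verit) zero_le_power2)
 ultimately show "Zb mpv (of_real x) = of_real (sqrt ((x-2 * lam)\<^sup>2+4*(1 - lam\<^sup>2)))"
  using positive_pdom[OF x] by (simp add: Zb_def csq_def)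
 show "\<bar>x-2 * lam\<bar><sqrt ((x-2 * lam)\<^sup>2+4*(1 - lam\<^sup>2))"
  using lam_sq by (intro real_less_rsqrt) simp
 have "(x-2 * lam)\<^sup>2+4*(1 - lam\<^sup>2)-(lam * x-2)\<^sup>2=(1 - lam\<^sup>2) * x\<^sup>2"
  by (simp add: power2_eq_square algebra_simps)
 moreover have "0<(1 - lam\<^sup>2) * x\<^sup>2" using lam_sq x by simp
 ultimately have "\<bar>lam * x-2\<bar>\<^sup>2<(x-2 * lam)\<^sup>2+4*(1 - lam\<^sup>2)" unfolding power2_abs by linarith
 thus "\<bar>lam * x-2\<bar><sqrt ((x-2 * lam)\<^sup>2+4*(1 - lam\<^sup>2))" by (rule real_less_rsqrt)
qed

lemma pdom_nz: "z\<in>pdom lam==>Zb mpv z~=0"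
 using csq_nz tp_g m_power4(1)[of z] by (auto simp: pdom_eq Zb_def)

lemma positive_Zb: "0<x==>0<Re (Zb mpv (of_real x))&Im (Zb mpv (of_real x))=0"
 using positive_branch[of x] by (smt (verit) Im_complex_of_real Re_complex_of_real)

lemma Z_pv_eq: "z\<in>pdom lam==>Z_pv lam z=Zb mpv z"
proof -
 assume z: "z\<in>pdom lam"
 let ?P = "%Z. continuous_on (pdom lam) Z&(\<forall>z\<in>pdom lam. (Z z)\<^sup>2=Q z) &
   (\<forall>x::real. 0<x-->Im (Z (of_real x))=0&0<Re (Z (of_real x)))"
 have ex: "?P (Zb mpv)" using Zb_continuous(1) positive_Zb Zb_sq[of mpv, OF m_power4(1)] by (simp add: pdom_eq)
 have P: "?P (Z_pv lam)" unfolding Z_pv_def by (rule someI[of ?P, OF ex])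
 show ?thesis
 proof (rule sqrt_branch_unique[OF _ _ _ _ pdom_nz _ _ z])
  show "connected (pdom lam)" "complex_of_real 1\<in>pdom lam" using cut_connected(2) positive_pdom[of 1] by (simp_all add: pdom_eq)
  show "Z_pv lam (of_real 1)=Zb mpv (of_real 1)"
  proof (rule sq_eq_Re_pos)
   show "Z_pv lam (of_real 1)^2=Zb mpv (of_real 1)^2" using P ex positive_pdom[of 1] by (metis zero_less_one)
   show "0<Re (Z_pv lam (of_real 1))" "0<Re (Zb mpv (of_real 1))" using P ex zero_less_one by blast+
  qed
 qed (use P ex in auto)
qed

lemma rt_pv_eq: "z\<in>pdom lam==>rt_pv lam z=qb mpv z"
proof -
 assume z: "z\<in>pdom lam"
 let ?P = "%q. continuous_on (pdom lam) q&(\<forall>z\<in>pdom lam. (q z)\<^sup>2=z/Z_pv lam z) &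
   (\<forall>x::real. 0<x-->Im (q (of_real x))=0&0<Re (q (of_real x)))"
 have "Im (qb mpv (of_real x))=0&0<Re (qb mpv (of_real x))" if x: "0<x" for x
 proof -
  have "Zb mpv (of_real x)=csq lam (of_real x)" using positive_pdom[OF x] by (simp add: Zb_def)
  then obtain s where s: "csq lam (of_real x) = of_real s" "0<s"
   using positive_Zb[OF x] by (metis complex_eq_iff Im_complex_of_real Re_complex_of_real)
  have "qb mpv (of_real x)=csqrt (of_real (x/s))" using positive_pdom[OF x] s by (simp add: qb_def q0_def)
  thus ?thesis using x s by simp
 qed
 hence ex: "?P (qb mpv)" using qb_continuous(1) qb_sq[of mpv, OF m_power4(1)] Z_pv_eq by (simp add: pdom_eq)
 have P: "?P (rt_pv lam)" unfolding rt_pv_def by (rule someI[of ?P, OF ex])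
 show ?thesis
 proof (rule sqrt_branch_unique[OF _ _ _ _ _ _ _ z])
  show "connected (pdom lam)" "complex_of_real 1\<in>pdom lam" using cut_connected(2) positive_pdom[of 1] by (simp_all add: pdom_eq)
  show "rt_pv lam (of_real 1)=qb mpv (of_real 1)"
  proof (rule sq_eq_Re_pos)
   show "rt_pv lam (of_real 1)^2=qb mpv (of_real 1)^2" using P ex positive_pdom[of 1] by (metis zero_less_one)
   show "0<Re (rt_pv lam (of_real 1))" "0<Re (qb mpv (of_real 1))" using P ex zero_less_one by blast+
  qed
  show "qb mpv w~=0" if "w\<in>pdom lam" for w
   using qb_sq[of mpv w, OF m_power4(1)] that pdom_nz[OF that] by (auto simp: pdom_def Cplus_def)
 qed (use P ex in auto)
qed

text \<open>Two choices of the logarithms differ by imaginary constants on the connected domain, so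
  the two versions of xi differ by a single imaginary constant. Reality on the positive axis makes
  it 0.\<close>

lemma xi_pv_eq: "z\<in>pdom lam==>xi_pv lam z=xiB lam (Zb mpv z) z"
proof -
 assume z: "z\<in>pdom lam"
 let ?L = "%\<xi> L1 L2. continuous_on (pdom lam) L1&continuous_on (pdom lam) L2 &
    (\<forall>z\<in>pdom lam. exp (L1 z)=Z_pv lam z + z-2 * of_real lam &
    exp (L2 z)=(Z_pv lam z - of_real lam * z+2)/z &
    \<xi> z=Z_pv lam z/2 - of_real lam * L1 z - L2 z)"
 let ?P = "%\<xi>. (\<exists>L1 L2. ?L \<xi> L1 L2)&(\<forall>x::real. 0<x-->Im (\<xi> (of_real x))=0)"
 let ?\<xi> = "%z. xiB lam (Zb mpv z) z"
 let ?L1 = "%z. ulog (Zb mpv z + z-2 * of_real lam)" and ?L2 = "%z. - ulog (z/(Zb mpv z - of_real lam * z+2))"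
 have sq: "Zb mpv w^2=Q w" for w by (rule Zb_sq[of mpv, OF m_power4(1)])
 have wC: "w\<in>Cplus" "w~=0" if "w\<in>pdom lam" for w using that by (auto simp: pdom_def Cplus_def)
 have cu: "continuous (at w within A) ulog" if "0<=Im w" "w~=0" for w A
  using has_field_derivative_imp_has_derivative[OF ulog_has_derivative[OF that]] has_derivative_continuous by blast
 have co: "continuous_on (pdom lam) (%z. ulog (g z))" if "continuous_on (pdom lam) g" "!!w. w\<in>pdom lam==>0<=Im (g w)&g w~=0" for g
  by (rule continuous_on_compose2[of "{w. 0<=Im w&w~=0}"]) (use that cu in "auto simp: continuous_on_eq_continuous_within")
 have nz: "Zb mpv w + w-2 * of_real lam~=0" "Zb mpv w - of_real lam * w+2~=0" if "w\<in>pdom lam" for w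
  using branch_nonzero[OF sq wC(2)[OF that]] by auto
 have Lex: "?L ?\<xi> ?L1 ?L2"
 proof (intro conjI ballI)
  show "continuous_on (pdom lam) ?L1" using Zb_continuous(1) nz branch_upper(1)[OF sq wC(1)]
   by (intro co continuous_intros) (auto simp: pdom_eq)
  have "continuous_on (pdom lam) (%z. ulog (z/(Zb mpv z - of_real lam * z+2)))" using Zb_continuous(1) nz branch_upper(2)[OF sq wC(1)] wC
   by (intro co continuous_intros) (auto simp: pdom_eq)
  thus "continuous_on (pdom lam) ?L2" by (intro continuous_intros)
  fix w assume w: "w\<in>pdom lam"
  show "exp (?L1 w)=Z_pv lam w + w-2 * of_real lam" "exp (?L2 w)=(Z_pv lam w - of_real lam * w+2)/w"
   "?\<xi> w=Z_pv lam w/2 - of_real lam*?L1 w-?L2 w"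
   using Z_pv_eq[OF w] nz[OF w] wC[OF w] by (auto simp: exp_ulog exp_minus xiB_def)
 qed
 have Im0: "Im (?\<xi> (of_real x))=0" if x: "0<x" for x
 proof -
  define s where "s=sqrt ((x-2 * lam)\<^sup>2+4*(1 - lam\<^sup>2))"
  have s: "Zb mpv (of_real x) = of_real s" "\<bar>x-2 * lam\<bar><s" "\<bar>lam * x-2\<bar><s"
   using positive_branch[OF x] by (auto simp: s_def)
  have "?\<xi> (of_real x) = of_real (s/2) - of_real lam * ulog (of_real (s + x-2 * lam)) + ulog (of_real (x/(s - lam * x+2)))"
   unfolding xiB_def s by simp
  moreover have "0<s + x-2 * lam" "0<x/(s - lam * x+2)" using s x by (auto intro!: divide_pos_pos)
  ultimately show ?thesis by (simp only: ulog_real) simp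
 qed
 have ex: "?P ?\<xi>" using Lex Im0 by blast
 have P: "?P (xi_pv lam)" unfolding xi_pv_def by (rule someI[of ?P, OF ex])
 then obtain L1 L2 where L: "?L (xi_pv lam) L1 L2" by blast
 have conn: "connected (pdom lam)" using cut_connected(2) by (simp add: pdom_eq)
 obtain r1 where r1: "\<forall>z\<in>pdom lam. L1 z=?L1 z+\<i> * of_real r1"
  using log_branch_unique[OF conn, of L1 ?L1] L Lex by auto
 obtain r2 where r2: "\<forall>z\<in>pdom lam. L2 z=?L2 z+\<i> * of_real r2"
  using log_branch_unique[OF conn, of L2 ?L2] L Lex by auto
 have eq: "xi_pv lam w=?\<xi> w-\<i> * of_real (lam * r1 + r2)" if "w\<in>pdom lam" for w
 proof -
  have "xi_pv lam w=Z_pv lam w/2 - of_real lam * L1 w - L2 w" using L that by blast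
  also have "\<dots>=Zb mpv w/2 - of_real lam*(?L1 w+\<i> * of_real r1)-(?L2 w+\<i> * of_real r2)"
   using r1 r2 that Z_pv_eq by simp
  finally show ?thesis by (simp add: xiB_def algebra_simps)
 qed
 have "Im (xi_pv lam (of_real 1))=0" using P zero_less_one by blast
 hence "lam * r1 + r2=0" using eq[of "of_real 1"] positive_pdom[of 1] Im0[of 1] by simp
 thus ?thesis using eq[OF z] by simp
qed

end

section \<open>Polynomial form of the coefficients\<close>

lemma degree_diff_scaled:
 fixes p q :: "complex poly"
 assumes "degree p<=Suc d" "degree q<=Suc d" "coeff p (Suc d)=coeff q (Suc d)"
 shows "degree (p - q)<=d"
proof (rule degree_le, intro allI impI)
 fix i assume "d<i"
 then consider "i=Suc d" | "Suc d<i" by linarith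
 thus "coeff (p - q) i=0" using assms by cases (auto simp: coeff_eq_0)
qed

text \<open>The coefficient of X^n will stand for a numerator over Z^(3 n), so \<open>d\<close>
  counts the guaranteed order of vanishing at infinity.\<close>

definition fdeg :: "nat=>complex poly fps=>bool" where
 "fdeg d f\<longleftrightarrow>(\<forall>n. fps_nth f n=0\<or>degree (fps_nth f n) + d<=3 * n)"

lemma fdeg_sum_poly:
 fixes f :: "'b=>complex poly"
 assumes "!!i. i\<in>I==>f i=0\<or>degree (f i) + d<=N"
 shows "sum f I=0\<or>degree (sum f I) + d<=N"
proof (cases "\<exists>i\<in>I. f i~=0")
 case True
 hence "d<=N" using assms by fastforce
 moreover have "degree (sum f I)<=N - d"
  by (cases "finite I", rule degree_sum_le) (use assms in fastforce)+
 ultimately show ?thesis by auto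
qed (simp add: sum.neutral)

lemma fdeg_mult: "fdeg a f==>fdeg b g==>fdeg (a + b) (f * g)"
 unfolding fdeg_def fps_mult_nth
proof (intro allI, rule fdeg_sum_poly)
 fix n i :: nat
 assume f: "\<forall>n. fps_nth f n=0\<or>degree (fps_nth f n) + a<=3 * n" and g: "\<forall>n. fps_nth g n=0\<or>degree (fps_nth g n) + b<=3 * n"
  and i: "i\<in>{0..n}"
 show "fps_nth f i * fps_nth g (n - i)=0\<or>degree (fps_nth f i * fps_nth g (n - i))+(a + b)<=3 * n"
  using f[rule_format, of i] g[rule_format, of "n - i"] i degree_mult_le[of "fps_nth f i" "fps_nth g (n - i)"] by auto
qed

lemma fdeg_power: "fdeg a f==>fdeg (a * Suc k) (f^Suc k)"
proof (induction k)
 case (Suc k)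
 thus ?case using fdeg_mult[of a f "a * Suc k" "f^Suc k"] by simp
qed simp

context lam_range
begin

section \<open>Differentiation of polynomials over powers of Z\<close>

definition Qp :: "complex poly" where "Qp=[:4, - 4 * of_real lam,1:]"

lemma poly_Qp: "poly Qp z=Q z" by (simp add: Qp_def Zsq_def algebra_simps power2_eq_square)
lemma pderiv_Qp: "pderiv Qp=[:- 4 * of_real lam,2:]" by (simp add: Qp_def pderiv_pCons)
lemma degree_Qp: "degree Qp=2" by (simp add: Qp_def)

text \<open>Numerator of a derivative: (A Q^(-m))' = \<open>Top m A\<close> Q^(-m-1). With Z^2 = Q
  the exponent m is half the power of Z.\<close>

definition Top :: "complex=>complex poly=>complex poly" where
 "Top m A=pderiv A * Qp - smult m (pderiv Qp * A)"

lemma Top_add: "Top m (A + B)=Top m A + Top m B"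
 by (simp add: Top_def pderiv_add algebra_simps smult_add_right)

lemma Top_smult: "Top m (smult c A)=smult c (Top m A)"
 by (simp add: Top_def pderiv_smult smult_diff_right mult.commute)

lemma Top_monom: "Top m (monom b k)=monom (b*(of_nat k-2 * m)) (Suc k) + monom (b * of_real lam*4*(m - of_nat k)) k + monom (4 * of_nat k * b) (k-1)"
proof -
 have "poly (Top m (monom b k)) z=poly (monom (b*(of_nat k-2 * m)) (Suc k) + monom (b * of_real lam*4*(m - of_nat k)) k + monom (4 * of_nat k * b) (k-1)) z" for z
  by (cases k) (simp_all add: Top_def pderiv_monom poly_monom poly_Qp Zsq_def pderiv_Qp algebra_simps power2_eq_square)
 thus ?thesis by (simp add: poly_eq_poly_eq_iff[symmetric] fun_eq_iff)
qed

text \<open>Applied to a monomial of degree k, \<open>Top m\<close> has leading factor k - 2 m in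
  degree k + 1. While this is nonzero the top coefficient of \<open>p\<close> can be removed, until
  a constant is left.\<close>

lemma Top_reduce:
 assumes m: "!!k. k<d==>of_nat k~=2 * m" and p: "degree p<=d"
 shows "\<exists>A c. (degree A<d\<or>A=0)&p=Top m A + [:c:]"
 using assms
proof (induction d arbitrary: p)
 case 0
 then obtain c where "p=[:c:]" using degree_eq_zeroE by blast
 thus ?case by (intro exI[of _ 0] exI[of _ c]) (simp add: Top_def)
next
 case (Suc d)
 define b where "b=coeff p (Suc d)/(of_nat d-2 * m)"
 have b: "b*(of_nat d-2 * m)=coeff p (Suc d)" using Suc.prems(1)[of d] by (simp add: b_def)
 have deg: "degree (p - Top m (monom b d))<=d"
 proof (rule degree_diff_scaled)
  show "degree (Top m (monom b d))<=Suc d" unfolding Top_monom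
   by (intro degree_add_le order_trans[OF degree_monom_le]) auto
  show "coeff p (Suc d)=coeff (Top m (monom b d)) (Suc d)" unfolding Top_monom using b by (simp add: coeff_monom)
 qed (use Suc.prems in auto)
 obtain A c where A: "degree A<d\<or>A=0" "p - Top m (monom b d)=Top m A + [:c:]"
  using Suc.IH[OF _ deg] Suc.prems by auto
 have "degree (A + monom b d)<Suc d"
  using A(1) degree_monom_le[of b d] degree_add_le[of A d "monom b d"] by fastforce
 moreover have "p=Top m (A + monom b d) + [:c:]" using A(2) by (simp add: Top_add algebra_simps)
 ultimately show ?case by blast
qed

lemma Top_mult_Qp: "Top (m+1) (Qp * B)=Qp * Top m B"
 by (simp add: Top_def pderiv_mult algebra_simps smult_add_left smult_diff_right smult_add_right)

lemma Qp_disc: "smult 4 Qp - pderiv Qp * pderiv Qp=[:16 * of_real (1 - lam\<^sup>2):]"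
 by (simp add: pderiv_Qp) (simp add: Qp_def power2_eq_square)

text \<open>Deals with the constant left by \<open>Top_reduce\<close>: Q^(-m-3/2) has an algebraic
  primitive. The induction rests on the fact that 4 Q - Q'^2 is the constant 16 (1 - lam^2), which
  is not 0.\<close>

lemma Top_one: "\<exists>A. degree A<=2 * m+1&Top (of_nat m+1/2) A=1"
proof (induction m)
 case 0
 have "Top (1/2) (pderiv Qp)=[:8 * of_real (1 - lam\<^sup>2):]"
  by (simp add: Top_def pderiv_Qp Qp_def pderiv_pCons power2_eq_square)
 hence "Top (of_nat 0+1/2) (smult (1/(8 * of_real (1 - lam\<^sup>2))) (pderiv Qp))=1"
  using of_real_lam_nz(1) by (simp add: Top_smult one_pCons del: of_real_diff)
 moreover have "degree (smult (1/(8 * of_real (1 - lam\<^sup>2))) (pderiv Qp))<=2*0+1" by (simp add: pderiv_Qp)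
 ultimately show ?case by blast
next
 case (Suc m)
 then obtain B where B: "degree B<=2 * m+1" "Top (of_nat m+1/2) B=1" by blast
 define M :: complex where "M = of_nat m+1/2+1"
 have "2 * M = of_nat (2 * m+3)" by (simp add: M_def algebra_simps)
 hence M: "M~=0" by (metis mult_zero_right of_nat_eq_0_iff add_eq_0_iff_both_eq_0 zero_neq_numeral)
 have 1: "Top M (Qp * B)=Qp" using Top_mult_Qp[of "of_nat m+1/2" B] B(2) by (simp add: M_def)
 have 2: "Top M (pderiv Qp)=smult 2 Qp - smult M (pderiv Qp * pderiv Qp)"
  by (simp add: Top_def pderiv_Qp Qp_def pderiv_pCons)
 \<comment> \<open>The weights make the multiples of Q add up to 4 Q and the multiple of Q'^2 equal
   to -1, which is \<open>Qp_disc\<close>.\<close>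
 let ?A = "smult (4-2/M) (Qp * B) + smult (1/M) (pderiv Qp)"
 have "Top M ?A=smult (4-2/M) Qp + smult (1/M) (smult 2 Qp - smult M (pderiv Qp * pderiv Qp))"
  by (simp only: Top_add Top_smult 1 2)
 also have "\<dots>=smult 4 Qp - pderiv Qp * pderiv Qp"
  using M by (simp add: smult_diff_right smult_diff_left)
 finally have "Top M (smult (1/(16 * of_real (1 - lam\<^sup>2))) ?A)=1"
  unfolding Qp_disc Top_smult using of_real_lam_nz(1) by (simp add: one_pCons del: of_real_diff)
 moreover have dA: "degree ?A<=2 * m+3"
 proof (rule degree_add_le)
  show "degree (smult (4-2/M) (Qp * B))<=2 * m+3"
   using degree_mult_le[of Qp B] B(1) degree_smult_le[of "4-2/M" "Qp * B"] degree_Qp by linarith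
  show "degree (smult (1/M) (pderiv Qp))<=2 * m+3" by (simp add: pderiv_Qp)
 qed
 hence "degree (smult (1/(16 * of_real (1 - lam\<^sup>2))) ?A)<=2 * Suc m+1"
  using order_trans[OF degree_smult_le dA] by simp
 ultimately show ?case unfolding M_def by (intro exI[of _ "smult (1/(16 * of_real (1 - lam\<^sup>2))) ?A"]) (simp add: M_def algebra_simps)
qed

text \<open>For a half-integral exponent the critical degree is 2 m + 1, which the degrees reduced
  by \<open>Top_reduce\<close> do not reach.\<close>

lemma Top_surj:
 assumes "degree p<=2 * m+1"
 shows "\<exists>A. degree A<=2 * m+1&Top (of_nat m+1/2) A=p"
proof -
 have ne: "of_nat k~=2*(of_nat m+1/2::complex)" if "k<2 * m+1" for k
 proof
  assume "of_nat k=2*(of_nat m+1/2::complex)"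
  hence "(of_nat k::complex) = of_nat (2 * m+1)" by (simp add: algebra_simps)
  thus False using that by (simp only: of_nat_eq_iff)
 qed
 obtain A c where A: "degree A<2 * m+1\<or>A=0" "p=Top (of_nat m+1/2) A + [:c:]"
  using Top_reduce[OF ne assms] by auto
 obtain B where B: "degree B<=2 * m+1" "Top (of_nat m+1/2) B=1" using Top_one by blast
 have "Top (of_nat m+1/2) (A + smult c B)=p" using A B by (simp add: Top_add Top_smult one_pCons)
 moreover have "degree (A + smult c B)<=2 * m+1"
  using A(1) B(1) degree_smult_le[of c B] by (intro degree_add_le) auto
 ultimately show ?thesis by blast
qed

text \<open>Numerators of the coefficients: F_s is \<open>Pc s\<close> over Z^(3 s + 3). The
  recursion is that of \<open>hatF\<close> with differentiation expressed by
  \<open>Top\<close>.\<close>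

fun Pc :: "nat=>complex poly" where
 "Pc 0=0"
| "Pc (Suc 0)=smult (- 1/2) [:0,16 * of_real lam,4 * of_real lam^2-16,0,1:]"
| "Pc (Suc (Suc s)) = - ([:0,1:] * Top (3 * of_nat (s+2)/2) (Pc (Suc s)))
   - smult (1/2) (\<Sum>j\<in>{1..s}. Pc j * Pc (Suc s - j))"

lemma Pc_0: "poly (Pc s) 0=0"
proof (induction s rule: less_induct)
 case (less s)
 have "poly (\<Sum>j\<in>{1..t}. Pc j * Pc (Suc t - j)) 0=0" if "t<s" for t
  using less that by (auto simp: poly_sum intro!: sum.neutral)
 thus ?case by (cases s rule: Pc.cases) auto
qed

lemma degree_Top: "degree (Top m A)<=Suc (degree A)"
proof -
 have "degree (pderiv A * Qp)<=Suc (degree A)"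
 proof (cases "degree A")
  case 0
  thus ?thesis using pderiv_eq_0_iff[of A] by simp
 next
  case (Suc k)
  thus ?thesis using degree_mult_le[of "pderiv A" Qp] degree_Qp degree_pderiv[of A] by simp
 qed
 moreover have "degree (smult m (pderiv Qp * A))<=Suc (degree A)"
  using degree_mult_le[of "pderiv Qp" A] degree_smult_le[of m "pderiv Qp * A"] by (simp add: pderiv_Qp)
 ultimately show ?thesis unfolding Top_def by (rule degree_diff_le)
qed

lemma degree_Pc: "degree (Pc s)<=3 * s+1"
proof (induction s rule: less_induct)
 case (less s)
 show ?case
 proof (cases s rule: Pc.cases)
  case (3 t)
  have "degree ([:0,1:] * Top (3 * of_nat (t+2)/2) (Pc (Suc t)))<=3 * s+1"
   using degree_mult_le[of "[:0,1::complex:]" "Top (3 * of_nat (t+2)/2) (Pc (Suc t))"] degree_Top[of "3 * of_nat (t+2)/2" "Pc (Suc t)"] less[of "Suc t"] 3 by simp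
  moreover have "degree (\<Sum>j\<in>{1..t}. Pc j * Pc (Suc t - j))<=3 * s+1"
  proof (rule degree_sum_le)
   fix j assume j: "j\<in>{1..t}"
   hence "Suc t - j<s" "j<s" using 3 by auto
   from less[OF this(1)] less[OF this(2)] show "degree (Pc j * Pc (Suc t - j))<=3 * s+1"
    using degree_mult_le[of "Pc j" "Pc (Suc t - j)"] j 3 by auto
  qed simp
  ultimately show ?thesis unfolding 3 Pc.simps
   using degree_smult_le[of "1/2" "\<Sum>j\<in>{1..t}. Pc j * Pc (Suc t - j)"] 3 by (intro degree_diff_le) auto
 qed auto
qed

text \<open>Z F_s/z is (\<open>Pc s\<close>/z) over Z^(3 s + 2), an odd power of Z for odd s, so
  \<open>Top_surj\<close> supplies an algebraic primitive. The division by z is possible by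
  \<open>Pc_0\<close>.\<close>

lemma odd_primitive:
 assumes "odd s"
 shows "\<exists>A. degree A<=3 * s&2*([:0,1:] * Top (3 * of_nat s/2) A)=Pc s"
proof -
 obtain k where k: "s=2 * k+1" using assms oddE by blast
 have "[:0,1:] dvd Pc s" using Pc_0[of s] by (metis poly_eq_0_iff_dvd neg_0_equal_iff_equal)
 then obtain p where p: "Pc s=[:0,1:] * p" by (rule dvdE)
 have dp: "degree p<=2*(3 * k+1)+1"
 proof (cases "p=0")
  case False
  hence "degree (Pc s)=1 + degree p" unfolding p by (subst degree_mult_eq) auto
  thus ?thesis using degree_Pc[of s] k by simp
 qed simp
 hence "degree (smult (1/2) p)<=2*(3 * k+1)+1" using degree_smult_le le_trans by blast
 from Top_surj[OF this] obtain A where A: "degree A<=2*(3 * k+1)+1" "Top (of_nat (3 * k+1)+1/2) A=smult (1/2) p" by blast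
 have eq: "of_nat (3 * k+1)+1/2=(3 * of_nat s/2::complex)" by (simp add: k field_simps)
 have "2*([:0,1:] * Top (3 * of_nat s/2) A)=Pc s" unfolding p A(2)[unfolded eq] by (simp add: numeral_poly)
 thus ?thesis using A(1) k by (intro exI[of _ A]) simp
qed

text \<open>The derivation (2 z/Z) d/dz, that is d/dxi, on formal series in which the coefficient of
  X^n stands for a numerator over Z^(3 n). It raises the index by one.\<close>

definition Dp :: "complex poly fps=>complex poly fps" where
 "Dp f=Abs_fps (%n. case n of 0=>0 | Suc n=>2*([:0,1:] * Top (3 * of_nat n/2) (fps_nth f n)))"

lemma Dp_nth: "fps_nth (Dp f) 0=0" "fps_nth (Dp f) (Suc n)=2*([:0,1:] * Top (3 * of_nat n/2) (fps_nth f n))"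
 by (simp_all add: Dp_def)

lemma Dp_add: "Dp (f + g)=Dp f + Dp g"
proof (rule fps_ext)
 show "fps_nth (Dp (f + g)) n=fps_nth (Dp f + Dp g) n" for n
  by (cases n) (simp_all add: Dp_nth Top_add algebra_simps)
qed

lemma Top_mult: "Top (a + b) (A * B)=A * Top b B + B * Top a A"
 by (simp add: Top_def pderiv_mult algebra_simps smult_add_left)

lemma Top_sum: "Top m (sum f I)=(\<Sum>i\<in>I. Top m (f i))"
proof (cases "finite I")
 case True
 thus ?thesis by induction (simp_all add: Top_add, simp add: Top_def)
qed (simp add: Top_def)

text \<open>The exponents 3 i/2 and 3 (n - i)/2 add up to 3 n/2, so the product rule
  \<open>Top_mult\<close> holds coefficient by coefficient.\<close>

lemma Dp_mult: "Dp (f * g)=f * Dp g + g * Dp f"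
proof (rule fps_ext)
 fix n
 show "fps_nth (Dp (f * g)) n=fps_nth (f * Dp g + g * Dp f) n"
 proof (cases n)
  case (Suc n)
  let ?x = "2 * [:0,1:]::complex poly"
  have sh: "fps_nth (u * Dp v) (Suc n)=(\<Sum>i=0..n. fps_nth u i*(?x * Top (3 * of_nat (n - i)/2) (fps_nth v (n - i))))" for u v
   unfolding fps_mult_nth by (subst sum.atLeast0_atMost_Suc) (auto simp: Dp_nth Suc_diff_le intro!: sum.cong)
  have "fps_nth (Dp (f * g)) (Suc n)=?x*(\<Sum>i=0..n. Top (3 * of_nat n/2) (fps_nth f i * fps_nth g (n - i)))"
   by (simp add: Dp_nth fps_mult_nth Top_sum)
  also have "(\<Sum>i=0..n. Top (3 * of_nat n/2) (fps_nth f i * fps_nth g (n - i))) =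
   (\<Sum>i=0..n. fps_nth f i * Top (3 * of_nat (n - i)/2) (fps_nth g (n - i)) + fps_nth g (n - i) * Top (3 * of_nat i/2) (fps_nth f i))"
  proof (rule sum.cong)
   fix i assume "i\<in>{0..n}"
   hence "(3 * of_nat n/2::complex)=3 * of_nat i/2+3 * of_nat (n - i)/2" by (simp add: of_nat_diff field_simps)
   thus "Top (3 * of_nat n/2) (fps_nth f i * fps_nth g (n - i))=fps_nth f i * Top (3 * of_nat (n - i)/2) (fps_nth g (n - i)) + fps_nth g (n - i) * Top (3 * of_nat i/2) (fps_nth f i)"
    by (simp only: Top_mult)
  qed simp
  also have "?x*\<dots>=(\<Sum>i=0..n. fps_nth f i*(?x * Top (3 * of_nat (n - i)/2) (fps_nth g (n - i))))+(\<Sum>i=0..n. fps_nth g (n - i)*(?x * Top (3 * of_nat i/2) (fps_nth f i)))"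
   by (simp add: sum.distrib sum_distrib_left algebra_simps)
  also have "(\<Sum>i=0..n. fps_nth g (n - i)*(?x * Top (3 * of_nat i/2) (fps_nth f i)))=(\<Sum>i=0..n. fps_nth g i*(?x * Top (3 * of_nat (n - i)/2) (fps_nth f (n - i))))"
   by (rule sum.reindex_bij_witness[of _ "%i. n - i" "%i. n - i"]) auto
  finally show ?thesis unfolding Suc fps_add_nth sh .
 qed (simp add: Dp_nth)
qed

lemma Dp_power: "Dp (f^Suc k) = of_nat (Suc k) * f^k * Dp f"
proof (induction k)
 case (Suc k)
 have "Dp (f^Suc (Suc k))=f * Dp (f^Suc k) + f^Suc k * Dp f" using Dp_mult[of f "f^Suc k"] by simp
 thus ?case unfolding Suc.IH by (simp add: algebra_simps)
qed simp

lemma Dp_const: "Dp (fps_const [:c:] * f)=fps_const [:c:] * Dp f"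
proof (rule fps_ext)
 show "fps_nth (Dp (fps_const [:c:] * f)) n=fps_nth (fps_const [:c:] * Dp f) n" for n
  by (cases n) (simp_all add: Dp_nth Top_smult)
qed

text \<open>\<open>gA\<close> collects the F_s of odd index and \<open>gB\<close> those of even
  index. The shift by one accounts for the denominator Z^(3 (s + 1)); at n = 0 truncated subtraction
  yields \<open>Pc 0\<close> = 0.\<close>

definition gA :: "complex poly fps" where "gA=Abs_fps (%n. if odd n then 0 else Pc (n-1))"
definition gB :: "complex poly fps" where "gB=Abs_fps (%n. if odd n then Pc (n-1) else 0)"

text \<open>The part of the recursion in which one factor of each product has odd and the other even
  index. It says that \<open>gB\<close> is the derivative of -1/2 log (1 + gA): the amplitude is the
  inverse square root of the derivative of the phase.\<close>

lemma gAB: "gB*(1 + gA) = - (fps_const [:1/2:] * Dp gA)"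
proof (rule fps_ext)
 fix n
 show "fps_nth (gB*(1 + gA)) n=fps_nth (- (fps_const [:1/2:] * Dp gA)) n"
 proof (cases "odd n")
  case False
  have "fps_nth gB i * fps_nth gA (n - i)=0" if "i<=n" for i
   using False that by (auto simp: gA_def gB_def)
  hence "fps_nth (gB * gA) n=0" unfolding fps_mult_nth by (intro sum.neutral) auto
  moreover have "fps_nth gB n=0" using False by (simp add: gB_def)
  moreover have "fps_nth (Dp gA) n=0" using False by (cases n) (simp_all add: Dp_nth gA_def Top_def)
  ultimately show ?thesis by (simp add: algebra_simps)
 next
  case True
  show ?thesis
  proof (cases "n=1")
   case True
   thus ?thesis by (simp add: fps_mult_nth gA_def gB_def Dp_nth Top_def)
  next
   case False
   then obtain t where n: "n=Suc (Suc (Suc t))" using True by (metis One_nat_def even_zero not0_implies_Suc even_Suc)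
   have t: "even t" using True n by simp
   let ?g = "%n. Pc (n-1)"
   have "(\<Sum>j\<in>{1..t}. Pc j * Pc (Suc t - j))=(\<Sum>i\<in>{0..n}. ?g i*?g (n - i))"
   proof -
    have "(\<Sum>j\<in>{1..t}. Pc j * Pc (Suc t - j))=(\<Sum>i\<in>{2..Suc t}. ?g i*?g (n - i))"
    by (rule sum.reindex_bij_witness[of _ "%i. i-1" Suc]) (auto simp: n Suc_diff_le)
    also have "\<dots>=(\<Sum>i\<in>{0..n}. ?g i*?g (n - i))"
    proof (rule sum.mono_neutral_left)
    show "\<forall>i\<in>{0..n} - {2..Suc t}. ?g i*?g (n - i)=0"
    proof
    fix i assume i: "i\<in>{0..n} - {2..Suc t}"
    then consider "i<=1" | "n - i<=1" using n by auto
    thus "?g i*?g (n - i)=0" by cases simp_all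
    qed
    qed (auto simp: n)
    finally show ?thesis .
   qed
   also have "\<dots>=(\<Sum>i\<in>{0..n}. fps_nth gB i * fps_nth gA (n - i) + fps_nth gA i * fps_nth gB (n - i))"
   proof (rule sum.cong)
    fix i assume "i\<in>{0..n}"
    thus "?g i*?g (n - i)=fps_nth gB i * fps_nth gA (n - i) + fps_nth gA i * fps_nth gB (n - i)"
    using True by (cases "odd i") (auto simp: gA_def gB_def)
   qed simp
   also have "\<dots>=fps_nth (gB * gA) n + fps_nth (gA * gB) n" by (simp add: fps_mult_nth sum.distrib)
   also have "\<dots>=2 * fps_nth (gB * gA) n" by (simp add: mult.commute)
   finally have *: "(\<Sum>j\<in>{1..t}. Pc j * Pc (Suc t - j))=2 * fps_nth (gB * gA) n" .
   have "smult (1/2) (2 * x)=x" for x :: "complex poly" by (simp add: numeral_poly)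
   hence "Pc (Suc (Suc t)) = - ([:0,1:] * Top (3 * of_nat (t+2)/2) (Pc (Suc t))) - fps_nth (gB * gA) n"
    by (simp only: Pc.simps *)
   moreover have "fps_nth gB n=Pc (Suc (Suc t))" using True n by (simp add: gB_def del: Pc.simps)
   moreover have "fps_nth (gB*(1 + gA)) n=fps_nth gB n + fps_nth (gB * gA) n" by (simp add: distrib_left)
   moreover have "fps_nth (- (fps_const [:1/2:] * Dp gA)) n = - smult (1/2) (fps_nth (Dp gA) n)" by simp
   moreover have half: "smult (1/2) (2 * x)=x" for x :: "complex poly" by (simp add: numeral_poly)
   moreover have "fps_nth (Dp gA) n=2*([:0,1:] * Top (3 * of_nat (t+2)/2) (Pc (Suc t)))"
    unfolding n Dp_nth using t by (simp add: gA_def)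
   ultimately show ?thesis by (simp only: half) simp
  qed
 qed
qed

text \<open>By \<open>gAB\<close> the series -1/2 log (1 + gA) is a primitive of \<open>gB\<close>,
  and its coefficients are polynomials again. They vanish at 0 because the \<open>Pc\<close> do, and
  each factor \<open>gA\<close> contributes two orders of decay at infinity.\<close>

lemma even_primitive:
 assumes "even s"
 shows "\<exists>A. degree A<=3 * s&2*([:0,1:] * Top (3 * of_nat s/2) A)=Pc s&poly A 0=0&coeff A (3 * s)=0"
proof -
 \<comment> \<open>The logarithm may be truncated here: \<open>gA\<close> has no constant term, so
   powers from the \<open>K\<close>-th on do not reach index s + 1.\<close>
 define K where "K=Suc (Suc s)"
 define c :: "nat=>complex" where "c k = - (1/2)*(-1)^k/of_nat (Suc k)" for k
 define C where "C=(\<Sum>k<K. fps_const [:c k:] * gA^Suc k)"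
 have gA0: "fps_nth gA 0=0" by (simp add: gA_def)
 have Dsum: "Dp (\<Sum>k\<in>I. f k)=(\<Sum>k\<in>I. Dp (f k))" if "finite I" for f and I :: "nat set"
  using that by induction (simp_all add: Dp_add, simp add: fps_eq_iff Dp_def Top_def split: nat.split)
 have "Dp C=(\<Sum>k<K. fps_const [:- (1/2):] * (- gA)^k * Dp gA)"
  unfolding C_def
 proof (subst Dsum, simp, rule sum.cong)
  fix k
  have "Dp (fps_const [:c k:] * gA^Suc k)=(fps_const [:c k:] * of_nat (Suc k)) * gA^k * Dp gA"
   unfolding Dp_const Dp_power by (simp only: mult.assoc)
  also have "fps_const [:c k:] * of_nat (Suc k)=fps_const [:- (1/2):] * fps_const [:(- 1)^k:]"
   by (simp add: fps_of_nat[symmetric] of_nat_poly c_def del: of_nat_Suc)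
  also have "fps_const [:(- 1)^k:]=((- 1)^k::complex poly fps)"
   by (cases "even k") (simp_all add: fps_eq_iff one_pCons)
  finally show "Dp (fps_const [:c k:] * gA^Suc k)=fps_const [:- (1/2):] * (- gA)^k * Dp gA"
   by (simp add: power_minus[of gA] mult.assoc)
 qed simp
 also have "\<dots>=fps_const [:- (1/2):] * Dp gA*(\<Sum>k<K. (- gA)^k)"
  unfolding sum_distrib_left by (intro sum.cong refl) (simp only: mult.assoc mult.commute mult.left_commute)
 finally have "(1 + gA) * Dp C=fps_const [:- (1/2):] * Dp gA*((1-(- gA))*(\<Sum>k<K. (- gA)^k))" by simp
 also have "\<dots>=fps_const [:- (1/2):] * Dp gA*(1-(- gA)^K)"
  by (simp only: one_diff_power_eq)
 also have "fps_const [:- (1/2):] * Dp gA=gB*(1 + gA)"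
  unfolding gAB by (simp add: fps_eq_iff)
 finally have "(1 + gA) * Dp C=(1 + gA)*(gB*(1-(- gA)^K))" by (simp only: mult.assoc mult.commute mult.left_commute)
 moreover have "1 + gA~=0"
 proof
  assume "1 + gA=0"
  hence "fps_nth (1 + gA) 0=0" by simp
  thus False using gA0 by simp
 qed
 ultimately have DC: "Dp C=gB*(1-(- gA)^K)" by simp
 have "fps_nth (gB*(- gA)^K) (Suc s)=0"
 proof -
  have "fps_nth ((- gA)^K) i=0" if "i<K" for i
   using that gA0 startsby_zero_power_prefix[of "- gA" K] by simp
  hence "fps_nth ((- gA)^K) (Suc s - i)=0" for i by (simp only: K_def less_Suc_eq_le diff_le_self)
  thus ?thesis unfolding fps_mult_nth by simp
 qed
 hence "fps_nth (Dp C) (Suc s)=fps_nth gB (Suc s)" unfolding DC by (simp add: algebra_simps)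
 hence 1: "2*([:0,1:] * Top (3 * of_nat s/2) (fps_nth C s))=Pc s" using assms unfolding Dp_nth by (simp add: gB_def)
 have Cn: "fps_nth C s=(\<Sum>k<K. smult (c k) (fps_nth (gA^Suc k) s))"
  unfolding C_def by (simp add: fps_sum_nth)
 have "fdeg 2 gA"
  unfolding fdeg_def gA_def
 proof
  show "fps_nth (Abs_fps (%n. if odd n then 0 else Pc (n-1))) n=0\<or>degree (fps_nth (Abs_fps (%n. if odd n then 0 else Pc (n-1))) n)+2<=3 * n" for n
   using degree_Pc[of "n-1"] by (cases n) auto
 qed
 hence fd: "fdeg (2 * Suc k) (gA^Suc k)" for k by (rule fdeg_power)
 have 2: "fps_nth C s=0\<or>degree (fps_nth C s)+2<=3 * s"
  unfolding Cn
 proof (rule fdeg_sum_poly)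
  fix k
  show "smult (c k) (fps_nth (gA^Suc k) s)=0\<or>degree (smult (c k) (fps_nth (gA^Suc k) s))+2<=3 * s"
   using fd[of k] degree_smult_le[of "c k" "fps_nth (gA^Suc k) s"] unfolding fdeg_def by fastforce
 qed
 have "poly (fps_nth gA n) 0=0" for n using Pc_0 by (simp add: gA_def)
 hence "poly (fps_nth (gA^Suc k) s) 0=0" for k by (simp add: fps_mult_nth poly_sum)
 hence 3: "poly (fps_nth C s) 0=0" unfolding Cn by (simp add: poly_sum)
 have "coeff (fps_nth C s) (3 * s)=0" using 2 by (auto intro: coeff_eq_0)
 thus ?thesis using 1 2 3 by (intro exI[of _ "fps_nth C s"]) auto
qed

text \<open>Numerator over Z^(3 s) of a primitive of Z F_s/(2 z). Its values at 0 and at infinity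
  will give the constants k and l.\<close>

definition Ac :: "nat=>complex poly" where
 "Ac s=(SOME A. degree A<=3 * s&2*([:0,1:] * Top (3 * of_nat s/2) A)=Pc s&(even s-->poly A 0=0&coeff A (3 * s)=0))"

lemma Ac: "degree (Ac s)<=3 * s" "2*([:0,1:] * Top (3 * of_nat s/2) (Ac s))=Pc s"
 "even s==>poly (Ac s) 0=0" "even s==>coeff (Ac s) (3 * s)=0"
proof -
 have "\<exists>A. degree A<=3 * s&2*([:0,1:] * Top (3 * of_nat s/2) A)=Pc s&(even s-->poly A 0=0&coeff A (3 * s)=0)"
  using odd_primitive[of s] even_primitive[of s] by blast
 from someI_ex[OF this] show "degree (Ac s)<=3 * s" "2*([:0,1:] * Top (3 * of_nat s/2) (Ac s))=Pc s"
  "even s==>poly (Ac s) 0=0" "even s==>coeff (Ac s) (3 * s)=0" unfolding Ac_def[symmetric] by auto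
qed

end

lemma field_derivative_transform_set:
 assumes "x\<in>S" "!!x. x\<in>S==>g x=f x" "(f has_field_derivative d) (at x within S)"
 shows "(g has_field_derivative d) (at x within S)"
 using has_derivative_transform[OF assms(1) _ assms(3)[unfolded has_field_derivative_def]] assms(2)
 unfolding has_field_derivative_def by blast

lemma deriv_within_eqI:
 assumes d: "(f has_field_derivative d) (at z within S)" and z: "at z within S~=bot"
 shows "deriv_within S f z=d"
 unfolding deriv_within_def
proof (rule the_equality)
 show "(f has_field_derivative d) (at z within S)" by (rule d)
 show "d'=d" if "(f has_field_derivative d') (at z within S)" for d'
  using tendsto_unique[OF z] that d unfolding has_field_derivative_iff by blast
qed

lemma poly_over_power_tendsto:
 assumes "degree A<=n"
 shows "((%z. poly A z/z^n)\<longlongrightarrow>coeff A n) (at_infinity::complex filter)"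
proof -
 have "((%z. \<Sum>i\<le>n. coeff A i * inverse z^(n - i))\<longlongrightarrow>(\<Sum>i\<le>n. coeff A i*0^(n - i))) (at_infinity::complex filter)"
  by (intro tendsto_intros tendsto_inverse_0)
 also have "(\<Sum>i\<le>n. coeff A i*0^(n - i))=(\<Sum>i\<in>{n}. coeff A i)"
  by (rule sum.mono_neutral_cong_right) auto
 finally have "((%z. \<Sum>i\<le>n. coeff A i * inverse z^(n - i))\<longlongrightarrow>coeff A n) (at_infinity::complex filter)" by simp
 thus ?thesis
 proof (rule Lim_transform_eventually, intro eventually_at_infinityI[of 1])
  fix z :: complex assume z: "1<=norm z"
  have z0: "z~=0" using z by auto
  have poly_bound: "poly A z=(\<Sum>i\<le>n. coeff A i * z^i)" for z
   unfolding poly_altdef using assms by (intro sum.mono_neutral_left) (auto simp: coeff_eq_0)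
  have "(\<Sum>i\<le>n. coeff A i * inverse z^(n - i))=(\<Sum>i\<le>n. coeff A i * z^i/z^n)"
  proof (rule sum.cong)
   fix i assume "i\<in>{..n}"
   hence "z^n=z^i * z^(n - i)" by (simp flip: power_add)
   thus "coeff A i * inverse z^(n - i)=coeff A i * z^i/z^n" using z0 by (simp add: field_simps power_inverse)
  qed simp
  also have "\<dots>=poly A z/z^n" using poly_bound[of z] by (simp add: sum_divide_distrib)
  finally show "(\<Sum>i\<le>n. coeff A i * inverse z^(n - i))=poly A z/z^n" .
 qed
qed

section \<open>The coefficients on arbitrary branches, and the constants k and l\<close>

context lam_range
begin

text \<open>The value of the root is a separate argument, so that one formula serves the principal
  branch and both continuations.\<close>

definition Fb :: "nat=>complex=>complex=>complex" where "Fb s Z z=poly (Pc s) z/Z^(3 * s+3)"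
definition Eb :: "nat=>complex=>complex=>complex" where "Eb s Z z=poly (Ac s) z/Z^(3 * s)"

lemma branch_poly_deriv:
 assumes d: "(Z has_field_derivative (z-2 * of_real lam)/Z z) (at z within S)" and Z: "Z z^2=Q z" "Z z~=0"
 shows "((%t. poly P t/Z t^n) has_field_derivative poly (Top (of_nat n/2) P) z/Z z^(n+2)) (at z within S)"
proof -
 have "((%t. poly P t/Z t^n) has_field_derivative
   (poly (pderiv P) z * Z z^n - poly P z*(of_nat n*((z-2 * of_real lam)/Z z * Z z^(n - Suc 0))))/(Z z^n * Z z^n)) (at z within S)"
  using Z(2) by (intro DERIV_divide DERIV_power d has_field_derivative_at_within[OF poly_DERIV]) simp
 moreover have "of_nat n*((z-2 * of_real lam)/Z z * Z z^(n - Suc 0)) = of_nat n*(z-2 * of_real lam) * Z z^n/Z z^2"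
  using Z(2) by (cases n) (auto simp: power2_eq_square)
 moreover have "(poly (pderiv P) z * Z z^n - poly P z*(of_nat n*(z-2 * of_real lam) * Z z^n/Z z^2))/(Z z^n * Z z^n) =
   poly (Top (of_nat n/2) P) z/Z z^(n+2)"
  using Z(2) by (simp add: Top_def poly_Qp Z(1)[symmetric] pderiv_Qp power_add field_simps power2_eq_square)
 ultimately show ?thesis by (simp only:)
qed

lemma Eb_deriv:
 assumes d: "(Z has_field_derivative (z-2 * of_real lam)/Z z) (at z within S)" and Z: "Z z^2=Q z" "Z z~=0" and z: "z~=0"
 shows "((%t. Eb s (Z t) t) has_field_derivative Z z * Fb s (Z z) z/(2 * z)) (at z within S)"
proof -
 have "poly (Pc s) z=2 * z * poly (Top (of_nat (3 * s)/2) (Ac s)) z"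
  using Ac(2)[of s, symmetric] by simp
 hence "poly (Top (of_nat (3 * s)/2) (Ac s)) z/Z z^(3 * s+2)=Z z * Fb s (Z z) z/(2 * z)"
  using Z(2) z by (simp add: Fb_def power_add field_simps eval_nat_numeral)
 thus ?thesis using branch_poly_deriv[OF d Z, of "Ac s" "3 * s"] unfolding Eb_def by simp
qed

text \<open>The recursion of \<open>hatF\<close> solved for the derivative.\<close>

lemma Fb_deriv:
 assumes d: "(Z has_field_derivative (z-2 * of_real lam)/Z z) (at z within S)" and Z: "Z z^2=Q z" "Z z~=0" and z: "z~=0"
 shows "((%t. Fb (Suc s) (Z t) t) has_field_derivative
  - (Z z/z)*(Fb (Suc (Suc s)) (Z z) z+1/2*(\<Sum>j\<in>{1..s}. Fb j (Z z) z * Fb (Suc s - j) (Z z) z))) (at z within S)"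
proof -
 let ?w = "Z z"
 have "(\<Sum>j\<in>{1..s}. Fb j ?w z * Fb (Suc s - j) ?w z)=(\<Sum>j\<in>{1..s}. poly (Pc j) z * poly (Pc (Suc s - j)) z/?w^(3 * s+9))"
 proof (rule sum.cong)
  fix j assume j: "j\<in>{1..s}"
  hence "3 * s+9=(3 * j+3)+(3*(Suc s - j)+3)" by (simp add: diff_mult_distrib2)
  thus "Fb j ?w z * Fb (Suc s - j) ?w z=poly (Pc j) z * poly (Pc (Suc s - j)) z/?w^(3 * s+9)"
   unfolding Fb_def by (simp only: power_add times_divide_times_eq)
 qed simp
 hence 1: "(\<Sum>j\<in>{1..s}. Fb j ?w z * Fb (Suc s - j) ?w z)=(\<Sum>j\<in>{1..s}. poly (Pc j) z * poly (Pc (Suc s - j)) z)/?w^(3 * s+9)"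
  by (simp add: sum_divide_distrib)
 have 2: "Fb (Suc (Suc s)) ?w z=(- (z * poly (Top (of_nat (3 * s+6)/2) (Pc (Suc s))) z)-1/2*(\<Sum>j\<in>{1..s}. poly (Pc j) z * poly (Pc (Suc s - j)) z))/?w^(3 * s+9)"
  by (simp add: Fb_def poly_sum algebra_simps)
 have "poly (Top (of_nat (3 * s+6)/2) (Pc (Suc s))) z/?w^(3 * s+6+2) =
  - (?w/z)*(Fb (Suc (Suc s)) ?w z+1/2*(\<Sum>j\<in>{1..s}. Fb j ?w z * Fb (Suc s - j) ?w z))"
  unfolding 1 2 using Z(2) z by (simp add: field_simps power_add eval_nat_numeral)
 moreover have "Fb (Suc s) (Z t) t=poly (Pc (Suc s)) t/Z t^(3 * s+6)" for t
  by (simp add: Fb_def add.commute)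
 ultimately show ?thesis using branch_poly_deriv[OF d Z, of "Pc (Suc s)" "3 * s+6"] by simp
qed

lemma Zb_deriv:
 "z\<in>Cplus - g2==>(Zb mpv has_field_derivative (z-2 * of_real lam)/Zb mpv z) (at z within Cplus - g2)"
 "z\<in>Cplus - g1==>(Zb m1 has_field_derivative (z-2 * of_real lam)/Zb m1 z) (at z within Cplus - g1)"
 "z\<in>Cplus - g3==>(Zb m3 has_field_derivative (z-2 * of_real lam)/Zb m3 z) (at z within Cplus - g3)"
 and Zb_nz: "z\<in>Cplus - g2==>Zb mpv z~=0" "z\<in>Cplus - g1==>Zb m1 z~=0" "z\<in>Cplus - g3==>Zb m3 z~=0"
proof -
 have nz: "Zb m z~=0" if "m z^4=1" "z\<in>Cplus" "z~=tp" for m :: "complex=>complex" and z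
  using that csq_nz[of z] by (auto simp: Zb_def)
 show a: "z\<in>Cplus - g2==>Zb mpv z~=0" "z\<in>Cplus - g1==>Zb m1 z~=0" "z\<in>Cplus - g3==>Zb m3 z~=0" for z
  using nz[of mpv, OF m_power4(1)] nz[of m1, OF m_power4(2)] nz[of m3, OF m_power4(3)] tp_g by (metis Diff_iff)+
 show "z\<in>Cplus - g2==>(Zb mpv has_field_derivative (z-2 * of_real lam)/Zb mpv z) (at z within Cplus - g2)"
  "z\<in>Cplus - g1==>(Zb m1 has_field_derivative (z-2 * of_real lam)/Zb m1 z) (at z within Cplus - g1)"
  "z\<in>Cplus - g3==>(Zb m3 has_field_derivative (z-2 * of_real lam)/Zb m3 z) (at z within Cplus - g3)"
  using Zb_continuous Zb_sq[of mpv, OF m_power4(1)] Zb_sq[of m1, OF m_power4(2)] Zb_sq[of m3, OF m_power4(3)] a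
  by (auto intro!: branch_deriv simp: continuous_on_eq_continuous_within)
qed

lemma hatF_eq: "z\<in>pdom lam==>hatF lam s z=Fb s (Zb mpv z) z"
proof (induction s arbitrary: z rule: less_induct)
 case (less s)
 have z: "z\<in>Cplus - g2" and z0: "z~=0" using less.prems by (auto simp: pdom_eq Cplus_def)
 show ?case
 proof (cases s rule: Pc.cases)
  case 1
  thus ?thesis by (simp add: Fb_def)
 next
  case 2
  thus ?thesis using Z_pv_eq[OF less.prems] Zb_nz(1)[OF z] by (simp add: Fb_def field_simps eval_nat_numeral)
 next
  case (3 t)
  \<comment> \<open>The \<open>THE\<close> in \<open>deriv_within\<close> needs a limit point of the
    domain; a connected set with two points has no isolated ones.\<close>
  have nt: "at z within pdom lam~=bot"
  proof -
   have "complex_of_real 1\<in>pdom lam" "complex_of_real 2\<in>pdom lam" "complex_of_real 1~=complex_of_real 2"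
    using positive_pdom[of 1] positive_pdom[of 2] by auto
   hence "\<nexists>x. pdom lam={x}" by (metis singletonD)
   hence "z islimpt pdom lam" using connected_imp_perfect[of "pdom lam" z] cut_connected(2) less.prems by (auto simp: pdom_eq)
   thus ?thesis by (simp add: trivial_limit_within)
  qed
  have d: "((%z. Fb (Suc t) (Zb mpv z) z) has_field_derivative
   - (Zb mpv z/z)*(Fb (Suc (Suc t)) (Zb mpv z) z+1/2*(\<Sum>j\<in>{1..t}. Fb j (Zb mpv z) z * Fb (Suc t - j) (Zb mpv z) z))) (at z within pdom lam)"
   unfolding pdom_eq by (rule Fb_deriv[OF Zb_deriv(1)[OF z] Zb_sq[of mpv, OF m_power4(1)] Zb_nz(1)[OF z] z0])
  have "deriv_within (pdom lam) (hatF lam (Suc t)) z =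
   - (Zb mpv z/z)*(Fb (Suc (Suc t)) (Zb mpv z) z+1/2*(\<Sum>j\<in>{1..t}. Fb j (Zb mpv z) z * Fb (Suc t - j) (Zb mpv z) z))"
   by (rule deriv_within_eqI[OF field_derivative_transform_set[OF less.prems _ d] nt]) (use less.IH[of "Suc t"] 3 in auto)
  moreover have "(\<Sum>j\<in>{1..t}. hatF lam j z * hatF lam (Suc t - j) z)=(\<Sum>j\<in>{1..t}. Fb j (Zb mpv z) z * Fb (Suc t - j) (Zb mpv z) z)"
   using less.IH less.prems 3 by (intro sum.cong) auto
  ultimately have "hatF lam s z = - (z/Zb mpv z)*(- (Zb mpv z/z)*(Fb (Suc (Suc t)) (Zb mpv z) z+1/2*(\<Sum>j\<in>{1..t}. Fb j (Zb mpv z) z * Fb (Suc t - j) (Zb mpv z) z)))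
    - 1/2*(\<Sum>j\<in>{1..t}. Fb j (Zb mpv z) z * Fb (Suc t - j) (Zb mpv z) z)"
   unfolding 3 hatF.simps Z_pv_eq[OF less.prems] by (simp only:)
  thus ?thesis using 3 Zb_nz(1)[OF z] z0 by simp
 qed
qed

text \<open>Limit of \<open>Eb s\<close> at infinity when Z ~ z. When Z ~ -z the limit is (-1)^s
  times this.\<close>

definition ainf :: "nat=>complex" where "ainf s=coeff (Ac s) (3 * s)"

lemma Eb_tendsto_inf:
 assumes g: "filterlim g at_infinity F" and Z: "((%x. Z x/g x)\<longlongrightarrow>c) F" "c~=0"
 shows "((%x. Eb s (Z x) (g x))\<longlongrightarrow>ainf s/c^(3 * s)) F"
proof -
 have "((%x. (poly (Ac s) (g x)/g x^(3 * s))/(Z x/g x)^(3 * s))\<longlongrightarrow>ainf s/c^(3 * s)) F"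
  unfolding ainf_def by (intro tendsto_divide tendsto_power Z filterlim_compose[OF poly_over_power_tendsto g] Ac(1)) (use Z(2) in simp)
 moreover have "\<forall>\<^sub>F x in F. g x~=0"
  using g by (metis eventually_mono filterlim_at_infinity_imp_eventually_ne)
 hence "\<forall>\<^sub>F x in F. (poly (Ac s) (g x)/g x^(3 * s))/(Z x/g x)^(3 * s)=Eb s (Z x) (g x)"
  by (rule eventually_mono) (simp add: Eb_def power_divide)
 ultimately show ?thesis by (rule Lim_transform_eventually)
qed

lemma real_line_Zsq: "Q (of_real x) = of_real ((x-2 * lam)\<^sup>2+4*(1 - lam\<^sup>2))"
 by (simp add: Zsq_def power2_eq_square algebra_simps)

lemma csq_real: "csq lam (of_real x) = of_real (sqrt ((x-2 * lam)\<^sup>2+4*(1 - lam\<^sup>2)))"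
proof -
 have "0<=(x-2 * lam)\<^sup>2+4*(1 - lam\<^sup>2)" using lam_sq by (smt (verit) zero_le_power2)
 thus ?thesis unfolding csq_def real_line_Zsq by simp
qed

lemma hatE_eq: "z\<in>pdom lam==>hatE lam s z=Eb s (Zb mpv z) z - ainf s"
proof -
 assume z: "z\<in>pdom lam"
 let ?e = "%z. 2 * Eb s (Zb mpv z) z"
 have d: "(?e has_field_derivative Z_pv lam z * hatF lam s z/z) (at z within pdom lam)" if z: "z\<in>pdom lam" for z
 proof -
  have "(?e has_field_derivative 2*(Zb mpv z * Fb s (Zb mpv z) z/(2 * z))) (at z within pdom lam)"
   using z unfolding pdom_eq by (intro DERIV_cmult Eb_deriv Zb_deriv(1) Zb_sq[of mpv, OF m_power4(1)] Zb_nz(1)) (auto simp: Cplus_def)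
  thus ?thesis using Z_pv_eq[OF z] hatF_eq[OF z] by simp
 qed
 have "((%x. Zb mpv (of_real x)/of_real x)\<longlongrightarrow>1) at_top"
 proof (rule Lim_transform_eventually)
  have "((%x. sqrt ((x-2 * lam)\<^sup>2+4*(1 - lam\<^sup>2))/x)\<longlongrightarrow>1) at_top" by real_asymp
  from tendsto_of_real[OF this, where 'a = complex]
  show "((%x. complex_of_real (sqrt ((x-2 * lam)\<^sup>2+4*(1 - lam\<^sup>2))/x))\<longlongrightarrow>1) at_top" by simp
  show "\<forall>\<^sub>F x in at_top. complex_of_real (sqrt ((x-2 * lam)\<^sup>2+4*(1 - lam\<^sup>2))/x)=Zb mpv (of_real x)/of_real x"
   using eventually_gt_at_top[of 0] by eventually_elim (simp add: positive_branch(1))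
 qed
 from Eb_tendsto_inf[OF filterlim_of_real_at_infinity this, of s]
 have lim: "((%R. ?e (complex_of_real R))\<longlongrightarrow>2 * ainf s) at_top" by (auto intro!: tendsto_intros simp: filterlim_ident)
 have "\<forall>\<^sub>F R in at_top. complex_of_real R\<in>pdom lam"
  using eventually_gt_at_top[of 0] by eventually_elim (simp add: positive_pdom)
 from contour_integral_to_infinity[OF _ _ z d this lim] gamma_open(2) cut_connected(2)
 have "Lim at_top (%R::real. contour_integral
   (SOME p. valid_path p&path_image p\<subseteq>pdom lam&pathstart p = of_real R&pathfinish p=z)
   (%z. Z_pv lam z * hatF lam s z/z))=?e z-2 * ainf s" by (simp add: pdom_eq)
 thus ?thesis by (simp add: hatE_def)
qed

text \<open>Continuations from the region at the start of a path: the branch \<open>Zb m1\<close> of \<open>Z\<close> for paths from \<open>0\<close>,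
 and \<open>Zb m3\<close> for paths from \<open>\<infinity> e\<^bsup>\<pi> i\<^esup>\<close>.\<close>

lemma continue_from_0:
 assumes h: "!!z. z\<in>pdom lam==>f z=h (Zb mpv z) z" and hol: "(%z. h (Zb m1 z) z) holomorphic_on (Cplus - g1)" and z: "z\<in>Cplus - g1"
 shows "continue_from (Sm1 lam) (gamma1 lam) f z=h (Zb m1 z) z"
 unfolding Sm1_eq gamma1_eq
proof (rule continue_from_eqI[OF gamma_open(1) cut_connected(1) region_open(1) regions_nonempty(1) region_in_cut(1) hol _ z])
 show "h (Zb m1 z) z=f z" if "z\<in>RA" for z using h[of z] that region_in_cut(2) Zb_RA(1)[OF that] by (auto simp: pdom_eq)
qed

lemma continue_from_inf:
 assumes h: "!!z. z\<in>pdom lam==>f z=h (Zb mpv z) z" and hol: "(%z. h (Zb m3 z) z) holomorphic_on (Cplus - g3)" and z: "z\<in>Cplus - g3"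
 shows "continue_from (S1 lam) (gamma3 lam) f z=h (Zb m3 z) z"
 unfolding S1_eq gamma3_eq
proof (rule continue_from_eqI[OF gamma_open(3) cut_connected(3) region_open(3) regions_nonempty(3) region_in_cut(6) hol _ z])
 show "h (Zb m3 z) z=f z" if "z\<in>RC" for z using h[of z] that region_in_cut(5) Zb_RC(2)[OF that] by (auto simp: pdom_eq)
qed

definition Gb :: "nat=>nat=>complex=>complex=>complex" where
 "Gb n s Z z=(\<Sum>k\<in>{s..<n}. Fb k Z z * Fb (s + n - k-1) Z z)"

lemma hatG_eq: "z\<in>pdom lam==>hatG lam n s z=Gb n s (Zb mpv z) z"
 by (simp add: hatG_def Gb_def hatF_eq)

lemma branch_holomorphic:
 assumes c: "continuous_on T Z" and Z: "!!t. t\<in>T==>Z t^2=Q t" "!!t. t\<in>T==>Z t~=0" and T: "T\<subseteq>Cplus"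
 shows "(%z. xiB lam (Z z) z) holomorphic_on T" "(%z. Z z * Fb n (Z z) z/z) holomorphic_on T"
  "(%z. Z z * Gb n s (Z z) z/z) holomorphic_on T" "(%z. Eb n (Z z) z - a) holomorphic_on T"
proof -
 have ZT: "Z holomorphic_on T" unfolding holomorphic_on_def field_differentiable_def
  using branch_deriv[OF _ Z(1) _ Z(2)] c unfolding continuous_on_eq_continuous_within by blast
 have T0: "z~=0" if "z\<in>T" for z using T that by (auto simp: Cplus_def)
 show "(%z. xiB lam (Z z) z) holomorphic_on T" unfolding holomorphic_on_def field_differentiable_def
  using branch_xi_deriv[OF _ Z(1) _ Z(2) T] c unfolding continuous_on_eq_continuous_within by blast
 have F: "(%z. Fb n (Z z) z) holomorphic_on T" for n unfolding Fb_def using Z(2)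
  by (intro holomorphic_intros ZT poly_holomorphic_on) auto
 show "(%z. Z z * Fb n (Z z) z/z) holomorphic_on T" "(%z. Z z * Gb n s (Z z) z/z) holomorphic_on T"
  unfolding Gb_def using T0 by (intro holomorphic_intros ZT F; simp)+
 show "(%z. Eb n (Z z) z - a) holomorphic_on T" unfolding Eb_def using Z(2)
  by (intro holomorphic_intros ZT poly_holomorphic_on) auto
qed

lemmas hol_m1 = branch_holomorphic[OF Zb_continuous(2) Zb_sq[of m1, OF m_power4(2)] Zb_nz(2) Diff_subset]
lemmas hol_m3 = branch_holomorphic[OF Zb_continuous(3) Zb_sq[of m3, OF m_power4(3)] Zb_nz(3) Diff_subset]

lemma continue_0:
 assumes z: "z\<in>Cplus - g1"
 shows "continue_from (Sm1 lam) (gamma1 lam) (xi_pv lam) z=xiB lam (Zb m1 z) z"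
  "continue_from (Sm1 lam) (gamma1 lam) (%t. Z_pv lam t * hatF lam n t/t) z=Zb m1 z * Fb n (Zb m1 z) z/z"
  "continue_from (Sm1 lam) (gamma1 lam) (%t. Z_pv lam t * hatG lam n s t/t) z=Zb m1 z * Gb n s (Zb m1 z) z/z"
  "continue_from (Sm1 lam) (gamma1 lam) (hatE lam n) z=Eb n (Zb m1 z) z - ainf n"
 apply (rule continue_from_0[where h = "xiB lam", OF _ hol_m1(1) z], simp_all add: xi_pv_eq)
 apply (rule continue_from_0[where h = "%Z z. Z * Fb n Z z/z", OF _ hol_m1(2) z], simp_all add: Z_pv_eq hatF_eq)
 apply (rule continue_from_0[where h = "%Z z. Z * Gb n s Z z/z", OF _ hol_m1(3) z], simp_all add: Z_pv_eq hatG_eq)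
 apply (rule continue_from_0[where h = "%Z z. Eb n Z z - ainf n", OF _ hol_m1(4) z], simp_all add: hatE_eq)
 done

lemma continue_inf:
 assumes z: "z\<in>Cplus - g3"
 shows "continue_from (S1 lam) (gamma3 lam) (xi_pv lam) z=xiB lam (Zb m3 z) z"
  "continue_from (S1 lam) (gamma3 lam) (%t. Z_pv lam t * hatF lam n t/t) z=Zb m3 z * Fb n (Zb m3 z) z/z"
  "continue_from (S1 lam) (gamma3 lam) (%t. Z_pv lam t * hatG lam n s t/t) z=Zb m3 z * Gb n s (Zb m3 z) z/z"
 apply (rule continue_from_inf[where h = "xiB lam", OF _ hol_m3(1) z], simp_all add: xi_pv_eq)
 apply (rule continue_from_inf[where h = "%Z z. Z * Fb n Z z/z", OF _ hol_m3(2) z], simp_all add: Z_pv_eq hatF_eq)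
 apply (rule continue_from_inf[where h = "%Z z. Z * Gb n s Z z/z", OF _ hol_m3(3) z], simp_all add: Z_pv_eq hatG_eq)
 done

lemma csq_tendsto_0: "((%z. csq lam z)\<longlongrightarrow>2) (at 0 within S)"
proof -
 have "isCont csqrt (Q 0)" by (rule continuous_at_csqrt) (simp add: Zsq_def)
 moreover have "(Q\<longlongrightarrow>Q 0) (at 0 within S)" unfolding Zsq_def by (intro tendsto_intros)
 ultimately have "((%z. csqrt (Q z))\<longlongrightarrow>csqrt (Q 0)) (at 0 within S)" by (rule isCont_tendsto_compose)
 moreover have "csqrt (Q 0)=2" by (simp add: Zsq_def)
 ultimately show ?thesis by (simp add: csq_def)
qed

lemma near_0: "\<forall>\<^sub>F z in at 0 within Cplus. z\<in>RA&mpv z=1"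
proof -
 obtain e where e: "0<e" "e<2" "\<forall>z\<in>Cplus. norm z<e-->lev lam z<0" using lev_neg_near_0 by auto
 show ?thesis unfolding eventually_at
  by (rule exI[of _ e]) (use e in "auto simp: RA_def mpv_def")
qed

lemma Eb_tendsto_0:
 assumes "(Z\<longlongrightarrow>2) F" "(g\<longlongrightarrow>0) F"
 shows "((%x. Eb s (Z x) (g x))\<longlongrightarrow>poly (Ac s) 0/8^s) F"
proof -
 have "((%x. Eb s (Z x) (g x))\<longlongrightarrow>poly (Ac s) 0/2^(3 * s)) F"
  unfolding Eb_def by (intro tendsto_intros assms) simp
 thus ?thesis by (simp add: power_mult)
qed

lemma of_real_at_bot: "filterlim complex_of_real at_infinity at_bot"
proof (rule filterlim_norm_at_top_imp_at_infinity)
 have "filterlim (%x::real. \<bar>x\<bar>) at_top at_bot" by real_asymp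
 thus "filterlim (%x. norm (complex_of_real x)) at_top at_bot" by simp
qed

text \<open>At the far end of the negative axis the continued root is ~ -z, so for odd s the
  primitive tends to -\<open>ainf s\<close>; the normalisation at +infinity subtracts another
  \<open>ainf s\<close>.\<close>

lemma l_const_eq: "l_const lam s=(if odd s then-2 * ainf s else 0)"
proof (cases "odd s")
 case True
 have "((%x. Zb m1 (of_real x)/of_real x)\<longlongrightarrow>-1) at_bot"
 proof (rule Lim_transform_eventually)
  have "((%x. sqrt ((x-2 * lam)\<^sup>2+4*(1 - lam\<^sup>2))/x)\<longlongrightarrow>-1) at_bot" by real_asymp
  from tendsto_of_real[OF this, where 'a = complex]
  show "((%x. complex_of_real (sqrt ((x-2 * lam)\<^sup>2+4*(1 - lam\<^sup>2))/x))\<longlongrightarrow>-1) at_bot" by simp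
  show "\<forall>\<^sub>F x in at_bot. complex_of_real (sqrt ((x-2 * lam)\<^sup>2+4*(1 - lam\<^sup>2))/x)=Zb m1 (of_real x)/of_real x"
   using eventually_gt_at_bot[of 0] eventually_le_at_bot[of "-1"] by eventually_elim (use lam0 in "simp add: Zb_def m1_def csq_real")
 qed
 from Eb_tendsto_inf[OF of_real_at_bot this, of s]
 have "((%x. Eb s (Zb m1 (of_real x)) (of_real x) - ainf s)\<longlongrightarrow>ainf s/(-1)^(3 * s) - ainf s) at_bot"
  by (intro tendsto_intros) (auto simp: filterlim_ident)
 moreover have "ainf s/(-1)^(3 * s) - ainf s = - 2 * ainf s" using True by simp
 moreover have "\<forall>\<^sub>F x in at_bot. Eb s (Zb m1 (of_real x)) (of_real x) - ainf s=continue_from (Sm1 lam) (gamma1 lam) (hatE lam s) (of_real x)"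
  using eventually_le_at_bot[of "-3"]
 proof eventually_elim
  case (elim x)
  hence "complex_of_real x\<in>Cplus - g1" using region_in_cut(4) real_in_RC[of x] by auto
  from continue_0(4)[OF this] show ?case by simp
 qed
 ultimately have "((%x. continue_from (Sm1 lam) (gamma1 lam) (hatE lam s) (of_real x))\<longlongrightarrow>- 2 * ainf s) at_bot"
  using Lim_transform_eventually by fastforce
 hence "Lim at_bot (%x::real. continue_from (Sm1 lam) (gamma1 lam) (hatE lam s) (of_real x)) = - 2 * ainf s"
  by (intro tendsto_Lim) simp_all
 thus ?thesis using True by (simp add: l_const_def)
qed (simp add: l_const_def)

text \<open>Near 0 the root tends to 2, so that Z^(3 s) tends to 8^s.\<close>

lemma k_const_eq: "k_const lam s=(if odd s then - ainf s - poly (Ac s) 0/8^s else 0)"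
proof (cases "odd s")
 case True
 have ev: "\<forall>\<^sub>F z in at 0 within pdom lam. z\<in>pdom lam&mpv z=1"
  using eventually_mono[OF near_0] filter_leD[OF at_le[of "pdom lam" Cplus 0], OF _ near_0]
  by (auto simp: pdom_eq eventually_at_filter elim!: eventually_mono)
 have "((%z. Eb s (csq lam z) z - ainf s)\<longlongrightarrow>poly (Ac s) 0/8^s - ainf s) (at 0 within pdom lam)"
  by (intro tendsto_diff Eb_tendsto_0 csq_tendsto_0 tendsto_const tendsto_ident_at)
 hence "(hatE lam s\<longlongrightarrow>poly (Ac s) 0/8^s - ainf s) (at 0 within pdom lam)"
  by (rule Lim_transform_eventually) (rule eventually_mono[OF ev], simp add: hatE_eq Zb_def)
 moreover have "at 0 within pdom lam~=bot"
 proof -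
  have "(0::complex) islimpt pdom lam" unfolding islimpt_approachable
  proof (intro allI impI)
   fix e :: real assume "0<e"
   thus "\<exists>x'\<in>pdom lam. x'~=0&dist x' 0<e" using positive_pdom[of "e/2"] by (intro bexI[of _ "of_real (e/2)"]) auto
  qed
  thus ?thesis by (simp add: trivial_limit_within)
 qed
 ultimately have "Lim (at 0 within pdom lam) (hatE lam s)=poly (Ac s) 0/8^s - ainf s" by (intro tendsto_Lim)
 thus ?thesis using True by (simp add: k_const_def l_const_eq)
qed (simp add: k_const_def)

end

section \<open>Growth estimates along piecewise smooth paths\<close>

lemma sqrt_branch_deriv:
 fixes f :: "complex=>complex"
 assumes c: "continuous (at z within S) f" and f: "!!t. t\<in>S==>f t^2=g t" "f z~=0"
  and g: "(g has_field_derivative g') (at z within S)" and z: "z\<in>S"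
 shows "(f has_field_derivative g'/(2 * f z)) (at z within S)"
 unfolding has_field_derivative_iff
proof (rule Lim_transform_eventually)
 have fz: "(f\<longlongrightarrow>f z) (at z within S)" using c by (simp add: continuous_within)
 have "((%y. (g y - g z)/(y - z)/(f y + f z))\<longlongrightarrow>g'/(f z + f z)) (at z within S)"
  using g f(2) unfolding has_field_derivative_iff by (intro tendsto_divide tendsto_add fz tendsto_const) auto
 thus "((%y. (g y - g z)/(y - z)/(f y + f z))\<longlongrightarrow>g'/(2 * f z)) (at z within S)" by simp
 have "((%y. f y + f z)\<longlongrightarrow>f z + f z) (at z within S)" by (intro tendsto_intros fz)
 hence "\<forall>\<^sub>F y in at z within S. f y + f z~=0" by (rule tendsto_imp_eventually_ne) (use f(2) in simp)
 moreover have "\<forall>\<^sub>F y in at z within S. y\<in>S" by (simp add: eventually_at_filter)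
 ultimately show "\<forall>\<^sub>F y in at z within S. (g y - g z)/(y - z)/(f y + f z)=(f y - f z)/(y - z)"
 proof eventually_elim
  case (elim y)
  have "g y - g z=(f y - f z)*(f y + f z)" using f(1)[OF elim(2)] f(1)[OF z] by (simp add: power2_eq_square algebra_simps)
  thus ?case using elim(1) by simp
 qed
qed

lemma norm_increment_le_integral:
 fixes F :: "real=>complex"
 assumes "a<=b" and F: "!!t. t\<in>{a..b}==>(F has_vector_derivative F' t) (at t within {a..b})"
  and g: "continuous_on {a..b} g" "!!t. t\<in>{a..b}==>norm (F' t)<=g t"
 shows "norm (F b - F a)<=integral {a..b} g"
proof -
 have "(F' has_integral F b - F a) {a..b}" by (rule fundamental_theorem_of_calculus[OF assms(1) F])
 hence "F' integrable_on {a..b}" "F b - F a=integral {a..b} F'" by (auto simp: integral_unique has_integral_integrable)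
 thus ?thesis using integral_norm_bound_integral[of F' "{a..b}" g] integrable_continuous_real[OF g(1)] g(2) by simp
qed

text \<open>With W and R the integrals of \<open>w\<close> and \<open>r\<close>, the function u exp
  (-W) - R is nonincreasing because exp (-W) <= 1.\<close>

lemma gronwall:
 fixes u :: "real=>real"
 assumes ab: "a<=b" and u: "continuous_on {a..b} u" "!!t. a<t==>t<b==>(u has_real_derivative u' t) (at t)&u' t<=r t + w t * u t"
  and rw: "continuous_on {a..b} r" "continuous_on {a..b} w" "!!t. t\<in>{a..b}==>0<=r t&0<=w t"
 shows "u b<=(u a + integral {a..b} r) * exp (integral {a..b} w)"
proof -
 let ?R = "%t. integral {a..t} r" and ?W = "%t. integral {a..t} w"
 let ?f = "%t. u t * exp (- ?W t)-?R t"
 have c: "continuous_on {a..b} ?W" "continuous_on {a..b} ?R"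
  by (intro indefinite_integral_continuous_1 integrable_continuous_real rw)+
 have "?f a\<ge>?f b"
 proof (rule DERIV_nonpos_imp_decreasing_open[OF ab])
  show "continuous_on {a..b} ?f" by (intro continuous_intros u c)
  fix t assume t: "a<t" "t<b"
  hence at: "at t within {a..b}=at t" and tt: "t\<in>{a..b}" by (auto intro: at_within_interior)
  have "(?R has_real_derivative r t) (at t)" "(?W has_real_derivative w t) (at t)"
   using integral_has_real_derivative[OF rw(1) tt] integral_has_real_derivative[OF rw(2) tt] by (simp_all add: at)
  hence "(?f has_real_derivative u' t * exp (- ?W t) + u t*(exp (- ?W t) * - w t) - r t) (at t)"
   using u(2)[OF t] by (auto intro!: derivative_eq_intros)
  moreover have "u' t * exp (- ?W t) + u t*(exp (- ?W t) * - w t) - r t<=0"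
  proof -
   have "0<=?W t" by (rule integral_nonneg) (use rw t in "auto intro!: integrable_continuous_real intro: continuous_on_subset")
   hence e1: "exp (- ?W t)<=1" by simp
   have "u' t * exp (- ?W t) + u t*(exp (- ?W t) * - w t)=(u' t - w t * u t) * exp (- ?W t)" by (simp add: algebra_simps)
   also have "\<dots><=r t * exp (- ?W t)" using u(2)[OF t] by (intro mult_right_mono) auto
   also have "\<dots><=r t" using e1 rw(3)[OF tt] by (simp add: mult_left_le)
   finally show ?thesis by simp
  qed
  ultimately show "\<exists>y. DERIV ?f t :> y&y<=0" by blast
 qed
 hence "u b * exp (- ?W b)<=u a+?R b" by simp
 hence "u b * exp (- ?W b) * exp (?W b)<=(u a+?R b) * exp (?W b)" by (intro mult_right_mono) auto
 thus ?thesis by (simp add: mult.assoc flip: exp_add)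
qed

text \<open>The quantities \<open>k\<close> and \<open>2 mu h + k\<close> are the two that stay small along the path, the first because
 \<open>Re x\<close> increases.\<close>

lemma LG_growth_piece:
 fixes h k x :: "real=>complex" and r w :: "real=>real"
 assumes ab: "a<=b" and mu: "0<mu"
  and d: "!!t. t\<in>{a..b}==>(h has_vector_derivative k t * x' t) (at t within {a..b}) &
    (k has_vector_derivative-2 * of_real mu * k t * x' t-\<phi> t) (at t within {a..b}) &
    (x has_vector_derivative x' t) (at t within {a..b})"
  and mono: "!!s t. s\<in>{a..b}==>t\<in>{a..b}==>s<=t==>Re (x s)<=Re (x t)"
  and \<phi>: "continuous_on {a..b} \<phi>" "!!t. t\<in>{a..b}==>norm (\<phi> t)<=r t*(1 + norm (h t)) + w t * norm (k t)"
  and rw: "continuous_on {a..b} r" "continuous_on {a..b} w" "!!t. t\<in>{a..b}==>0<=r t&0<=w t"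
  and c: "norm (k a)<=c" "norm (2 * of_real mu * h a + k a)<=c"
 shows "norm (k b)<=(c + integral {a..b} r) * exp (integral {a..b} (%t. r t/mu + w t)) &
  norm (2 * of_real mu * h b + k b)<=(c + integral {a..b} r) * exp (integral {a..b} (%t. r t/mu + w t))"
proof -
 define u where "u t=c + integral {a..t} (%s. norm (\<phi> s))" for t
 have nc: "continuous_on {a..b} (%s. norm (\<phi> s))" by (intro continuous_intros \<phi>)
 have ku: "norm (k t)<=u t" and mu': "norm (2 * of_real mu * h t + k t)<=u t" if t: "t\<in>{a..b}" for t
 proof -
  have sub: "{a..t}\<subseteq>{a..b}" "a<=t" using t by auto
  have d': "(h has_vector_derivative k s * x' s) (at s within {a..t})"
    "(k has_vector_derivative-2 * of_real mu * k s * x' s-\<phi> s) (at s within {a..t})"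
    "(x has_vector_derivative x' s) (at s within {a..t})" if "s\<in>{a..t}" for s
   using d[of s] that t by (auto intro: has_vector_derivative_within_subset[OF _ sub(1)])
  have nct: "continuous_on {a..t} (%s. norm (\<phi> s))" using nc sub continuous_on_subset by blast
  \<comment> \<open>Integrating factor for the term -2 mu k x'. Its modulus is at most 1 for s <= t,
    since Re x increases.\<close>
  let ?e = "%s. exp (2 * of_real mu*(x s - x t))"
  have "norm (k t*?e t - k a*?e a)<=integral {a..t} (%s. norm (\<phi> s))"
  proof (rule norm_increment_le_integral[OF sub(2) _ nct])
   fix s assume s: "s\<in>{a..t}"
   have e: "(?e has_vector_derivative (2 * of_real mu * x' s)*?e s) (at s within {a..t})"
   proof -
    have "((%s. 2 * of_real mu*(x s - x t)) has_vector_derivative 2 * of_real mu*(x' s-0)) (at s within {a..t})"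
    by (intro has_vector_derivative_mult_right has_vector_derivative_diff has_vector_derivative_const d' s)
    from field_vector_diff_chain_within[OF this has_field_derivative_at_within[OF DERIV_exp]]
    show ?thesis by (simp add: o_def)
   qed
   have "((%s. k s*?e s) has_vector_derivative k s*((2 * of_real mu * x' s)*?e s)+(- 2 * of_real mu * k s * x' s-\<phi> s)*?e s) (at s within {a..t})"
    by (intro has_vector_derivative_mult e d' s)
   thus "((%s. k s*?e s) has_vector_derivative-\<phi> s*?e s) (at s within {a..t})" by (simp add: algebra_simps)
   have "Re (x s)<=Re (x t)" using mono[of s t] s t by auto
   hence "norm (?e s)<=1" using mu by (simp add: norm_exp_eq_Re mult_nonneg_nonpos)
   thus "norm (- \<phi> s*?e s)<=norm (\<phi> s)" by (simp add: norm_mult mult_left_le)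
  qed
  moreover have "norm (k a*?e a)<=norm (k a)"
  proof -
   have "Re (x a)<=Re (x t)" using mono[of a t] t by auto
   hence "norm (?e a)<=1" using mu by (simp add: norm_exp_eq_Re mult_nonneg_nonpos)
   thus ?thesis by (simp add: norm_mult mult_left_le)
  qed
  ultimately show "norm (k t)<=u t" unfolding u_def
   using c(1) norm_triangle_sub[of "k t*?e t" "k a*?e a"] by simp
  have "norm ((2 * of_real mu * h t + k t)-(2 * of_real mu * h a + k a))<=integral {a..t} (%s. norm (\<phi> s))"
  proof (rule norm_increment_le_integral[OF sub(2) _ nct])
   fix s assume s: "s\<in>{a..t}"
   have "((%s. 2 * of_real mu * h s + k s) has_vector_derivative 2 * of_real mu*(k s * x' s)+(- 2 * of_real mu * k s * x' s-\<phi> s)) (at s within {a..t})"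
    by (intro has_vector_derivative_add has_vector_derivative_mult_right d' s)
   thus "((%s. 2 * of_real mu * h s + k s) has_vector_derivative-\<phi> s) (at s within {a..t})" by (simp add: algebra_simps)
  qed simp
  thus "norm (2 * of_real mu * h t + k t)<=u t" unfolding u_def
   using c(2) norm_triangle_sub[of "2 * of_real mu * h t + k t" "2 * of_real mu * h a + k a"] by linarith
 qed
 have hu: "norm (h t)<=u t/mu" if t: "t\<in>{a..b}" for t
 proof -
  have "2*mu * norm (h t)=norm (2 * of_real mu * h t)" using mu by (simp add: norm_mult)
  also have "\<dots><=norm (2 * of_real mu * h t + k t) + norm (k t)" using norm_triangle_ineq4[of "2 * of_real mu * h t + k t" "k t"] by simp
  also have "\<dots><=2 * u t" using ku[OF t] mu'[OF t] by simp
  finally show ?thesis using mu by (simp add: field_simps)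
 qed
 have "u b<=(u a + integral {a..b} r) * exp (integral {a..b} (%t. r t/mu + w t))"
 proof (rule gronwall[OF ab])
  show "continuous_on {a..b} u" unfolding u_def
   by (intro continuous_intros indefinite_integral_continuous_1 integrable_continuous_real nc)
  show "(u has_real_derivative norm (\<phi> t)) (at t)&norm (\<phi> t)<=r t+(r t/mu + w t) * u t" if t: "a<t" "t<b" for t
  proof
   have at: "at t within {a..b}=at t" and tt: "t\<in>{a..b}" using t by (auto intro: at_within_interior)
   show "(u has_real_derivative norm (\<phi> t)) (at t)" unfolding u_def
    using integral_has_real_derivative[OF nc tt] at by (auto intro!: derivative_eq_intros)
   have "norm (\<phi> t)<=r t*(1 + u t/mu) + w t * u t"
    using \<phi>(2)[OF tt] hu[OF tt] ku[OF tt] rw(3)[OF tt]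
    mult_left_mono[of "1 + norm (h t)" "1 + u t/mu" "r t"] mult_left_mono[of "norm (k t)" "u t" "w t"] by simp
   thus "norm (\<phi> t)<=r t+(r t/mu + w t) * u t" by (simp add: algebra_simps)
  qed
  show "continuous_on {a..b} (%t. r t/mu + w t)" using mu by (intro continuous_intros rw) auto
 qed (use rw mu in auto)
 moreover have "u a=c" by (simp add: u_def)
 moreover have "b\<in>{a..b}" using ab by simp
 ultimately show ?thesis using ku[of b] mu'[of b] by auto
qed

text \<open>Reduces a property of intervals to one arc with continuous derivative and to
  concatenation. Starting at a parameter e > 0 treats paths from 0 and paths from infinity
  alike.\<close>

lemma R2_chain_induct:
 assumes R: "R2_chain I L" and I: "{0<..1}\<subseteq>I" and e: "0<e" "e<1"
  and piece: "!!a b L'. 0<a==>a<b==>b<=1==>continuous_on {a..b} L' ==>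
   (!!t. t\<in>{a..b}==>(L has_vector_derivative L' t) (at t within {a..b}))==>P a b"
  and trans: "!!a b c. 0<a==>a<b==>b<c==>c<=1==>P a b==>P b c==>P a c"
 shows "P e (1::real)"
proof -
 obtain m and c :: "nat=>real" where c: "c 0=0" "c m=1" "!!i. i<m==>c i<c (Suc i)&R2_arc_on ({c i..c (Suc i)}\<inter>I) L"
  using R unfolding R2_chain_def by blast
 have mono: "c i<=c j" if "i<=j" "j<=m" for i j
  using that
 proof (induction j rule: dec_induct)
  case (step n)
  thus ?case using c(3)[of n] by simp
 qed simp
 have "e<c i-->P e (c i)" if "i<=m" for i using that
 proof (induction i)
  case (Suc i)
  have i: "i<m" "c i<c (Suc i)" "0<=c i" "c (Suc i)<=1" using Suc c mono[of 0 i] mono[of "Suc i" m] by auto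
  have pc: "P a (c (Suc i))" if a: "0<a" "c i<=a" "a<c (Suc i)" for a
  proof -
   obtain L' L'' where L: "!!t. t\<in>{c i..c (Suc i)}\<inter>I==>(L has_vector_derivative L' t) (at t within {c i..c (Suc i)}\<inter>I)&L' t~=0 &
    (L' has_vector_derivative L'' t) (at t within {c i..c (Suc i)}\<inter>I)"
    using c(3)[OF i(1)] unfolding R2_arc_on_def by blast
   have sub: "{a..c (Suc i)}\<subseteq>{c i..c (Suc i)}\<inter>I" using a i I by auto
   show ?thesis
   proof (rule piece[OF a(1,3) i(4)])
    show "continuous_on {a..c (Suc i)} L'" unfolding continuous_on_eq_continuous_within
    using L sub by (meson continuous_within_subset has_vector_derivative_continuous subsetD)
    show "(L has_vector_derivative L' t) (at t within {a..c (Suc i)})" if "t\<in>{a..c (Suc i)}" for t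
    using L[of t] that sub by (meson has_vector_derivative_within_subset subsetD)
   qed
  qed
  show ?case
  proof
   assume ei: "e<c (Suc i)"
   show "P e (c (Suc i))"
   proof (cases "e<c i")
    case True
    have "P e (c i)" using Suc.IH i(1) True by simp
    moreover have "P (c i) (c (Suc i))" by (rule pc) (use i e True in auto)
    ultimately show ?thesis by (rule trans[OF e(1) True i(2,4)])
   qed (use pc e ei in auto)
  qed
 qed (use c e in auto)
 from this[of m] show ?thesis using c e by simp
qed

text \<open>The weight of \<open>variation_along\<close>. At the finitely many corners of a chain
  its value is unspecified, which integrals do not see.\<close>

definition speed :: "(real=>complex)=>real=>real" where
 "speed L t=norm (vector_derivative L (at t within {0..1}))"

lemma speed_piece:
 assumes "0<a" "b<=1" "a<t" "t<b" "(L has_vector_derivative L' t) (at t within {a..b})"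
 shows "speed L t=norm (L' t)"
proof -
 have "at t within {a..b}=at t" "at t within {0..1}=at t" using assms by (auto intro!: at_within_interior)
 thus ?thesis using assms(5) by (simp add: speed_def vector_derivative_at)
qed

lemma speed_integral_piece:
 assumes ab: "0<a" "a<b" "b<=1" and L': "continuous_on {a..b} L'" "!!t. t\<in>{a..b}==>(L has_vector_derivative L' t) (at t within {a..b})"
  and d: "continuous_on {a..b} d"
 shows "((%t. d t * speed L t) has_integral integral {a..b} (%t. d t * norm (L' t))) {a..b}"
proof (rule has_integral_spike_finite[of "{a,b}"])
 show "((%t. d t * norm (L' t)) has_integral integral {a..b} (%t. d t * norm (L' t))) {a..b}"
  using d L' by (intro integrable_integral integrable_continuous_real continuous_intros)
 show "d t * speed L t=d t * norm (L' t)" if "t\<in>{a..b} - {a,b}" for t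
  using speed_piece[OF ab(1,3), of t L L'] L'(2)[of t] that by auto
qed simp

lemma speed_integrable:
 assumes R: "R2_chain I L" "{0<..1}\<subseteq>I" and d: "continuous_on {0<..1} d" and e: "0<e" "e<1"
 shows "(%t. d t * speed L t) integrable_on {e..1}"
proof (rule R2_chain_induct[OF R e])
 fix a b :: real and L' assume "0<a" "a<b" "b<=1" "continuous_on {a..b} L'" "!!t. t\<in>{a..b}==>(L has_vector_derivative L' t) (at t within {a..b})"
 moreover from this have "continuous_on {a..b} d" by (intro continuous_on_subset[OF d]) auto
 ultimately have "((%t. d t * speed L t) has_integral integral {a..b} (%t. d t * norm (L' t))) {a..b}" by (rule speed_integral_piece)
 thus "(%t. d t * speed L t) integrable_on {a..b}" by (auto dest: has_integral_integrable)
next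
 fix a b c :: real assume "0<a" "a<b" "b<c" "c<=1" and 1: "(%t. d t * speed L t) integrable_on {a..b}" "(%t. d t * speed L t) integrable_on {b..c}"
 thus "(%t. d t * speed L t) integrable_on {a..c}"
  using Henstock_Kurzweil_Integration.integrable_combine[OF _ _ 1] by simp
qed

lemma speed_integral_le_variation:
 assumes R: "R2_chain I L" "{0<..1}\<subseteq>I" and g: "continuous_on {0<..1} (%t. g (L t))" and e: "0<e" "e<1"
  and f: "!!t. t\<in>{0<..1}==>f (L t)=g (L t)"
 shows "ennreal (integral {e..1} (%t. norm (g (L t)) * speed L t))<=variation_along f L"
proof -
 have I: "((%t. norm (g (L t)) * speed L t) has_integral integral {e..1} (%t. norm (g (L t)) * speed L t)) {e..1}"
  by (rule integrable_integral[OF speed_integrable[OF R _ e]]) (intro continuous_intros g)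
 have "ennreal (integral {e..1} (%t. norm (g (L t)) * speed L t))=integral\<^sup>N lborel (%t. ennreal (norm (g (L t)) * speed L t) * indicator {e..1} t)"
  by (rule nn_integral_has_integral_lebesgue'[OF _ I, symmetric]) (simp add: speed_def)
 also have "\<dots><=variation_along f L" unfolding variation_along_def
  by (rule nn_integral_mono) (use e f in "auto simp: speed_def indicator_def")
 finally show ?thesis .
qed

text \<open>The bound of \<open>LG_growth_piece\<close> composes: the bound at the end of one piece
  serves as the initial \<open>c\<close> of the next, and the exponential factors multiply.\<close>

lemma LG_growth:
 fixes h k x \<phi>0 :: "complex=>complex" and dr dw :: "real=>real"
 assumes R: "R2_chain I L" "{0<..1}\<subseteq>I" and mu: "0<mu" and e: "0<e" "e<1" and LT: "!!t. t\<in>{0<..1}==>L t\<in>T"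
  and d: "!!z. z\<in>T==>(h has_field_derivative k z * x' z) (at z within T)"
   "!!z. z\<in>T==>(k has_field_derivative (- 2 * of_real mu * k z-\<phi> z) * x' z) (at z within T)"
   "!!z. z\<in>T==>(x has_field_derivative x' z) (at z within T)"
  and mono: "!!s t. s\<in>{0<..1}==>t\<in>{0<..1}==>s<=t==>Re (x (L s))<=Re (x (L t))"
  and cont: "continuous_on T \<phi>" "continuous_on T x'"
  and \<phi>: "!!t. t\<in>{0<..1}==>norm (\<phi> (L t) * x' (L t))<=dr t*(1 + norm (h (L t))) + dw t * norm (k (L t))"
  and rw: "continuous_on {0<..1} dr" "continuous_on {0<..1} dw" "!!t. t\<in>{0<..1}==>0<=dr t&0<=dw t"
  and c: "norm (k (L e))<=c" "norm (2 * of_real mu * h (L e) + k (L e))<=c"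
 shows "mu * norm (h (L 1))<=(c + integral {e..1} (%t. dr t * speed L t)) *
   exp (integral {e..1} (%t. dr t * speed L t)/mu + integral {e..1} (%t. dw t * speed L t))"
proof -
 let ?r = "%t. dr t * speed L t" and ?w = "%t. dw t * speed L t"
 let ?B = "%c a b. (c + integral {a..b} ?r) * exp (integral {a..b} ?r/mu + integral {a..b} ?w)"
 let ?P = "%a b. ?r integrable_on {a..b}&?w integrable_on {a..b} &
  (\<forall>c. norm (k (L a))<=c-->norm (2 * of_real mu * h (L a) + k (L a))<=c -->
   norm (k (L b))<=?B c a b&norm (2 * of_real mu * h (L b) + k (L b))<=?B c a b)"
 have sp: "0<=speed L t" for t by (simp add: speed_def)
 have "?P e 1"
 proof (rule R2_chain_induct[OF R e])
  fix a b :: real and L' assume ab: "0<a" "a<b" "b<=1" and L': "continuous_on {a..b} L'" "!!t. t\<in>{a..b}==>(L has_vector_derivative L' t) (at t within {a..b})"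
  have sub: "{a..b}\<subseteq>{0<..1}" using ab by auto
  have LT': "L ` {a..b}\<subseteq>T" using LT sub by auto
  have Lc: "continuous_on {a..b} L" unfolding continuous_on_eq_continuous_within
   using L'(2) has_vector_derivative_continuous by blast
  note rw' = continuous_on_subset[OF rw(1) sub] continuous_on_subset[OF rw(2) sub]
  note I = speed_integral_piece[OF ab L' rw'(1)] speed_integral_piece[OF ab L' rw'(2)]
  have ch: "((%t. f (L t)) has_vector_derivative f' (L t) * L' t) (at t within {a..b})"
   if t: "t\<in>{a..b}" and f: "!!z. z\<in>T==>(f has_field_derivative f' z) (at z within T)" for f f' :: "complex=>complex" and t
  proof -
   have "(f has_field_derivative f' (L t)) (at (L t) within L ` {a..b})"
    using has_field_derivative_subset[OF f LT'] LT' t by blast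
   from field_vector_diff_chain_within[OF L'(2)[OF t] this] show ?thesis by (simp add: o_def mult.commute)
  qed
  have cT: "continuous_on {a..b} (%t. f (L t))" if "continuous_on T f" for f :: "complex=>complex"
   using continuous_on_compose2[OF that Lc] LT' by auto
  have "norm (k (L b))<=(c + integral {a..b} (%t. dr t * norm (L' t))) * exp (integral {a..b} (%t. dr t * norm (L' t)/mu + dw t * norm (L' t))) &
   norm (2 * of_real mu * h (L b) + k (L b))<=(c + integral {a..b} (%t. dr t * norm (L' t))) * exp (integral {a..b} (%t. dr t * norm (L' t)/mu + dw t * norm (L' t)))"
   if c: "norm (k (L a))<=c" "norm (2 * of_real mu * h (L a) + k (L a))<=c" for c
  proof (rule LG_growth_piece[where h = "%t. h (L t)" and k = "%t. k (L t)" and r = "%t. dr t * norm (L' t)" and w = "%t. dw t * norm (L' t)" and a = a and b = b and mu = mu and x = "%t. x (L t)" and x' = "%t. x' (L t) * L' t" and \<phi> = "%t. \<phi> (L t)*(x' (L t) * L' t)"])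
   show "a<=b" "0<mu" using ab mu by simp_all
   fix t assume t: "t\<in>{a..b}"
   show "((%t. h (L t)) has_vector_derivative k (L t)*(x' (L t) * L' t)) (at t within {a..b}) &
    ((%t. k (L t)) has_vector_derivative-2 * of_real mu * k (L t)*(x' (L t) * L' t)-\<phi> (L t)*(x' (L t) * L' t)) (at t within {a..b}) &
    ((%t. x (L t)) has_vector_derivative x' (L t) * L' t) (at t within {a..b})"
    using ch[OF t d(1)] ch[OF t d(2)] ch[OF t d(3)] by (simp add: algebra_simps)
   show "norm (\<phi> (L t)*(x' (L t) * L' t))<=dr t * norm (L' t)*(1 + norm (h (L t))) + dw t * norm (L' t) * norm (k (L t))"
    using mult_right_mono[OF \<phi>[of t], of "norm (L' t)"] t sub by (auto simp: norm_mult algebra_simps)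
   show "0<=dr t * norm (L' t)&0<=dw t * norm (L' t)" using rw(3)[of t] t sub by auto
  next
   show "Re (x (L s))<=Re (x (L t))" if "s\<in>{a..b}" "t\<in>{a..b}" "s<=t" for s t
    using mono[of s t] that subsetD[OF sub, of s] subsetD[OF sub, of t] by blast
   show "continuous_on {a..b} (%t. \<phi> (L t)*(x' (L t) * L' t))" by (intro continuous_intros cT cont L')
   show "continuous_on {a..b} (%t. dr t * norm (L' t))" "continuous_on {a..b} (%t. dw t * norm (L' t))"
    by (intro continuous_intros rw' L')+
  qed (use c in simp_all)
  moreover have "integral {a..b} ?r=integral {a..b} (%t. dr t * norm (L' t))" "integral {a..b} ?w=integral {a..b} (%t. dw t * norm (L' t))"
   using I by (auto intro: integral_unique)
  moreover have "integral {a..b} (%t. dr t * norm (L' t)/mu + dw t * norm (L' t))=integral {a..b} (%t. dr t * norm (L' t))/mu + integral {a..b} (%t. dw t * norm (L' t))"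
  proof -
   have "(%t. dr t * norm (L' t)) integrable_on {a..b}" "(%t. dw t * norm (L' t)) integrable_on {a..b}"
    by (intro integrable_continuous_real continuous_intros rw' L')+
   thus ?thesis by (subst integral_add) (auto intro: integrable_on_divide)
  qed
  ultimately show "?P a b" using I[THEN has_integral_integrable] by simp
 next
  fix a b c :: real assume abc: "0<a" "a<b" "b<c" "c<=1" and 1: "?P a b" and 2: "?P b c"
  have int: "?r integrable_on {a..c}" "?w integrable_on {a..c}"
   using Henstock_Kurzweil_Integration.integrable_combine[of a b c ?r]
    Henstock_Kurzweil_Integration.integrable_combine[of a b c ?w] 1 2 abc by simp_all
  have sp: "integral {a..c} ?r=integral {a..b} ?r + integral {b..c} ?r" "integral {a..c} ?w=integral {a..b} ?w + integral {b..c} ?w"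
   using int abc by (simp_all add: Henstock_Kurzweil_Integration.integral_combine)
  have nn: "0<=integral {b..c} ?r" "0<=integral {a..b} ?r" "0<=integral {b..c} ?w" "0<=integral {a..b} ?w"
  proof -
   have nn: "0<=?r t" "0<=?w t" if "t\<in>{a..b}\<or>t\<in>{b..c}" for t
    using rw(3)[of t] that abc by (auto simp: speed_def)
   note ii = conjunct1[OF 1] conjunct1[OF conjunct2[OF 1]] conjunct1[OF 2] conjunct1[OF conjunct2[OF 2]]
   show "0<=integral {b..c} ?r" "0<=integral {a..b} ?r" "0<=integral {b..c} ?w" "0<=integral {a..b} ?w"
    by (rule Henstock_Kurzweil_Integration.integral_nonneg[OF ii(3)] Henstock_Kurzweil_Integration.integral_nonneg[OF ii(1)]
    Henstock_Kurzweil_Integration.integral_nonneg[OF ii(4)] Henstock_Kurzweil_Integration.integral_nonneg[OF ii(2)], simp add: nn)+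
  qed
  have B: "?B (?B C a b) b c<=?B C a c" for C
  proof -
   let ?E = "exp (integral {a..b} ?r/mu + integral {a..b} ?w)" and ?F = "exp (integral {b..c} ?r/mu + integral {b..c} ?w)"
   have "1<=?E" using nn mu by simp
   hence "integral {b..c} ?r<=integral {b..c} ?r*?E" using nn(1) by (simp add: mult_le_cancel_left1)
   hence "(?B C a b + integral {b..c} ?r)*?F<=((C + integral {a..b} ?r)*?E + integral {b..c} ?r*?E)*?F"
    by (intro mult_right_mono) auto
   also have "\<dots>=?B C a c" unfolding sp by (simp add: algebra_simps add_divide_distrib exp_add)
   finally show ?thesis .
  qed
  have "norm (k (L c))<=?B C a c&norm (2 * of_real mu * h (L c) + k (L c))<=?B C a c"
   if C: "norm (k (L a))<=C" "norm (2 * of_real mu * h (L a) + k (L a))<=C" for C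
  proof -
   have "norm (k (L b))<=?B C a b" "norm (2 * of_real mu * h (L b) + k (L b))<=?B C a b" using 1 C by blast+
   hence "norm (k (L c))<=?B (?B C a b) b c" "norm (2 * of_real mu * h (L c) + k (L c))<=?B (?B C a b) b c" using 2 by blast+
   thus ?thesis using B[of C] by linarith
  qed
  thus "?P a c" using int by blast
 qed
 hence b: "norm (k (L 1))<=?B c e 1" "norm (2 * of_real mu * h (L 1) + k (L 1))<=?B c e 1" using c by auto
 have "2*mu * norm (h (L 1))=norm (2 * of_real mu * h (L 1))" using mu by (simp add: norm_mult)
 also have "\<dots><=norm (2 * of_real mu * h (L 1) + k (L 1)) + norm (k (L 1))" using norm_triangle_ineq4[of "2 * of_real mu * h (L 1) + k (L 1)" "k (L 1)"] by simp
 finally show ?thesis using b by simp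
qed

text \<open>Riccati residual of the partial sum of the F_s/m^s. Products F_k F_l with k + l < N
  cancel against the derivative, those with k + l >= N form the G-sums, and the linear terms
  telescope down to -2 F_N.\<close>

lemma LG_residual:
 fixes F :: "nat=>'a::field"
 assumes N: "1<=N" and m: "m~=0"
 shows "(\<Sum>s\<in>{1..<N}. (- 2 * F (Suc s)-(\<Sum>j\<in>{1..<s}. F j * F (s - j)))/m^s)+2 * m*(\<Sum>s\<in>{1..<N}. F s/m^s)
   + (\<Sum>s\<in>{1..<N}. F s/m^s)\<^sup>2-2 * F 1
 =(- 2 * F N+(\<Sum>s\<in>{1..<N}. (\<Sum>k\<in>{s..<N}. F k * F (s + N - k-1))/m^s))/m^(N-1)"
proof -
 let ?f = "%(k,l). F k * F l/m^(k + l)"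
 let ?P = "{1..<N} \<times> {1..<N}"
 have sq: "(\<Sum>s\<in>{1..<N}. F s/m^s)\<^sup>2=(\<Sum>x\<in>?P. ?f x)"
  unfolding power2_eq_square sum_product sum.cartesian_product by (intro sum.cong) (auto simp: power_add)
 have low: "(\<Sum>s\<in>{1..<N}. (\<Sum>j\<in>{1..<s}. F j * F (s - j))/m^s)=(\<Sum>x\<in>{x\<in>?P. fst x + snd x<N}. ?f x)"
 proof -
  have "(\<Sum>s\<in>{1..<N}. (\<Sum>j\<in>{1..<s}. F j * F (s - j))/m^s)=(\<Sum>(s,j)\<in>(SIGMA s:{1..<N}. {1..<s}). F j * F (s - j)/m^s)"
   by (simp add: sum_divide_distrib sum.Sigma)
  also have "\<dots>=(\<Sum>x\<in>{x\<in>?P. fst x + snd x<N}. ?f x)"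
   by (rule sum.reindex_bij_witness[of _ "%(k,l). (k + l,k)" "%(s,j). (j,s - j)"]) auto
  finally show ?thesis .
 qed
 have high: "(\<Sum>s\<in>{1..<N}. (\<Sum>k\<in>{s..<N}. F k * F (s + N - k-1))/m^s)/m^(N-1)=(\<Sum>x\<in>{x\<in>?P. \<not> fst x + snd x<N}. ?f x)"
 proof -
  have "(\<Sum>s\<in>{1..<N}. (\<Sum>k\<in>{s..<N}. F k * F (s + N - k-1))/m^s)/m^(N-1)
    =(\<Sum>s\<in>{1..<N}. \<Sum>k\<in>{s..<N}. F k * F (s + N - k-1)/m^(s+(N-1)))"
   unfolding sum_divide_distrib power_add by (simp only: divide_divide_eq_left)
  also have "\<dots>=(\<Sum>(s,k)\<in>(SIGMA s:{1..<N}. {s..<N}). F k * F (s + N - k-1)/m^(s+(N-1)))"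
   by (rule sum.Sigma) auto
  also have "\<dots>=(\<Sum>x\<in>{x\<in>?P. \<not> fst x + snd x<N}. ?f x)"
  proof (rule sum.reindex_bij_witness[of _ "%(k,l). (k + l+1 - N,k)" "%(s,k). (k,s + N - k-1)"])
   fix a assume "a\<in>(SIGMA s:{1..<N}. {s..<N})"
   then obtain s k where a: "a=(s,k)" "1<=s" "s<N" "s<=k" "k<N" by auto
   have "k+(s + N - k-1)+1 - N=s" "k+(s + N - k-1)=s+(N-1)" "1<=s + N - k-1" "s + N - k-1<N" using a by arith+
   thus "(case case a of (s,k)=>(k,s + N - k-1) of (k,l)=>(k + l+1 - N,k))=a"
    "(case a of (s,k)=>(k,s + N - k-1))\<in>{x\<in>?P. \<not> fst x + snd x<N}"
    "?f (case a of (s,k)=>(k,s + N - k-1))=(case a of (s,k)=>F k * F (s + N - k-1)/m^(s+(N-1)))"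
    unfolding a(1) prod.case using a by (simp_all del: One_nat_def)
  next
   fix b assume "b\<in>{x\<in>?P. \<not> fst x + snd x<N}"
   then obtain k l where b: "b=(k,l)" "1<=k" "k<N" "1<=l" "l<N" "\<not> k + l<N" by auto
   have "k + l+1 - N + N - k-1=l" "1<=k + l+1 - N" "k + l+1 - N<N" "k + l+1 - N<=k" using b by arith+
   thus "(case case b of (k,l)=>(k + l+1 - N,k) of (s,k)=>(k,s + N - k-1))=b"
    "(case b of (k,l)=>(k + l+1 - N,k))\<in>(SIGMA s:{1..<N}. {s..<N})"
    unfolding b(1) prod.case using b by (simp_all del: One_nat_def)
  qed
  finally show ?thesis .
 qed
 have split: "(\<Sum>x\<in>?P. ?f x)=(\<Sum>x\<in>{x\<in>?P. fst x + snd x<N}. ?f x)+(\<Sum>x\<in>{x\<in>?P. \<not> fst x + snd x<N}. ?f x)"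
  by (subst sum.union_disjoint[symmetric]) (auto intro!: sum.cong)
 have tel: "(\<Sum>s\<in>{1..<N}. - 2 * F (Suc s)/m^s)+2 * m*(\<Sum>s\<in>{1..<N}. F s/m^s)=2 * F 1-2 * F N/m^(N-1)"
  using N
 proof (induction N rule: nat_induct_at_least)
  case (Suc n)
  obtain j where n: "n=Suc j" using Suc.hyps(1) by (cases n) auto
  have "F n*2 * m/m^n=2 * F n/m^(n-1)" using m n by (simp add: field_simps)
  thus ?case using Suc by (simp add: sum.atLeastLessThan_Suc distrib_left) (simp add: algebra_simps)
 qed simp
 have "(\<Sum>s\<in>{1..<N}. (- 2 * F (Suc s)-(\<Sum>j\<in>{1..<s}. F j * F (s - j)))/m^s)
   =(\<Sum>s\<in>{1..<N}. - 2 * F (Suc s)/m^s)-(\<Sum>s\<in>{1..<N}. (\<Sum>j\<in>{1..<s}. F j * F (s - j))/m^s)"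
  by (simp add: diff_divide_distrib sum_subtractf)
 note dec = this
 have alg: "a - lo + t+(lo + hi)-2 * f = - g + hi" if "a + t=2 * f - g" for a t f g lo hi :: 'a
 proof -
  have "a - lo + t+(lo + hi)-2 * f=(a + t)-2 * f + hi" by (simp add: algebra_simps)
  thus ?thesis using that by simp
 qed
 show ?thesis unfolding sq split dec low add_divide_distrib high using alg[OF tel] by (simp only: minus_divide_left mult_minus_left)
qed

section \<open>The Liouville-Green system for the relative error\<close>

context lam_range
begin

text \<open>Logarithmic derivative of (z/Z)^(1/2) with respect to xi. Similarly \<open>psum\<close>
  is the derivative of the correction terms of the exponent \<open>Ssum\<close>, and
  \<open>Rres\<close> is the residual found in \<open>LG_residual\<close>.\<close>

definition bq :: "complex=>complex=>complex" where "bq Z z=(4-2 * of_real lam * z)/Z^3"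
definition psum :: "real=>nat=>complex=>complex=>complex" where
 "psum mu N Z z=(\<Sum>s\<in>{1..<N}. Fb s Z z/of_real mu^s)"
definition Ssum :: "real=>nat=>(nat=>complex)=>complex=>complex=>complex" where
 "Ssum mu N e Z z = of_real mu * xiB lam Z z+(\<Sum>s\<in>{1..<N}. (Eb s Z z - e s)/of_real mu^s)"
definition Rres :: "real=>nat=>complex=>complex=>complex" where
 "Rres mu N Z z=(- 2 * Fb N Z z+(\<Sum>s\<in>{1..<N}. Gb N s Z z/of_real mu^s))/of_real mu^(N-1)"

lemma bq_alt: "Z^2=Q z==>Z~=0==>bq Z z=1/Z - z*(z-2 * of_real lam)/Z^3"
proof -
 assume Z: "Z^2=Q z" "Z~=0"
 have "1/Z - z*(z-2 * of_real lam)/Z^3=(Z^2 - z*(z-2 * of_real lam))/Z^3"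
  using Z(2) by (simp add: field_simps eval_nat_numeral)
 also have "Z^2 - z*(z-2 * of_real lam)=4-2 * of_real lam * z"
  unfolding Z(1) Zsq_def by (simp add: algebra_simps power2_eq_square)
 finally show ?thesis by (simp add: bq_def)
qed

text \<open>The origin of F_1: with b = \<open>bq\<close>, the Liouville transformation leaves
  db/dxi + 1/Z^2 - b^2, and this is -2 F_1. The fraction on the left is db/dxi by
  \<open>bq_deriv\<close>.\<close>

lemma F1_identity:
 assumes Z: "Z^2=Q z" "Z~=0"
 shows "2 * z*(- 2 * of_real lam * Z^2-3*(4-2 * of_real lam * z)*(z-2 * of_real lam))/Z^6+1/Z^2-(bq Z z)\<^sup>2 = - 2 * Fb 1 Z z"
proof -
 have F: "- 2 * Fb 1 Z z=z*(z^3-16 * z+4 * of_real lam^2 * z+16 * of_real lam)/Z^6"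
 proof -
  have "poly (Pc 1) z = - (1/2)*(z*(z^3-16 * z+4 * of_real lam^2 * z+16 * of_real lam))"
   by (simp add: algebra_simps eval_nat_numeral)
  thus ?thesis by (simp add: Fb_def)
 qed
 have "1/Z^2=(Z^2)\<^sup>2/Z^6" using Z(2) by (simp add: field_simps eval_nat_numeral)
 moreover have "(bq Z z)\<^sup>2=(4-2 * of_real lam * z)\<^sup>2/Z^6" by (simp add: bq_def power_divide flip: power_mult)
 ultimately have "2 * z*(- 2 * of_real lam * Z^2-3*(4-2 * of_real lam * z)*(z-2 * of_real lam))/Z^6+1/Z^2-(bq Z z)\<^sup>2 =
  (2 * z*(- 2 * of_real lam * Z^2-3*(4-2 * of_real lam * z)*(z-2 * of_real lam))+(Z^2)\<^sup>2-(4-2 * of_real lam * z)\<^sup>2)/Z^6"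
  by (simp add: add_divide_distrib diff_divide_distrib)
 also have "2 * z*(- 2 * of_real lam * Z^2-3*(4-2 * of_real lam * z)*(z-2 * of_real lam))+(Z^2)\<^sup>2-(4-2 * of_real lam * z)\<^sup>2
  =z*(z^3-16 * z+4 * of_real lam^2 * z+16 * of_real lam)"
  unfolding Z(1) Zsq_def by (simp add: algebra_simps eval_nat_numeral)
 finally show ?thesis using F by simp
qed

lemma psum_deriv:
 assumes d: "(Z has_field_derivative (z-2 * of_real lam)/Z z) (at z within T)" and Z: "Z z^2=Q z" "Z z~=0" and z: "z~=0"
 shows "((%t. psum mu N (Z t) t) has_field_derivative
  (\<Sum>s\<in>{1..<N}. (- 2 * Fb (Suc s) (Z z) z-(\<Sum>j\<in>{1..<s}. Fb j (Z z) z * Fb (s - j) (Z z) z))/of_real mu^s)*(Z z/(2 * z))) (at z within T)"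
 unfolding psum_def sum_distrib_right
proof (rule DERIV_sum)
 fix s assume "s\<in>{1..<N}"
 then obtain t where s: "s=Suc t" by (cases s) auto
 have "((%t. Fb s (Z t) t/of_real mu^s) has_field_derivative
  (- (Z z/z)*(Fb (Suc s) (Z z) z+1/2*(\<Sum>j\<in>{1..t}. Fb j (Z z) z * Fb (s - j) (Z z) z)))/of_real mu^s) (at z within T)"
  unfolding s by (intro DERIV_cdivide Fb_deriv[where Z = Z] assms)
 moreover have "{1..t}={1..<s}" using s by auto
 ultimately have "((%t. Fb s (Z t) t/of_real mu^s) has_field_derivative
  (- (Z z/z)*(Fb (Suc s) (Z z) z+1/2*(\<Sum>j\<in>{1..<s}. Fb j (Z z) z * Fb (s - j) (Z z) z)))/of_real mu^s) (at z within T)" by (simp only:)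
 note calculation = this
 show "((%t. Fb s (Z t) t/of_real mu^s) has_field_derivative
   (- 2 * Fb (Suc s) (Z z) z-(\<Sum>j\<in>{1..<s}. Fb j (Z z) z * Fb (s - j) (Z z) z))/of_real mu^s*(Z z/(2 * z))) (at z within T)"
 proof -
  have "- (w/z)*(f+1/2 * g)/M=(- 2 * f - g)/M*(w/(2 * z))" for w f g M :: complex
   using z by (cases "M=0") (simp_all add: field_simps)
  thus ?thesis using calculation by (simp only:)
 qed
qed

lemma Ssum_deriv:
 assumes c: "continuous_on T Z" and Z: "!!t. t\<in>T==>Z t^2=Q t" "!!t. t\<in>T==>Z t~=0" and T: "T\<subseteq>Cplus" and z: "z\<in>T"
 shows "((%t. Ssum mu N e (Z t) t) has_field_derivative (of_real mu + psum mu N (Z z) z)*(Z z/(2 * z))) (at z within T)"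
proof -
 have cz: "continuous (at z within T) Z" using c z by (simp add: continuous_on_eq_continuous_within)
 have z0: "z~=0" using T z by (auto simp: Cplus_def)
 have d: "(Z has_field_derivative (z-2 * of_real lam)/Z z) (at z within T)" by (rule branch_deriv[OF cz Z(1) z Z(2)[OF z]])
 have "((%t. Ssum mu N e (Z t) t) has_field_derivative of_real mu*(Z z/(2 * z))+(\<Sum>s\<in>{1..<N}. (Z z * Fb s (Z z) z/(2 * z)-0)/of_real mu^s)) (at z within T)"
  unfolding Ssum_def
  by (intro DERIV_add DERIV_cmult branch_xi_deriv[OF cz Z(1) z Z(2)[OF z] T] DERIV_sum DERIV_cdivide DERIV_diff DERIV_const Eb_deriv[where Z = Z] d Z z z0)
 moreover have "(\<Sum>s\<in>{1..<N}. (Z z * Fb s (Z z) z/(2 * z)-0)/of_real mu^s)=psum mu N (Z z) z*(Z z/(2 * z))"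
  unfolding psum_def sum_distrib_right by (intro sum.cong) (auto simp: field_simps)
 ultimately show ?thesis by (simp only: distrib_right)
qed

lemma bq_deriv:
 assumes d: "(Z has_field_derivative (z-2 * of_real lam)/Z z) (at z within T)" and Z: "Z z~=0" and z: "z~=0"
 shows "((%t. bq (Z t) t) has_field_derivative
  (2 * z*(- 2 * of_real lam * Z z^2-3*(4-2 * of_real lam * z)*(z-2 * of_real lam))/Z z^6)*(Z z/(2 * z))) (at z within T)"
proof -
 have "((%t. bq (Z t) t) has_field_derivative
  ((0-2 * of_real lam*1) * Z z^3-(4-2 * of_real lam * z)*(of_nat 3*((z-2 * of_real lam)/Z z * Z z^(3 - Suc 0))))/(Z z^3 * Z z^3)) (at z within T)"
  unfolding bq_def by (intro DERIV_divide DERIV_diff DERIV_const DERIV_cmult DERIV_ident DERIV_power d) (use Z in simp)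
 moreover have "((0-2 * of_real lam*1) * Z z^3-(4-2 * of_real lam * z)*(of_nat 3*((z-2 * of_real lam)/Z z * Z z^(3 - Suc 0))))/(Z z^3 * Z z^3)
  =(2 * z*(- 2 * of_real lam * Z z^2-3*(4-2 * of_real lam * z)*(z-2 * of_real lam))/Z z^6)*(Z z/(2 * z))"
 proof -
  have "((0-2 * l*1) * w^3 - a*(of_nat 3*(g/w * w^(3 - Suc 0))))/(w^3 * w^3)=(2 * z*(- 2 * l * w^2-3 * a * g)/w^6)*(w/(2 * z))"
   if "w~=0" for w a g l :: complex
  proof -
   have "w^3 * w^3=w^6" "w^6=w * w^5" "w^3=w * w^2" "g/w * w^(3 - Suc 0)=g * w" using that by (simp_all add: eval_nat_numeral)
   hence "((0-2 * l*1) * w^3 - a*(of_nat 3*(g/w * w^(3 - Suc 0))))/(w^3 * w^3)=(w*(- 2 * l * w^2-3 * a * g))/(w * w^5)"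
    by (simp only:) (simp add: algebra_simps)
   also have "\<dots>=(2 * z*(- 2 * l * w^2-3 * a * g)/(w * w^5))*(w/(2 * z))" using z by simp
   finally show ?thesis by (simp add: eval_nat_numeral)
  qed
  from this[OF Z] show ?thesis .
 qed
 ultimately show ?thesis by simp
qed

text \<open>Reciprocal of the truncated approximation, \<open>A\<close> being its normalising
  constant and \<open>e\<close> the constants subtracted from the E_s. In \<open>LGk\<close> the
  argument \<open>W1\<close> stands for z dW/dz, so that 2 W1/Z is dW/dxi; what is subtracted is W
  times the logarithmic derivative of the approximation.\<close>

definition LGu :: "real=>nat=>(nat=>complex)=>complex=>complex=>complex=>complex=>complex" where
 "LGu mu N e A Z q z=exp (- Ssum mu N e Z z)/(A * q)"
definition LGk :: "real=>nat=>complex=>complex=>complex=>complex=>complex" where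
 "LGk mu N Z z W W1=2 * W1/Z-(of_real mu + psum mu N Z z + bq Z z) * W"

text \<open>The independent variable is xi on the branch \<open>Z\<close>, and k = u V is the
  derivative of W u. In the derivative of k the terms free of the F_s reduce to -2 F_1 by
  \<open>F1_identity\<close>, and \<open>LG_residual\<close> leaves only
  \<open>Rres\<close>.\<close>

lemma LG_equations:
 fixes e :: "nat=>complex"
 assumes c: "continuous_on T Z" and Z: "!!t. t\<in>T==>Z t^2=Q t" "!!t. t\<in>T==>Z t~=0" and T: "T\<subseteq>Cplus" and z: "z\<in>T"
  and q: "continuous_on T q" "!!t. t\<in>T==>q t^2=t/Z t" and A: "A~=0" and mu: "0<mu" and N: "1<=N"
  and W: "(W has_field_derivative W1 z/z) (at z within T)"
   "(W1 has_field_derivative (W1 z+(of_real mu^2 * Q z/4-1/4) * W z)/z) (at z within T)"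
 defines "u \<equiv> %t. LGu mu N e A (Z t) (q t) t" and "V \<equiv> %t. LGk mu N (Z t) t (W t) (W1 t)"
 shows "((%t. W t * u t) has_field_derivative u z * V z*(Z z/(2 * z))) (at z within T)"
  "((%t. u t * V t) has_field_derivative (- 2 * of_real mu*(u z * V z)-(2 * psum mu N (Z z) z*(u z * V z) + Rres mu N (Z z) z*(W z * u z)))*(Z z/(2 * z))) (at z within T)"
proof -
 have cz: "continuous (at z within T) Z" and cq: "continuous (at z within T) q" using c q z by (simp_all add: continuous_on_eq_continuous_within)
 have z0: "z~=0" using T z by (auto simp: Cplus_def)
 have Zz: "Z z^2=Q z" "Z z~=0" using Z z by auto
 have q0: "q z~=0" using q(2)[OF z] z0 Zz by auto
 have d: "(Z has_field_derivative (z-2 * of_real lam)/Z z) (at z within T)" by (rule branch_deriv[OF cz Z(1) z Zz(2)])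
 let ?x = "Z z/(2 * z)" and ?b = "bq (Z z) z" and ?p = "psum mu N (Z z) z"
 let ?Dp = "\<Sum>s\<in>{1..<N}. (- 2 * Fb (Suc s) (Z z) z-(\<Sum>j\<in>{1..<s}. Fb j (Z z) z * Fb (s - j) (Z z) z))/of_real mu^s"
 let ?Db = "2 * z*(- 2 * of_real lam * Z z^2-3*(4-2 * of_real lam * z)*(z-2 * of_real lam))/Z z^6"
 have b: "?b=1/Z z - z*(z-2 * of_real lam)/Z z^3" by (rule bq_alt[OF Zz])
 have dq: "(q has_field_derivative q z*?b*?x) (at z within T)"
 proof -
  have "((%t. t/Z t) has_field_derivative (1 * Z z - z*((z-2 * of_real lam)/Z z))/(Z z * Z z)) (at z within T)"
   by (intro DERIV_divide DERIV_ident d Zz)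
  from sqrt_branch_deriv[OF cq q(2) q0 this z]
  have "(q has_field_derivative (1 * Z z - z*((z-2 * of_real lam)/Z z))/(Z z * Z z)/(2 * q z)) (at z within T)" .
  moreover have "(1 * Z z - z*((z-2 * of_real lam)/Z z))/(Z z * Z z)=?b"
   unfolding b using Zz(2) by (simp add: field_simps eval_nat_numeral)
  moreover have "?b/(2 * q z)=q z*?b*?x"
  proof -
   have "?x=1/(2 * q z^2)" using q(2)[OF z] z0 Zz(2) by simp
   thus ?thesis using q0 by (simp add: power2_eq_square)
  qed
  ultimately show ?thesis by (simp only:)
 qed
 have du: "(u has_field_derivative - u z*(of_real mu + ?p+?b)*?x) (at z within T)"
 proof -
  have "((%t. exp (- Ssum mu N e (Z t) t)) has_field_derivative exp (- Ssum mu N e (Z z) z)*(- ((of_real mu + ?p)*?x))) (at z within T)"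
   by (rule DERIV_chain2[where f = exp, OF DERIV_exp]) (intro DERIV_minus Ssum_deriv c Z T z)
  hence "(u has_field_derivative (exp (- Ssum mu N e (Z z) z)*(- ((of_real mu + ?p)*?x))*(A * q z) - exp (- Ssum mu N e (Z z) z)*(A*(q z*?b*?x)))/((A * q z)*(A * q z))) (at z within T)"
   unfolding u_def LGu_def by (intro DERIV_divide DERIV_cmult dq) (use A q0 in auto)
  moreover have "(exp (- Ssum mu N e (Z z) z)*(- ((of_real mu + ?p)*?x))*(A * q z) - exp (- Ssum mu N e (Z z) z)*(A*(q z*?b*?x)))/((A * q z)*(A * q z))
   = - u z*(of_real mu + ?p+?b)*?x"
  proof -
   have "(E*(- (M * x)) * B - E*(A*(q z*?b * x)))/(B * B) = - (E/B)*(M+?b) * x" if "B=A * q z" "B~=0" for E M x B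
   proof -
    have "E*(- (M * x)) * B - E*(A*(q z*?b * x))=(- E*(M+?b) * x) * B" unfolding that(1) by (simp add: algebra_simps)
    thus ?thesis using that(2) by simp
   qed
   from this[OF refl] A q0 show ?thesis unfolding u_def LGu_def by (simp only: mult_eq_0_iff not_False_eq_True simp_thms)
  qed
  ultimately show ?thesis by (simp only:)
 qed
 have W': "(W has_field_derivative (2 * W1 z/Z z)*?x) (at z within T)"
  using W(1) Zz(2) z0 by simp
 show "((%t. W t * u t) has_field_derivative u z * V z*?x) (at z within T)"
 proof -
  have "w*(- u * M * x)+(v * x) * u=u*(v - M * w) * x" for w u M x v :: complex by (simp add: algebra_simps)
  with DERIV_mult'[OF W' du] show ?thesis unfolding V_def LGk_def by (simp only:)
 qed
 have R: "Rres mu N (Z z) z=?Dp+2 * of_real mu*?p+?p\<^sup>2+?Db+1/Z z^2-?b\<^sup>2"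
  using LG_residual[OF N, of "complex_of_real mu" "%s. Fb s (Z z) z"] mu F1_identity[OF Zz]
  by (simp add: Rres_def Gb_def psum_def algebra_simps)
 have dV: "(V has_field_derivative ((2*(W1 z+(of_real mu^2 * Q z/4-1/4) * W z)/z) * Z z-2 * W1 z*((z-2 * of_real lam)/Z z))/(Z z * Z z)
   - ((of_real mu + ?p+?b)*((2 * W1 z/Z z)*?x)+(0+?Dp*?x+?Db*?x) * W z)) (at z within T)"
  unfolding V_def LGk_def times_divide_eq_right[symmetric, of 2 _ z]
  by (intro DERIV_diff DERIV_divide DERIV_cmult W DERIV_mult' DERIV_add DERIV_const psum_deriv bq_deriv d W' Zz z0)
 \<comment> \<open>The cancellation as an identity in t = 1/Z, with x for dxi/dz and Q written as
   1/t^2.\<close>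
 have alg: "- u * M * x * V + u*(x*(4 * t^2*(w1+(m^2/(4 * t^2)-1/4) * w)-4 * t*(t - b) * w1)-(M*((2 * w1 * t) * x)+(0 + Dp * x + Db * x) * w))
  =(- 2 * m*(u * V)-(2 * p*(u * V)+(Dp+2 * m * p + p^2 + Db + t^2 - b^2)*(w * u))) * x"
  if "M=m + p + b" "V=2 * w1 * t - M * w" "t~=0" for u M x V t m p b w w1 Dp Db :: complex
 proof -
  have "4 * t^2*(w1+(m^2/(4 * t^2)-1/4) * w)=4 * t^2 * w1 + m^2 * w - t^2 * w" using that(3) by (simp add: field_simps)
  thus ?thesis unfolding that(1,2) by (simp add: algebra_simps power2_eq_square)
 qed
 have e1: "((2*(W1 z+(of_real mu^2 * Q z/4-1/4) * W z)/z) * Z z-2 * W1 z*((z-2 * of_real lam)/Z z))/(Z z * Z z)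
  =?x*(4*(1/Z z)^2*(W1 z+(of_real mu ^2/(4*(1/Z z)^2)-1/4) * W z)-4*(1/Z z)*(1/Z z-?b) * W1 z)"
 proof -
  have "4*(1/Z z)*(1/Z z-?b)=4 * z*(z-2 * of_real lam)/Z z^4" unfolding b using Zz(2) by (simp add: field_simps eval_nat_numeral)
  moreover have "of_real mu ^2/(4*(1/Z z)^2) = of_real mu^2 * Q z/4" using Zz by (simp add: field_simps)
  moreover have "((2 * M/y) * w-2 * w1*(g/w))/(w * w)=(w/(2 * y))*(4*(1/w)^2 * M-4 * y * g/w^4 * w1)"
   if "w~=0" "y~=0" for M w w1 g y :: complex
   using that by (simp add: field_simps eval_nat_numeral)
  ultimately show ?thesis using Zz(2) z0 by (simp only: not_False_eq_True simp_thms)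
 qed
 from DERIV_mult'[OF du dV[unfolded e1]]
 have "((%t. u t * V t) has_field_derivative - u z*(of_real mu + ?p+?b)*?x * V z +
   u z*(?x*(4*(1/Z z)^2*(W1 z+(of_real mu ^2/(4*(1/Z z)^2)-1/4) * W z)-4*(1/Z z)*(1/Z z-?b) * W1 z)
   - ((of_real mu + ?p+?b)*((2 * W1 z*(1/Z z))*?x)+(0+?Dp*?x+?Db*?x) * W z))) (at z within T)"
  by (simp add: add.commute)
 thus "((%t. u t * V t) has_field_derivative (- 2 * of_real mu*(u z * V z)-(2*?p*(u z * V z) + Rres mu N (Z z) z*(W z * u z)))*?x) (at z within T)"
  by (subst (asm) alg) (use Zz(2) in "simp_all add: V_def LGk_def R power_one_over")
qed

lemma LG_bound:
 fixes e :: "nat=>complex"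
 assumes c: "continuous_on T Z" and Z: "!!t. t\<in>T==>Z t^2=Q t" "!!t. t\<in>T==>Z t~=0" and T: "T\<subseteq>Cplus"
  and q: "continuous_on T q" "!!t. t\<in>T==>q t^2=t/Z t" and A: "A~=0" and mu: "0<mu" and N: "1<=N"
  and W: "!!z. z\<in>T==>(W has_field_derivative W1 z/z) (at z within T)"
   "!!z. z\<in>T==>(W1 has_field_derivative (W1 z+(of_real mu^2 * Q z/4-1/4) * W z)/z) (at z within T)"
  and R: "R2_chain I L" "{0<..1}\<subseteq>I" and LT: "!!t. t\<in>{0<..1}==>L t\<in>T"
  and mono: "!!s t. s\<in>{0<..1}==>t\<in>{0<..1}==>s<=t==>Re (xiB lam (Z (L s)) (L s))<=Re (xiB lam (Z (L t)) (L t))"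
  and cf: "!!z n. z\<in>T==>continue_from S C (%t. Z_pv lam t * hatF lam n t/t) z=Z z * Fb n (Z z) z/z"
   "!!z n s. z\<in>T==>continue_from S C (%t. Z_pv lam t * hatG lam n s t/t) z=Z z * Gb n s (Z z) z/z"
  and lim: "((%t. W (L t) * LGu mu N e A (Z (L t)) (q (L t)) (L t))\<longlongrightarrow>1) (at_right 0)"
   "((%t. LGu mu N e A (Z (L t)) (q (L t)) (L t) * LGk mu N (Z (L t)) (L t) (W (L t)) (W1 (L t)))\<longlongrightarrow>0) (at_right 0)"
  and fin: "omega lam mu S C N L<\<infinity>" "varpi lam mu S C N L<\<infinity>"
 shows "norm (W (L 1) * LGu mu N e A (Z (L 1)) (q (L 1)) (L 1)-1)<=enn2real (omega lam mu S C N L)/mu^N *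
  exp (enn2real (varpi lam mu S C N L)/(2*mu) + enn2real (omega lam mu S C N L)/mu^N)"
proof -
 define u where "u z=LGu mu N e A (Z z) (q z) z" for z
 define V where "V z=LGk mu N (Z z) z (W z) (W1 z)" for z
 define h where "h z=W z * u z-1" for z
 define k where "k z=u z * V z" for z
 define p where "p z=2 * psum mu N (Z z) z" for z
 define R0 where "R0 z=Rres mu N (Z z) z" for z
 define x' where "x' z=Z z/(2 * z)" for z
 define \<phi> where "\<phi> z=p z * k z + R0 z*(h z+1)" for z
 define f where "f s z=Z z * Fb s (Z z) z/z" for s z
 define g where "g s z=Z z * Gb N s (Z z) z/z" for s z
 define dr where "dr z=(norm (f N z)+(\<Sum>s\<in>{1..<N}. norm (g s z)/(2*mu^s)))/mu^(N-1)" for z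
 define dw where "dw z=(\<Sum>s\<in>{1..<N}. norm (f s z)/mu^s)" for z
 define om where "om=enn2real (omega lam mu S C N L)"
 define nu where "nu=enn2real (varpi lam mu S C N L)"
 have eqs: "((%t. W t * u t) has_field_derivative k z * x' z) (at z within T)"
  "(k has_field_derivative (- 2 * of_real mu * k z-\<phi> z) * x' z) (at z within T)" if z: "z\<in>T" for z
  using LG_equations[OF c Z T z q A mu N W[OF z], of e]
  unfolding u_def[symmetric] V_def[symmetric] x'_def[symmetric] p_def[symmetric] R0_def[symmetric]
  by (simp_all add: k_def[abs_def] \<phi>_def p_def h_def mult.assoc)
 have T0: "z~=0" if "z\<in>T" for z using T that by (auto simp: Cplus_def)
 have hd: "(h has_field_derivative k z * x' z) (at z within T)" if "z\<in>T" for z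
  using DERIV_diff[OF eqs(1)[OF that] DERIV_const[of 1]] by (simp add: h_def[abs_def])
 have xd: "((%z. xiB lam (Z z) z) has_field_derivative x' z) (at z within T)" if "z\<in>T" for z unfolding x'_def
  using c that by (intro branch_xi_deriv[OF _ Z(1) that Z(2)[OF that] T]) (auto simp: continuous_on_eq_continuous_within)
 have hc: "continuous_on T h" "continuous_on T k"
  using DERIV_continuous hd eqs(2) unfolding continuous_on_eq_continuous_within by blast+
 have Fc: "continuous_on T (%z. Fb s (Z z) z)" for s unfolding Fb_def using Z(2) by (intro continuous_intros c) auto
 have Gc: "continuous_on T (%z. Gb N s (Z z) z)" for s unfolding Gb_def by (intro continuous_intros Fc)
 have \<phi>c: "continuous_on T \<phi>" unfolding \<phi>_def p_def R0_def psum_def Rres_def using mu by (intro continuous_intros Fc Gc hc) auto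
 have xc: "continuous_on T x'" unfolding x'_def using T0 by (intro continuous_intros c) auto
 have Lc: "continuous_on {0<..1} L" using R continuous_on_subset unfolding R2_chain_def by blast
 have fgT: "continuous_on T (f s)" "continuous_on T (g s)" for s
  unfolding f_def g_def using T0 by (intro continuous_intros c Fc Gc; simp)+
 have cL: "continuous_on {0<..1} (%t. F (L t))" if "continuous_on T F" for F :: "complex=>complex"
  by (rule continuous_on_compose2[OF that Lc]) (use LT in blast)
 have fgc: "continuous_on {0<..1} (%t. norm (f s (L t)))" "continuous_on {0<..1} (%t. norm (g s (L t)))" for s
  by (rule continuous_on_norm cL fgT)+
 have drc: "continuous_on {0<..1} (%t. dr (L t))" "continuous_on {0<..1} (%t. dw (L t))"
  unfolding dr_def dw_def using mu by (intro continuous_intros fgc; simp)+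
 have drn: "0<=dr z&0<=dw z" for z unfolding dr_def dw_def
  using mu by (intro conjI divide_nonneg_nonneg add_nonneg_nonneg sum_nonneg) auto
 have sum_tri: "norm (- a + sum F J)<=norm a+(\<Sum>s\<in>J. norm (F s))" for a :: complex and F and J :: "nat set"
  using norm_triangle_ineq[of "- a" "sum F J"] norm_sum[of F J] by simp
 have phib: "norm (\<phi> z * x' z)<=dr z*(1 + norm (h z)) + dw z * norm (k z)" for z
 proof -
  have "p z * x' z = - 0+(\<Sum>s\<in>{1..<N}. f s z/of_real mu^s)"
   unfolding p_def x'_def f_def psum_def sum_distrib_left sum_distrib_right add.left_neutral minus_zero by (intro sum.cong) (auto simp: field_simps)
  also have "norm \<dots><=norm (0::complex)+(\<Sum>s\<in>{1..<N}. norm (f s z/of_real mu^s))" by (rule sum_tri)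
  also have "\<dots>=dw z" unfolding dw_def using mu by (simp add: norm_divide norm_power)
  finally have pb: "norm (p z * x' z)<=dw z" .
  have "(\<Sum>s\<in>{1..<N}. Gb N s (Z z) z/of_real mu^s) * x' z=(\<Sum>s\<in>{1..<N}. g s z/(2 * of_real mu^s))"
   unfolding x'_def g_def sum_distrib_right by (intro sum.cong) (auto simp: field_simps)
  moreover have "R0 z * x' z=(- f N z+(\<Sum>s\<in>{1..<N}. Gb N s (Z z) z/of_real mu^s) * x' z)/of_real mu^(N-1)"
   unfolding R0_def Rres_def f_def x'_def times_divide_eq_left distrib_right by simp
  ultimately have "norm (R0 z * x' z)=norm (- f N z+(\<Sum>s\<in>{1..<N}. g s z/(2 * of_real mu^s)))/mu^(N-1)"
   using mu by (simp add: norm_divide norm_power)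
  also have "\<dots><=(norm (f N z)+(\<Sum>s\<in>{1..<N}. norm (g s z/(2 * of_real mu^s))))/mu^(N-1)"
   using mu by (intro divide_right_mono sum_tri) simp
  also have "\<dots>=dr z" unfolding dr_def using mu by (simp add: norm_divide norm_mult norm_power)
  finally have rb: "norm (R0 z * x' z)<=dr z" .
  have "\<phi> z * x' z=(p z * x' z) * k z+(R0 z * x' z)*(h z+1)" by (simp add: \<phi>_def algebra_simps)
  hence "norm (\<phi> z * x' z)<=norm (p z * x' z) * norm (k z) + norm (R0 z * x' z) * norm (h z+1)"
   by (metis norm_mult norm_triangle_ineq)
  also have "\<dots><=dw z * norm (k z) + dr z*(1 + norm (h z))"
   using norm_triangle_ineq[of "h z" 1] drn[of z] by (intro add_mono mult_mono pb rb) auto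
  finally show ?thesis by simp
 qed
 have bound: "mu * norm (h (L 1))<=(norm (k (L \<epsilon>)) + norm (2 * of_real mu * h (L \<epsilon>) + k (L \<epsilon>)) + om/mu^(N-1)) * exp (om/mu^(N-1)/mu + nu/(2*mu))"
  if \<epsilon>: "0<\<epsilon>" "\<epsilon><1" for \<epsilon>
 proof -
  let ?c = "norm (k (L \<epsilon>)) + norm (2 * of_real mu * h (L \<epsilon>) + k (L \<epsilon>))"
  define I where "I F=integral {\<epsilon>..1} (%t. norm (F (L t)) * speed L t)" for F :: "complex=>complex"
  have hI: "((%t. norm (F (L t)) * speed L t) has_integral I F) {\<epsilon>..1}" if "continuous_on T F" for F
   unfolding I_def by (intro integrable_integral speed_integrable[OF R _ \<epsilon>] continuous_on_norm cL that)
  note hfg = hI[OF fgT(1)] hI[OF fgT(2)]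
  have I0: "0<=I F" for F unfolding I_def by (cases "(%t. norm (F (L t)) * speed L t) integrable_on {\<epsilon>..1}")
   (auto intro!: Henstock_Kurzweil_Integration.integral_nonneg simp: speed_def not_integrable_integral)
  have VF: "ennreal (I (f s))<=variation_along (continue_from S C (%t. Z_pv lam t * hatF lam s t/t)) L" for s
   unfolding I_def by (rule speed_integral_le_variation[OF R cL[OF fgT(1)] \<epsilon>]) (simp add: cf(1) LT f_def)
  have VG: "ennreal (I (g s))<=variation_along (continue_from S C (%t. Z_pv lam t * hatG lam N s t/t)) L" for s
   unfolding I_def by (rule speed_integral_le_variation[OF R cL[OF fgT(2)] \<epsilon>]) (simp add: cf(2) LT g_def)
  let ?r = "I (f N)+(\<Sum>s\<in>{1..<N}. 1/(2*mu^s) * I (g s))" and ?w = "\<Sum>s<N-1. 2/mu^s * I (f (s+1))"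
  have "((%t. (norm (f N (L t)) * speed L t+(\<Sum>s\<in>{1..<N}. 1/(2*mu^s)*(norm (g s (L t)) * speed L t)))/mu^(N-1)) has_integral ?r/mu^(N-1)) {\<epsilon>..1}"
   by (intro has_integral_divide has_integral_add has_integral_sum has_integral_mult_right hfg finite_atLeastLessThan)
  moreover have "(norm (f N z) * v+(\<Sum>s\<in>{1..<N}. 1/(2*mu^s)*(norm (g s z) * v)))/mu^(N-1)=dr z * v" for z v
   by (simp add: dr_def distrib_right sum_distrib_right)
  ultimately have r: "integral {\<epsilon>..1} (%t. dr (L t) * speed L t)=?r/mu^(N-1)" by (simp only: integral_unique)
  have "((%t. \<Sum>s\<in>{1..<N}. norm (f s (L t)) * speed L t/mu^s) has_integral (\<Sum>s\<in>{1..<N}. I (f s)/mu^s)) {\<epsilon>..1}"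
   by (intro has_integral_divide has_integral_sum hfg finite_atLeastLessThan)
  hence w: "integral {\<epsilon>..1} (%t. dw (L t) * speed L t)=(\<Sum>s\<in>{1..<N}. I (f s)/mu^s)"
   unfolding dw_def by (simp add: sum_distrib_right integral_unique)
  have esum: "ennreal (\<Sum>s\<in>J. a s * I (F s))=(\<Sum>s\<in>J. ennreal (a s) * ennreal (I (F s)))" if "!!s. 0<=a s" for a F and J :: "nat set"
   using that I0 by (subst sum_ennreal[symmetric]) (auto simp: ennreal_mult)
  have nn: "0<=(\<Sum>s\<in>{1..<N}. 1/(2*mu^s) * I (g s))" "0<=?w" using mu I0 by (auto intro!: sum_nonneg)
  have "ennreal ?r=ennreal (I (f N))+(\<Sum>s\<in>{1..<N}. ennreal (1/(2*mu^s)) * ennreal (I (g s)))"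
   using mu I0 nn by (subst ennreal_plus) (simp_all only: esum zero_le_divide_1_iff zero_le_mult_iff zero_le_power less_imp_le zero_le_numeral simp_thms)
  also have "\<dots><= omega lam mu S C N L" unfolding omega_def by (intro add_mono VF sum_mono mult_left_mono VG) auto
  finally have "enn2real (ennreal ?r)<= om" unfolding om_def using fin(1) by (intro enn2real_mono) auto
  hence r1: "?r<= om" using I0[of "f N"] nn(1) by (simp only: enn2real_ennreal add_nonneg_nonneg)
  have "ennreal ?w=(\<Sum>s<N-1. ennreal (2/mu^s) * ennreal (I (f (s+1))))" using mu by (intro esum) simp
  also have "\<dots><=varpi lam mu S C N L" unfolding varpi_def by (intro sum_mono mult_left_mono VF) auto
  finally have "enn2real (ennreal ?w)<=nu" unfolding nu_def using fin(2) by (intro enn2real_mono) auto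
  hence "?w<=nu" using nn by simp
  \<comment> \<open>The weight 2/mu^s in \<open>varpi\<close> belongs to the index s + 1; shifting
    the index produces the factor 1/(2 mu).\<close>
  moreover have "(\<Sum>s\<in>{1..<N}. I (f s)/mu^s)=?w/(2*mu)"
   unfolding sum_divide_distrib
   by (rule sum.reindex_bij_witness[of _ "%s. s+1" "%s. s-1"]) (auto simp: field_simps simp flip: power_Suc)
  ultimately have w1: "(\<Sum>s\<in>{1..<N}. I (f s)/mu^s)<=nu/(2*mu)" using mu by (simp add: divide_right_mono)
  have r2: "?r/mu^(N-1)<= om/mu^(N-1)" using mu r1 by (intro divide_right_mono) auto
  have "mu * norm (h (L 1))<=(?c+?r/mu^(N-1)) * exp (?r/mu^(N-1)/mu + (\<Sum>s\<in>{1..<N}. I (f s)/mu^s))"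
   unfolding r[symmetric] w[symmetric] by (rule LG_growth[OF R mu \<epsilon> LT hd eqs(2) xd mono \<phi>c xc phib drc drn]) auto
  also have "\<dots><=(?c + om/mu^(N-1)) * exp (om/mu^(N-1)/mu + nu/(2*mu))"
   by (rule mult_mono[OF add_mono[OF order_refl r2] iffD2[OF exp_le_cancel_iff add_mono[OF divide_right_mono[OF r2] w1]]]) (use mu in "auto simp: om_def")
  finally show ?thesis .
 qed
 have h0: "((%t. h (L t))\<longlongrightarrow>0) (at_right 0)" using tendsto_diff[OF lim(1) tendsto_const[of 1]] by (simp add: h_def u_def)
 have k0: "((%t. k (L t))\<longlongrightarrow>0) (at_right 0)" using lim(2) by (simp add: k_def u_def V_def)
 \<comment> \<open>The initial values of h and k tend to 0 at the start of the path, so the bounds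
   obtained on [eps, 1] pass to the limit eps -> 0.\<close>
 have "((%\<epsilon>. (norm (k (L \<epsilon>)) + norm (2 * of_real mu * h (L \<epsilon>) + k (L \<epsilon>)) + om/mu^(N-1)) * exp (om/mu^(N-1)/mu + nu/(2*mu))) \<longlongrightarrow>
  (norm (0::complex) + norm (2 * of_real mu*0+0::complex) + om/mu^(N-1)) * exp (om/mu^(N-1)/mu + nu/(2*mu))) (at_right 0)"
  by (intro tendsto_mult tendsto_add tendsto_norm h0 k0 tendsto_const)
 moreover have "\<forall>\<^sub>F \<epsilon> in at_right 0. mu * norm (h (L 1))<=(norm (k (L \<epsilon>)) + norm (2 * of_real mu * h (L \<epsilon>) + k (L \<epsilon>)) + om/mu^(N-1)) * exp (om/mu^(N-1)/mu + nu/(2*mu))"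
  by (rule eventually_mono[OF eventually_at_right_real[OF zero_less_one]]) (rule bound; simp)
 ultimately have "mu * norm (h (L 1))<=(norm (0::complex) + norm (2 * of_real mu*0+0::complex) + om/mu^(N-1)) * exp (om/mu^(N-1)/mu + nu/(2*mu))"
  by (rule tendsto_lowerbound) simp
 moreover have "mu^N=mu*mu^(N-1)" using N by (cases N) auto
 ultimately have "norm (h (L 1))<= om/mu^N * exp (nu/(2*mu) + om/mu^N)"
  using mu by (simp add: field_simps)
 thus ?thesis by (simp add: h_def u_def om_def nu_def)
qed

end

section \<open>Behaviour at the start of a path\<close>

lemma ulog_Ln: "0<=Im z==>z~=0==>ulog z=Ln z"
proof -
 assume z: "0<=Im z" "z~=0"
 have "0<=Im (Ln z)" "Im (Ln z)<=pi" using z Im_Ln_pos_le[of z] Im_Ln_le_pi[of z] by auto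
 hence "- pi<Im (Ln z)" "Im (Ln z)<2 * pi" using pi_gt_zero by linarith+
 thus ?thesis using z by (intro ulog_unique) auto
qed

lemma exp_half_ulog: "z\<in>Cplus==>exp (ulog z/2)=csqrt z"
 by (simp add: Cplus_def ulog_Ln csqrt_exp_Ln)

lemma ulog_scale: "0<r==>z\<in>Cplus==>ulog (of_real r * z) = of_real (ln r) + ulog z"
proof (rule ulog_unique)
 assume r: "0<r" and z: "z\<in>Cplus"
 thus "exp (of_real (ln r) + ulog z) = of_real r * z" "0<=Im (of_real r * z)"
  by (simp_all add: exp_add exp_ulog Cplus_def exp_of_real[symmetric] del: exp_of_real) (simp add: exp_of_real)
 show "- pi<Im (of_real (ln r) + ulog z)" "Im (of_real (ln r) + ulog z)<2 * pi"
 proof -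
  have "0<=Im (ulog z)" "Im (ulog z)<=pi" using Im_ulog[of z] z by (auto simp: Cplus_def)
  thus "- pi<Im (of_real (ln r) + ulog z)" "Im (of_real (ln r) + ulog z)<2 * pi"
   unfolding plus_complex.sel Im_complex_of_real using pi_gt_zero by linarith+
 qed
qed

lemma ulog_mult_right:
 assumes "z\<in>Cplus" "0<=Im (z * w)" "0<Re w"
 shows "ulog (z * w)=ulog z + Ln w"
proof (rule ulog_unique)
 have w: "w~=0" using assms by auto
 thus "exp (ulog z + Ln w)=z * w" using assms by (simp add: exp_add exp_ulog Cplus_def)
 show "0<=Im (z * w)" by fact
 show "- pi<Im (ulog z + Ln w)" "Im (ulog z + Ln w)<2 * pi"
  using Im_ulog[of z] assms(1) Re_Ln_pos_lt[OF w] assms(3) pi_gt_zero by (auto simp: Cplus_def)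
qed

lemma isCont_ulog_pos: "0<r==>isCont ulog (of_real r)"
 by (rule DERIV_isCont[OF ulog_has_derivative]) auto

context lam_range
begin

text \<open>Splits the root of the quotient so that the square root of z can be matched with the one
  in the leading term of M.\<close>

lemma q0_RA: "z\<in>RA==>q0 z=csqrt z/csqrt (csq lam z)"
proof -
 assume z: "z\<in>RA"
 have pos: "0<Re (csq lam w)" if "w\<in>RA" for w using that by (intro Re_csq_pos) (auto simp: RA_def)
 have m: "mpv w=1" if "w\<in>RA" for w using that by (auto simp: RA_def mpv_def)
 have cq: "continuous_on RA (qb mpv)" by (rule continuous_on_subset[OF qb_continuous(1) region_in_cut(2)])
 have cz: "continuous_on RA (Zb mpv)" by (rule continuous_on_subset[OF Zb_continuous(1) region_in_cut(2)])
 have Zc: "Zb mpv w=csq lam w" "qb mpv w=q0 w" if "w\<in>RA" for w using m[OF that] by (simp_all add: Zb_def qb_def)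
 have c1: "continuous_on RA (csq lam)" "continuous_on RA q0" using cz cq Zc by (auto cong: continuous_on_cong)
 have c2: "continuous_on RA (%w. csqrt (csq lam w))"
  by (rule continuous_on_compose2[OF continuous_csqrt_slit c1(1)]) (use pos in "force simp: complex_nonpos_Reals_iff")
 have c3: "continuous_on RA csqrt" by (rule continuous_on_subset[OF csqrt_continuous_upper]) (auto simp: RA_def Cplus_def)
 have nz: "w~=0" "csq lam w~=0" if "w\<in>RA" for w using pos[OF that] that by (auto simp: RA_def Cplus_def)
 obtain e where e: "0<e" "e<2" "\<forall>z\<in>Cplus. norm z<e-->lev lam z<0" using lev_neg_near_0 by auto
 have a: "complex_of_real (e/2)\<in>RA" using e of_real_Cplus[of "e/2"] by (auto simp: RA_def)
 show ?thesis
 proof (rule sqrt_branch_unique[OF connected_RA c1(2) _ _ _ a _ z])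
  show "continuous_on RA (%w. csqrt w/csqrt (csq lam w))" using nz by (intro continuous_on_divide c2 c3) auto
  show "q0 w^2=(csqrt w/csqrt (csq lam w))^2" if "w\<in>RA" for w by (simp add: q0_sq power_divide)
  show "csqrt w/csqrt (csq lam w)~=0" if "w\<in>RA" for w using nz[OF that] by simp
  obtain s where s: "csq lam (of_real (e/2)) = of_real s" "0<s" using pos[OF a] unfolding csq_real by auto
  show "q0 (of_real (e/2))=csqrt (of_real (e/2))/csqrt (csq lam (of_real (e/2)))"
   unfolding q0_def s(1) using e s(2) by (simp add: real_sqrt_divide real_sqrt_mult flip: of_real_divide)
 qed
qed

text \<open>\<open>E\<close> is the known leading term of W and \<open>th\<close> its logarithmic
  derivative. The function k splits into the defect of W1 against th W and the difference of 2 th/Z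
  and mu + \<open>psum\<close> + \<open>bq\<close>; both tend to 0.\<close>

lemma start_limits:
 assumes E0: "!!t. E t~=0" and W: "((%t. W t/E t)\<longlongrightarrow>1) F" and W1: "((%t. (W1 t-th t * W t)/E t)\<longlongrightarrow>0) F"
  and uE: "((%t. u t * E t)\<longlongrightarrow>1) F" and th: "((%t. 2*th t/Z t)\<longlongrightarrow>of_real mu + b) F" and iZ: "((%t. 1/Z t)\<longlongrightarrow>iz) F"
  and p: "((%t. psum mu N (Z t) (g t))\<longlongrightarrow>0) F" and b: "((%t. bq (Z t) (g t))\<longlongrightarrow>b) F"
 shows "((%t. W t * u t)\<longlongrightarrow>1) F" "((%t. u t * LGk mu N (Z t) (g t) (W t) (W1 t))\<longlongrightarrow>0) F"
proof -
 have "((%t. (W t/E t)*(u t * E t))\<longlongrightarrow>1*1) F" by (intro tendsto_mult W uE)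
 thus "((%t. W t * u t)\<longlongrightarrow>1) F" using E0 by (simp add: field_simps)
 have "((%t. (u t * E t)*(2*(1/Z t)*((W1 t-th t * W t)/E t)+(2*th t/Z t-(of_real mu + psum mu N (Z t) (g t) + bq (Z t) (g t)))*(W t/E t)))
  \<longlongrightarrow>1*(2 * iz*0+(of_real mu + b-(of_real mu + 0 + b))*1)) F"
  by (intro tendsto_intros uE iZ W1 th p b W)
 moreover have "(u t * E t)*(2*(1/Z t)*((W1 t-th t * W t)/E t)+(2*th t/Z t-(of_real mu + psum mu N (Z t) (g t) + bq (Z t) (g t)))*(W t/E t))
  =u t * LGk mu N (Z t) (g t) (W t) (W1 t)" for t
 proof -
  have "(u * E)*(2*(1/Z)*((W1-th * W)/E)+(2*th/Z - M)*(W/E))=u*(2 * W1/Z - M * W)" if "E~=0" for u E Z W1 th W M :: complex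
   using that by (cases "Z=0") (simp_all add: field_simps)
  from this[OF E0] show ?thesis unfolding LGk_def .
 qed
 ultimately have "((%t. u t * LGk mu N (Z t) (g t) (W t) (W1 t))\<longlongrightarrow>1*(2 * iz*0+(of_real mu + b-(of_real mu + 0 + b))*1)) F" by (simp only:)
 thus "((%t. u t * LGk mu N (Z t) (g t) (W t) (W1 t))\<longlongrightarrow>0) F" by simp
qed

lemma start_0:
 assumes g: "(g\<longlongrightarrow>0) F" "\<forall>\<^sub>F t in F. g t\<in>Cplus"
 shows "\<forall>\<^sub>F t in F. g t\<in>RA&Zb m1 (g t)=csq lam (g t)&qb m1 (g t)=csqrt (g t)/csqrt (csq lam (g t))"
  "((%t. Zb m1 (g t))\<longlongrightarrow>2) F"
  "((%t. ulog (g t) - xiB lam (Zb m1 (g t)) (g t))\<longlongrightarrow>of_real (lam * ln (2-2 * lam) + ln 4-1)) F"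
proof -
 let ?Z = "%t. Zb m1 (g t)" and ?x = "%t. xiB lam (Zb m1 (g t)) (g t)"
 have "filterlim g (at 0 within Cplus) F"
  unfolding filterlim_at using g by (auto simp: Cplus_def elim!: eventually_mono)
 from filterlim_compose[OF csq_tendsto_0 this] filterlim_iff[THEN iffD1, OF this, rule_format, OF near_0]
 have c: "((%t. csq lam (g t))\<longlongrightarrow>2) F" and RA: "\<forall>\<^sub>F t in F. g t\<in>RA&mpv (g t)=1" by auto
 show ev: "\<forall>\<^sub>F t in F. g t\<in>RA&?Z t=csq lam (g t)&qb m1 (g t)=csqrt (g t)/csqrt (csq lam (g t))"
  using RA by eventually_elim (use q0_RA m_RA(1) in "simp add: Zb_def qb_def")
 show Z: "((%t. ?Z t)\<longlongrightarrow>2) F" by (rule Lim_transform_eventually[OF c]) (use ev in "auto elim: eventually_mono")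
 have w: "((%t. ?Z t - of_real lam * g t+2)\<longlongrightarrow>2 - of_real lam*0+2) F" by (intro tendsto_intros Z g)
 hence w4: "((%t. ?Z t - of_real lam * g t+2)\<longlongrightarrow>4) F" by simp
 have lw: "((%t. Ln (?Z t - of_real lam * g t+2))\<longlongrightarrow>Ln 4) F" by (rule tendsto_Ln[OF w4]) simp
 have "((%t. ?Z t + g t-2 * of_real lam)\<longlongrightarrow>2+0-2 * of_real lam) F" by (intro tendsto_intros Z g)
 hence "((%t. ?Z t + g t-2 * of_real lam)\<longlongrightarrow>of_real (2-2 * lam)) F" by simp
 from isCont_tendsto_compose[OF isCont_ulog_pos this] lam1
 have l2: "((%t. ulog (?Z t + g t-2 * of_real lam))\<longlongrightarrow>of_real (ln (2-2 * lam))) F" by (simp add: ulog_real del: of_real_diff)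
 have "((%t. of_real lam * ulog (?Z t + g t-2 * of_real lam) + Ln (?Z t - of_real lam * g t+2)-?Z t/2)\<longlongrightarrow>of_real lam * of_real (ln (2-2 * lam)) + Ln 4-2/2) F"
  by (intro tendsto_intros l2 lw Z) simp
 moreover have "of_real lam * of_real (ln (2-2 * lam)) + Ln 4-2/2=complex_of_real (lam * ln (2-2 * lam) + ln 4-1)"
  using Ln_of_real[of 4] by simp
 ultimately have lim: "((%t. of_real lam * ulog (?Z t + g t-2 * of_real lam) + Ln (?Z t - of_real lam * g t+2)-?Z t/2)\<longlongrightarrow>of_real (lam * ln (2-2 * lam) + ln 4-1)) F" by simp
 have "((%t. Re (?Z t - of_real lam * g t+2))\<longlongrightarrow>Re 4) F" by (intro tendsto_Re w4)
 hence "\<forall>\<^sub>F t in F. 0<Re (?Z t - of_real lam * g t+2)" by (rule order_tendstoD) simp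
 with g(2) have "\<forall>\<^sub>F t in F. of_real lam * ulog (?Z t + g t-2 * of_real lam) + Ln (?Z t - of_real lam * g t+2)-?Z t/2=ulog (g t)-?x t"
 proof eventually_elim
  case (elim t)
  let ?w = "?Z t - of_real lam * g t+2"
  have w0: "?w~=0" using elim(2) by (metis less_irrefl zero_complex.simps(1))
  have iw: "0<Re (1/?w)" using elim(2) by (auto simp: Re_divide sum_power2_gt_zero_iff intro!: divide_pos_pos)
  have "ulog (g t*(1/?w))=ulog (g t) + Ln (1/?w)"
   using branch_upper(2)[OF Zb_sq[of m1, OF m_power4(2)] elim(1)] by (intro ulog_mult_right elim(1) iw) simp
  moreover have "Ln (1/?w) = - Ln ?w" using elim(2) w0 Ln_inverse[of ?w] by (auto simp: complex_nonpos_Reals_iff divide_inverse)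
  ultimately show ?case by (simp add: xiB_def)
 qed
 from Lim_transform_eventually[OF lim this]
 show "((%t. ulog (g t)-?x t)\<longlongrightarrow>of_real (lam * ln (2-2 * lam) + ln 4-1)) F" .
qed

text \<open>Chosen so that AM (z/Z)^(1/2) exp (mu xi) ~ (mu z)^(mu + 1/2) at 0. The powers come from
  the limit of ln z - xi in \<open>start_0\<close>, the square root from Z -> 2.\<close>

definition AM :: "real=>complex" where
 "AM mu = of_real ((4*mu/exp 1) powr mu*(2*(1 - lam)) powr (lam*mu) * sqrt (2*mu))"

lemma AM_nz: "0<mu==>AM mu~=0" using lam1 by (simp add: AM_def)

lemma Re_xi_at_bot:
 assumes "((%t. a t - x t)\<longlongrightarrow>(c::complex)) F" "filterlim (%t. Re (a t)) at_bot F"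
 shows "filterlim (%t. Re (x t)) at_bot F"
proof -
 have "((%t. - Re (a t - x t))\<longlongrightarrow>- Re c) F" by (intro tendsto_intros assms)
 from filterlim_tendsto_add_at_bot_iff[OF this, THEN iffD2, OF assms(2)] show ?thesis by simp
qed

lemma start_M:
 fixes N :: nat
 assumes mu: "0<mu" and g: "(g\<longlongrightarrow>0) F" "\<forall>\<^sub>F t in F. g t\<in>Cplus"
 defines "W \<equiv> %z. whittaker_M (lam*mu) mu (ulog (of_real mu * z))" and "W1 \<equiv> %z. deriv (whittaker_M (lam*mu) mu) (ulog (of_real mu * z))"
  and "u \<equiv> %z. LGu mu N (%s. poly (Ac s) 0/8^s) (AM mu) (Zb m1 z) (qb m1 z) z"
 shows "((%t. W (g t) * u (g t))\<longlongrightarrow>1) F" "((%t. u (g t) * LGk mu N (Zb m1 (g t)) (g t) (W (g t)) (W1 (g t)))\<longlongrightarrow>0) F"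
  "filterlim (%t. Re (xiB lam (Zb m1 (g t)) (g t))) at_bot F"
proof -
 let ?Z = "%t. Zb m1 (g t)" and ?x = "%t. xiB lam (Zb m1 (g t)) (g t)"
 note st = start_0[OF g]
 let ?v = "%t. ulog (of_real mu * g t)" and ?E = "%t. exp ((of_real mu + 1/2) * ulog (of_real mu * g t))"
 have lnbot: "filterlim (%t. ln (norm (g t))) at_bot F"
 proof (rule filterlim_compose[OF ln_at_0])
  show "filterlim (%t. norm (g t)) (at_right 0) F"
   unfolding filterlim_at using tendsto_norm[OF g(1)] g(2) by (auto simp: Cplus_def elim!: eventually_mono)
 qed
 have Rul: "filterlim (%t. Re (ulog (g t))) at_bot F"
  by (rule filterlim_mono_eventually[OF lnbot order_refl order_refl]) (use g(2) in "auto simp: Re_ulog Cplus_def elim!: eventually_mono")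
 have sc: "\<forall>\<^sub>F t in F. ?v t = of_real (ln mu) + ulog (g t)" using g(2) by eventually_elim (rule ulog_scale[OF mu])
 have Rv: "filterlim (%t. Re (?v t)) at_bot F"
 proof (rule filterlim_mono_eventually[OF filterlim_tendsto_add_at_bot_iff[OF tendsto_const, THEN iffD2, OF Rul] order_refl order_refl])
  show "\<forall>\<^sub>F t in F. ln mu + Re (ulog (g t))=Re (?v t)" using sc by eventually_elim simp
 qed
 have fv: "filterlim ?v (filtercomap Re at_bot) F" using Rv by (simp add: filterlim_filtercomap_iff o_def)
 show "filterlim (%t. Re (?x t)) at_bot F" by (rule Re_xi_at_bot[OF st(3) Rul])
 have uE: "((%t. u (g t)*?E t)\<longlongrightarrow>1) F"
 proof -
  let ?X = "%t. exp (of_real mu*(of_real (ln mu)+(ulog (g t)-?x t))) * exp (- (\<Sum>s\<in>{1..<N}. (Eb s (?Z t) (g t) - poly (Ac s) 0/8^s)/of_real mu^s))*(of_real (sqrt mu) * csqrt (csq lam (g t)))/AM mu"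
  have csq2: "((%t. csq lam (g t))\<longlongrightarrow>2) F" by (rule Lim_transform_eventually[OF st(2)]) (use st(1) in "auto elim: eventually_mono")
  have "((%t. csqrt (csq lam (g t)))\<longlongrightarrow>csqrt 2) F" by (rule isCont_tendsto_compose[OF continuous_at_csqrt csq2]) simp
  hence "(?X\<longlongrightarrow>exp (of_real mu*(of_real (ln mu) + of_real (lam * ln (2-2 * lam) + ln 4-1))) * exp (- (\<Sum>s\<in>{1..<N}. (poly (Ac s) 0/8^s - poly (Ac s) 0/8^s)/of_real mu^s))*(of_real (sqrt mu) * csqrt 2)/AM mu) F"
   by (intro tendsto_intros st(3) Eb_tendsto_0 st(2) g(1)) (use mu AM_nz in auto)
  moreover have "exp (of_real mu*(of_real (ln mu) + of_real (lam * ln (2-2 * lam) + ln 4-1))) * exp (- (\<Sum>s\<in>{1..<N}. (poly (Ac s) 0/8^s - poly (Ac s) 0/8^s)/of_real mu^s))*(of_real (sqrt mu) * csqrt 2)=AM mu"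
  proof -
   have "exp (mu*(ln mu + (lam * ln (2-2 * lam) + ln 4-1)))=(4*mu/exp 1) powr mu*(2*(1 - lam)) powr (lam*mu)"
    using mu lam1 by (simp add: powr_def ln_div ln_mult exp_add[symmetric] algebra_simps)
   hence e: "exp (of_real mu*(of_real (ln mu) + of_real (lam * ln (2-2 * lam) + ln 4-1)))=complex_of_real ((4*mu/exp 1) powr mu*(2*(1 - lam)) powr (lam*mu))"
    by (metis exp_of_real of_real_add of_real_mult)
   have "csqrt 2 = of_real (sqrt 2)" using csqrt_of_real_nonneg[of 2] by simp
   thus ?thesis unfolding e AM_def by (simp add: real_sqrt_mult)
  qed
  ultimately have "(?X\<longlongrightarrow>1) F" using AM_nz[OF mu] by simp
  thus ?thesis
  proof (rule Lim_transform_eventually, use st(1) g(2) sc in eventually_elim)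
   case (elim t)
   have "exp (ulog (g t)/2)=csqrt (g t)" by (rule exp_half_ulog[OF elim(2)])
   moreover have "exp (complex_of_real (ln mu)/2) = of_real (sqrt mu)"
   proof -
    have "exp (ln mu/2)=sqrt mu" using mu by (simp add: powr_half_sqrt[symmetric] powr_def)
    thus ?thesis by (metis exp_of_real of_real_divide of_real_numeral)
   qed
   moreover have "?E t=exp (of_real mu*(of_real (ln mu) + ulog (g t)))*(exp (complex_of_real (ln mu)/2) * exp (ulog (g t)/2))"
    unfolding elim(3) by (simp add: exp_add[symmetric] algebra_simps add_divide_distrib)
   ultimately have E: "?E t=exp (of_real mu*(of_real (ln mu) + ulog (g t)))*(of_real (sqrt mu) * csqrt (g t))" by simp
   have nz: "csqrt (g t)~=0" "csqrt (csq lam (g t))~=0" using elim(1,2) Re_csq_pos[of "g t"] by (auto simp: Cplus_def RA_def)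
   have u: "u (g t)=exp (- of_real mu*?x t) * exp (- (\<Sum>s\<in>{1..<N}. (Eb s (?Z t) (g t) - poly (Ac s) 0/8^s)/of_real mu^s))/(AM mu*(csqrt (g t)/csqrt (csq lam (g t))))"
    unfolding u_def LGu_def Ssum_def using elim(1) by (simp add: exp_add[symmetric])
   have "exp (of_real mu*(of_real (ln mu)+(ulog (g t)-?x t)))=exp (of_real mu*(of_real (ln mu) + ulog (g t))) * exp (- of_real mu*?x t)"
    by (simp add: exp_add[symmetric] algebra_simps)
   thus "?X t=u (g t)*?E t" unfolding u E using nz by (simp add: field_simps)
  qed
 qed
 have iZ: "((%t. 1/?Z t)\<longlongrightarrow>1/2) F" by (intro tendsto_intros st(2)) simp
 have th: "((%t. 2*(of_real mu + 1/2)/?Z t)\<longlongrightarrow>of_real mu + 1/2) F"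
 proof -
  have e: "2*(of_real mu + 1/2)*(1/2)=complex_of_real mu + 1/2" by (simp add: algebra_simps)
  have "((%t. 2*(of_real mu + 1/2)*(1/?Z t))\<longlongrightarrow>of_real mu + 1/2) F"
   using tendsto_mult[OF tendsto_const[of "2*(of_real mu + 1/2)"] iZ] unfolding e .
  thus ?thesis by simp
 qed
 have p: "((%t. psum mu N (?Z t) (g t))\<longlongrightarrow>0) F"
 proof -
  have "((%t. psum mu N (?Z t) (g t))\<longlongrightarrow>(\<Sum>s\<in>{1..<N}. poly (Pc s) 0/2^(3 * s+3)/of_real mu^s)) F"
   unfolding psum_def Fb_def by (intro tendsto_intros st(2) g(1)) (use mu in auto)
  thus ?thesis by (simp add: Pc_0)
 qed
 have b: "((%t. bq (?Z t) (g t))\<longlongrightarrow>1/2) F"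
 proof -
  have "((%t. bq (?Z t) (g t))\<longlongrightarrow>(4-2 * of_real lam*0)/2^3) F"
   unfolding bq_def by (intro tendsto_intros st(2) g(1)) simp
  thus ?thesis by simp
 qed
 have lim: "((%t. W (g t)/?E t)\<longlongrightarrow>1) F" "((%t. (W1 (g t)-(of_real mu + 1/2) * W (g t))/?E t)\<longlongrightarrow>0) F"
  unfolding W_def W1_def
  using filterlim_compose[OF whittaker_M_props(2)[OF mu, of "lam*mu"] fv] filterlim_compose[OF M_char[OF whittaker_M_props[OF mu, of "lam*mu"]] fv] by auto
 show "((%t. W (g t) * u (g t))\<longlongrightarrow>1) F" "((%t. u (g t) * LGk mu N (?Z t) (g t) (W (g t)) (W1 (g t)))\<longlongrightarrow>0) F"
  by (rule start_limits[where E = ?E, OF _ lim uE th iZ p b]; simp)+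
qed

text \<open>The analogous constant at infinity, where exp v = -mu z is inserted into the leading
  term exp (-kappa v - exp v/2) of W. The phase comes from the rotation by -pi through the limit in
  \<open>start_inf\<close>.\<close>

definition AW :: "real=>complex" where
 "AW mu=exp (\<i> * of_real (pi*(lam*mu))) * of_real ((2 * exp 1/mu) powr (lam*mu)*(1 - lam) powr mu)"

lemma AW_nz: "0<mu==>AW mu~=0" using lam1 by (simp add: AW_def)

lemma start_inf:
 assumes g: "filterlim g at_infinity F" "((%t. Arg (g t))\<longlongrightarrow>pi) F" "\<forall>\<^sub>F t in F. g t\<in>Cplus"
 shows "((%t. Zb m3 (g t)/g t)\<longlongrightarrow>1) F" "((%t. qb m3 (g t))\<longlongrightarrow>1) F"
  "((%t. - of_real lam*(ulog (g t)-\<i> * of_real pi) + g t/2 - xiB lam (Zb m3 (g t)) (g t)) \<longlongrightarrow>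
   of_real (lam + lam * ln 2 + ln (1 - lam))+\<i> * of_real (pi * lam)) F"
  "filterlim (%t. Re (- of_real lam*(ulog (g t)-\<i> * of_real pi) + g t/2)) at_bot F"
proof -
 let ?Z = "%t. Zb m3 (g t)" and ?x = "%t. xiB lam (Zb m3 (g t)) (g t)"
 have ng: "filterlim (%t. norm (g t)) at_top F" using g(1) filterlim_at_infinity_imp_norm_at_top by blast
 have "((%t. cos (Arg (g t)))\<longlongrightarrow>cos pi) F" by (rule isCont_tendsto_compose[OF isCont_cos g(2)])
 hence "\<forall>\<^sub>F t in F. cos (Arg (g t)) < - (1/2)" by (rule order_tendstoD) simp
 hence Rg: "\<forall>\<^sub>F t in F. Re (g t)<=- norm (g t)/2"
 proof eventually_elim
  case (elim t)
  have "Re (g t)=norm (g t) * cos (Arg (g t))" using arg_cong[OF rcis_cmod_Arg[of "g t"], of Re] by simp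
  also have "\<dots><=norm (g t) * - (1/2)" using elim by (intro mult_left_mono) auto
  finally show ?case by simp
 qed
 have ev: "\<forall>\<^sub>F t in F. g t\<in>Cplus&Re (g t)<0&Re (g t)<2 * lam"
  using g(3) Rg
 proof eventually_elim
  case (elim t)
  hence "0<norm (g t)" by (simp add: Cplus_def)
  hence "Re (g t)<0" using elim(2) by linarith
  thus ?case using elim(1) lam0 by auto
 qed
 have ig: "((%t. inverse (g t))\<longlongrightarrow>0) F" by (rule filterlim_compose[OF tendsto_inverse_0 g(1)])
 have Zc: "\<forall>\<^sub>F t in F. ?Z t = - csq lam (g t)&qb m3 (g t) = - \<i> * q0 (g t)"
  using ev by eventually_elim (simp add: Zb_def qb_def m3_def)
 let ?\<rho> = "%t. ?Z t/g t"
 have sq: "Zb m3 w^2=Q w" for w by (rule Zb_sq[of m3, OF m_power4(3)])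
 \<comment> \<open>With rho = Z/z the product (rho - 1)(rho + 1) tends to 0. On this branch Z and z
   have real parts of the same sign and imaginary parts of the same sign, so Re rho >= 0 and rho + 1
   stays away from 0.\<close>
 show \<rho>: "(?\<rho>\<longlongrightarrow>1) F"
 proof (rule LIM_zero_cancel, rule Lim_null_comparison)
  have "((%t. - 4 * of_real lam * inverse (g t)+4 * inverse (g t)^2)\<longlongrightarrow>- 4 * of_real lam*0+4*0^2) F" by (intro tendsto_intros ig)
  from tendsto_norm[OF this] show "((%t. norm (- 4 * of_real lam * inverse (g t)+4 * inverse (g t)^2))\<longlongrightarrow>0) F" by simp
  show "\<forall>\<^sub>F t in F. norm (?\<rho> t-1)<=norm (- 4 * of_real lam * inverse (g t)+4 * inverse (g t)^2)"
   using ev Zc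
  proof eventually_elim
   case (elim t)
   have g0: "g t~=0" using elim by (auto simp: Cplus_def)
   have "?\<rho> t^2-1 = - 4 * of_real lam * inverse (g t)+4 * inverse (g t)^2"
    unfolding power_divide sq Zsq_def using g0 by (simp add: field_simps power2_eq_square)
   moreover have "?\<rho> t^2-1=(?\<rho> t-1)*(?\<rho> t+1)" by (simp add: power2_eq_square algebra_simps)
   moreover have "1<=norm (?\<rho> t+1)"
   proof -
    have "0<=Re (?Z t) * Re (g t) + Im (?Z t) * Im (g t)"
    proof (rule add_nonneg_nonneg)
    show "0<=Re (?Z t) * Re (g t)" using elim Re_csq_pos[of "g t"] by (simp add: mult_nonneg_nonpos)
    show "0<=Im (?Z t) * Im (g t)" using elim Im_csq_left[of "g t"]
    by (cases "Im (g t)=0") (auto simp: Cplus_def mult_nonpos_nonneg)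
    qed
    hence "0<=Re (?\<rho> t)" by (simp add: Re_divide)
    thus ?thesis using complex_Re_le_cmod[of "?\<rho> t+1"] by simp
   qed
   ultimately have eq: "norm (- 4 * of_real lam * inverse (g t)+4 * inverse (g t)^2)=norm (?\<rho> t-1) * norm (?\<rho> t+1)" "1<=norm (?\<rho> t+1)"
    by (metis norm_mult)+
   thus ?case using mult_left_mono[of 1 "norm (?\<rho> t+1)" "norm (?\<rho> t-1)"] by simp
  qed
 qed
 show "((%t. qb m3 (g t))\<longlongrightarrow>1) F"
 proof -
  have "((%t. - (1/?\<rho> t))\<longlongrightarrow>- (1/1)) F" by (intro tendsto_intros \<rho>) simp
  hence "((%t. - (1/?\<rho> t))\<longlongrightarrow>- 1) F" by simp
  hence "((%t. g t/csq lam (g t))\<longlongrightarrow>- 1) F" by (rule Lim_transform_eventually) (use Zc in eventually_elim, simp)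
  moreover have "\<forall>\<^sub>F t in F. g t/csq lam (g t)\<in>{w. 0<=Im w}" using ev by eventually_elim (use rho_left in auto)
  ultimately have "((%t. csqrt (g t/csq lam (g t)))\<longlongrightarrow>csqrt (- 1)) F"
   by (intro continuous_on_tendsto_compose[OF csqrt_continuous_upper]) auto
  moreover have "csqrt (- 1)=\<i>" by (simp add: complex_eq_iff)
  ultimately have "((%t. - \<i> * q0 (g t))\<longlongrightarrow>- \<i>*\<i>) F" unfolding q0_def by (intro tendsto_intros) simp
  hence "((%t. - \<i> * q0 (g t))\<longlongrightarrow>1) F" by simp
  thus ?thesis by (rule Lim_transform_eventually) (use Zc in eventually_elim, simp)
 qed
 show "((%t. - of_real lam*(ulog (g t)-\<i> * of_real pi) + g t/2-?x t) \<longlongrightarrow>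
   of_real (lam + lam * ln 2 + ln (1 - lam))+\<i> * of_real (pi * lam)) F"
 proof -
  let ?w = "%t. ?\<rho> t+1-2 * of_real lam * inverse (g t)"
  \<comment> \<open>This is (z - Z)/2 in a rationalised form that shows the limit of a difference of
    two unbounded terms.\<close>
  let ?a = "%t. (4 * of_real lam-4 * inverse (g t))/(1+?\<rho> t)/2"
  have w: "(?w\<longlongrightarrow>1+1-2 * of_real lam*0) F" by (intro tendsto_intros \<rho> ig)
  hence w2: "(?w\<longlongrightarrow>2) F" by simp
  have lw: "((%t. Ln (?w t))\<longlongrightarrow>Ln 2) F" by (rule tendsto_Ln[OF w2]) simp
  have a: "(?a\<longlongrightarrow>(4 * of_real lam-4*0)/(1+1)/2) F" by (intro tendsto_intros \<rho> ig) simp_all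
  have "((%t. 1/(?\<rho> t - of_real lam+2 * inverse (g t)))\<longlongrightarrow>1/(1 - of_real lam+2*0)) F"
   using lam1 by (intro tendsto_intros \<rho> ig) (simp add: of_real_eq_1_iff[symmetric] del: of_real_eq_1_iff, metis eq_iff_diff_eq_0 less_irrefl of_real_1 of_real_eq_iff)
  hence "((%t. 1/(?\<rho> t - of_real lam+2 * inverse (g t)))\<longlongrightarrow>of_real (1/(1 - lam))) F" by simp
  from isCont_tendsto_compose[OF isCont_ulog_pos this] lam1
  have l3: "((%t. ulog (1/(?\<rho> t - of_real lam+2 * inverse (g t))))\<longlongrightarrow>of_real (- ln (1 - lam))) F"
   by (simp add: ulog_real ln_div del: of_real_diff of_real_divide)
  have "((%t. of_real lam*\<i> * of_real pi+?a t + of_real lam * Ln (?w t) - ulog (1/(?\<rho> t - of_real lam+2 * inverse (g t)))) \<longlongrightarrow>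
   of_real lam*\<i> * of_real pi+(4 * of_real lam-4*0)/(1+1)/2 + of_real lam * Ln 2 - of_real (- ln (1 - lam))) F"
   by (intro tendsto_add tendsto_diff tendsto_mult tendsto_const a lw l3)
  moreover have "of_real lam*\<i> * of_real pi+(4 * of_real lam-4*0)/(1+1)/2 + of_real lam * Ln 2 - of_real (- ln (1 - lam))
   = of_real (lam + lam * ln 2 + ln (1 - lam))+\<i> * complex_of_real (pi * lam)"
   using Ln_of_real[of 2] by simp
  ultimately have lim: "((%t. of_real lam*\<i> * of_real pi+?a t + of_real lam * Ln (?w t) - ulog (1/(?\<rho> t - of_real lam+2 * inverse (g t)))) \<longlongrightarrow>
   of_real (lam + lam * ln 2 + ln (1 - lam))+\<i> * complex_of_real (pi * lam)) F" by (simp only:)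
  have "((%t. Re (?w t))\<longlongrightarrow>Re 2) F" by (intro tendsto_Re w2)
  hence w0: "\<forall>\<^sub>F t in F. 0<Re (?w t)" by (rule order_tendstoD) simp
  have "((%t. 1+?\<rho> t)\<longlongrightarrow>1+1) F" by (intro tendsto_intros \<rho>)
  hence n0: "\<forall>\<^sub>F t in F. 1+?\<rho> t~=0" by (rule tendsto_imp_eventually_ne) simp
  from lim show ?thesis
  proof (rule Lim_transform_eventually, use ev w0 n0 in eventually_elim)
   case (elim t)
   have g0: "g t~=0" using elim by (auto simp: Cplus_def)
   have e1: "?Z t + g t-2 * of_real lam=g t*?w t" using g0 by (simp add: field_simps)
   have "ulog (g t*?w t)=ulog (g t) + Ln (?w t)"
    using branch_upper(1)[OF sq, of "g t"] elim unfolding e1 by (intro ulog_mult_right) auto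
   moreover have "g t/(?Z t - of_real lam * g t+2)=1/(?\<rho> t - of_real lam+2 * inverse (g t))"
   proof -
    have "?Z t - of_real lam * g t+2=g t*(?\<rho> t - of_real lam+2 * inverse (g t))" using g0 by (simp add: field_simps)
    thus ?thesis using g0 by simp
   qed
   moreover have "?a t=g t/2-?Z t/2"
   proof -
    have s0: "g t+?Z t~=0" using elim(3) g0 by (simp add: field_simps)
    have "(g t-?Z t)*(g t+?Z t)=g t^2-?Z t^2" by (simp add: power2_eq_square algebra_simps)
    also have "\<dots>=4 * of_real lam * g t-4" unfolding sq Zsq_def by simp
    finally have "g t-?Z t=(4 * of_real lam * g t-4)/(g t+?Z t)" using s0 by (simp add: field_simps)
    moreover have "(4 * of_real lam-4 * inverse (g t))/(1+?\<rho> t)=(4 * of_real lam * g t-4)/(g t+?Z t)"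
    proof -
    have "4 * of_real lam-4 * inverse (g t)=(4 * of_real lam * g t-4)/g t" "1+?\<rho> t=(g t+?Z t)/g t" using g0 by (simp_all add: field_simps)
    thus ?thesis using g0 by simp
    qed
    ultimately have "(4 * of_real lam-4 * inverse (g t))/(1+?\<rho> t)=g t-?Z t" by simp
    thus ?thesis by (simp only: diff_divide_distrib)
   qed
   ultimately show ?case unfolding xiB_def e1 by (simp add: algebra_simps)
  qed
 qed
 show "filterlim (%t. Re (- of_real lam*(ulog (g t)-\<i> * of_real pi) + g t/2)) at_bot F"
 proof (rule filterlim_at_bot_mono)
  have "filterlim (%t. - (1/4) * norm (g t)) at_bot F"
   using filterlim_tendsto_neg_mult_at_bot[OF tendsto_const[of "- (1/4::real)"] _ ng] by simp
  thus "filterlim (%t. - (1/4) * norm (g t)) at_bot F" .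
  have "\<forall>\<^sub>F t in F. 1<=norm (g t)" using ng by (simp add: filterlim_at_top)
  thus "\<forall>\<^sub>F t in F. Re (- of_real lam*(ulog (g t)-\<i> * of_real pi) + g t/2)<=- (1/4) * norm (g t)"
   using Rg g(3)
  proof eventually_elim
   case (elim t)
   have "0<=lam * ln (norm (g t))" using lam0 elim by simp
   moreover have "Re (ulog (g t))=ln (norm (g t))" using elim by (simp add: Re_ulog Cplus_def)
   ultimately show ?case using elim(2) by simp
  qed
 qed
qed

lemma start_W:
 fixes N :: nat
 assumes mu: "1<=mu - lam*mu - 1/2" and g: "filterlim g at_infinity F" "((%t. Arg (g t))\<longlongrightarrow>pi) F" "\<forall>\<^sub>F t in F. g t\<in>Cplus"
 defines "W \<equiv> %z. whittaker_W (- (lam*mu)) mu (ulog (of_real mu * z) - of_real pi*\<i>)" and "W1 \<equiv> %z. deriv (whittaker_W (- (lam*mu)) mu) (ulog (of_real mu * z) - of_real pi*\<i>)"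
  and "u \<equiv> %z. LGu mu N ainf (AW mu) (Zb m3 z) (qb m3 z) z"
 shows "((%t. W (g t) * u (g t))\<longlongrightarrow>1) F" "((%t. u (g t) * LGk mu N (Zb m3 (g t)) (g t) (W (g t)) (W1 (g t)))\<longlongrightarrow>0) F"
  "filterlim (%t. Re (xiB lam (Zb m3 (g t)) (g t))) at_bot F"
proof -
 let ?Z = "%t. Zb m3 (g t)" and ?x = "%t. xiB lam (Zb m3 (g t)) (g t)"
 have mu0: "0<mu"
 proof (rule ccontr)
  assume "\<not> 0<mu"
  hence "(1 - lam)*mu<=0" using lam1 by (intro mult_nonneg_nonpos) auto
  thus False using mu by (simp add: algebra_simps)
 qed
 have mu1: "0<mu - - (lam*mu)-1/2" using mu mult_nonneg_nonneg[OF lam0, of mu] mu0 by simp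
 have mu2: "1<=mu + - (lam*mu)-1/2" using mu by simp
 note st = start_inf[OF g]
 let ?\<rho> = "%t. ?Z t/g t"
 let ?v = "%t. ulog (of_real mu * g t) - of_real pi*\<i>"
 let ?E = "%t. exp (of_real (- (lam*mu))*?v t - exp (?v t)/2)"
 have sc: "\<forall>\<^sub>F t in F. ?v t = of_real (ln mu) + ulog (g t) - of_real pi*\<i>" using g(3) by eventually_elim (simp add: ulog_scale mu0)
 have ev: "\<forall>\<^sub>F t in F. exp (?v t) = - (of_real mu * g t)" using g(3)
  by eventually_elim (use mu0 in \<open>simp add: exp_diff exp_ulog Cplus_def mult.commute[of _ \<i>]\<close>)
 have ng: "filterlim (%t. norm (g t)) at_top F" using g(1) filterlim_at_infinity_imp_norm_at_top by blast
 have Rv: "filterlim (%t. Re (?v t)) at_top F"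
 proof (rule filterlim_mono_eventually[OF filterlim_tendsto_add_at_top[OF tendsto_const[of "ln mu"] filterlim_compose[OF ln_at_top ng]] order_refl order_refl])
  show "\<forall>\<^sub>F t in F. ln mu + ln (norm (g t))=Re (?v t)" using sc g(3) by eventually_elim (simp add: Re_ulog Cplus_def)
 qed
 have "\<forall>\<^sub>F t in F. pi/2<Arg (g t)" using g(2) by (rule order_tendstoD) simp
 \<comment> \<open>The rotation by -pi brings the end of the negative axis to the positive real
   direction, well inside the range where the asymptotics of W hold.\<close>
 hence Iv: "\<forall>\<^sub>F t in F. \<bar>Im (?v t)\<bar><=pi/2" using sc g(3)
 proof eventually_elim
  case (elim t)
  have "Im (ulog (g t))=Arg (g t)" using elim by (simp add: ulog_Ln Cplus_def Arg_eq_Im_Ln)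
  thus ?case using elim Arg_bounded[of "g t"] by simp
 qed
 have fv: "filterlim ?v (strip_at_top {x. \<bar>x-0\<bar><=pi/2}) F"
  unfolding strip_at_top_def filterlim_inf filterlim_principal filterlim_filtercomap_iff using Rv Iv by (simp add: o_def)
 show "filterlim (%t. Re (?x t)) at_bot F" by (rule Re_xi_at_bot[OF st(3,4)])
 have uE: "((%t. u (g t)*?E t)\<longlongrightarrow>1) F"
 proof -
  let ?a = "%t. - of_real lam*(ulog (g t)-\<i> * of_real pi) + g t/2"
  let ?c = "of_real (lam + lam * ln 2 + ln (1 - lam))+\<i> * complex_of_real (pi * lam)"
  let ?X = "%t. exp (of_real mu*(of_real (- lam * ln mu)+(?a t-?x t))) * exp (- (\<Sum>s\<in>{1..<N}. (Eb s (?Z t) (g t) - ainf s)/of_real mu^s))/(AW mu * qb m3 (g t))"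
  have "((%t. Eb s (?Z t) (g t))\<longlongrightarrow>ainf s) F" for s using Eb_tendsto_inf[OF g(1) st(1), of s] by simp
  hence "(?X\<longlongrightarrow>exp (of_real mu*(of_real (- lam * ln mu)+?c)) * exp (- (\<Sum>s\<in>{1..<N}. (ainf s - ainf s)/of_real mu^s))/(AW mu*1)) F"
   by (intro tendsto_intros st) (use mu0 AW_nz in auto)
  moreover have "exp (of_real mu*(of_real (- lam * ln mu)+?c))=AW mu"
  proof -
   have "exp (mu*(- lam * ln mu + (lam + lam * ln 2 + ln (1 - lam))))=(2 * exp 1/mu) powr (lam*mu)*(1 - lam) powr mu"
    using mu0 lam1 by (simp add: powr_def ln_div ln_mult exp_add[symmetric] algebra_simps)
   hence "exp (complex_of_real (mu*(- lam * ln mu + (lam + lam * ln 2 + ln (1 - lam))))) = of_real ((2 * exp 1/mu) powr (lam*mu)*(1 - lam) powr mu)"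
    by (simp only: exp_of_real)
   moreover have "of_real mu*(of_real (- lam * ln mu)+?c)=\<i> * of_real (pi*(lam*mu)) + complex_of_real (mu*(- lam * ln mu + (lam + lam * ln 2 + ln (1 - lam))))"
    by (simp add: algebra_simps)
   ultimately show ?thesis by (simp only: exp_add AW_def)
  qed
  ultimately have "(?X\<longlongrightarrow>1) F" using AW_nz[OF mu0] by simp
  thus ?thesis
  proof (rule Lim_transform_eventually, use sc ev in eventually_elim)
   case (elim t)
   have E: "?E t=exp (of_real mu*(of_real (- lam * ln mu)+?a t))" unfolding elim(2) unfolding elim(1) by (simp add: algebra_simps)
   have "exp (of_real mu*(of_real (- lam * ln mu)+(?a t-?x t)))=exp (of_real mu*(of_real (- lam * ln mu)+?a t)) * exp (- of_real mu*?x t)"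
    by (simp add: exp_add[symmetric] algebra_simps)
   moreover have "u (g t)=exp (- of_real mu*?x t) * exp (- (\<Sum>s\<in>{1..<N}. (Eb s (?Z t) (g t) - ainf s)/of_real mu^s))/(AW mu * qb m3 (g t))"
    unfolding u_def LGu_def Ssum_def by (simp add: exp_add[symmetric])
   moreover have gen: "(E * x) * S/B=(x * S/B) * E" for E x S B :: complex by simp
   ultimately show "?X t=u (g t)*?E t" unfolding E by (simp only: gen)
  qed
 qed
 have ig: "((%t. inverse (g t))\<longlongrightarrow>0) F" by (rule filterlim_compose[OF tendsto_inverse_0 g(1)])
 have g0: "\<forall>\<^sub>F t in F. g t~=0" using g(3) by eventually_elim (simp add: Cplus_def)
 have iZ: "((%t. 1/?Z t)\<longlongrightarrow>0) F"
 proof -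
  have "((%t. inverse (g t)/?\<rho> t)\<longlongrightarrow>0/1) F" by (intro tendsto_intros ig st) simp
  hence "((%t. inverse (g t)/?\<rho> t)\<longlongrightarrow>0) F" by simp
  thus ?thesis by (rule Lim_transform_eventually) (use g0 in eventually_elim, simp add: field_simps)
 qed
 have th: "((%t. 2*(of_real (- (lam*mu)) - exp (?v t)/2)/?Z t)\<longlongrightarrow>of_real mu + 0) F"
 proof -
  have "((%t. 2 * of_real (- (lam*mu))*(1/?Z t) + of_real mu/?\<rho> t)\<longlongrightarrow>2 * of_real (- (lam*mu))*0 + of_real mu/1) F"
   by (intro tendsto_intros iZ st) simp
  hence "((%t. 2 * of_real (- (lam*mu))*(1/?Z t) + of_real mu/?\<rho> t)\<longlongrightarrow>of_real mu + 0) F" by simp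
  thus ?thesis
   by (rule Lim_transform_eventually) (use ev in eventually_elim, simp only:, simp add: algebra_simps add_divide_distrib diff_divide_distrib)
 qed
 have p: "((%t. psum mu N (?Z t) (g t))\<longlongrightarrow>0) F"
 proof -
  have F0: "((%t. Fb s (?Z t) (g t))\<longlongrightarrow>0) F" for s
  proof -
   have "degree (Pc s)<3 * s+3" using degree_Pc[of s] by simp
   hence "((%t. poly (Pc s) (g t)/g t^(3 * s+3))\<longlongrightarrow>0) F"
    using filterlim_compose[OF poly_over_power_tendsto[of "Pc s" "3 * s+3"] g(1)] coeff_eq_0[of "Pc s" "3 * s+3"] by simp
   hence "((%t. poly (Pc s) (g t)/g t^(3 * s+3)/?\<rho> t^(3 * s+3))\<longlongrightarrow>0/1^(3 * s+3)) F"
    by (intro tendsto_divide tendsto_power st) simp_all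
   hence "((%t. poly (Pc s) (g t)/g t^(3 * s+3)/?\<rho> t^(3 * s+3))\<longlongrightarrow>0) F" by simp
   thus ?thesis by (rule Lim_transform_eventually) (use g0 in eventually_elim, simp add: Fb_def power_divide)
  qed
  have "((%t. psum mu N (?Z t) (g t))\<longlongrightarrow>(\<Sum>s\<in>{1..<N}. 0/of_real mu^s)) F"
   unfolding psum_def by (intro tendsto_sum tendsto_divide F0 tendsto_const) (use mu0 in simp)
  thus ?thesis by simp
 qed
 have b: "((%t. bq (?Z t) (g t))\<longlongrightarrow>0) F"
 proof -
  have "((%t. (4 * inverse (g t)^3-2 * of_real lam * inverse (g t)^2)/?\<rho> t^3)\<longlongrightarrow>(4*0^3-2 * of_real lam*0^2)/1^3) F"
   by (intro tendsto_intros ig st) simp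
  hence "((%t. (4 * inverse (g t)^3-2 * of_real lam * inverse (g t)^2)/?\<rho> t^3)\<longlongrightarrow>0) F" by simp
  thus ?thesis
  proof (rule Lim_transform_eventually, use g0 in eventually_elim)
   case (elim t)
   have "4 * inverse (g t)^3-2 * of_real lam * inverse (g t)^2=(4-2 * of_real lam * g t)/g t^3"
    using elim by (simp add: field_simps eval_nat_numeral)
   thus "(4 * inverse (g t)^3-2 * of_real lam * inverse (g t)^2)/?\<rho> t^3=bq (?Z t) (g t)"
    using elim by (simp add: bq_def power_divide)
  qed
 qed
 note Wp = whittaker_W_props[OF mu1 mu2]
 have lim: "((%t. W (g t)/?E t)\<longlongrightarrow>1) F" "((%t. (W1 (g t)-(of_real (- (lam*mu)) - exp (?v t)/2) * W (g t))/?E t)\<longlongrightarrow>0) F"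
 proof -
  have s: "strip_at_top {x. \<bar>x-0\<bar><=pi/2}<=strip_at_top {x. \<bar>x\<bar><=3/2 * pi - pi/2}" by (rule strip_at_top_mono) auto
  have 2: "{x::real. \<bar>x-0\<bar><=2*(pi/2)}={x. \<bar>x\<bar><=3/2 * pi - pi/2}" by auto
  have l1: "((%v. whittaker_W (- (lam*mu)) mu v/exp (of_real (- (lam*mu)) * v - exp v/2))\<longlongrightarrow>1) (strip_at_top {x. \<bar>x\<bar><=3/2 * pi - pi/2})"
   by (rule Wp(2)) simp
  have hol: "whittaker_W (- (lam*mu)) mu holomorphic_on UNIV" using Wp(1) by (simp add: whit_on_def)
  have l2: "((%v. (deriv (whittaker_W (- (lam*mu)) mu) v-(of_real (- (lam*mu)) - exp v/2) * whittaker_W (- (lam*mu)) mu v)/exp (of_real (- (lam*mu)) * v - exp v/2))\<longlongrightarrow>0)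
    (strip_at_top {x. \<bar>x-0\<bar><=pi/2})"
   by (rule W_char[OF hol open_UNIV UNIV_I _ l1[folded 2]]) simp
  show "((%t. W (g t)/?E t)\<longlongrightarrow>1) F" unfolding W_def by (rule filterlim_compose[OF tendsto_mono[OF s l1] fv])
  show "((%t. (W1 (g t)-(of_real (- (lam*mu)) - exp (?v t)/2) * W (g t))/?E t)\<longlongrightarrow>0) F"
   unfolding W_def W1_def by (rule filterlim_compose[OF l2 fv])
 qed
 show "((%t. W (g t) * u (g t))\<longlongrightarrow>1) F" "((%t. u (g t) * LGk mu N (?Z t) (g t) (W (g t)) (W1 (g t)))\<longlongrightarrow>0) F"
  by (rule start_limits[where E = ?E, OF _ lim uE th iZ p b]; simp)+
qed

end

section \<open>The expansions\<close>

context lam_range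
begin

lemma whit_pullback:
 assumes Y: "whit_on \<kappa>' mu UNIV Y" and v: "(v has_field_derivative 1/z) (at z within T)"
  and pot: "whit_pot \<kappa>' mu (v z) = of_real mu^2 * Q z/4-1/4"
 shows "((%z. Y (v z)) has_field_derivative deriv Y (v z)/z) (at z within T)"
  "((%z. deriv Y (v z)) has_field_derivative (deriv Y (v z)+(of_real mu^2 * Q z/4-1/4) * Y (v z))/z) (at z within T)"
proof -
 have h: "Y holomorphic_on UNIV" and ode: "deriv (deriv Y) w=deriv Y w + whit_pot \<kappa>' mu w * Y w" for w using Y by (auto simp: whit_on_def)
 have "(Y has_field_derivative deriv Y w) (at w)" "(deriv Y has_field_derivative deriv (deriv Y) w) (at w)" for w
  using holomorphic_derivI[OF h open_UNIV] holomorphic_derivI[OF holomorphic_deriv[OF h open_UNIV] open_UNIV] by auto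
 from DERIV_chain2[OF this(1) v] DERIV_chain2[OF this(2) v]
 show "((%z. Y (v z)) has_field_derivative deriv Y (v z)/z) (at z within T)"
  "((%z. deriv Y (v z)) has_field_derivative (deriv Y (v z)+(of_real mu^2 * Q z/4-1/4) * Y (v z))/z) (at z within T)"
  by (simp_all add: ode pot)
qed

lemma ulog_scale_deriv:
 assumes "0<mu" "z\<in>Cplus"
 shows "((%z. ulog (of_real mu * z)) has_field_derivative 1/z) (at z within T)"
proof -
 have "((%z. of_real mu * z) has_field_derivative of_real mu*1) (at z within T)" by (intro DERIV_cmult DERIV_ident)
 moreover have "(ulog has_field_derivative 1/(of_real mu * z)) (at (of_real mu * z) within (%z. of_real mu * z) ` T)"
  using assms by (intro ulog_has_derivative) (auto simp: Cplus_def)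
 ultimately have "((%z. ulog (of_real mu * z)) has_field_derivative 1/(of_real mu * z)*(of_real mu*1)) (at z within T)"
  using DERIV_image_chain[of ulog "1/(of_real mu * z)" "%z. of_real mu * z" z T "of_real mu*1"] unfolding o_def by blast
 moreover have "1/(of_real mu * z)*(of_real mu*1)=1/z" using assms by simp
 ultimately show ?thesis by (simp only:)
qed

text \<open>A progressive path may have Re xi monotone in either sense. As Re xi on the continued
  branch tends to -infinity at the start, only the increasing alternative remains.\<close>

lemma monotone_path:
 fixes x :: "real=>real"
 assumes m: "monotone_on {0<..1} (<=) (<=) x\<or>monotone_on {0<..1} (<=) (\<ge>) x" and b: "filterlim x at_bot (at_right 0)"
  and st: "s\<in>{0<..1}" "t\<in>{0<..1}" "s<=t"
 shows "x s<=x t"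
proof -
 have "\<not> monotone_on {0<..1} (<=) (\<ge>) x"
 proof
  assume a: "monotone_on {0<..1} (<=) (\<ge>) x"
  have "\<forall>\<^sub>F t in at_right 0. x t<x 1" using b filterlim_at_bot_dense[of x "at_right 0"] by blast
  moreover have "\<forall>\<^sub>F t in at_right (0::real). t\<in>{0<..<1}" by (rule eventually_at_right_real) simp
  ultimately have "\<exists>t. x t<x 1&t\<in>{0<..<1}"
   using eventually_happens[OF eventually_conj] trivial_limit_at_right_real by blast
  then obtain t where t: "x t<x 1" "0<t" "t<1" by auto
  hence "x t\<ge>x 1" using monotone_onD[OF a, of t 1] by auto
  thus False using t by simp
 qed
 thus ?thesis using m monotone_onD[of "{0<..1}" "(<=)" "(<=)" x s t] st by blast
qed

text \<open>The estimate with n + r terms is used, and the terms from n to n + r - 1 are split off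
  the exponent by a b - 1 = (b - 1) + (a - 1) b.\<close>

lemma eta_bound:
 fixes e :: "nat=>complex"
 assumes mu: "0<mu" and n: "1<=n" and nn: "0<= om" "0<=nu"
  and b: "norm (W * LGu mu (n + r) e A Z q z-1)<= om/mu^(n + r) * exp (nu/(2*mu) + om/mu^(n + r))"
 shows "norm (W * LGu mu n e A Z q z-1)<=norm (exp (\<Sum>s\<in>{n..<n + r}. (Eb s Z z - e s)/of_real mu^s)-1)
   + om/mu^(n + r) * exp (nu/mu + (\<Sum>s\<in>{n..<n + r}. Re (Eb s Z z - e s)/mu^s) + om/mu^(n + r))"
proof -
 let ?d = "%s. (Eb s Z z - e s)/of_real mu^s"
 let ?s = "\<Sum>s\<in>{n..<n + r}. ?d s" and ?v = "W * LGu mu (n + r) e A Z q z"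
 have "sum ?d {1..<n + r}=sum ?d {1..<n} + ?s" using sum.atLeastLessThan_concat[of 1 n "n + r" ?d] n by simp
 hence "Ssum mu (n + r) e Z z=Ssum mu n e Z z+?s" unfolding Ssum_def by (simp only: add.assoc)
 hence "exp (- Ssum mu n e Z z)=exp (- Ssum mu (n + r) e Z z) * exp ?s" by (simp add: exp_add[symmetric])
 hence v: "W * LGu mu n e A Z q z=?v * exp ?s" by (simp add: LGu_def)
 have "a * b-1=(b-1)+(a-1) * b" for a b :: complex by (simp add: algebra_simps)
 hence "norm (a * b-1)<=norm (b-1) + norm (a-1) * norm b" for a b :: complex
  by (simp only: norm_mult[symmetric] norm_triangle_ineq)
 hence "norm (W * LGu mu n e A Z q z-1)<=norm (exp ?s-1) + norm (?v-1) * norm (exp ?s)"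
  unfolding v by blast
 also have "norm (?v-1) * norm (exp ?s)<=(om/mu^(n + r) * exp (nu/mu + om/mu^(n + r))) * norm (exp ?s)"
 proof (rule mult_right_mono)
  \<comment> \<open>The growth argument gives half of the exponent \<open>nu/mu\<close> of the
    claimed bound.\<close>
  have "nu/(2*mu)<=nu/mu" using mu nn by (simp add: field_simps)
  thus "norm (?v-1)<= om/mu^(n + r) * exp (nu/mu + om/mu^(n + r))"
   using mu nn by (intro order_trans[OF b] mult_left_mono) auto
 qed simp
 also have "norm (exp ?s)=exp (\<Sum>s\<in>{n..<n + r}. Re (Eb s Z z - e s)/mu^s)"
  by (simp add: norm_exp_eq_Re Re_divide_of_real flip: of_real_power)
 also have "om/mu^(n + r) * exp (nu/mu + om/mu^(n + r)) * exp (\<Sum>s\<in>{n..<n + r}. Re (Eb s Z z - e s)/mu^s) =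
  om/mu^(n + r) * exp (nu/mu + (\<Sum>s\<in>{n..<n + r}. Re (Eb s Z z - e s)/mu^s) + om/mu^(n + r))"
  by (simp add: exp_add)
 finally show ?thesis by simp
qed

text \<open>The limits of the primitives at 0 on the branch Z -> 2. Subtracting them makes the
  corrections in the exponent vanish where the path to M starts.\<close>

definition e0 :: "nat=>complex" where "e0 s=poly (Ac s) 0/8^s"

lemma M_bound:
 assumes mu: "0<mu" and N: "1<=N" and L: "progressive1 lam \<delta> L z" and fin: "omega1 lam mu N L<\<infinity>" "varpi1 lam mu N L<\<infinity>"
 shows "norm (whittaker_M (lam*mu) mu (ulog (of_real mu * z)) * LGu mu N e0 (AM mu) (Zb m1 z) (qb m1 z) z-1)
  <=enn2real (omega1 lam mu N L)/mu^N * exp (enn2real (varpi1 lam mu N L)/(2*mu) + enn2real (omega1 lam mu N L)/mu^N)"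
proof -
 have P: "L 0=0" "L 1=z" "R2_chain {0..1} L" and LT: "!!t. t\<in>{0<..1}==>L t\<in>Cplus - g1"
  and m: "monotone_on {0<..1} (<=) (<=) (%\<tau>. Re (continue_from (Sm1 lam) (gamma1 lam) (xi_pv lam) (L \<tau>))) \<or>
   monotone_on {0<..1} (<=) (\<ge>) (%\<tau>. Re (continue_from (Sm1 lam) (gamma1 lam) (xi_pv lam) (L \<tau>)))"
  using L unfolding progressive1_def progressive_def gamma1_eq by auto
 have m': "monotone_on {0<..1} (<=) (<=) (%\<tau>. Re (xiB lam (Zb m1 (L \<tau>)) (L \<tau>))) \<or>
   monotone_on {0<..1} (<=) (\<ge>) (%\<tau>. Re (xiB lam (Zb m1 (L \<tau>)) (L \<tau>)))"
  using m continue_0(1)[OF LT] by (simp add: monotone_on_def)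
 have "continuous_on {0..1} L" using P(3) by (simp add: R2_chain_def)
 hence g: "(L\<longlongrightarrow>0) (at_right 0)" using continuous_on_Icc_at_rightD[of 0 1 L] P(1) by simp
 have ev: "\<forall>\<^sub>F t in at_right 0. L t\<in>Cplus"
  by (rule eventually_mono[OF eventually_at_right_real[OF zero_less_one]]) (use LT in auto)
 note st = start_M[OF mu g ev, folded e0_def]
 have Y: "whit_on (lam*mu) mu UNIV (whittaker_M (lam*mu) mu)" by (rule whittaker_M_props(1)[OF mu])
 have pot: "whit_pot (lam*mu) mu (ulog (of_real mu * z)) = of_real mu^2 * Q z/4-1/4" if "z\<in>Cplus - g1" for z
  using that mu by (simp add: whit_pot_def exp_ulog Cplus_def Zsq_def power2_eq_square field_simps)
 have Wd: "((%z. whittaker_M (lam*mu) mu (ulog (of_real mu * z))) has_field_derivative deriv (whittaker_M (lam*mu) mu) (ulog (of_real mu * z))/z) (at z within Cplus - g1)"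
  "((%z. deriv (whittaker_M (lam*mu) mu) (ulog (of_real mu * z))) has_field_derivative (deriv (whittaker_M (lam*mu) mu) (ulog (of_real mu * z))+(of_real mu^2 * Q z/4-1/4) * whittaker_M (lam*mu) mu (ulog (of_real mu * z)))/z) (at z within Cplus - g1)"
  if "z\<in>Cplus - g1" for z
  by (rule whit_pullback[OF Y ulog_scale_deriv[OF mu] pot[OF that]], use that in simp)+
 have mono: "Re (xiB lam (Zb m1 (L s)) (L s))<=Re (xiB lam (Zb m1 (L t)) (L t))" if "s\<in>{0<..1}" "t\<in>{0<..1}" "s<=t" for s t
  by (rule monotone_path[OF m' st(3) that])
 show ?thesis unfolding P(2)[symmetric] omega1_def varpi1_def
 proof (rule LG_bound[where T = "Cplus - g1" and I = "{0..1}"])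
  show "continue_from (Sm1 lam) (gamma1 lam) (%t. Z_pv lam t * hatF lam n t/t) w=Zb m1 w * Fb n (Zb m1 w) w/w"
   "continue_from (Sm1 lam) (gamma1 lam) (%t. Z_pv lam t * hatG lam n s t/t) w=Zb m1 w * Gb n s (Zb m1 w) w/w" if "w\<in>Cplus - g1" for w n s
   using continue_0[OF that] by blast+
 qed (use Zb_continuous qb_continuous Zb_sq[of m1, OF m_power4(2)] Zb_nz(2) qb_sq[of m1, OF m_power4(2)] AM_nz[OF mu] mu N Wd P(3) LT mono st fin in "auto simp: omega1_def varpi1_def")
qed

lemma W_bound:
 assumes mu: "1<=mu - lam*mu - 1/2" "0<mu" and N: "1<=N" and L: "progressive3 lam \<delta> L z" and fin: "omega3 lam mu N L<\<infinity>" "varpi3 lam mu N L<\<infinity>"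
 shows "norm (whittaker_W (- (lam*mu)) mu (ulog (of_real mu * z) - of_real pi*\<i>) * LGu mu N ainf (AW mu) (Zb m3 z) (qb m3 z) z-1)
  <=enn2real (omega3 lam mu N L)/mu^N * exp (enn2real (varpi3 lam mu N L)/(2*mu) + enn2real (omega3 lam mu N L)/mu^N)"
proof -
 have P: "filterlim L at_infinity (at_right 0)" "((%\<tau>. Arg (L \<tau>))\<longlongrightarrow>pi) (at_right 0)" "L 1=z" "R2_chain {0<..1} L" and LT: "!!t. t\<in>{0<..1}==>L t\<in>Cplus - g3"
  and m: "monotone_on {0<..1} (<=) (<=) (%\<tau>. Re (continue_from (S1 lam) (gamma3 lam) (xi_pv lam) (L \<tau>))) \<or>
   monotone_on {0<..1} (<=) (\<ge>) (%\<tau>. Re (continue_from (S1 lam) (gamma3 lam) (xi_pv lam) (L \<tau>)))"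
  using L unfolding progressive3_def progressive_def gamma3_eq by auto
 have m': "monotone_on {0<..1} (<=) (<=) (%\<tau>. Re (xiB lam (Zb m3 (L \<tau>)) (L \<tau>))) \<or>
   monotone_on {0<..1} (<=) (\<ge>) (%\<tau>. Re (xiB lam (Zb m3 (L \<tau>)) (L \<tau>)))"
  using m continue_inf(1)[OF LT] by (simp add: monotone_on_def)
 have ev: "\<forall>\<^sub>F t in at_right 0. L t\<in>Cplus"
  by (rule eventually_mono[OF eventually_at_right_real[OF zero_less_one]]) (use LT in auto)
 note st = start_W[OF mu(1) P(1,2) ev]
 let ?Y = "whittaker_W (- (lam*mu)) mu" and ?v = "%z. ulog (of_real mu * z) - of_real pi*\<i>"
 have "0<mu - - (lam*mu)-1/2" using mu mult_nonneg_nonneg[OF lam0, of mu] by simp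
 hence Y: "whit_on (- (lam*mu)) mu UNIV ?Y" by (rule whittaker_W_props(1)) (use mu in simp)
 have pot: "whit_pot (- (lam*mu)) mu (?v z) = of_real mu^2 * Q z/4-1/4" if "z\<in>Cplus - g3" for z
 proof -
  have "exp (?v z) = - (of_real mu * z)" using that mu by (simp add: exp_diff exp_ulog Cplus_def mult.commute[of _ \<i>])
  thus ?thesis unfolding whit_pot_def by (simp add: Zsq_def power2_eq_square field_simps)
 qed
 have vd: "(?v has_field_derivative 1/z) (at z within Cplus - g3)" if "z\<in>Cplus - g3" for z
  using DERIV_diff[OF ulog_scale_deriv[OF mu(2), of z "Cplus - g3"] DERIV_const[of "of_real pi*\<i>"]] that by simp
 have Wd: "((%z. ?Y (?v z)) has_field_derivative deriv ?Y (?v z)/z) (at z within Cplus - g3)"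
  "((%z. deriv ?Y (?v z)) has_field_derivative (deriv ?Y (?v z)+(of_real mu^2 * Q z/4-1/4)*?Y (?v z))/z) (at z within Cplus - g3)"
  if "z\<in>Cplus - g3" for z
  by (rule whit_pullback[OF Y vd[OF that] pot[OF that]])+
 have mono: "Re (xiB lam (Zb m3 (L s)) (L s))<=Re (xiB lam (Zb m3 (L t)) (L t))" if "s\<in>{0<..1}" "t\<in>{0<..1}" "s<=t" for s t
  by (rule monotone_path[OF m' st(3) that])
 show ?thesis unfolding P(3)[symmetric] omega3_def varpi3_def
 proof (rule LG_bound[where T = "Cplus - g3" and I = "{0<..1}"])
  show "continue_from (S1 lam) (gamma3 lam) (%t. Z_pv lam t * hatF lam n t/t) w=Zb m3 w * Fb n (Zb m3 w) w/w"
   "continue_from (S1 lam) (gamma3 lam) (%t. Z_pv lam t * hatG lam n s t/t) w=Zb m3 w * Gb n s (Zb m3 w) w/w" if "w\<in>Cplus - g3" for w n s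
   using continue_inf[OF that] by blast+
 qed (use Zb_continuous qb_continuous Zb_sq[of m3, OF m_power4(3)] Zb_nz(3) qb_sq[of m3, OF m_power4(3)] AW_nz[OF mu(2)] mu N Wd P(4) LT mono st fin in "auto simp: omega3_def varpi3_def")
qed

text \<open>The power 3 s of Z has the parity of s, which is the origin of the alternating signs in
  the expansions.\<close>

lemma Eb_uminus: "Eb s (- Z) z=(- 1)^s * Eb s Z z"
proof -
 have "(- Z)^(3 * s)=(- 1)^s * Z^(3 * s)" by (cases "even s") auto
 thus ?thesis by (cases "even s") (simp_all add: Eb_def)
qed

text \<open>On the far side of the cut the principal value of \<open>Z\<close> is minus the continued one, which turns the
 alternating signs of the expansion into the plain ones of the exponent \<open>Ssum\<close>.\<close>

lemma values_S1:
 assumes z: "z\<in>Cplus - g1" "z\<in>closure (S1 lam)"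
 shows "from_region (S1 lam) (xi_pv lam) z=xiB lam (- Zb m1 z) z"
  "from_region (S1 lam) (rt_pv lam) z = - \<i> * qb m1 z"
  "(- 1)^s*(from_region (S1 lam) (hatE lam s) z - k_const lam s)=Eb s (Zb m1 z) z - e0 s"
proof -
 have RC: "w\<in>pdom lam" "Zb mpv w = - Zb m1 w" "qb mpv w = - \<i> * qb m1 w" if "w\<in>RC" for w
  using region_in_cut(5) that Zb_RC(1)[OF that] qb_RC(1)[OF that] by (auto simp: pdom_eq)
 have c: "continuous_on (Cplus - g1) (%w. - Zb m1 w)" by (intro continuous_intros Zb_continuous)
 have sq: "(- Zb m1 w)^2=Q w" for w using Zb_sq[of m1 w, OF m_power4(2)] by simp
 note hol = branch_holomorphic[OF c sq _ Diff_subset, THEN holomorphic_on_imp_continuous_on]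
 note cut = region_in_cut(4)
 show "from_region (S1 lam) (xi_pv lam) z=xiB lam (- Zb m1 z) z"
  unfolding S1_eq by (rule from_region_eqI[OF hol(1) cut]) (use z Zb_nz(2) RC xi_pv_eq in "auto simp: S1_eq")
 show "from_region (S1 lam) (rt_pv lam) z = - \<i> * qb m1 z"
  unfolding S1_eq by (rule from_region_eqI[OF _ cut]) (use z RC rt_pv_eq qb_continuous in "auto simp: S1_eq intro!: continuous_intros")
 have "from_region (S1 lam) (hatE lam s) z=Eb s (- Zb m1 z) z - ainf s"
  unfolding S1_eq by (rule from_region_eqI[OF hol(4) cut]) (use z Zb_nz(2) RC hatE_eq in "auto simp: S1_eq")
 thus "(- 1)^s*(from_region (S1 lam) (hatE lam s) z - k_const lam s)=Eb s (Zb m1 z) z - e0 s"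
  using Ac(3,4)[of s] by (cases "even s") (simp_all add: k_const_eq e0_def Eb_uminus ainf_def)
qed

lemma values_Sm1:
 assumes z: "z\<in>Cplus - g3" "z\<in>closure (Sm1 lam)"
 shows "from_region (Sm1 lam) (xi_pv lam) z=xiB lam (- Zb m3 z) z"
  "from_region (Sm1 lam) (rt_pv lam) z=\<i> * qb m3 z"
  "(- 1)^s*(from_region (Sm1 lam) (hatE lam s) z - l_const lam s)=Eb s (Zb m3 z) z - ainf s"
proof -
 have RA: "w\<in>pdom lam" "Zb mpv w = - Zb m3 w" "qb mpv w=\<i> * qb m3 w" if "w\<in>RA" for w
  using region_in_cut(2) that Zb_RA(2)[OF that] qb_RA(2)[OF that] by (auto simp: pdom_eq)
 have c: "continuous_on (Cplus - g3) (%w. - Zb m3 w)" by (intro continuous_intros Zb_continuous)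
 have sq: "(- Zb m3 w)^2=Q w" for w using Zb_sq[of m3 w, OF m_power4(3)] by simp
 note hol = branch_holomorphic[OF c sq _ Diff_subset, THEN holomorphic_on_imp_continuous_on]
 note cut = region_in_cut(3)
 show "from_region (Sm1 lam) (xi_pv lam) z=xiB lam (- Zb m3 z) z"
  unfolding Sm1_eq by (rule from_region_eqI[OF hol(1) cut]) (use z Zb_nz(3) RA xi_pv_eq in "auto simp: Sm1_eq")
 show "from_region (Sm1 lam) (rt_pv lam) z=\<i> * qb m3 z"
  unfolding Sm1_eq by (rule from_region_eqI[OF _ cut]) (use z RA rt_pv_eq qb_continuous in "auto simp: Sm1_eq intro!: continuous_intros")
 have "from_region (Sm1 lam) (hatE lam s) z=Eb s (- Zb m3 z) z - ainf s"
  unfolding Sm1_eq by (rule from_region_eqI[OF hol(4) cut]) (use z Zb_nz(3) RA hatE_eq in "auto simp: Sm1_eq")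
 thus "(- 1)^s*(from_region (Sm1 lam) (hatE lam s) z - l_const lam s)=Eb s (Zb m3 z) z - ainf s"
  using Ac(3,4)[of s] by (cases "even s") (simp_all add: l_const_eq Eb_uminus ainf_def)
qed

lemma exp_xi_uminus:
 assumes mu: "0<mu" and Z: "Z^2=Q z" and z: "z\<in>Cplus"
 shows "exp (- of_real mu * xiB lam (- Z) z + w)=exp (of_real mu * xiB lam Z z + w)
  * of_real ((4*(1 - lam\<^sup>2)) powr (lam*mu)*(1 - lam\<^sup>2) powr mu) * exp (- (of_real (mu - lam*mu) * of_real pi*\<i>))"
proof -
 have "(4*(1 - lam\<^sup>2)) powr (lam*mu)*(1 - lam\<^sup>2) powr mu=exp (mu*(lam * ln (4*(1 - lam\<^sup>2)) + ln (1 - lam\<^sup>2)))"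
  using lam_sq by (simp add: powr_def exp_add[symmetric] algebra_simps)
 hence "complex_of_real ((4*(1 - lam\<^sup>2)) powr (lam*mu)*(1 - lam\<^sup>2) powr mu)=exp (of_real (mu*(lam * ln (4*(1 - lam\<^sup>2)) + ln (1 - lam\<^sup>2))))"
  by (simp only: exp_of_real)
 moreover have "- of_real mu * xiB lam (- Z) z + w=(of_real mu * xiB lam Z z + w) + of_real (mu*(lam * ln (4*(1 - lam\<^sup>2)) + ln (1 - lam\<^sup>2))) + - (of_real (mu - lam*mu) * of_real pi*\<i>)"
  unfolding xiB_uminus[OF Z z] by (simp add: algebra_simps)
 ultimately show ?thesis by (simp only: exp_add)
qed

text \<open>Of 4 (1 - lam^2) = 2 (1 + lam) 2 (1 - lam), the first factor cancels against the
  denominator and the second survives in \<open>AM\<close>. The phase cancels against the one in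
  \<open>exp_xi_uminus\<close>.\<close>

lemma prefactor_M:
 assumes mu: "0<mu" and Z: "Z^2=Q z" and z: "z\<in>Cplus"
 shows "\<i> * exp (of_real (mu - lam*mu) * of_real pi*\<i>)/of_real ((1 - lam\<^sup>2) powr mu*(2*(1 + lam)) powr (lam*mu))
  * of_real ((4*mu/exp 1) powr mu)*(of_real (sqrt (2*mu))*(- \<i> * q)) * exp (- of_real mu * xiB lam (- Z) z + w)
  =AM mu * q * exp (of_real mu * xiB lam Z z + w)"
proof -
 let ?e = "exp (of_real (mu - lam*mu) * of_real pi*\<i>)"
 let ?a = "(1 - lam\<^sup>2) powr mu" and ?b = "(2*(1 + lam)) powr (lam*mu)" and ?c = "(2*(1 - lam)) powr (lam*mu)" and ?d = "(4*mu/exp 1) powr mu"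
 have "4*(1 - lam\<^sup>2)=(2*(1 + lam))*(2*(1 - lam))" by (simp add: power2_eq_square algebra_simps)
 hence p: "(4*(1 - lam\<^sup>2)) powr (lam*mu)=?b*?c" using lam0 lam1 by (simp only: powr_mult)
 have nz: "complex_of_real ?a~=0" "complex_of_real ?b~=0" using lam_sq lam0 by auto
 have alg: "\<i> * E/(a * b) * d*(sq*(- \<i> * q))*(X*(b * c * a) * inverse E)=(d * c * sq) * q * X"
  if "a~=0" "b~=0" "E~=0" for E a b c d sq X :: complex
  using that by (simp add: field_simps)
 show ?thesis unfolding exp_xi_uminus[OF mu Z z] p exp_minus[of "of_real (mu - lam*mu) * of_real pi*\<i>"] AM_def of_real_mult[of ?a] of_real_mult[of "?b*?c"] of_real_mult[of ?b] of_real_mult[of "?d*?c"] of_real_mult[of ?d]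
  by (rule alg[OF nz exp_not_eq_zero])
qed

text \<open>Here 1 - lam^2 = (1 + lam)(1 - lam) leaves the power of 1 - lam in \<open>AW\<close>,
  the two bases with exponent kappa multiply to 2 e/mu, and the remaining phase is exp (i pi
  kappa).\<close>

lemma prefactor_W:
 assumes mu: "0<mu" and Z: "Z^2=Q z" and z: "z\<in>Cplus"
 shows "- (\<i> * exp (of_real mu * of_real pi*\<i>)/of_real ((1 + lam) powr mu)) * of_real ((exp 1/(2*mu*(1 - lam\<^sup>2))) powr (lam*mu))
  * (\<i> * q) * exp (- of_real mu * xiB lam (- Z) z + w)
  =AW mu * q * exp (of_real mu * xiB lam Z z + w)"
proof -
 let ?a = "(1 + lam) powr mu" and ?b = "(1 - lam) powr mu"
 let ?c = "(exp 1/(2*mu*(1 - lam\<^sup>2))) powr (lam*mu)" and ?d = "(4*(1 - lam\<^sup>2)) powr (lam*mu)"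
 have "1 - lam\<^sup>2=(1 + lam)*(1 - lam)" by (simp add: power2_eq_square algebra_simps)
 hence p: "(1 - lam\<^sup>2) powr mu=?a*?b" using lam0 lam1 by (simp only: powr_mult)
 have "(exp 1/(2*mu*(1 - lam\<^sup>2)))*(4*(1 - lam\<^sup>2))=2 * exp 1/mu" using lam_sq mu by (simp add: field_simps)
 moreover have "0<=exp 1/(2*mu*(1 - lam\<^sup>2))" "0<=4*(1 - lam\<^sup>2)" using lam_sq mu by auto
 ultimately have cd: "(2 * exp 1/mu) powr (lam*mu)=?c*?d" by (metis powr_mult)
 have nz: "complex_of_real ?a~=0" using lam0 by auto
 let ?x = "of_real (mu - lam*mu) * of_real pi*\<i>"
 have E: "exp (of_real mu * of_real pi*\<i>) * exp (- ?x)=exp (\<i> * of_real (pi*(lam*mu)))"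
  by (simp add: exp_add[symmetric] algebra_simps)
 have alg: "- (\<i> * E1/a) * c*(\<i> * q)*(X*(d*(a * b)) * E2)=(E1 * E2)*(c * d * b) * q * X"
  if "a~=0" for E1 E2 a b c d X :: complex
  using that by (simp add: field_simps)
 show ?thesis unfolding exp_xi_uminus[OF mu Z z] p AW_def cd E[symmetric] of_real_mult[of ?d] of_real_mult[of ?a] of_real_mult[of "?c*?d"] of_real_mult[of ?c]
  by (rule alg[OF nz])
qed

text \<open>The witness is the relative error of the approximation with n terms. It is fixed before
  any path is chosen, so one value satisfies the bounds of all admissible paths.\<close>

lemma eta_exists:
 fixes e :: "nat=>complex" and om vp :: "'a=>ennreal"
 assumes mu: "0<mu" and n: "1<=n" and A: "A~=0" and q: "q~=0"
  and b: "!!L. P L==>om L<\<infinity>==>vp L<\<infinity>==>norm (W * LGu mu (n + r) e A Z q z-1) <=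
   enn2real (om L)/mu^(n + r) * exp (enn2real (vp L)/(2*mu) + enn2real (om L)/mu^(n + r))"
 shows "\<exists>\<eta>. W=A * q * exp (of_real mu * xiB lam Z z+(\<Sum>s\<in>{1..<n}. (Eb s Z z - e s)/of_real mu^s))*(1+\<eta>) &
  (\<forall>L. P L-->om L<\<infinity>-->vp L<\<infinity>-->norm \<eta><=norm (exp (\<Sum>s\<in>{n..<n + r}. (Eb s Z z - e s)/of_real mu^s)-1)
   + enn2real (om L)/mu^(n + r) * exp (enn2real (vp L)/mu + (\<Sum>s\<in>{n..<n + r}. Re (Eb s Z z - e s)/mu^s) + enn2real (om L)/mu^(n + r)))"
proof (intro exI[of _ "W * LGu mu n e A Z q z-1"] conjI allI impI)
 have "W=A * q * exp S*(1+(W*(exp (- S)/(A * q))-1))" for S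
  using A q by (simp add: exp_minus)
 thus "W=A * q * exp (of_real mu * xiB lam Z z+(\<Sum>s\<in>{1..<n}. (Eb s Z z - e s)/of_real mu^s))*(1+(W * LGu mu n e A Z q z-1))"
  unfolding LGu_def Ssum_def .
qed (rule eta_bound[OF mu n enn2real_nonneg enn2real_nonneg b])

lemma Re_alternating: "(- 1)^s*(Re a - Re b)=Re ((- 1)^s*(a - b))" "(- 1)^s * Re (a - b)=Re ((- 1)^s*(a - b))"
 by (cases "even s"; simp)+

end

theorem theorem2p3:
  fixes \<delta> :: real and n r :: nat
  assumes "0 < \<delta>" and "1 \<le> n"
  shows "\<forall>\<^sub>F \<mu>::real in at_top. \<forall>lam\<in>{0..1 - \<delta>}.
    (let \<kappa> = lam * \<mu> in
     (\<forall>z \<in> away_from (gamma1 lam) \<delta> \<inter> closure (S1 lam).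
       (let \<xi> = from_region (S1 lam) (xi_pv lam) z;
            q = from_region (S1 lam) (rt_pv lam) z;
            E = (\<lambda>s. from_region (S1 lam) (hatE lam s) z);
            k = k_const lam
        in \<exists>\<eta>::complex.
          whittaker_M \<kappa> \<mu> (Ln (of_real \<mu> * z)) =
            \<i> * exp (of_real (\<mu> - \<kappa>) * of_real pi * \<i>)
              / of_real ((1 - lam\<^sup>2) powr \<mu> * (2 * (1 + lam)) powr \<kappa>)
            * of_real ((4 * \<mu> / exp 1) powr \<mu>) * (of_real (sqrt (2 * \<mu>)) * q)
            * exp (- of_real \<mu> * \<xi> + (\<Sum>s\<in>{1..<n}. (-1) ^ s * (E s - k s) / of_real \<mu> ^ s))
            * (1 + \<eta>) \<and>
          (\<forall>L. progressive1 lam \<delta> L z \<longrightarrow>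
             omega1 lam \<mu> (n + r) L < \<infinity> \<longrightarrow> varpi1 lam \<mu> (n + r) L < \<infinity> \<longrightarrow>
             (let \<omega> = enn2real (omega1 lam \<mu> (n + r) L);
                  \<nu> = enn2real (varpi1 lam \<mu> (n + r) L)
              in norm \<eta> \<le>
                norm (exp (\<Sum>s\<in>{n..<n + r}. (-1) ^ s * (E s - k s) / of_real \<mu> ^ s) - 1)
                + \<omega> / \<mu> ^ (n + r)
                  * exp (\<nu> / \<mu> + (\<Sum>s\<in>{n..<n + r}. (-1) ^ s * (Re (E s) - Re (k s)) / \<mu> ^ s)
                         + \<omega> / \<mu> ^ (n + r)))))) \<and>
     (\<forall>z \<in> away_from (gamma3 lam) \<delta> \<inter> closure (Sm1 lam).
       (let \<xi> = from_region (Sm1 lam) (xi_pv lam) z;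
            q = from_region (Sm1 lam) (rt_pv lam) z;
            E = (\<lambda>s. from_region (Sm1 lam) (hatE lam s) z);
            l = l_const lam
        in \<exists>\<eta>::complex.
          whittaker_W (- \<kappa>) \<mu> (Ln (of_real \<mu> * z) - of_real pi * \<i>) =
            - (\<i> * exp (of_real \<mu> * of_real pi * \<i>) / of_real ((1 + lam) powr \<mu>))
            * of_real ((exp 1 / (2 * \<mu> * (1 - lam\<^sup>2))) powr \<kappa>) * q
            * exp (- of_real \<mu> * \<xi> + (\<Sum>s\<in>{1..<n}. (-1) ^ s * (E s - l s) / of_real \<mu> ^ s))
            * (1 + \<eta>) \<and>
          (\<forall>L. progressive3 lam \<delta> L z \<longrightarrow>
             omega3 lam \<mu> (n + r) L < \<infinity> \<longrightarrow> varpi3 lam \<mu> (n + r) L < \<infinity> \<longrightarrow>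
             (let \<omega> = enn2real (omega3 lam \<mu> (n + r) L);
                  \<nu> = enn2real (varpi3 lam \<mu> (n + r) L)
              in norm \<eta> \<le>
                norm (exp (\<Sum>s\<in>{n..<n + r}. (-1) ^ s * (E s - l s) / of_real \<mu> ^ s) - 1)
                + \<omega> / \<mu> ^ (n + r)
                  * exp (\<nu> / \<mu> + (\<Sum>s\<in>{n..<n + r}. (-1) ^ s * Re (E s - l s) / \<mu> ^ s)
                         + \<omega> / \<mu> ^ (n + r)))))))"
proof (rule eventually_mono[OF eventually_ge_at_top[of "max 1 (3/(2*\<delta>))"]], intro ballI, unfold Let_def, intro conjI ballI, goal_cases)
 case (1 mu lam z)
 then interpret lam_range lam by unfold_locales (use \<open>0 < \<delta>\<close> in auto)
 have mu: "0<mu" using 1 by auto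
 have z: "z\<in>Cplus - g1" "z\<in>closure (S1 lam)" using 1 \<open>0 < \<delta>\<close> by (auto simp: away_from_def gamma1_eq)
 hence zC: "z\<in>Cplus" by auto
 note Zsq = Zb_sq[of m1 z, OF m_power4(2)]
 have q: "qb m1 z~=0" using qb_sq[of m1 z, OF m_power4(2)] Zb_nz(2)[OF z(1)] zC by (auto simp: Cplus_def)
 have ln: "Ln (of_real mu * z)=ulog (of_real mu * z)" using mu zC by (intro ulog_Ln[symmetric]) (auto simp: Cplus_def)
 show ?case unfolding values_S1(1,2)[OF z] Re_alternating values_S1(3)[OF z] prefactor_M[OF mu Zsq zC] ln
  by (rule eta_exists[OF mu \<open>1 \<le> n\<close> AM_nz[OF mu] q M_bound[OF mu]]) (use \<open>1 \<le> n\<close> in auto)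
next
 case (2 mu lam z)
 then interpret lam_range lam by unfold_locales (use \<open>0 < \<delta>\<close> in auto)
 have mu: "0<mu" using 2 by auto
 \<comment> \<open>The threshold 3/(2 delta) for mu guarantees (1 - lam) mu >= 3/2, hence mu - kappa
   - 1/2 >= 1, as the Laplace integral for W with parameters -kappa and mu requires.\<close>
 have "3/2<=\<delta>*mu" using 2 \<open>0 < \<delta>\<close> by (simp add: field_simps)
 also have "\<dots><=(1 - lam)*mu" using 2 mu by (intro mult_right_mono) auto
 finally have mu1: "1<=mu - lam*mu - 1/2" by (simp add: algebra_simps)
 have z: "z\<in>Cplus - g3" "z\<in>closure (Sm1 lam)" using 2 \<open>0 < \<delta>\<close> by (auto simp: away_from_def gamma3_eq)
 hence zC: "z\<in>Cplus" by auto
 note Zsq = Zb_sq[of m3 z, OF m_power4(3)]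
 have q: "qb m3 z~=0" using qb_sq[of m3 z, OF m_power4(3)] Zb_nz(3)[OF z(1)] zC by (auto simp: Cplus_def)
 have ln: "Ln (of_real mu * z)=ulog (of_real mu * z)" using mu zC by (intro ulog_Ln[symmetric]) (auto simp: Cplus_def)
 show ?case unfolding values_Sm1(1,2)[OF z] Re_alternating values_Sm1(3)[OF z] prefactor_W[OF mu Zsq zC] ln
  by (rule eta_exists[OF mu \<open>1 \<le> n\<close> AW_nz[OF mu] q W_bound[OF mu1 mu]]) (use \<open>1 \<le> n\<close> in auto)
qed

end
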